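(* The input-output operators $\Phi_0,\Phi_\ell:\mathcal F\subset L^2(\Omega_T)\to L^2(0,T)$ given by $\Phi_0(F)(t):=u_x(0,t;F)$ and $\Phi_\ell(F)(t):=u_x(\ell,t;F)$, $t\in[0,T]$, where $u(\cdot,\cdot;F)$ is the unique weak solution of the forward problem (stated in the context) with load $F$, are compact.
   Context: Let $\ell,T>0$ and $\Omega_T=(0,\ell)\times(0,T)$. The coefficients satisfy $\rho_A,\mu,T_r,r,\kappa\in L^\infty(0,\ell)$ and there are constants with, for $x\in(0,\ell)$, $0<\rho_0\le\rho_A(x)\le\rho_1$, $0\le T_{r0}\le T_r(x)\le T_{r1}$, $0<r_0\le r(x)\le r_1$, $0\le\mu_0\le\mu(x)\le\mu_1$, $0<\kappa_0\le\kappa(x)\le\kappa_1$. Let $\mathcal V^2(0,\ell)=\{v\in H^2(0,\ell): v(0)=v(\ell)=0\}$. The set of admissible loads is $\mathcal F=\{F\in L^2(\Omega_T):\Vert F\Vert^2_{L^2(\Omega_T)}\le C_F\}$, with $C_F>0$ a fixed constant. Forward problem with load $F$: $\rho_A(x)u_{tt}+\mu(x)u_t-(T_r(x)u_x)_x+(r(x)u_{xx}+\kappa(x)u_{xxt})_{xx}=F(x,t)$ in $\Omega_T$; $u(x,0)=u_t(x,0)=0$ for $x\in(0,\ell)$; $u(0,t)=u(\ell,t)=0$ and $(r u_{xx}+\kappa u_{xxt})|_{x=0}=(r u_{xx}+\kappa u_{xxt})|_{x=\ell}=0$ for $t\in[0,T]$. A weak solution is $u\in L^2(0,T;\mathcal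 V^2(0,\ell))$ with $u_t\in L^2(0,T;L^2(0,\ell))$, $u_{tt}\in L^2(0,T;H^{-2}(0,\ell))$, in the usual variational sense: $u(\cdot,0)=0$ and for all $v\in H^1(0,T;\mathcal V^2(0,\ell))$ with $v(\cdot,T)=0$, $\int_0^T\int_0^\ell[-\rho_A u_tv_t+\mu u_tv+T_ru_xv_x+ru_{xx}v_{xx}-\kappa u_{xx}v_{xxt}]\,dx\,dt=\int_0^T\int_0^\ell Fv\,dx\,dt$. Compact means that bounded subsets of the domain are mapped to relatively compact subsets of $L^2(0,T)$. *)

theory Defs
  imports "HOL-Analysis.Analysis"
begin

section \<open>The metric space \<open>L\<^sup>2\<close>\<close>

definition sq_integrable :: "'a measure \<Rightarrow> ('a \<Rightarrow> real) set" where
  "sq_integrable M = {f \<in> borel_measurable M. integrable M (\<lambda>x. (f x)\<^sup>2)}"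

definition ae_equal :: "'a measure \<Rightarrow> (('a \<Rightarrow> real) \<times> ('a \<Rightarrow> real)) set" where
  "ae_equal M = {(f, g). f \<in> sq_integrable M \<and> g \<in> sq_integrable M \<and> (AE x in M. f x = g x)}"

definition L2_class :: "'a measure \<Rightarrow> ('a \<Rightarrow> real) \<Rightarrow> ('a \<Rightarrow> real) set" where
  "L2_class M f = ae_equal M `` {f}"

definition L2_rep :: "('a \<Rightarrow> real) set \<Rightarrow> 'a \<Rightarrow> real" where
  "L2_rep A = (SOME f. f \<in> A)"

definition L2_norm :: "'a measure \<Rightarrow> ('a \<Rightarrow> real) set \<Rightarrow> real" where
  "L2_norm M A = sqrt (\<integral>x. (L2_rep A x)\<^sup>2 \<partial>M)"

definition L2_dist :: "'a measure \<Rightarrow> ('a \<Rightarrow> real) set \<Rightarrow> ('a \<Rightarrow> real) set \<Rightarrow> real" where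
  "L2_dist M A B = sqrt (\<integral>x. (L2_rep A x - L2_rep B x)\<^sup>2 \<partial>M)"

definition L2 :: "'a measure \<Rightarrow> ('a \<Rightarrow> real) set metric" where
  "L2 M = metric (sq_integrable M // ae_equal M, L2_dist M)"

lemma sq_integrable_product:
  assumes "f \<in> sq_integrable M" "g \<in> sq_integrable M"
  shows "integrable M (\<lambda>x. f x * g x)"
proof (rule Bochner_Integration.integrable_bound)
  show "integrable M (\<lambda>x. (f x)\<^sup>2 + (g x)\<^sup>2)"
    using assms by (auto simp: sq_integrable_def)
  show "(\<lambda>x. f x * g x) \<in> borel_measurable M"
    using assms by (auto simp: sq_integrable_def)
  have "\<bar>a * b\<bar> \<le> a\<^sup>2 + b\<^sup>2" for a b :: real
  proof -
    have "2 * (\<bar>a\<bar> * \<bar>b\<bar>) \<le> \<bar>a\<bar>\<^sup>2 + \<bar>b\<bar>\<^sup>2"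
      using sum_squares_bound[of "\<bar>a\<bar>" "\<bar>b\<bar>"] by (simp add: mult.assoc)
    moreover have "0 \<le> \<bar>a\<bar> * \<bar>b\<bar>" by simp
    ultimately show ?thesis unfolding abs_mult power2_abs by linarith
  qed
  then show "AE x in M. norm (f x * g x) \<le> norm ((f x)\<^sup>2 + (g x)\<^sup>2)"
    by (intro AE_I2) simp
qed

lemma sq_integrable_diff:
  assumes f: "f \<in> sq_integrable M" and g: "g \<in> sq_integrable M"
  shows "(\<lambda>x. f x - g x) \<in> sq_integrable M"
proof -
  have "integrable M (\<lambda>x. (f x)\<^sup>2 + (g x)\<^sup>2 - 2 * (f x * g x))"
    using f g sq_integrable_product[OF f g]
    by (intro Bochner_Integration.integrable_diff Bochner_Integration.integrable_add
        integrable_mult_right) (auto simp: sq_integrable_def)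
  then show ?thesis
    using f g by (auto simp: sq_integrable_def power2_diff mult.assoc)
qed

lemma sq_integrable_triangle:
  assumes f: "f \<in> sq_integrable M" and g: "g \<in> sq_integrable M"
  shows "sqrt (\<integral>x. (f x + g x)\<^sup>2 \<partial>M) \<le> sqrt (\<integral>x. (f x)\<^sup>2 \<partial>M) + sqrt (\<integral>x. (g x)\<^sup>2 \<partial>M)"
    (is "sqrt ?c \<le> sqrt ?a + sqrt ?b")
proof -
  have a0: "?a \<ge> 0" and b0: "?b \<ge> 0" by auto
  have i: "integrable M (\<lambda>x. (f x)\<^sup>2)" "integrable M (\<lambda>x. (g x)\<^sup>2)"
    "integrable M (\<lambda>x. f x * g x)"
    using f g sq_integrable_product[OF f g] by (auto simp: sq_integrable_def)
  have c: "?c = ?a + ?b + 2 * (\<integral>x. f x * g x \<partial>M)"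
    using i by (simp add: power2_sum mult.assoc)
  have "(\<integral>x. f x * g x \<partial>M)\<^sup>2 \<le> ?a * ?b"
  proof -
    have quad: "0 \<le> ?a * s\<^sup>2 - 2 * s * (\<integral>x. f x * g x \<partial>M) + ?b" for s
    proof -
      have "0 \<le> (\<integral>x. (s * f x - g x)\<^sup>2 \<partial>M)" by simp
      also have "\<dots> = (\<integral>x. s\<^sup>2 * (f x)\<^sup>2 + (g x)\<^sup>2 - 2 * s * (f x * g x) \<partial>M)"
        by (intro Bochner_Integration.integral_cong) (auto simp: power2_eq_square algebra_simps)
      also have "\<dots> = s\<^sup>2 * ?a + ?b - 2 * s * (\<integral>x. f x * g x \<partial>M)"
        using i by simp
      finally show ?thesis by (simp add: algebra_simps)
    qed
    let ?m = "\<integral>x. f x * g x \<partial>M"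
    show ?thesis
    proof (cases "?a = 0")
      case True
      have "?m = 0"
      proof (rule ccontr)
        assume m: "?m \<noteq> 0"
        have "2 * ((?b + 1) / (2 * ?m)) * ?m = ?b + 1" using m by simp
        then show False
          using quad[of "(?b + 1) / (2 * ?m)"] unfolding True by linarith
      qed
      then show ?thesis using True by simp
    next
      case False
      then have "?a > 0" using a0 by linarith
      then show ?thesis
        using quad[of "?m / ?a"] by (simp add: field_simps power2_eq_square)
    qed
  qed
  then have "\<bar>\<integral>x. f x * g x \<partial>M\<bar> \<le> sqrt ?a * sqrt ?b"
    using real_sqrt_le_mono by (fastforce simp: real_sqrt_mult)
  moreover have "(sqrt ?a + sqrt ?b)\<^sup>2 = ?a + ?b + 2 * (sqrt ?a * sqrt ?b)"
    by (simp only: power2_sum real_sqrt_pow2[OF a0] real_sqrt_pow2[OF b0] mult.assoc)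
  ultimately have "?c \<le> (sqrt ?a + sqrt ?b)\<^sup>2"
    using c by linarith
  then show ?thesis using a0 b0 by (intro real_le_lsqrt) auto
qed

lemma equiv_ae_equal: "equiv (sq_integrable M) (ae_equal M)"
proof (rule equivI)
  show "ae_equal M \<subseteq> sq_integrable M \<times> sq_integrable M"
    by (auto simp: ae_equal_def)
  show "refl_on (sq_integrable M) (ae_equal M)"
    by (auto simp: ae_equal_def refl_on_def)
  show "sym (ae_equal M)"
    by (auto simp: ae_equal_def sym_def eq_commute)
  show "trans (ae_equal M)"
  proof (rule transI)
    fix f g h assume "(f, g) \<in> ae_equal M" "(g, h) \<in> ae_equal M"
    then have "f \<in> sq_integrable M" "h \<in> sq_integrable M"
      "AE x in M. f x = g x" "AE x in M. g x = h x"
      by (auto simp: ae_equal_def)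
    then show "(f, h) \<in> ae_equal M" unfolding ae_equal_def by auto
  qed
qed

lemma L2_rep_in:
  assumes "A \<in> sq_integrable M // ae_equal M"
  shows "L2_rep A \<in> sq_integrable M" "L2_class M (L2_rep A) = A"
proof -
  obtain f where f: "f \<in> sq_integrable M" "A = ae_equal M `` {f}"
    using assms by (rule quotientE)
  then have "f \<in> A" using equiv_class_self[OF equiv_ae_equal] by blast
  then have "L2_rep A \<in> A" unfolding L2_rep_def by (rule someI[where P = "\<lambda>f. f \<in> A"])
  then have "(f, L2_rep A) \<in> ae_equal M" using f by blast
  then show "L2_rep A \<in> sq_integrable M" "L2_class M (L2_rep A) = A"
    unfolding L2_class_def f(2)
    using equiv_class_eq[OF equiv_ae_equal] by (force simp: ae_equal_def, metis)
qed

lemma Metric_space_L2: "Metric_space (sq_integrable M // ae_equal M) (L2_dist M)"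
proof
  fix A B C :: "('a \<Rightarrow> real) set"
  show "0 \<le> L2_dist M A B" by (simp add: L2_dist_def)
  show "L2_dist M A B = L2_dist M B A" by (simp add: L2_dist_def power2_commute)
  assume A: "A \<in> sq_integrable M // ae_equal M" and B: "B \<in> sq_integrable M // ae_equal M"
  note A' = L2_rep_in[OF A] and B' = L2_rep_in[OF B]
  have "L2_dist M A B = 0 \<longleftrightarrow> (AE x in M. (L2_rep A x - L2_rep B x)\<^sup>2 = 0)"
    unfolding L2_dist_def real_sqrt_eq_0_iff
    using sq_integrable_diff[OF A'(1) B'(1)]
    by (intro integral_nonneg_eq_0_iff_AE) (auto simp: sq_integrable_def)
  also have "\<dots> \<longleftrightarrow> (L2_rep A, L2_rep B) \<in> ae_equal M"
    using A' B' by (simp add: ae_equal_def)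
  also have "\<dots> \<longleftrightarrow> A = B"
    using A' B' eq_equiv_class_iff[OF equiv_ae_equal A'(1) B'(1)] by (simp add: L2_class_def)
  finally show "L2_dist M A B = 0 \<longleftrightarrow> A = B" .
  assume C: "C \<in> sq_integrable M // ae_equal M"
  note C' = L2_rep_in[OF C]
  show "L2_dist M A C \<le> L2_dist M A B + L2_dist M B C"
    using sq_integrable_triangle[OF sq_integrable_diff[OF A'(1) B'(1)]
        sq_integrable_diff[OF B'(1) C'(1)]]
    by (simp add: L2_dist_def)
qed

lemma mspace_L2: "mspace (L2 M) = sq_integrable M // ae_equal M"
  and mdist_L2: "mdist (L2 M) = L2_dist M"
  using Metric_space.mspace_metric[OF Metric_space_L2]
    Metric_space.mdist_metric[OF Metric_space_L2] by (auto simp: L2_def)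

definition compact_operator ::
  "'a metric \<Rightarrow> 'b metric \<Rightarrow> 'a set \<Rightarrow> ('a \<Rightarrow> 'b) \<Rightarrow> bool" where
  "compact_operator X Y D \<Phi> \<longleftrightarrow>
     D \<subseteq> mspace X \<and> \<Phi> ` D \<subseteq> mspace Y \<and>
     (\<forall>B\<subseteq>D. Metric_space.mbounded (mspace X) (mdist X) B \<longrightarrow>
        compactin (mtopology_of Y) (mtopology_of Y closure_of (\<Phi> ` B)))"


section \<open>Sobolev spaces on an interval\<close>

abbreviation interval :: "real \<Rightarrow> real measure" where
  "interval b \<equiv> lebesgue_on {0<..<b}"

abbreviation cylinder :: "real \<Rightarrow> real \<Rightarrow> (real \<times> real) measure" where
  "cylinder l T \<equiv> lebesgue_on ({0<..<l} \<times> {0<..<T})"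

definition Linf :: "'a measure \<Rightarrow> ('a \<Rightarrow> real) set" where
  "Linf M = {f \<in> borel_measurable M. \<exists>C. AE x in M. \<bar>f x\<bar> \<le> C}"

text \<open>\<open>C\<^sub>c\<^sup>\<infinity>(0,b)\<close>, extended by zero to the real line.\<close>

definition test_functions :: "real \<Rightarrow> (real \<Rightarrow> real) set" where
  "test_functions b =
     {\<phi>. (\<forall>n x. ((deriv ^^ n) \<phi>) field_differentiable (at x)) \<and>
         (\<exists>K. compact K \<and> K \<subseteq> {0<..<b} \<and> (\<forall>x. x \<notin> K \<longrightarrow> \<phi> x = 0))}"

definition has_weak_deriv :: "real \<Rightarrow> (real \<Rightarrow> real) \<Rightarrow> (real \<Rightarrow> real) \<Rightarrow> bool" where
  "has_weak_deriv b f g \<longleftrightarrow>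
     f \<in> sq_integrable (interval b) \<and> g \<in> sq_integrable (interval b) \<and>
     (\<forall>\<phi>\<in>test_functions b.
        (\<integral>x. f x * deriv \<phi> x \<partial>interval b) = - (\<integral>x. g x * \<phi> x \<partial>interval b))"

definition weak_deriv :: "real \<Rightarrow> (real \<Rightarrow> real) \<Rightarrow> real \<Rightarrow> real" where
  "weak_deriv b f = (SOME g. has_weak_deriv b f g)"

definition H2 :: "real \<Rightarrow> (real \<Rightarrow> real) set" where
  "H2 b = {f. \<exists>f1 f2. has_weak_deriv b f f1 \<and> has_weak_deriv b f1 f2}"

definition H2_norm :: "real \<Rightarrow> (real \<Rightarrow> real) \<Rightarrow> real" where
  "H2_norm b f =
     sqrt ((\<integral>x. (f x)\<^sup>2 \<partial>interval b) + (\<integral>x. (weak_deriv b f x)\<^sup>2 \<partial>interval b)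
         + (\<integral>x. (weak_deriv b (weak_deriv b f) x)\<^sup>2 \<partial>interval b))"

text \<open>
  The value at \<open>p \<in> {0, b}\<close> of the continuous representative of \<open>f\<close>. It exists whenever \<open>f\<close> has a
  weak derivative in \<open>L\<^sup>2(0,b)\<close>, and is unique because null sets have dense complement.
\<close>

definition boundary_value :: "real \<Rightarrow> (real \<Rightarrow> real) \<Rightarrow> real \<Rightarrow> real" where
  "boundary_value b f p =
     (THE c. \<exists>g. continuous_on {0..b} g \<and> (AE x in interval b. g x = f x) \<and> g p = c)"

definition V2 :: "real \<Rightarrow> (real \<Rightarrow> real) set" where
  "V2 b = {v \<in> H2 b. boundary_value b v 0 = 0 \<and> boundary_value b v b = 0}"

definition H2_0 :: "real \<Rightarrow> (real \<Rightarrow> real) set" where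
  "H2_0 b = {v \<in> H2 b. \<exists>\<phi>. (\<forall>n. \<phi> n \<in> test_functions b) \<and>
                       (\<lambda>n. H2_norm b (\<lambda>x. v x - \<phi> n x)) \<longlonglongrightarrow> 0}"

text \<open>
  \<open>H\<^sup>-\<^sup>2(0,b)\<close> is the dual of \<open>H\<^sup>2\<^sub>0(0,b)\<close>. Functionals act on representatives; boundedness forces
  them to agree on almost everywhere equal ones. Their values outside \<open>H\<^sup>2\<^sub>0(0,b)\<close> are irrelevant.
\<close>

definition Hminus2 :: "real \<Rightarrow> ((real \<Rightarrow> real) \<Rightarrow> real) set" where
  "Hminus2 b =
     {w. (\<forall>u\<in>H2_0 b. \<forall>v\<in>H2_0 b. \<forall>c d. w (\<lambda>x. c * u x + d * v x) = c * w u + d * w v) \<and>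
         (\<exists>C. \<forall>v\<in>H2_0 b. \<bar>w v\<bar> \<le> C * H2_norm b v)}"

definition Hminus2_norm :: "real \<Rightarrow> ((real \<Rightarrow> real) \<Rightarrow> real) \<Rightarrow> real" where
  "Hminus2_norm b w = Sup {\<bar>w v\<bar> | v. v \<in> H2_0 b \<and> H2_norm b v \<le> 1}"


section \<open>Functions of space and time\<close>

text \<open>
  A function \<open>u\<close> of time with values in a space of functions on \<open>(0,l)\<close> is given by
  \<open>u (x, t)\<close>, and \<open>L\<^sup>2(0,T; L\<^sup>2(0,l))\<close> is identified with \<open>L\<^sup>2((0,l) \<times> (0,T))\<close>.
  The following says \<open>u \<in> L\<^sup>2(0,T; V\<^sup>2(0,l))\<close>, with \<open>ux\<close> and \<open>uxx\<close> the weak \<open>x\<close>-derivatives of \<open>u\<close>;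
  these are determined by \<open>u\<close> almost everywhere.
\<close>

definition L2_V2 :: "real \<Rightarrow> real \<Rightarrow> (real \<times> real \<Rightarrow> real) \<Rightarrow> (real \<times> real \<Rightarrow> real) \<Rightarrow>
    (real \<times> real \<Rightarrow> real) \<Rightarrow> bool" where
  "L2_V2 l T u ux uxx \<longleftrightarrow>
     u \<in> sq_integrable (cylinder l T) \<and> ux \<in> sq_integrable (cylinder l T) \<and>
     uxx \<in> sq_integrable (cylinder l T) \<and>
     (AE t in interval T.
        (\<lambda>x. u (x, t)) \<in> V2 l \<and>
        has_weak_deriv l (\<lambda>x. u (x, t)) (\<lambda>x. ux (x, t)) \<and>
        has_weak_deriv l (\<lambda>x. ux (x, t)) (\<lambda>x. uxx (x, t)))"

text \<open>The weak derivative in time is that of an \<open>L\<^sup>2(0,l)\<close>-valued function: the two Bochner integrals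
  below are elements of \<open>L\<^sup>2(0,l)\<close>, hence compared almost everywhere in \<open>x\<close>.\<close>

definition has_weak_time_deriv ::
  "real \<Rightarrow> real \<Rightarrow> (real \<times> real \<Rightarrow> real) \<Rightarrow> (real \<times> real \<Rightarrow> real) \<Rightarrow> bool" where
  "has_weak_time_deriv l T u ut \<longleftrightarrow>
     u \<in> sq_integrable (cylinder l T) \<and> ut \<in> sq_integrable (cylinder l T) \<and>
     (\<forall>\<psi>\<in>test_functions T. AE x in interval l.
        (\<integral>t. u (x, t) * deriv \<psi> t \<partial>interval T) = - (\<integral>t. ut (x, t) * \<psi> t \<partial>interval T))"

text \<open>
  \<open>w \<in> L\<^sup>2(0,T; H\<^sup>-\<^sup>2(0,l))\<close>, where weak and strong measurability coincide since \<open>H\<^sup>2\<^sub>0(0,l)\<close> is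
  separable; for the same reason the dual norm is a measurable function of \<open>t\<close>, and the
  nonnegative integral is the usual one.
\<close>

definition L2_Hminus2 :: "real \<Rightarrow> real \<Rightarrow> (real \<Rightarrow> (real \<Rightarrow> real) \<Rightarrow> real) \<Rightarrow> bool" where
  "L2_Hminus2 l T w \<longleftrightarrow>
     (AE t in interval T. w t \<in> Hminus2 l) \<and>
     (\<forall>\<phi>\<in>H2_0 l. (\<lambda>t. w t \<phi>) \<in> borel_measurable (interval T)) \<and>
     (\<integral>\<^sup>+t. ennreal ((Hminus2_norm l (w t))\<^sup>2) \<partial>interval T) < \<infinity>"

definition has_weak_time_deriv_Hminus2 ::
  "real \<Rightarrow> real \<Rightarrow> (real \<times> real \<Rightarrow> real) \<Rightarrow> (real \<Rightarrow> (real \<Rightarrow> real) \<Rightarrow> real) \<Rightarrow> bool" where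
  "has_weak_time_deriv_Hminus2 l T u w \<longleftrightarrow>
     u \<in> sq_integrable (cylinder l T) \<and> L2_Hminus2 l T w \<and>
     (\<forall>\<psi>\<in>test_functions T. \<forall>\<phi>\<in>H2_0 l.
        (\<integral>(x, t). u (x, t) * \<phi> x * deriv \<psi> t \<partial>cylinder l T)
          = - (\<integral>t. w t \<phi> * \<psi> t \<partial>interval T))"

text \<open>\<open>u(\<cdot>,s) = 0\<close> for the representative of \<open>u\<close> in \<open>C([0,T]; L\<^sup>2(0,l))\<close>, which exists for
  \<open>u \<in> H\<^sup>1(0,T; L\<^sup>2(0,l))\<close>.\<close>

definition vanishes_at_time :: "real \<Rightarrow> real \<Rightarrow> (real \<times> real \<Rightarrow> real) \<Rightarrow> real \<Rightarrow> bool" where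
  "vanishes_at_time l T u s \<longleftrightarrow>
     (\<exists>U. (\<forall>t\<in>{0..T}. U t \<in> sq_integrable (interval l)) \<and>
          (AE t in interval T. AE x in interval l. U t x = u (x, t)) \<and>
          (\<forall>t\<in>{0..T}. ((\<lambda>t'. \<integral>x. (U t' x - U t x)\<^sup>2 \<partial>interval l) \<longlongrightarrow> 0) (at t within {0..T})) \<and>
          (AE x in interval l. U s x = 0))"


section \<open>The forward problem and the input-output operators\<close>

text \<open>The test functions are the \<open>v \<in> H\<^sup>1(0,T; V\<^sup>2(0,l))\<close> with \<open>v(\<cdot>,T) = 0\<close>. The condition
  \<open>u\<^sub>t(\<cdot>,0) = 0\<close> and the moment boundary conditions are encoded in the variational identity.\<close>

definition weak_solution ::
  "real \<Rightarrow> real \<Rightarrow> (real \<Rightarrow> real) \<Rightarrow> (real \<Rightarrow> real) \<Rightarrow> (real \<Rightarrow> real) \<Rightarrow> (real \<Rightarrow> real) \<Rightarrow>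
   (real \<Rightarrow> real) \<Rightarrow> (real \<times> real \<Rightarrow> real) \<Rightarrow> (real \<times> real \<Rightarrow> real) \<Rightarrow> bool" where
  "weak_solution l T \<rho> \<mu> Tr r \<kappa> F u \<longleftrightarrow>
     (\<exists>ux uxx ut utt.
        L2_V2 l T u ux uxx \<and>
        has_weak_time_deriv l T u ut \<and>
        has_weak_time_deriv_Hminus2 l T ut utt \<and>
        vanishes_at_time l T u 0 \<and>
        (\<forall>v vx vxx vt vxt vxxt.
           L2_V2 l T v vx vxx \<longrightarrow> L2_V2 l T vt vxt vxxt \<longrightarrow>
           has_weak_time_deriv l T v vt \<longrightarrow> vanishes_at_time l T v T \<longrightarrow>
           (\<integral>(x, t). - \<rho> x * ut (x, t) * vt (x, t) + \<mu> x * ut (x, t) * v (x, t)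
                     + Tr x * ux (x, t) * vx (x, t) + r x * uxx (x, t) * vxx (x, t)
                     - \<kappa> x * uxx (x, t) * vxxt (x, t) \<partial>cylinder l T)
             = (\<integral>(x, t). F (x, t) * v (x, t) \<partial>cylinder l T)))"

definition is_solution ::
  "real \<Rightarrow> real \<Rightarrow> (real \<Rightarrow> real) \<Rightarrow> (real \<Rightarrow> real) \<Rightarrow> (real \<Rightarrow> real) \<Rightarrow> (real \<Rightarrow> real) \<Rightarrow>
   (real \<Rightarrow> real) \<Rightarrow> (real \<times> real \<Rightarrow> real) set \<Rightarrow> (real \<times> real \<Rightarrow> real) set \<Rightarrow> bool" where
  "is_solution l T \<rho> \<mu> Tr r \<kappa> F u \<longleftrightarrow>
     u \<in> mspace (L2 (cylinder l T)) \<and> weak_solution l T \<rho> \<mu> Tr r \<kappa> (L2_rep F) (L2_rep u)"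

definition solution ::
  "real \<Rightarrow> real \<Rightarrow> (real \<Rightarrow> real) \<Rightarrow> (real \<Rightarrow> real) \<Rightarrow> (real \<Rightarrow> real) \<Rightarrow> (real \<Rightarrow> real) \<Rightarrow>
   (real \<Rightarrow> real) \<Rightarrow> (real \<times> real \<Rightarrow> real) set \<Rightarrow> (real \<times> real \<Rightarrow> real) set" where
  "solution l T \<rho> \<mu> Tr r \<kappa> F = (THE u. is_solution l T \<rho> \<mu> Tr r \<kappa> F u)"

definition admissible_loads :: "real \<Rightarrow> real \<Rightarrow> real \<Rightarrow> (real \<times> real \<Rightarrow> real) set set" where
  "admissible_loads l T C = {F \<in> mspace (L2 (cylinder l T)). (L2_norm (cylinder l T) F)\<^sup>2 \<le> C}"

text \<open>\<open>slope_output \<dots> p\<close> is the operator \<open>F \<mapsto> u\<^sub>x(p,\<cdot>;F)\<close>, with \<open>p = 0\<close> or \<open>p = l\<close>.\<close>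

definition slope_output ::
  "real \<Rightarrow> real \<Rightarrow> (real \<Rightarrow> real) \<Rightarrow> (real \<Rightarrow> real) \<Rightarrow> (real \<Rightarrow> real) \<Rightarrow> (real \<Rightarrow> real) \<Rightarrow>
   (real \<Rightarrow> real) \<Rightarrow> real \<Rightarrow> (real \<times> real \<Rightarrow> real) set \<Rightarrow> (real \<Rightarrow> real) set" where
  "slope_output l T \<rho> \<mu> Tr r \<kappa> p F =
     L2_class (interval T)
       (\<lambda>t. boundary_value l
              (weak_deriv l (\<lambda>x. L2_rep (solution l T \<rho> \<mu> Tr r \<kappa> F) (x, t))) p)"

end

theory Submission
  imports Defs "HOL-Complex_Analysis.Great_Picard"
begin

text \<open>
  Since \<open>v'' = f\<close>, \<open>v(0) = v(l) = 0\<close> is solved by an integral operator \<open>G\<close>, the space \<open>V\<^sup>2(0,l)\<close> is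
  parametrised by \<open>L\<^sup>2(0,l)\<close>, and everything takes place in the Hilbert space \<open>L\<^sup>2\<close> of the plane. With
  \<open>q = u\<^bsub>xxt\<^esub>\<close>, \<open>s = u\<^bsub>tt\<^esub>\<close> and \<open>J\<close> the integration in time from \<open>0\<close>, the problem becomes \<open>G q = J s\<close> together
  with a variational equation for \<open>(q, s)\<close> whose operators are all bounded. Testing it with
  \<open>p + \<Lambda> J p\<close> where \<open>q = J p\<close>, \<open>s = G p\<close> (that is, with \<open>u\<^bsub>tt\<^esub> + \<Lambda> u\<^sub>t\<close>) is coercive in \<open>(q, s)\<close> for large
  \<open>\<Lambda>\<close>, so Lions' projection lemma gives existence. It even yields \<open>u\<^bsub>tt\<^esub> \<in> L\<^sup>2\<close>, which is essential: as \<open>\<rho>\<close> is merely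
  bounded, an estimate for \<open>\<rho> u\<^bsub>tt\<^esub>\<close> in a dual space would say nothing about \<open>u\<^bsub>tt\<^esub>\<close>. Uniqueness follows
  by testing the difference of two solutions with its time integral from \<open>t\<close> to \<open>T\<close>. Finally
  \<open>u\<^sub>x(p,t)\<close> is the integral over \<open>(0,t)\<close> of a function \<open>u\<^bsub>xt\<^esub>(p,\<cdot>)\<close> that is bounded in \<open>L\<^sup>2(0,T)\<close> by the load,
  so that Arzela--Ascoli applies.
\<close>

section \<open>Solvability of coercive problems in Hilbert space\<close>

text \<open>The coefficients depend on x alone, so multiplication by them commutes with integration
  in time, and energy identities become operator algebra. In the application E / T is the orthogonal
  projection onto functions constant in time, so each boundary term at time T appears as a quadratic
  form in \<open>E a\<close>. The value \<Lambda> = (R1 + K0) / K0 is what makes \<Lambda> times the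
  damping form dominate the elastic form of \<open>R\<close> with K0 to spare; this is where strict
  positivity of \<kappa> enters. Outside the abstract argument the obstacle is measurability and
  null sets. The definitions speak of Lebesgue measurable representatives on open sets, while Fubini
  wants Borel functions on the plane, and a slope at an end point is a value on a null set. Hence
  functions are replaced by Borel modifications extended by zero, and the kernels of the Dirichlet
  problem are defined up to the closed interval. Evaluating u_xt at an end is then bounded, since
  the rows of the kernel of \<open>D\<close> are bounded in L2 uniformly in x.\<close>

text \<open>Linear functionals and operators on a subspace are given by their graphs, so that they need not
  be defined outside the subspace.\<close>

lemma riesz_subspace:
  fixes \<Gamma> :: "('h::{real_inner,complete_space} \<times> real) set"
  assumes sub: "subspace \<Gamma>" and C: "0 \<le> C" and bd: "\<And>x c. (x, c) \<in> \<Gamma> \<Longrightarrow> \<bar>c\<bar> \<le> C * norm x"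
  shows "\<exists>w\<in>closure (fst ` \<Gamma>). norm w \<le> C \<and> (\<forall>(x, c)\<in>\<Gamma>. inner w x = c)"
proof -
  \<comment> \<open>Minimising this functional takes the place of a projection theorem: it works
    directly on a graph that need not be closed.\<close>
  define I where "I = (\<lambda>(x::'h, c). (norm x)\<^sup>2 / 2 - c)"
  define m where "m = Inf (I ` \<Gamma>)"
  have zero: "(0, 0) \<in> \<Gamma>" using subspace_0[OF sub] by (simp add: zero_prod_def)
  have lower: "- (C\<^sup>2 / 2) \<le> I p" if "p \<in> \<Gamma>" for p
  proof -
    obtain x c where p: "p = (x, c)" by fastforce
    have "0 \<le> (norm x - C)\<^sup>2" by simp
    then have "C * norm x \<le> (norm x)\<^sup>2 / 2 + C\<^sup>2 / 2" by (simp add: power2_diff algebra_simps)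
    then show ?thesis using bd[of x c] that by (auto simp: I_def p)
  qed
  have bdd: "bdd_below (I ` \<Gamma>)" using lower by (intro bdd_belowI[of _ "- (C\<^sup>2 / 2)"]) auto
  have mI: "m \<le> I p" if "p \<in> \<Gamma>" for p
    unfolding m_def using bdd that by (intro cInf_lower) auto
  have "\<exists>p\<in>\<Gamma>. I p < m + 1 / Suc n" for n
  proof -
    have "Inf (I ` \<Gamma>) < m + 1 / Suc n" by (simp add: m_def)
    then show ?thesis using zero bdd by (subst (asm) cInf_less_iff) auto
  qed
  then obtain p where p: "\<And>n. p n \<in> \<Gamma>" "\<And>n. I (p n) < m + 1 / Suc n" by metis
  define X where "X n = fst (p n)" for n
  define c where "c n = snd (p n)" for n
  have pX: "p n = (X n, c n)" for n by (simp add: X_def c_def)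
  \<comment> \<open>Parallelogram law: two almost minimising points are close, because their
    midpoint cannot fall below \<open>m\<close>.\<close>
  have close: "(norm (X i - X j))\<^sup>2 \<le> 4 * (1 / Suc i + 1 / Suc j)" for i j
  proof -
    have "(1/2) *\<^sub>R (p i + p j) \<in> \<Gamma>"
      using sub p by (intro subspace_scale subspace_add)
    then have "m \<le> I ((1/2) *\<^sub>R (p i + p j))" by (rule mI)
    moreover have "I (p i) + I (p j) - 2 * I ((1/2) *\<^sub>R (p i + p j)) = (norm (X i - X j))\<^sup>2 / 4"
      by (simp add: pX I_def power2_norm_eq_inner inner_simps inner_commute field_simps)
    ultimately show ?thesis using p(2)[of i] p(2)[of j] by argo
  qed
  have "Cauchy X"
  proof (rule CauchyI)
    fix e :: real assume e: "0 < e"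
    obtain N :: nat where N: "8 / e\<^sup>2 < N" using reals_Archimedean2 by blast
    have "norm (X i - X j) < e" if "i \<ge> N" "j \<ge> N" for i j
    proof -
      have N0: "N > 0"
      proof (rule ccontr)
        assume "\<not> 0 < N"
        then have "8 / e\<^sup>2 < 0" using N by simp
        then show False using e by (simp add: divide_less_0_iff)
      qed
      have "1 / Suc i < 1 / N" "1 / Suc j < 1 / N" using that N0 by (auto simp: field_simps)
      then have "4 * (1 / Suc i + 1 / Suc j) < 4 * (1 / real N + 1 / real N)"
        by (intro mult_strict_left_mono add_strict_mono) auto
      with close[of i j] have "(norm (X i - X j))\<^sup>2 < 4 * (1 / real N + 1 / real N)"
        by (rule le_less_trans)
      then have "(norm (X i - X j))\<^sup>2 < 8 / N" by simp
      also have "8 / N < e\<^sup>2" using N e N0 by (simp add: field_simps)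
      finally show ?thesis using e by (simp add: power_less_imp_less_base)
    qed
    then show "\<exists>M. \<forall>m\<ge>M. \<forall>n\<ge>M. norm (X m - X n) < e" by blast
  qed
  then obtain w where w: "X \<longlonglongrightarrow> w" using Cauchy_convergent_iff convergent_def by blast
  have "w \<in> closure (fst ` \<Gamma>)"
    unfolding closure_sequential using p(1) w X_def by blast
  moreover have eq: "inner w x = d" if "(x, d) \<in> \<Gamma>" for x d
  proof -
    \<comment> \<open>First variation in the direction \<open>(x, d)\<close>. The slack 1 / Suc n of
      the minimising sequence disappears in the limit.\<close>
    have pos: "0 \<le> s * (inner w x - d) + s\<^sup>2 / 2 * (norm x)\<^sup>2" for s
    proof (rule LIMSEQ_le_const)
      have lim: "(\<lambda>n. 1 / real (Suc n)) \<longlonglongrightarrow> 0" using LIMSEQ_Suc lim_1_over_n by blast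
      show "(\<lambda>n. 1 / Suc n + (s * (inner (X n) x - d) + s\<^sup>2 / 2 * (norm x)\<^sup>2))
          \<longlonglongrightarrow> s * (inner w x - d) + s\<^sup>2 / 2 * (norm x)\<^sup>2"
        by (rule tendsto_eq_intros lim w refl | simp)+
      have "0 \<le> 1 / Suc n + (s * (inner (X n) x - d) + s\<^sup>2 / 2 * (norm x)\<^sup>2)" for n
      proof -
        have "p n + s *\<^sub>R (x, d) \<in> \<Gamma>" using sub p that by (intro subspace_scale subspace_add)
        then have "m \<le> I (p n + s *\<^sub>R (x, d))" by (rule mI)
        also have "\<dots> = I (p n) + (s * (inner (X n) x - d) + s\<^sup>2 / 2 * (norm x)\<^sup>2)"
          unfolding pX I_def plus_prod_def scaleR_prod_def prod.case fst_conv snd_conv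
            power2_norm_eq_inner
          by (simp add: inner_simps inner_commute field_simps power2_eq_square)
        finally show ?thesis using p(2)[of n] by linarith
      qed
      then show "\<exists>N. \<forall>n\<ge>N. 0 \<le> 1 / Suc n + (s * (inner (X n) x - d) + s\<^sup>2 / 2 * (norm x)\<^sup>2)" by blast
    qed
    define a where "a = inner w x - d"
    have pos': "0 \<le> s * a + s\<^sup>2 / 2 * (norm x)\<^sup>2" for s using pos by (simp add: a_def)
    have "a = 0"
    proof (cases "norm x = 0")
      case True
      then show ?thesis using pos'[of "-a"] by (simp add: power2_eq_square[symmetric])
    next
      case False
      \<comment> \<open>The vertex of the quadratic in \<open>s\<close>; its value there is negative
        unless \<open>a\<close> is zero.\<close>
      have "- a / (norm x)\<^sup>2 * a + (- a / (norm x)\<^sup>2)\<^sup>2 / 2 * (norm x)\<^sup>2 = - (a\<^sup>2 / (2 * (norm x)\<^sup>2))"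
        using False by (simp add: field_simps power2_eq_square)
      then have "a\<^sup>2 / (2 * (norm x)\<^sup>2) \<le> 0" using pos'[of "- a / (norm x)\<^sup>2"] by simp
      then show ?thesis using False by (simp add: divide_le_0_iff power2_eq_square)
        (use False in \<open>auto simp: mult_le_0_iff zero_le_mult_iff\<close>)
    qed
    then show ?thesis by (simp add: a_def)
  qed
  moreover have "norm w \<le> C"
  proof -
    have "(\<lambda>n. inner w (X n)) \<longlonglongrightarrow> inner w w" by (intro tendsto_intros w)
    moreover have "(\<lambda>n. C * norm (X n)) \<longlonglongrightarrow> C * norm w" by (intro tendsto_intros w)
    moreover have "inner w (X n) \<le> C * norm (X n)" for n
      using eq[of "X n" "c n"] bd[of "X n" "c n"] p(1)[of n] pX by auto
    ultimately have "inner w w \<le> C * norm w" by (intro LIMSEQ_le) auto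
    then show ?thesis using C
      by (cases "w = 0") (auto simp: power2_norm_eq_inner[symmetric] power2_eq_square)
  qed
  ultimately show ?thesis by blast
qed

lemma subspace_closure:
  fixes S :: "'a::real_normed_vector set"
  assumes "subspace S" shows "subspace (closure S)"
  unfolding subspace_def
proof (intro conjI ballI allI)
  show "0 \<in> closure S" using subspace_0[OF assms] closure_subset by blast
  show "x + y \<in> closure S" if xy: "x \<in> closure S" "y \<in> closure S" for x y
  proof -
    obtain f g where "\<forall>n. f n \<in> S" "f \<longlonglongrightarrow> x" "\<forall>n. g n \<in> S" "g \<longlonglongrightarrow> y"
      using xy unfolding closure_sequential by blast
    then show ?thesis unfolding closure_sequential
      by (intro exI[of _ "\<lambda>n. f n + g n"]) (auto intro: subspace_add assms tendsto_add)
  qed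
  show "c *\<^sub>R x \<in> closure S" if x: "x \<in> closure S" for c x
  proof -
    obtain f where "\<forall>n. f n \<in> S" "f \<longlonglongrightarrow> x"
      using x unfolding closure_sequential by blast
    then show ?thesis unfolding closure_sequential
      by (intro exI[of _ "\<lambda>n. c *\<^sub>R f n"]) (auto intro: subspace_scale assms tendsto_scaleR)
  qed
qed

text \<open>A triple \<open>(a, k, c)\<close> holds a test vector, its image under an operator that
  may be unbounded, and the prescribed value of a functional. Coercivity bounds the test vector by
  the projection of its image onto the closed test space, so the value is a bounded functional of
  that projection and has a Riesz representative.\<close>

lemma lions:
  fixes \<Gamma> :: "('h::{real_inner,complete_space} \<times> 'h \<times> real) set"
  assumes sub: "subspace \<Gamma>" and c0: "0 < c0" and C: "0 \<le> C"
    and coercive: "\<And>a k c. (a, k, c) \<in> \<Gamma> \<Longrightarrow> c0 * (norm a)\<^sup>2 \<le> inner a k"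
    and bd: "\<And>a k c. (a, k, c) \<in> \<Gamma> \<Longrightarrow> \<bar>c\<bar> \<le> C * norm a"
  shows "\<exists>w\<in>closure (fst ` \<Gamma>). norm w \<le> C / c0 \<and> (\<forall>(a, k, c)\<in>\<Gamma>. inner w k = c)"
proof -
  define S where "S = fst ` \<Gamma>"
  define V where "V = closure S"
  have S: "subspace S" unfolding S_def
    by (intro linear_subspace_image sub) (auto intro: linearI)
  have V: "subspace V" unfolding V_def by (rule subspace_closure[OF S])
  have SV: "S \<subseteq> V" by (simp add: V_def closure_subset)
  have inner_eq: "inner v x = inner v y" if "v \<in> V" "\<And>s. s \<in> S \<Longrightarrow> inner s x = inner s y" for v x y
  proof -
    have "closed {v. inner v x = inner v y}" by (intro closed_Collect_eq continuous_intros)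
    then have "V \<subseteq> {v. inner v x = inner v y}"
      unfolding V_def using that(2) by (intro closure_minimal) auto
    then show ?thesis using that(1) by auto
  qed
  \<comment> \<open>Orthogonal projection of \<open>k\<close> onto \<open>V\<close>, obtained as the
    Riesz representative of the functional \<open>inner k\<close> on \<open>S\<close>.\<close>
  have proj: "\<exists>p\<in>V. \<forall>s\<in>S. inner s p = inner s k" for k
  proof -
    define G where "G = (\<lambda>s. (s, inner k s)) ` S"
    have "subspace G" unfolding G_def
  by (intro linear_subspace_image S linearI) (auto simp: inner_simps)
    moreover have "\<bar>c\<bar> \<le> norm k * norm x" if "(x, c) \<in> G" for x c
      using that Cauchy_Schwarz_ineq2[of k x] by (auto simp: G_def)
    ultimately have "\<exists>w\<in>closure (fst ` G). norm w \<le> norm k \<and> (\<forall>(x, c)\<in>G. inner w x = c)"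
      by (intro riesz_subspace) auto
    moreover have "fst ` G = S" by (force simp: G_def)
    ultimately obtain w where w: "w \<in> V" "\<forall>(x, c)\<in>G. inner w x = c" unfolding V_def by auto
    have "inner s w = inner s k" if "s \<in> S" for s
    proof -
      have "(s, inner k s) \<in> G" using that by (auto simp: G_def)
      then have "inner w s = inner k s" using w(2) by auto
      then show ?thesis by (simp add: inner_commute)
    qed
    then show ?thesis using w(1) by blast
  qed
  \<comment> \<open>Pairs of a projected image and its prescribed value. Coercivity gives c0
    \<open>norm a\<close> at most \<open>norm p\<close>, so \<open>c\<close> is controlled by
    \<open>p\<close> alone.\<close>
  define \<Gamma>2 where "\<Gamma>2 = {(p, c). p \<in> V \<and> (\<exists>a k. (a, k, c) \<in> \<Gamma> \<and> (\<forall>s\<in>S. inner s p = inner s k))}"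
  have "subspace \<Gamma>2" unfolding subspace_def
  proof (intro conjI ballI allI)
    have "(0, 0, 0) \<in> \<Gamma>" using subspace_0[OF sub] by (simp add: zero_prod_def)
    moreover have "0 \<in> V" using subspace_0[OF V] .
    ultimately show "0 \<in> \<Gamma>2" unfolding \<Gamma>2_def zero_prod_def by force
  next
    fix x y assume x: "x \<in> \<Gamma>2" and y: "y \<in> \<Gamma>2"
    obtain p c a k where 1: "x = (p, c)" "p \<in> V" "(a, k, c) \<in> \<Gamma>" "\<forall>s\<in>S. inner s p = inner s k"
      using x by (auto simp: \<Gamma>2_def)
    obtain p' c' a' k' where 2: "y = (p', c')" "p' \<in> V" "(a', k', c') \<in> \<Gamma>"
      "\<forall>s\<in>S. inner s p' = inner s k'"
      using y by (auto simp: \<Gamma>2_def)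
    have "(a + a', k + k', c + c') \<in> \<Gamma>" using subspace_add[OF sub 1(3) 2(3)] by simp
    moreover have "p + p' \<in> V" using subspace_add[OF V 1(2) 2(2)] .
    moreover have "\<forall>s\<in>S. inner s (p + p') = inner s (k + k')" using 1(4) 2(4) by (simp add: inner_simps)
    ultimately show "x + y \<in> \<Gamma>2" unfolding \<Gamma>2_def 1(1) 2(1) by auto
  next
    fix d x assume x: "x \<in> \<Gamma>2"
    obtain p c a k where 1: "x = (p, c)" "p \<in> V" "(a, k, c) \<in> \<Gamma>" "\<forall>s\<in>S. inner s p = inner s k"
      using x by (auto simp: \<Gamma>2_def)
    have "(d *\<^sub>R a, d *\<^sub>R k, d *\<^sub>R c) \<in> \<Gamma>" using subspace_scale[OF sub 1(3), of d] by simp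
    moreover have "d *\<^sub>R p \<in> V" using subspace_scale[OF V 1(2)] .
    moreover have "\<forall>s\<in>S. inner s (d *\<^sub>R p) = inner s (d *\<^sub>R k)" using 1(4) by (simp add: inner_simps)
    ultimately have "(d *\<^sub>R p, d *\<^sub>R c) \<in> \<Gamma>2" unfolding \<Gamma>2_def by blast
    then show "d *\<^sub>R x \<in> \<Gamma>2" by (simp add: 1(1))
  qed
  moreover have "\<bar>c\<bar> \<le> C / c0 * norm p" if pc: "(p, c) \<in> \<Gamma>2" for p c
  proof -
    obtain a k where ak: "(a, k, c) \<in> \<Gamma>" "\<forall>s\<in>S. inner s p = inner s k"
      using pc unfolding \<Gamma>2_def by blast
    have "a \<in> S" using ak(1) by (force simp: S_def)
    then have "c0 * (norm a)\<^sup>2 \<le> inner a p" using coercive[OF ak(1)] ak(2) by simp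
    also have "\<dots> \<le> norm a * norm p" by (rule norm_cauchy_schwarz)
    finally have "c0 * norm a \<le> norm p" using c0
      by (cases "a = 0") (auto simp: power2_eq_square)
    then have "norm a \<le> norm p / c0" using c0 by (simp add: field_simps)
    then have "C * norm a \<le> C * (norm p / c0)" using C by (rule mult_left_mono)
    then show ?thesis using bd[OF ak(1)] by simp
  qed
  ultimately have "\<exists>w\<in>closure (fst ` \<Gamma>2). norm w \<le> C / c0 \<and> (\<forall>(p, c)\<in>\<Gamma>2. inner w p = c)"
    using C c0 by (intro riesz_subspace) auto
  then obtain w where w0: "w \<in> closure (fst ` \<Gamma>2)"
    "norm w \<le> C / c0 \<and> (\<forall>(p, c)\<in>\<Gamma>2. inner w p = c)" by - (erule bexE, erule that)
  note w = w0(1) conjunct1[OF w0(2)] conjunct2[OF w0(2)]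
  have "fst ` \<Gamma>2 \<subseteq> V" by (auto simp: \<Gamma>2_def)
  then have wV: "w \<in> V" using w(1) closure_minimal[of "fst ` \<Gamma>2" V] by (auto simp: V_def)
  have "inner w k = c" if ak: "(a, k, c) \<in> \<Gamma>" for a k c
  proof -
    obtain p where p: "p \<in> V" "\<forall>s\<in>S. inner s p = inner s k" using proj by blast
    then have "(p, c) \<in> \<Gamma>2" using ak by (auto simp: \<Gamma>2_def)
    then have "inner w p = c" using w(3) by auto
    moreover have "inner w p = inner w k" by (rule inner_eq[OF wV]) (use p(2) in blast)
    ultimately show ?thesis by simp
  qed
  then have "\<forall>(a, k, c)\<in>\<Gamma>. inner w k = c" by blast
  with wV w(2) show ?thesis unfolding V_def S_def by (intro bexI conjI)
qed

section \<open>The Hilbert space of square integrable functions on the plane\<close>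

lemma sq_integrable_add:
  assumes f: "f \<in> sq_integrable M" and g: "g \<in> sq_integrable M"
  shows "(\<lambda>x. f x + g x) \<in> sq_integrable M"
proof -
  have "integrable M (\<lambda>x. (f x)\<^sup>2 + (g x)\<^sup>2 + 2 * (f x * g x))"
    using f g sq_integrable_product[OF f g]
    by (intro Bochner_Integration.integrable_add integrable_mult_right) (auto simp: sq_integrable_def)
  then show ?thesis
    using f g by (auto simp: sq_integrable_def power2_sum mult.assoc)
qed

lemma sq_integrable_scale:
  assumes f: "f \<in> sq_integrable M"
  shows "(\<lambda>x. c * f x) \<in> sq_integrable M"
  using f by (auto simp: sq_integrable_def power_mult_distrib)

lemma sq_integrable_zero: "(\<lambda>x. 0) \<in> sq_integrable M"
  by (simp add: sq_integrable_def)

lemma sq_integrable_uminus: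
  assumes f: "f \<in> sq_integrable M"
  shows "(\<lambda>x. - f x) \<in> sq_integrable M"
  using f by (auto simp: sq_integrable_def)

lemma sq_integrable_cong_AE:
  assumes "f \<in> sq_integrable M" "g \<in> borel_measurable M" "AE x in M. f x = g x"
  shows "g \<in> sq_integrable M"
proof -
  have "integrable M (\<lambda>x. (g x)\<^sup>2) \<longleftrightarrow> integrable M (\<lambda>x. (f x)\<^sup>2)"
    using assms by (intro integrable_cong_AE) (auto simp: sq_integrable_def elim!: eventually_mono)
  then show ?thesis using assms by (auto simp: sq_integrable_def)
qed

lemma sq_integrable_bound:
  fixes f g :: "'a \<Rightarrow> real"
  assumes f: "f \<in> sq_integrable M" and g: "g \<in> borel_measurable M"
    and le: "AE x in M. \<bar>g x\<bar> \<le> C * \<bar>f x\<bar>"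
  shows "g \<in> sq_integrable M"
proof -
  have "integrable M (\<lambda>x. C\<^sup>2 * (f x)\<^sup>2)"
    using f by (auto simp: sq_integrable_def)
  then have "integrable M (\<lambda>x. (g x)\<^sup>2)"
  proof (rule Bochner_Integration.integrable_bound)
    show "AE x in M. norm ((g x)\<^sup>2) \<le> norm (C\<^sup>2 * (f x)\<^sup>2)"
      using le
    proof eventually_elim
      case (elim x)
      then have "\<bar>g x\<bar>\<^sup>2 \<le> (C * \<bar>f x\<bar>)\<^sup>2" by (intro power_mono) auto
      then show ?case by (simp add: power_mult_distrib)
    qed
  qed (use g in auto)
  then show ?thesis using g by (simp add: sq_integrable_def)
qed

lemma cauchy_schwarz_integral:
  assumes f: "f \<in> sq_integrable M" and g: "g \<in> sq_integrable M"
  shows "(\<integral>x. f x * g x \<partial>M)\<^sup>2 \<le> (\<integral>x. (f x)\<^sup>2 \<partial>M) * (\<integral>x. (g x)\<^sup>2 \<partial>M)"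
proof -
  note i = sq_integrable_product[OF f g]
  have "ennreal ((\<integral>x. \<bar>f x * g x\<bar> \<partial>M)\<^sup>2) \<le> ennreal ((\<integral>x. (f x)\<^sup>2 \<partial>M) * (\<integral>x. (g x)\<^sup>2 \<partial>M))"
  proof -
    have "ennreal (\<integral>x. \<bar>f x * g x\<bar> \<partial>M) = (\<integral>\<^sup>+x. ennreal \<bar>f x * g x\<bar> \<partial>M)"
      using i by (subst nn_integral_eq_integral) auto
    also have "\<dots> = (\<integral>\<^sup>+x. ennreal \<bar>f x\<bar> * ennreal \<bar>g x\<bar> \<partial>M)"
      by (simp add: abs_mult ennreal_mult)
    finally have "ennreal ((\<integral>x. \<bar>f x * g x\<bar> \<partial>M)\<^sup>2) = (\<integral>\<^sup>+x. ennreal \<bar>f x\<bar> * ennreal \<bar>g x\<bar> \<partial>M)\<^sup>2"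
      by (subst ennreal_power[symmetric]) simp_all
    also have "\<dots> \<le> (\<integral>\<^sup>+x. (ennreal \<bar>f x\<bar>)\<^sup>2 \<partial>M) * (\<integral>\<^sup>+x. (ennreal \<bar>g x\<bar>)\<^sup>2 \<partial>M)"
      using f g by (intro Cauchy_Schwarz_nn_integral) (auto simp: sq_integrable_def)
    also have "\<dots> = ennreal ((\<integral>x. (f x)\<^sup>2 \<partial>M) * (\<integral>x. (g x)\<^sup>2 \<partial>M))"
      using f g by (auto simp: ennreal_power nn_integral_eq_integral ennreal_mult sq_integrable_def)
    finally show ?thesis .
  qed
  then have "(\<integral>x. \<bar>f x * g x\<bar> \<partial>M)\<^sup>2 \<le> (\<integral>x. (f x)\<^sup>2 \<partial>M) * (\<integral>x. (g x)\<^sup>2 \<partial>M)"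
    by (simp add: ennreal_le_iff)
  moreover have "\<bar>\<integral>x. f x * g x \<partial>M\<bar>\<^sup>2 \<le> (\<integral>x. \<bar>f x * g x\<bar> \<partial>M)\<^sup>2"
    by (intro power_mono integral_abs_bound) auto
  ultimately show ?thesis by simp
qed

abbreviation SI :: "('a::euclidean_space \<Rightarrow> real) set" where
  "SI \<equiv> sq_integrable lborel"

text \<open>The whole plane with Borel measure, not the cylinder: compactly supported kernels act
  there without restricted measure spaces, and Fubini applies directly. Localisation to the cylinder
  is left to the projection \<open>X\<close>.\<close>

typedef l2 = "(SI :: (real \<times> real \<Rightarrow> real) set) // ae_equal lborel"
  using quotientI[OF sq_integrable_zero] by blast

definition mk :: "(real \<times> real \<Rightarrow> real) \<Rightarrow> l2" where
  "mk f = Abs_l2 (L2_class lborel f)"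

definition rep :: "l2 \<Rightarrow> real \<times> real \<Rightarrow> real" where
  "rep q = L2_rep (Rep_l2 q)"

lemma rep_sq_integrable [simp]: "rep q \<in> SI"
  unfolding rep_def using L2_rep_in(1) Rep_l2 by blast

lemma mk_rep [simp]: "mk (rep q) = q"
  unfolding rep_def mk_def using L2_rep_in(2)[of "Rep_l2 q" lborel] Rep_l2[of q]
  by (simp add: Rep_l2_inverse)

lemma mk_eq_iff:
  assumes "f \<in> SI" "g \<in> SI"
  shows "mk f = mk g \<longleftrightarrow> (AE x in lborel. f x = g x)"
proof -
  have "L2_class lborel f \<in> SI // ae_equal lborel" "L2_class lborel g \<in> SI // ae_equal lborel"
    using assms by (auto simp: L2_class_def intro: quotientI)
  then have "mk f = mk g \<longleftrightarrow> L2_class lborel f = L2_class lborel g"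
    unfolding mk_def by (rule Abs_l2_inject)
  also have "\<dots> \<longleftrightarrow> (f, g) \<in> ae_equal lborel"
    unfolding L2_class_def using assms by (intro eq_equiv_class_iff[OF equiv_ae_equal])
  finally show ?thesis using assms by (simp add: ae_equal_def)
qed

lemma rep_mk:
  assumes "f \<in> SI" shows "AE x in lborel. rep (mk f) x = f x"
  using mk_eq_iff[of "rep (mk f)" f] assms by simp

lemma l2_cases: obtains f where "f \<in> SI" "q = mk f"
  using rep_sq_integrable mk_rep by metis

instantiation l2 :: real_inner
begin

definition zero_l2 where "0 = mk (\<lambda>x. 0)"
definition plus_l2 where "a + b = mk (\<lambda>x. rep a x + rep b x)"
definition uminus_l2 where "- a = mk (\<lambda>x. - rep a x)"
definition minus_l2 where "a - b = mk (\<lambda>x. rep a x - rep b x)"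
definition scaleR_l2 where "c *\<^sub>R a = mk (\<lambda>x. c * rep a x)"
definition inner_l2 where "inner a b = (\<integral>x. rep a x * rep b x \<partial>lborel)"
definition norm_l2 where "norm (a::l2) = sqrt (inner a a)"
definition dist_l2 where "dist (a::l2) b = norm (a - b)"
definition sgn_l2 where "sgn (a::l2) = inverse (norm a) *\<^sub>R a"
definition uniformity_l2 where
  "(uniformity :: (l2 \<times> l2) filter) = (INF e\<in>{0 <..}. principal {(x, y). dist x y < e})"
definition open_l2 where
  "open (U :: l2 set) \<longleftrightarrow> (\<forall>x\<in>U. eventually (\<lambda>(x', y). x' = x \<longrightarrow> y \<in> U) uniformity)"

lemma mk_add: "mk f + mk g = mk (\<lambda>x. f x + g x)" if "f \<in> SI" "g \<in> SI"
  unfolding plus_l2_def using that rep_mk[OF that(1)] rep_mk[OF that(2)]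
  by (subst mk_eq_iff) (auto intro!: sq_integrable_add elim: eventually_elim2)

lemma mk_diff: "mk f - mk g = mk (\<lambda>x. f x - g x)" if "f \<in> SI" "g \<in> SI"
  unfolding minus_l2_def using that rep_mk[OF that(1)] rep_mk[OF that(2)]
  by (subst mk_eq_iff) (auto intro!: sq_integrable_diff elim: eventually_elim2)

lemma mk_uminus: "- mk f = mk (\<lambda>x. - f x)" if "f \<in> SI"
  unfolding uminus_l2_def using that rep_mk[OF that]
  by (subst mk_eq_iff) (auto intro!: sq_integrable_uminus elim: eventually_mono)

lemma mk_scale: "c *\<^sub>R mk f = mk (\<lambda>x. c * f x)" if "f \<in> SI"
  unfolding scaleR_l2_def using that rep_mk[OF that]
  by (subst mk_eq_iff) (auto intro!: sq_integrable_scale elim: eventually_mono)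

lemma inner_mk: "inner (mk f) (mk g) = (\<integral>x. f x * g x \<partial>lborel)" if "f \<in> SI" "g \<in> SI"
  unfolding inner_l2_def using that rep_mk[OF that(1)] rep_mk[OF that(2)]
    rep_sq_integrable[of "mk f"] rep_sq_integrable[of "mk g"]
  by (intro integral_cong_AE) (auto simp: sq_integrable_def)

instance
proof
  fix a b c :: l2 and r s :: real
  obtain f where f: "f \<in> SI" "a = mk f" by (rule l2_cases)
  obtain g where g: "g \<in> SI" "b = mk g" by (rule l2_cases)
  obtain h where h: "h \<in> SI" "c = mk h" by (rule l2_cases)
  note ops = f g h sq_integrable_add sq_integrable_zero sq_integrable_uminus sq_integrable_scale
    mk_add mk_uminus mk_scale sq_integrable_diff mk_diff
  show "a + b + c = a + (b + c)" by (simp add: ops add.assoc)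
  show "a + b = b + a" by (simp add: ops add.commute)
  show "0 + a = a" by (simp add: ops zero_l2_def)
  show "- a + a = 0" by (simp add: ops zero_l2_def)
  show "a - b = a + - b" by (simp add: ops)
  show "r *\<^sub>R (a + b) = r *\<^sub>R a + r *\<^sub>R b" by (simp add: ops distrib_left)
  show "(r + s) *\<^sub>R a = r *\<^sub>R a + s *\<^sub>R a" by (simp add: ops distrib_right)
  show "r *\<^sub>R s *\<^sub>R a = (r * s) *\<^sub>R a" by (simp add: ops mult.assoc)
  show "1 *\<^sub>R a = a" by (simp add: ops)
  show "dist a b = norm (a - b)" by (rule dist_l2_def)
  show "sgn a = inverse (norm a) *\<^sub>R a" by (rule sgn_l2_def)
  show "(uniformity :: (l2 \<times> l2) filter) = (INF e\<in>{0 <..}. principal {(x, y). dist x y < e})"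
    by (rule uniformity_l2_def)
  show "open U \<longleftrightarrow> (\<forall>x\<in>U. eventually (\<lambda>(x', y). x' = x \<longrightarrow> y \<in> U) uniformity)" for U :: "l2 set"
    by (rule open_l2_def)
  show "inner a b = inner b a" by (simp add: inner_l2_def mult.commute)
  show "inner (a + b) c = inner a c + inner b c"
    using sq_integrable_product[OF f(1) h(1)] sq_integrable_product[OF g(1) h(1)]
    by (simp add: ops inner_mk distrib_right)
  show "inner (r *\<^sub>R a) b = r * inner a b"
    by (simp add: ops inner_mk mult.assoc)
  show "0 \<le> inner a a" by (simp add: f inner_mk)
  have "inner a a = 0 \<longleftrightarrow> (AE x in lborel. f x * f x = 0)"
    unfolding f(2) inner_mk[OF f(1) f(1)]
    by (intro integral_nonneg_eq_0_iff_AE sq_integrable_product f) auto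
  then show "inner a a = 0 \<longleftrightarrow> a = 0"
    using f by (simp add: zero_l2_def mk_eq_iff sq_integrable_zero)
  show "norm a = sqrt (inner a a)" by (rule norm_l2_def)
qed

end

lemma norm_mk: "norm (mk f) = sqrt (\<integral>x. (f x)\<^sup>2 \<partial>lborel)" if "f \<in> SI"
  using that by (simp add: norm_l2_def inner_mk power2_eq_square)

text \<open>Convergence in L2 of the plane does not give convergence in L1, where the subsequence
  theorem lives. Multiplying by a strictly positive square integrable weight, which exists by
  sigma-finiteness, gives an L1 Cauchy sequence; dividing by the weight afterwards loses nothing
  pointwise.\<close>

lemma AE_cauchy_subseq_l2:
  fixes X :: "nat \<Rightarrow> l2"
  assumes X: "Cauchy X"
  obtains r where "strict_mono r" "AE x in lborel. Cauchy (\<lambda>i. rep (X (r i)) x)"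
proof -
  obtain h :: "real \<times> real \<Rightarrow> ennreal" where h: "h \<in> borel_measurable lborel"
    "integral\<^sup>N lborel h \<noteq> \<infinity>" "\<forall>x\<in>space lborel. 0 < h x \<and> h x < \<infinity>"
    using sigma_finite_measure.Ex_finite_integrable_function[OF sigma_finite_lborel] by metis
  define w where "w x = sqrt (enn2real (h x))" for x
  have wp: "w x > 0" for x using h(3)[THEN bspec, of x] by (simp add: w_def enn2real_positive_iff)
  have w2: "ennreal ((w x)\<^sup>2) = h x" for x using h(3)[THEN bspec, of x] by (simp add: w_def)
  have wm: "w \<in> borel_measurable lborel" unfolding w_def using h(1) by measurable
  have "integrable lborel (\<lambda>x. (w x)\<^sup>2)"
    using wm h(2) w2 by (intro integrableI_nonneg) (auto simp: top.not_eq_extremum)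
  then have w: "w \<in> SI" using wm by (simp add: sq_integrable_def)
  define s where "s n x = rep (X n) x * w x" for n x
  have s: "integrable lborel (s n)" for n
    unfolding s_def by (intro sq_integrable_product w rep_sq_integrable)
  have sd: "(\<integral>x. norm (s i x - s j x) \<partial>lborel) \<le> dist (X i) (X j) * norm (mk w)" for i j
  proof -
    let ?d = "\<lambda>x. \<bar>rep (X i) x - rep (X j) x\<bar>"
    have dd: "(\<lambda>x. rep (X i) x - rep (X j) x) \<in> SI" by (intro sq_integrable_diff rep_sq_integrable)
    have d: "?d \<in> SI" using dd unfolding sq_integrable_def by (auto intro: borel_measurable_abs)
    have "(\<integral>x. norm (s i x - s j x) \<partial>lborel) = (\<integral>x. ?d x * w x \<partial>lborel)"
      using wp by (intro Bochner_Integration.integral_cong)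
        (auto simp: s_def abs_mult less_imp_le left_diff_distrib[symmetric])
    also have "\<dots> = inner (mk ?d) (mk w)" by (simp add: inner_mk d w)
    also have "\<dots> \<le> norm (mk ?d) * norm (mk w)" by (rule norm_cauchy_schwarz)
    also have "norm (mk ?d) = dist (X i) (X j)"
      unfolding norm_mk[OF d] dist_norm
      using norm_mk[OF dd] mk_diff[OF rep_sq_integrable rep_sq_integrable, of "X i" "X j"] by simp
    finally show ?thesis .
  qed
  have "\<exists>N. \<forall>i\<ge>N. \<forall>j\<ge>N. (\<integral>x. norm (s i x - s j x) \<partial>lborel) < e" if "e > 0" for e
  proof -
    have "e / (norm (mk w) + 1) > 0" using that by (intro divide_pos_pos) (auto intro: add_nonneg_pos)
    then obtain N where N: "\<forall>i\<ge>N. \<forall>j\<ge>N. dist (X i) (X j) < e / (norm (mk w) + 1)"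
      using X unfolding Cauchy_def by blast
    have "(\<integral>x. norm (s i x - s j x) \<partial>lborel) < e" if "i \<ge> N" "j \<ge> N" for i j
    proof -
      have "dist (X i) (X j) * (norm (mk w) + 1) < e"
        using N that by (simp add: pos_less_divide_eq add_nonneg_pos)
      moreover have "dist (X i) (X j) * norm (mk w) \<le> dist (X i) (X j) * (norm (mk w) + 1)"
        by (intro mult_left_mono) auto
      ultimately show ?thesis using sd[of i j] by linarith
    qed
    then show ?thesis by blast
  qed
  then obtain r where r: "strict_mono r" "AE x in lborel. Cauchy (\<lambda>i. s (r i) x)"
    using cauchy_L1_AE_cauchy_subseq[of lborel s, OF s] by blast
  from r(2) have "AE x in lborel. Cauchy (\<lambda>i. rep (X (r i)) x)"
  proof eventually_elim
    case (elim x)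
    then have "convergent (\<lambda>i. s (r i) x * (1 / w x))"
      by (intro convergent_mult convergent_const) (simp add: Cauchy_convergent_iff)
    moreover have "s (r i) x * (1 / w x) = rep (X (r i)) x" for i
      using wp[of x] by (simp add: s_def)
    ultimately show ?case by (simp add: Cauchy_convergent_iff)
  qed
  then show ?thesis using r(1) that by blast
qed

text \<open>The limit is the pointwise limit \<open>f\<close> of a subsequence. Fatou's lemma bounds
  the distance of \<open>X n\<close> to \<open>f\<close> by the Cauchy modulus; this also shows that
  \<open>f\<close> is square integrable, as the difference of \<open>X N\<close> and
  \<open>X N\<close> - f.\<close>

instance l2 :: complete_space
proof
  fix X :: "nat \<Rightarrow> l2" assume X: "Cauchy X"
  obtain r where r: "strict_mono r" "AE x in lborel. Cauchy (\<lambda>i. rep (X (r i)) x)"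
    using AE_cauchy_subseq_l2[OF X] by blast
  define f where "f x = lim (\<lambda>i. rep (X (r i)) x)" for x
  have meas [measurable]: "rep q \<in> borel_measurable lborel" for q
    using rep_sq_integrable[of q] unfolding sq_integrable_def by blast
  have f [measurable]: "f \<in> borel_measurable lborel" unfolding f_def by measurable
  have lim: "AE x in lborel. (\<lambda>i. rep (X (r i)) x) \<longlonglongrightarrow> f x"
    using r(2) by eventually_elim (simp add: f_def Cauchy_convergent_iff convergent_LIMSEQ_iff)
  have fatou: "(\<integral>\<^sup>+x. ennreal ((rep (X n) x - f x)\<^sup>2) \<partial>lborel) \<le> ennreal (e\<^sup>2)"
    if N: "\<forall>i\<ge>N. dist (X n) (X i) \<le> e" for n N e
  proof -
    have "(\<integral>\<^sup>+x. ennreal ((rep (X n) x - f x)\<^sup>2) \<partial>lborel)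
        = (\<integral>\<^sup>+x. liminf (\<lambda>i. ennreal ((rep (X n) x - rep (X (r i)) x)\<^sup>2)) \<partial>lborel)"
    proof (intro nn_integral_cong_AE)
      show "AE x in lborel. ennreal ((rep (X n) x - f x)\<^sup>2)
          = liminf (\<lambda>i. ennreal ((rep (X n) x - rep (X (r i)) x)\<^sup>2))"
        using lim
      proof eventually_elim
        case (elim x)
        then have "(\<lambda>i. ennreal ((rep (X n) x - rep (X (r i)) x)\<^sup>2)) \<longlonglongrightarrow> ennreal ((rep (X n) x - f x)\<^sup>2)"
          by (intro tendsto_intros tendsto_ennrealI)
        then show ?case by (intro lim_imp_Liminf[symmetric]) auto
      qed
    qed
    also have "\<dots> \<le> liminf (\<lambda>i. \<integral>\<^sup>+x. ennreal ((rep (X n) x - rep (X (r i)) x)\<^sup>2) \<partial>lborel)"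
      by (intro nn_integral_liminf) measurable
    also have "\<dots> \<le> limsup (\<lambda>i. \<integral>\<^sup>+x. ennreal ((rep (X n) x - rep (X (r i)) x)\<^sup>2) \<partial>lborel)"
      by (intro Liminf_le_Limsup) simp
    also have "\<dots> \<le> ennreal (e\<^sup>2)"
    proof (intro Limsup_bounded eventually_sequentiallyI[of N])
      fix i assume "i \<ge> N"
      then have "r i \<ge> N" using seq_suble[OF r(1), of i] by linarith
      let ?d = "\<lambda>x. rep (X n) x - rep (X (r i)) x"
      have d: "?d \<in> SI" by (intro sq_integrable_diff rep_sq_integrable)
      have "(\<integral>\<^sup>+x. ennreal ((?d x)\<^sup>2) \<partial>lborel) = ennreal (\<integral>x. (?d x)\<^sup>2 \<partial>lborel)"
        using d by (intro nn_integral_eq_integral) (auto simp: sq_integrable_def)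
      also have "(\<integral>x. (?d x)\<^sup>2 \<partial>lborel) = (dist (X n) (X (r i)))\<^sup>2"
        using norm_mk[OF d] mk_diff[OF rep_sq_integrable rep_sq_integrable, of "X n" "X (r i)"]
        by (simp add: dist_norm)
      also have "ennreal \<dots> \<le> ennreal (e\<^sup>2)"
        using N \<open>r i \<ge> N\<close> by (intro ennreal_leI power_mono) auto
      finally show "(\<integral>\<^sup>+x. ennreal ((?d x)\<^sup>2) \<partial>lborel) \<le> ennreal (e\<^sup>2)" .
    qed
    finally show ?thesis .
  qed
  have diffSI: "(\<lambda>x. rep (X n) x - f x) \<in> SI" if "\<forall>i\<ge>N. dist (X n) (X i) \<le> e" for n N e
  proof -
    have "integrable lborel (\<lambda>x. (rep (X n) x - f x)\<^sup>2)"
      using fatou[OF that] by (intro integrableI_nonneg) (auto simp: order.strict_trans1)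
    then show ?thesis by (simp add: sq_integrable_def)
  qed
  have ev: "\<exists>N. \<forall>n\<ge>N. \<forall>i\<ge>N. dist (X n) (X i) \<le> e" if "e > 0" for e
    using X that unfolding Cauchy_def by (meson less_imp_le)
  obtain N where N: "\<forall>n\<ge>N. \<forall>i\<ge>N. dist (X n) (X i) \<le> 1" using ev[of 1] by auto
  have "(\<lambda>x. rep (X N) x - (rep (X N) x - f x)) \<in> SI"
    using N by (intro sq_integrable_diff[OF rep_sq_integrable] diffSI[of N N 1]) auto
  then have fSI: "f \<in> SI" by simp
  have "X \<longlonglongrightarrow> mk f"
  proof (rule LIMSEQ_I)
    fix e :: real assume e: "e > 0"
    obtain N where N: "\<forall>n\<ge>N. \<forall>i\<ge>N. dist (X n) (X i) \<le> e / 2" using ev[of "e/2"] e by auto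
    have "norm (X n - mk f) < e" if n: "n \<ge> N" for n
    proof -
      have Nn: "\<forall>i\<ge>N. dist (X n) (X i) \<le> e / 2" using N n by blast
      have d: "(\<lambda>x. rep (X n) x - f x) \<in> SI" by (rule diffSI[OF Nn])
      have "norm (X n - mk f) = sqrt (\<integral>x. (rep (X n) x - f x)\<^sup>2 \<partial>lborel)"
        using norm_mk[OF d] mk_diff[OF rep_sq_integrable fSI, of "X n"] by simp
      also have "\<dots> \<le> sqrt ((e / 2)\<^sup>2)"
      proof (intro real_sqrt_le_mono)
        have "ennreal (\<integral>x. (rep (X n) x - f x)\<^sup>2 \<partial>lborel) \<le> ennreal ((e/2)\<^sup>2)"
          using fatou[OF Nn] d by (subst nn_integral_eq_integral[symmetric]) (auto simp: sq_integrable_def)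
        then show "(\<integral>x. (rep (X n) x - f x)\<^sup>2 \<partial>lborel) \<le> (e/2)\<^sup>2" by (simp add: ennreal_le_iff)
      qed
      also have "\<dots> < e" using e by simp
      finally show ?thesis .
    qed
    then show "\<exists>no. \<forall>n\<ge>no. norm (X n - mk f) < e" by blast
  qed
  then show "convergent X" by (auto simp: convergent_def)
qed

section \<open>Integral operators in one of two variables\<close>

lemma integrable_lborel2:
  fixes h :: "real \<times> real \<Rightarrow> real"
  assumes h: "integrable lborel h"
  shows "AE t in lborel. integrable lborel (\<lambda>x. h (x, t))"
    and "integrable lborel (\<lambda>t. \<integral>x. h (x, t) \<partial>lborel)"
    and "(\<integral>t. (\<integral>x. h (x, t) \<partial>lborel) \<partial>lborel) = (\<integral>p. h p \<partial>lborel)"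
    and "AE x in lborel. integrable lborel (\<lambda>t. h (x, t))"
    and "integrable lborel (\<lambda>x. \<integral>t. h (x, t) \<partial>lborel)"
    and "(\<integral>x. (\<integral>t. h (x, t) \<partial>lborel) \<partial>lborel) = (\<integral>p. h p \<partial>lborel)"
proof -
  have h': "integrable (lborel \<Otimes>\<^sub>M lborel) (case_prod (\<lambda>x t. h (x, t)))"
    using h by (simp add: lborel_prod)
  show "AE t in lborel. integrable lborel (\<lambda>x. h (x, t))"
    using lborel_pair.AE_integrable_snd[OF h'] .
  show "integrable lborel (\<lambda>t. \<integral>x. h (x, t) \<partial>lborel)"
    using lborel_pair.integrable_snd[OF h'] .
  show "(\<integral>t. (\<integral>x. h (x, t) \<partial>lborel) \<partial>lborel) = (\<integral>p. h p \<partial>lborel)"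
    using lborel_pair.integral_snd[OF h'] by (simp add: lborel_prod)
  show "AE x in lborel. integrable lborel (\<lambda>t. h (x, t))"
    using lborel_pair.AE_integrable_fst[OF h'] .
  show "integrable lborel (\<lambda>x. \<integral>t. h (x, t) \<partial>lborel)"
    using lborel_pair.integrable_fst[OF h'] .
  show "(\<integral>x. (\<integral>t. h (x, t) \<partial>lborel) \<partial>lborel) = (\<integral>p. h p \<partial>lborel)"
    using lborel_pair.integral_fst[OF h'] by (simp add: lborel_prod)
qed

lemma AE_lborel2:
  fixes P :: "real \<times> real \<Rightarrow> bool"
  assumes P: "AE p in lborel. P p"
  shows "AE x in lborel. AE t in lborel. P (x, t)" "AE t in lborel. AE x in lborel. P (x, t)"
proof -
  have "AE p in (lborel \<Otimes>\<^sub>M lborel). P p" unfolding lborel_prod by (rule P)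
  then show "AE x in lborel. AE t in lborel. P (x, t)" by (rule lborel_pair.AE_pair)
  obtain N where N: "N \<in> null_sets (lborel :: (real \<times> real) measure)" "{p. \<not> P p} \<subseteq> N"
    using P by (auto elim!: AE_E simp: null_sets_def)
  have "AE p in (lborel \<Otimes>\<^sub>M lborel). p \<notin> N" unfolding lborel_prod using N(1) by (rule AE_not_in)
  then have "AE x in lborel. AE t in lborel. (x, t) \<notin> N" by (rule lborel_pair.AE_pair)
  moreover have "N \<in> sets borel" using N(1) by auto
  then have "{p \<in> space (lborel \<Otimes>\<^sub>M lborel :: (real \<times> real) measure). (fst p, snd p) \<notin> N} \<in> sets (lborel \<Otimes>\<^sub>M lborel)"
    unfolding lborel_prod by simp
  ultimately have "AE t in lborel. AE x in lborel. (x, t) \<notin> N"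
    using lborel_pair.AE_commute[of "\<lambda>x t. (x, t) \<notin> N"] by simp
  then show "AE t in lborel. AE x in lborel. P (x, t)"
    by eventually_elim (use N(2) in \<open>auto elim!: eventually_mono\<close>)
qed

text \<open>Null slices give a null set only if the exceptional set is measurable. The outer
  quantifier runs over the second coordinate, the time.\<close>

lemma AE_lborel2I:
  fixes P :: "real \<times> real \<Rightarrow> bool"
  assumes P: "{p. P p} \<in> sets borel" and ae: "AE t in lborel. AE x in lborel. P (x, t)"
  shows "AE p in lborel. P p"
proof -
  have s: "{p \<in> space (lborel \<Otimes>\<^sub>M lborel :: (real \<times> real) measure). P (fst p, snd p)} \<in> sets (lborel \<Otimes>\<^sub>M lborel)"
    unfolding lborel_prod using P by simp
  then have "AE x in lborel. AE t in lborel. P (x, t)"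
    using lborel_pair.AE_commute[of "\<lambda>x t. P (x, t)"] ae by simp
  then have "AE p in (lborel \<Otimes>\<^sub>M lborel). P p"
    using s by (intro lborel_pair.AE_pair_measure) auto
  then show ?thesis unfolding lborel_prod .
qed

lemma borel_section:
  fixes f :: "real \<times> real \<Rightarrow> real"
  assumes f: "f \<in> borel_measurable borel"
  shows "(\<lambda>x. f (x, t)) \<in> borel_measurable borel" "(\<lambda>t. f (x, t)) \<in> borel_measurable borel"
proof -
  have [measurable]: "f \<in> borel_measurable (borel \<Otimes>\<^sub>M borel)" using f by (simp add: borel_prod)
  show "(\<lambda>x. f (x, t)) \<in> borel_measurable borel" "(\<lambda>t. f (x, t)) \<in> borel_measurable borel"
    by measurable
qed

lemma borel_swap:
  fixes f :: "real \<times> real \<Rightarrow> real"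
  assumes f: "f \<in> borel_measurable borel"
  shows "(\<lambda>p. f (snd p, fst p)) \<in> borel_measurable borel"
proof -
  have [measurable]: "f \<in> borel_measurable (borel \<Otimes>\<^sub>M borel)" using f by (simp add: borel_prod)
  have "(\<lambda>p. f (snd p, fst p)) \<in> borel_measurable (borel \<Otimes>\<^sub>M borel)" by measurable
  then show ?thesis by (simp add: borel_prod)
qed

lemma SI_measurable [measurable_dest]: "f \<in> SI \<Longrightarrow> f \<in> borel_measurable borel"
  by (simp add: sq_integrable_def)

lemma sq_integrable_measurable: "f \<in> sq_integrable M \<Longrightarrow> f \<in> borel_measurable M"
  by (simp add: sq_integrable_def)

lemma SI_sections:
  fixes f :: "real \<times> real \<Rightarrow> real"
  assumes f: "f \<in> SI"
  shows "AE t in lborel. (\<lambda>x. f (x, t)) \<in> SI"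
    and "AE x in lborel. (\<lambda>t. f (x, t)) \<in> SI"
proof -
  have [measurable]: "f \<in> borel_measurable borel" by (rule SI_measurable[OF f])
  have i: "integrable lborel (\<lambda>p. (f p)\<^sup>2)" using f by (simp add: sq_integrable_def)
  note m = borel_section[OF SI_measurable[OF f]]
  show "AE t in lborel. (\<lambda>x. f (x, t)) \<in> SI"
    using integrable_lborel2(1)[OF i] by eventually_elim (use m in \<open>simp add: sq_integrable_def\<close>)
  show "AE x in lborel. (\<lambda>t. f (x, t)) \<in> SI"
    using integrable_lborel2(4)[OF i] by eventually_elim (use m in \<open>simp add: sq_integrable_def\<close>)
qed

lemma SI_swap:
  fixes f :: "real \<times> real \<Rightarrow> real"
  assumes f: "f \<in> SI"
  shows "(\<lambda>p. f (snd p, fst p)) \<in> SI"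
proof -
  have [measurable]: "f \<in> borel_measurable borel" by (rule SI_measurable[OF f])
  have "integrable (lborel \<Otimes>\<^sub>M lborel) (\<lambda>p. (f p)\<^sup>2)" using f by (simp add: sq_integrable_def lborel_prod)
  then have "integrable (lborel \<Otimes>\<^sub>M lborel) (\<lambda>(x, y). (f (y, x))\<^sup>2)"
    by (rule lborel_pair.integrable_product_swap)
  then show ?thesis using borel_swap[OF SI_measurable[OF f]]
    by (simp add: sq_integrable_def lborel_prod split_beta')
qed

lemma integral_swap:
  fixes h :: "real \<times> real \<Rightarrow> real"
  assumes "h \<in> borel_measurable borel"
  shows "(\<integral>p. h (snd p, fst p) \<partial>lborel) = (\<integral>p. h p \<partial>lborel)"
  using lborel_pair.integral_product_swap[of h] assms by (simp add: lborel_prod split_beta')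

text \<open>Boundedness on a compact square makes every single row square integrable, so the
  operator can be evaluated at each point, not only almost everywhere. The support is the closed
  square because the rows at the end points carry boundary values.\<close>

definition kernel :: "real \<Rightarrow> real \<Rightarrow> (real \<Rightarrow> real \<Rightarrow> real) \<Rightarrow> bool" where
  "kernel b M k \<longleftrightarrow> 0 \<le> b \<and> 0 \<le> M \<and> (\<lambda>p. k (fst p) (snd p)) \<in> borel_measurable borel \<and>
     (\<forall>x y. \<bar>k x y\<bar> \<le> M * (indicator {0..b} x * indicator {0..b} y))"

lemma kernel_transpose: "kernel b M k \<Longrightarrow> kernel b M (\<lambda>x y. k y x)"
proof -
  assume k: "kernel b M k"
  have "(\<lambda>p. k (snd p) (fst p)) \<in> borel_measurable borel"
    using borel_swap[of "\<lambda>p. k (fst p) (snd p)"] k by (simp add: kernel_def)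
  moreover have "\<forall>x y. \<bar>k y x\<bar> \<le> M * (indicator {0..b} x * indicator {0..b} y)"
    using k unfolding kernel_def by (metis mult.commute)
  ultimately show ?thesis using k by (simp add: kernel_def)
qed

lemma kernel_bound:
  assumes "kernel b M k" shows "\<bar>k x y\<bar> \<le> M * indicator {0..b} y"
proof -
  have "\<bar>k x y\<bar> \<le> M * (indicator {0..b} x * indicator {0..b} y)" using assms by (simp add: kernel_def)
  also have "\<dots> \<le> M * indicator {0..b} y"
    using assms by (intro mult_left_mono) (auto simp: kernel_def indicator_def)
  finally show ?thesis .
qed

lemma kernel_measurable:
  assumes "kernel b M k"
  shows "(\<lambda>p. k (fst p) (snd p)) \<in> borel_measurable (borel \<Otimes>\<^sub>M borel)"
    "k x \<in> borel_measurable borel" "(\<lambda>x. k x y) \<in> borel_measurable borel"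
proof -
  show m: "(\<lambda>p. k (fst p) (snd p)) \<in> borel_measurable (borel \<Otimes>\<^sub>M borel)"
    using assms by (simp add: kernel_def borel_prod)
  show "k x \<in> borel_measurable borel"
    using borel_section(2)[of "\<lambda>p. k (fst p) (snd p)"] assms by (simp add: kernel_def)
  show "(\<lambda>x. k x y) \<in> borel_measurable borel"
    using borel_section(1)[of "\<lambda>p. k (fst p) (snd p)"] assms by (simp add: kernel_def)
qed

lemma kernel_row: "kernel b M k \<Longrightarrow> k x \<in> SI"
proof -
  assume k: "kernel b M k"
  have "integrable lborel (\<lambda>y. M\<^sup>2 * indicator {0..b} y)" using k by (simp add: kernel_def)
  then have "integrable lborel (\<lambda>y. (k x y)\<^sup>2)"
  proof (rule Bochner_Integration.integrable_bound)
    show "(\<lambda>y. (k x y)\<^sup>2) \<in> borel_measurable lborel" using kernel_measurable[OF k] by simp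
    have "(k x y)\<^sup>2 \<le> M\<^sup>2 * indicator {0..b} y" for y
      using power_mono[OF kernel_bound[OF k, of x y], of 2] by (cases "y \<in> {0..b}") (simp_all add: power_mult_distrib)
    then show "AE y in lborel. norm ((k x y)\<^sup>2) \<le> norm (M\<^sup>2 * indicator {0..b} y)" by simp
  qed
  then show ?thesis using kernel_measurable[OF k] by (simp add: sq_integrable_def)
qed

lemma kernel_square_integral:
  assumes k: "kernel b M k"
  shows "(\<integral>y. (k x y)\<^sup>2 \<partial>lborel) \<le> M\<^sup>2 * b * indicator {0..b} x"
proof -
  have "(\<integral>y. (k x y)\<^sup>2 \<partial>lborel) \<le> (\<integral>y. M\<^sup>2 * indicator {0..b} x * indicator {0..b} y \<partial>lborel)"
  proof (rule integral_mono)
    show "integrable lborel (\<lambda>y. (k x y)\<^sup>2)" using kernel_row[OF k] by (simp add: sq_integrable_def)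
    show "integrable lborel (\<lambda>y. M\<^sup>2 * indicator {0..b} x * indicator {0..b} y)"
      by (intro integrable_mult_right integrable_real_indicator) (auto simp: emeasure_lborel_Icc_eq)
    show "(k x y)\<^sup>2 \<le> M\<^sup>2 * indicator {0..b} x * indicator {0..b} y" for y
    proof -
      have "\<bar>k x y\<bar>\<^sup>2 \<le> (M * (indicator {0..b} x * indicator {0..b} y))\<^sup>2"
        using k by (intro power_mono) (auto simp: kernel_def)
      then show ?thesis by (cases "x \<in> {0..b}"; cases "y \<in> {0..b}") simp_all
    qed
  qed
  also have "\<dots> = M\<^sup>2 * b * indicator {0..b} x" using k by (simp add: kernel_def)
  finally show ?thesis .
qed

lemma kernel_integrable:
  assumes "kernel b M k" "g \<in> SI"
  shows "integrable lborel (\<lambda>y. k x y * g y)"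
  using sq_integrable_product[OF kernel_row[OF assms(1)] assms(2)] .

lemma kernel_apply_bound:
  assumes k: "kernel b M k" and g: "g \<in> SI"
  shows "(\<integral>y. k x y * g y \<partial>lborel)\<^sup>2 \<le> M\<^sup>2 * b * (\<integral>y. (g y)\<^sup>2 \<partial>lborel) * indicator {0..b} x"
proof -
  have "(\<integral>y. k x y * g y \<partial>lborel)\<^sup>2 \<le> (\<integral>y. (k x y)\<^sup>2 \<partial>lborel) * (\<integral>y. (g y)\<^sup>2 \<partial>lborel)"
    by (rule cauchy_schwarz_integral[OF kernel_row[OF k] g])
  also have "\<dots> \<le> M\<^sup>2 * b * indicator {0..b} x * (\<integral>y. (g y)\<^sup>2 \<partial>lborel)"
    by (intro mult_right_mono kernel_square_integral[OF k]) auto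
  finally show ?thesis by (simp add: mult_ac)
qed

lemma kernel_apply_measurable1:
  assumes k: "kernel b M k" and g [measurable]: "g \<in> borel_measurable borel"
  shows "(\<lambda>x. \<integral>y. k x y * g y \<partial>lborel) \<in> borel_measurable borel"
proof -
  note [measurable] = kernel_measurable(1)[OF k]
  have "(\<lambda>(x, y). k x y * g y) \<in> borel_measurable (borel \<Otimes>\<^sub>M lborel)"
    unfolding split_beta' by measurable
  then show ?thesis by (rule lborel.borel_measurable_lebesgue_integral)
qed

lemma integrable_tensor:
  fixes F G :: "real \<Rightarrow> real"
  assumes F: "integrable lborel F" and G: "integrable lborel G"
  shows "integrable lborel (\<lambda>(x, y). F x * G y)"
proof -
  have [measurable]: "F \<in> borel_measurable borel" "G \<in> borel_measurable borel" using F G by auto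
  have "integrable (lborel \<Otimes>\<^sub>M lborel) (\<lambda>(x, y). F x * G y)"
    using F G by (intro lborel_pair.Fubini_integrable) (auto simp: abs_mult)
  then show ?thesis by (simp add: lborel_prod)
qed

lemma integrable_on_strip:
  assumes g: "g \<in> SI"
  shows "integrable lborel (\<lambda>x. indicator {0..b::real} x * \<bar>g x\<bar>)"
proof -
  have "(indicator {0..b} :: real \<Rightarrow> real) \<in> SI"
    
  proof -
    have "(\<lambda>x. (indicator {0..b} x :: real)\<^sup>2) = indicator {0..b}" by (auto simp: indicator_def)
    moreover have "integrable lborel (indicator {0..b} :: real \<Rightarrow> real)"
      by (intro integrable_real_indicator) (auto simp: emeasure_lborel_Icc_eq)
    ultimately show ?thesis by (simp add: sq_integrable_def)
  qed
  moreover have "(\<lambda>x. \<bar>g x\<bar>) \<in> SI" using g by (auto simp: sq_integrable_def)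
  ultimately show ?thesis by (rule sq_integrable_product)
qed

lemma kernel_adjoint1:
  assumes k: "kernel b M k" and g: "g \<in> SI" and h: "h \<in> SI"
  shows "(\<integral>x. (\<integral>y. k x y * g y \<partial>lborel) * h x \<partial>lborel) = (\<integral>y. g y * (\<integral>x. k x y * h x \<partial>lborel) \<partial>lborel)"
proof -
  note [measurable] = kernel_measurable(1)[OF k]
  have [measurable]: "g \<in> borel_measurable borel" "h \<in> borel_measurable borel"
    using g h by (auto simp: sq_integrable_def)
  have "integrable (lborel \<Otimes>\<^sub>M lborel) (\<lambda>(x, y). M * ((indicator {0..b} x * \<bar>h x\<bar>) * (indicator {0..b} y * \<bar>g y\<bar>)))"
    using integrable_tensor[OF integrable_on_strip[OF h] integrable_on_strip[OF g]]
    by (simp add: lborel_prod split_beta')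
  then have "integrable (lborel \<Otimes>\<^sub>M lborel) (\<lambda>(x, y). k x y * g y * h x)"
  proof (rule Bochner_Integration.integrable_bound)
    have "\<bar>k x y * g y * h x\<bar> \<le> M * ((indicator {0..b} x * \<bar>h x\<bar>) * (indicator {0..b} y * \<bar>g y\<bar>))" for x y
    proof -
      have "\<bar>k x y\<bar> * (\<bar>g y\<bar> * \<bar>h x\<bar>) \<le> M * (indicator {0..b} x * indicator {0..b} y) * (\<bar>g y\<bar> * \<bar>h x\<bar>)"
        using k by (intro mult_right_mono) (auto simp: kernel_def)
      then show ?thesis by (simp add: abs_mult mult_ac)
    qed
    then show "AE p in lborel \<Otimes>\<^sub>M lborel. norm (case p of (x, y) \<Rightarrow> k x y * g y * h x) \<le>
        norm (case p of (x, y) \<Rightarrow> M * ((indicator {0..b} x * \<bar>h x\<bar>) * (indicator {0..b} y * \<bar>g y\<bar>)))"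
      by (auto intro!: AE_I2 order_trans[OF _ abs_ge_self])
    show "(\<lambda>(x, y). k x y * g y * h x) \<in> borel_measurable (lborel \<Otimes>\<^sub>M lborel)"
      unfolding split_beta' by measurable
  qed
  then have "(\<integral>y. (\<integral>x. k x y * g y * h x \<partial>lborel) \<partial>lborel) = (\<integral>x. (\<integral>y. k x y * g y * h x \<partial>lborel) \<partial>lborel)"
    by (rule lborel_pair.Fubini_integral)
  moreover have "(\<integral>x. k x y * g y * h x \<partial>lborel) = g y * (\<integral>x. k x y * h x \<partial>lborel)" for y
    by (subst integral_mult_right_zero[symmetric]) (simp add: mult_ac)
  ultimately show ?thesis by simp
qed

definition Kx :: "(real \<Rightarrow> real \<Rightarrow> real) \<Rightarrow> (real \<times> real \<Rightarrow> real) \<Rightarrow> real \<times> real \<Rightarrow> real" where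
  "Kx k f = (\<lambda>p. \<integral>y. k (fst p) y * f (y, snd p) \<partial>lborel)"

definition Kt :: "(real \<Rightarrow> real \<Rightarrow> real) \<Rightarrow> (real \<times> real \<Rightarrow> real) \<Rightarrow> real \<times> real \<Rightarrow> real" where
  "Kt k f = (\<lambda>p. \<integral>s. k (snd p) s * f (fst p, s) \<partial>lborel)"

lemma Kx_measurable:
  assumes k: "kernel b M k" and f: "f \<in> borel_measurable borel"
  shows "Kx k f \<in> borel_measurable borel"
proof -
  have f1: "f \<in> borel_measurable (borel \<Otimes>\<^sub>M borel)" using f by (simp add: borel_prod)
  have [measurable]: "(\<lambda>q::(real \<times> real) \<times> real. k (fst (fst q)) (snd q)) \<in> borel_measurable ((borel \<Otimes>\<^sub>M borel) \<Otimes>\<^sub>M lborel)"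
    by (rule measurable_compose[of "\<lambda>q. (fst (fst q), snd q)", OF _ kernel_measurable(1)[OF k], simplified]) measurable
  have [measurable]: "(\<lambda>q::(real \<times> real) \<times> real. f (snd q, snd (fst q))) \<in> borel_measurable ((borel \<Otimes>\<^sub>M borel) \<Otimes>\<^sub>M lborel)"
    by (rule measurable_compose[of "\<lambda>q. (snd q, snd (fst q))", OF _ f1]) measurable
  have "(\<lambda>(p, y). k (fst p) y * f (y, snd p)) \<in> borel_measurable ((borel \<Otimes>\<^sub>M borel) \<Otimes>\<^sub>M lborel)"
    unfolding split_beta' by measurable
  then have "(\<lambda>p. \<integral>y. k (fst p) y * f (y, snd p) \<partial>lborel) \<in> borel_measurable (borel \<Otimes>\<^sub>M borel)"
    by (rule lborel.borel_measurable_lebesgue_integral)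
  then show ?thesis by (simp add: Kx_def borel_prod)
qed

text \<open>Cauchy-Schwarz on a row contributes M^2 b and integration over x in [0, b] another b, so
  (M b)^2 bounds the squared Hilbert-Schmidt norm. The estimate is made with nonnegative integrals,
  so that integrability comes out along with it.\<close>

lemma Kx_SI:
  assumes k: "kernel b M k" and f: "f \<in> SI"
  shows "Kx k f \<in> SI" "(\<integral>p. (Kx k f p)\<^sup>2 \<partial>lborel) \<le> (M * b)\<^sup>2 * (\<integral>p. (f p)\<^sup>2 \<partial>lborel)"
proof -
  have [measurable]: "Kx k f \<in> borel_measurable borel" "f \<in> borel_measurable borel"
    using Kx_measurable[OF k] SI_measurable[OF f] by auto
  have b: "0 \<le> b" using k by (simp add: kernel_def)
  have "(\<integral>\<^sup>+p. ennreal ((Kx k f p)\<^sup>2) \<partial>lborel) = (\<integral>\<^sup>+t. \<integral>\<^sup>+x. ennreal ((Kx k f (x, t))\<^sup>2) \<partial>lborel \<partial>lborel)"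
    by (subst lborel_prod[symmetric], subst lborel_pair.nn_integral_snd[symmetric])
      (simp_all add: lborel_prod)
  also have "\<dots> \<le> (\<integral>\<^sup>+t. ennreal ((M * b)\<^sup>2) * (\<integral>\<^sup>+x. ennreal ((f (x, t))\<^sup>2) \<partial>lborel) \<partial>lborel)"
  proof (rule nn_integral_mono_AE)
    show "AE t in lborel. (\<integral>\<^sup>+x. ennreal ((Kx k f (x, t))\<^sup>2) \<partial>lborel)
        \<le> ennreal ((M * b)\<^sup>2) * (\<integral>\<^sup>+x. ennreal ((f (x, t))\<^sup>2) \<partial>lborel)"
      using SI_sections(1)[OF f]
    proof eventually_elim
      case (elim t)
      let ?I = "\<integral>y. (f (y, t))\<^sup>2 \<partial>lborel"
      have "(\<integral>\<^sup>+x. ennreal ((Kx k f (x, t))\<^sup>2) \<partial>lborel)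
          \<le> (\<integral>\<^sup>+x. ennreal (M\<^sup>2 * b * ?I) * indicator {0..b} x \<partial>lborel)"
      proof (rule nn_integral_mono)
        fix x
        have "(Kx k f (x, t))\<^sup>2 \<le> M\<^sup>2 * b * ?I * indicator {0..b} x"
          unfolding Kx_def using kernel_apply_bound[OF k elim, of x] by simp
        then have "ennreal ((Kx k f (x, t))\<^sup>2) \<le> ennreal (M\<^sup>2 * b * ?I * indicator {0..b} x)"
          by (rule ennreal_leI)
        then show "ennreal ((Kx k f (x, t))\<^sup>2) \<le> ennreal (M\<^sup>2 * b * ?I) * indicator {0..b} x"
          by (cases "x \<in> {0..b}") simp_all
      qed
      also have "\<dots> = ennreal (M\<^sup>2 * b * ?I) * ennreal b"
        using b by (subst nn_integral_cmult_indicator) auto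
      also have "\<dots> = ennreal ((M * b)\<^sup>2) * ennreal ?I"
      proof -
        have "ennreal (M\<^sup>2 * b * ?I) * ennreal b = ennreal (M\<^sup>2 * b * ?I * b)"
          using b by (subst ennreal_mult) auto
        also have "M\<^sup>2 * b * ?I * b = (M * b)\<^sup>2 * ?I" by (simp add: power2_eq_square)
        also have "ennreal \<dots> = ennreal ((M * b)\<^sup>2) * ennreal ?I" by (subst ennreal_mult) auto
        finally show ?thesis .
      qed
      also have "ennreal ?I = (\<integral>\<^sup>+x. ennreal ((f (x, t))\<^sup>2) \<partial>lborel)"
        using elim by (intro nn_integral_eq_integral[symmetric]) (auto simp: sq_integrable_def)
      finally show ?case .
    qed
  qed
  also have "\<dots> = ennreal ((M * b)\<^sup>2) * (\<integral>\<^sup>+t. \<integral>\<^sup>+x. ennreal ((f (x, t))\<^sup>2) \<partial>lborel \<partial>lborel)"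
    by (intro nn_integral_cmult) (auto simp: borel_prod[symmetric])
  also have "(\<integral>\<^sup>+t. \<integral>\<^sup>+x. ennreal ((f (x, t))\<^sup>2) \<partial>lborel \<partial>lborel) = (\<integral>\<^sup>+p. ennreal ((f p)\<^sup>2) \<partial>lborel)"
    by (subst lborel_prod[symmetric], subst lborel_pair.nn_integral_snd[symmetric])
      (simp_all add: lborel_prod)
  also have "\<dots> = ennreal (\<integral>p. (f p)\<^sup>2 \<partial>lborel)"
    using f by (intro nn_integral_eq_integral) (auto simp: sq_integrable_def)
  finally have le: "(\<integral>\<^sup>+p. ennreal ((Kx k f p)\<^sup>2) \<partial>lborel) \<le> ennreal ((M * b)\<^sup>2 * (\<integral>p. (f p)\<^sup>2 \<partial>lborel))"
    by (simp add: ennreal_mult)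
  have i: "integrable lborel (\<lambda>p. (Kx k f p)\<^sup>2)"
    using le by (intro integrableI_nonneg) (auto simp: order.strict_trans1)
  then show "Kx k f \<in> SI" by (simp add: sq_integrable_def)
  show "(\<integral>p. (Kx k f p)\<^sup>2 \<partial>lborel) \<le> (M * b)\<^sup>2 * (\<integral>p. (f p)\<^sup>2 \<partial>lborel)"
    using le i by (simp add: nn_integral_eq_integral)
qed

lemma Kx_cong_AE:
  assumes "AE p in lborel. f p = g p" "f \<in> borel_measurable borel" "g \<in> borel_measurable borel"
    and k: "kernel b M k"
  shows "AE p in lborel. Kx k f p = Kx k g p"
proof (rule AE_lborel2I)
  have [measurable]: "Kx k f \<in> borel_measurable borel" "Kx k g \<in> borel_measurable borel"
    using Kx_measurable[OF k] assms by auto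
  show "{p. Kx k f p = Kx k g p} \<in> sets borel" by measurable
  show "AE t in lborel. AE x in lborel. Kx k f (x, t) = Kx k g (x, t)"
    using AE_lborel2(2)[OF assms(1)]
  proof eventually_elim
    case (elim t)
    have "Kx k f (x, t) = Kx k g (x, t)" for x
      unfolding Kx_def using elim borel_section(1)[OF assms(2)] borel_section(1)[OF assms(3)] kernel_measurable[OF k]
      by (intro integral_cong_AE) (auto elim!: eventually_mono)
    then show ?case by simp
  qed
qed

text \<open>Additivity may fail at the null set of times whose sections are not square integrable,
  where an integral can take its default value 0.\<close>

lemma Kx_add:
  assumes k: "kernel b M k" and f: "f \<in> SI" and g: "g \<in> SI"
  shows "AE p in lborel. Kx k (\<lambda>p. f p + g p) p = Kx k f p + Kx k g p"
proof (rule AE_lborel2I)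
  have [measurable]: "Kx k f \<in> borel_measurable borel" "Kx k g \<in> borel_measurable borel"
    "Kx k (\<lambda>p. f p + g p) \<in> borel_measurable borel"
    using SI_measurable[OF f] SI_measurable[OF g] by (auto intro!: Kx_measurable[OF k])
  show "{p. Kx k (\<lambda>p. f p + g p) p = Kx k f p + Kx k g p} \<in> sets borel" by measurable
  show "AE t in lborel. AE x in lborel. Kx k (\<lambda>p. f p + g p) (x, t) = Kx k f (x, t) + Kx k g (x, t)"
    using SI_sections(1)[OF f] SI_sections(1)[OF g]
  proof eventually_elim
    case (elim t)
    then show ?case using kernel_integrable[OF k elim(1)] kernel_integrable[OF k elim(2)]
      by (simp add: Kx_def distrib_left)
  qed
qed

lemma Kx_scale: "Kx k (\<lambda>p. c * f p) = (\<lambda>p. c * Kx k f p)"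
proof
  fix p
  show "Kx k (\<lambda>p. c * f p) p = c * Kx k f p"
    unfolding Kx_def by (subst integral_mult_right_zero[symmetric]) (simp add: mult_ac)
qed

lemma Kx_adjoint:
  assumes k: "kernel b M k" and f: "f \<in> SI" and g: "g \<in> SI"
  shows "(\<integral>p. Kx k f p * g p \<partial>lborel) = (\<integral>p. f p * Kx (\<lambda>x y. k y x) g p \<partial>lborel)"
proof -
  have 1: "integrable lborel (\<lambda>p. Kx k f p * g p)"
    "integrable lborel (\<lambda>p. f p * Kx (\<lambda>x y. k y x) g p)"
    by (intro sq_integrable_product Kx_SI[OF k] Kx_SI[OF kernel_transpose[OF k]] f g)+
  have "(\<integral>p. Kx k f p * g p \<partial>lborel) = (\<integral>t. (\<integral>x. Kx k f (x, t) * g (x, t) \<partial>lborel) \<partial>lborel)"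
    using integrable_lborel2(3)[OF 1(1)] by simp
  also have "\<dots> = (\<integral>t. (\<integral>x. f (x, t) * Kx (\<lambda>x y. k y x) g (x, t) \<partial>lborel) \<partial>lborel)"
  proof (rule integral_cong_AE)
    show "(\<lambda>t. \<integral>x. Kx k f (x, t) * g (x, t) \<partial>lborel) \<in> borel_measurable lborel"
      using integrable_lborel2(2)[OF 1(1)] by (rule borel_measurable_integrable)
    show "(\<lambda>t. \<integral>x. f (x, t) * Kx (\<lambda>x y. k y x) g (x, t) \<partial>lborel) \<in> borel_measurable lborel"
      using integrable_lborel2(2)[OF 1(2)] by (rule borel_measurable_integrable)
    show "AE t in lborel. (\<integral>x. Kx k f (x, t) * g (x, t) \<partial>lborel)
        = (\<integral>x. f (x, t) * Kx (\<lambda>x y. k y x) g (x, t) \<partial>lborel)"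
      using SI_sections(1)[OF f] SI_sections(1)[OF g]
      by eventually_elim (simp add: Kx_def kernel_adjoint1[OF k])
  qed
  also have "\<dots> = (\<integral>p. f p * Kx (\<lambda>x y. k y x) g p \<partial>lborel)"
    using integrable_lborel2(3)[OF 1(2)] by simp
  finally show ?thesis .
qed

text \<open>The product of a row of \<open>k\<close> and a row of \<open>k'\<close> is square
  integrable on the plane, so Fubini applies at every point. Equality everywhere matters: it is
  later used at x = 0 and x = l, which an almost everywhere statement cannot see.\<close>

lemma Kx_Kt_commute:
  assumes k: "kernel b M k" and k': "kernel b' M' k'" and f: "f \<in> SI"
  shows "Kx k (Kt k' f) = Kt k' (Kx k f)"
proof
  fix p :: "real \<times> real"
  obtain x t where p: "p = (x, t)" by fastforce
  have [measurable]: "f \<in> borel_measurable borel" by (rule SI_measurable[OF f])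
  note [measurable] = kernel_measurable(2)[OF k] kernel_measurable(2)[OF k']
  have "(\<lambda>(y, s). k x y * k' t s) \<in> SI"
  proof -
    have "integrable lborel (\<lambda>(y, s). (k x y)\<^sup>2 * (k' t s)\<^sup>2)"
      using kernel_row[OF k] kernel_row[OF k'] by (intro integrable_tensor) (auto simp: sq_integrable_def)
    moreover have "(\<lambda>(y, s). k x y * k' t s) \<in> borel_measurable (borel \<Otimes>\<^sub>M borel)" by measurable
    ultimately show ?thesis
      by (simp add: sq_integrable_def borel_prod split_beta' power_mult_distrib)
  qed
  from sq_integrable_product[OF this f]
  have i: "integrable lborel (\<lambda>(y, s). k x y * k' t s * f (y, s))" by (simp add: split_beta')
  have "Kx k (Kt k' f) p = (\<integral>y. (\<integral>s. k x y * k' t s * f (y, s) \<partial>lborel) \<partial>lborel)"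
    by (simp add: p Kx_def Kt_def mult.assoc)
  also have "\<dots> = (\<integral>s. (\<integral>y. k x y * k' t s * f (y, s) \<partial>lborel) \<partial>lborel)"
    using integrable_lborel2(3,6)[OF i] by simp
  also have "\<dots> = (\<integral>s. k' t s * (\<integral>y. k x y * f (y, s) \<partial>lborel) \<partial>lborel)"
    by (subst integral_mult_right_zero[symmetric]) (simp add: mult_ac)
  also have "\<dots> = Kt k' (Kx k f) p" by (simp add: p Kx_def Kt_def)
  finally show "Kx k (Kt k' f) p = Kt k' (Kx k f) p" .
qed

section \<open>The abstract evolution equation\<close>

text \<open>\<open>J\<close> plays the role of integration in time from \<open>0\<close>, its adjoint \<open>Js\<close> that of integration up to
  \<open>T\<close>, and \<open>G\<close> that of the solution operator of \<open>v'' = f\<close>, \<open>v(0) = v(l) = 0\<close>. Integration by parts in time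
  is the identity \<open>J + Js = E\<close>, where \<open>E\<close> integrates over the whole of \<open>(0,T)\<close>.\<close>

locale evolution =
  fixes J Js G Gt \<rho> \<mu> R K :: "'h::{real_inner,complete_space} \<Rightarrow> 'h"
    and T \<rho>0 R1 K0 :: real
  assumes bl: "bounded_linear J" "bounded_linear Js" "bounded_linear G" "bounded_linear Gt"
    "bounded_linear \<rho>" "bounded_linear \<mu>" "bounded_linear R" "bounded_linear K"
    and adj: "\<And>a b. inner (J a) b = inner a (Js b)" "\<And>a b. inner (G a) b = inner a (Gt b)"
    and self: "\<And>a b. inner (\<rho> a) b = inner a (\<rho> b)" "\<And>a b. inner (\<mu> a) b = inner a (\<mu> b)"
      "\<And>a b. inner (R a) b = inner a (R b)" "\<And>a b. inner (K a) b = inner a (K b)"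
    and comm: "\<And>a. J (G a) = G (J a)" "\<And>a. J (\<rho> a) = \<rho> (J a)" "\<And>a. J (\<mu> a) = \<mu> (J a)"
      "\<And>a. J (R a) = R (J a)" "\<And>a. J (K a) = K (J a)"
    and T: "0 < T" and EE: "\<And>a. (J (J a + Js a) + Js (J a + Js a)) = T *\<^sub>R (J a + Js a)"
    and \<rho>0: "0 < \<rho>0" "\<And>a. \<rho>0 * (norm a)\<^sup>2 \<le> inner (\<rho> a) a"
    and \<mu>0: "\<And>a. 0 \<le> inner (\<mu> a) a"
    and R0: "\<And>a. 0 \<le> inner (R a) a" "\<And>a. inner (R a) a \<le> R1 * (norm a)\<^sup>2" "0 \<le> R1"
    and K0: "0 < K0" "\<And>a. K0 * (norm a)\<^sup>2 \<le> inner (K a) a"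
begin

section \<open>Integration by parts in time as operator algebra\<close>

definition E where "E a = J a + Js a"

lemmas lin = bl[THEN bounded_linear.linear]
lemmas ladd = lin[THEN linear_add]
lemmas lscale = lin[THEN linear_scale]
lemmas lneg = lin[THEN linear_neg]

lemma EE': "E (E a) = T *\<^sub>R E a" using EE by (simp add: E_def)

lemma E_self: "inner (E a) b = inner a (E b)"
  using adj(1)[of a b] adj(1)[of b a] by (simp add: E_def inner_simps inner_commute)

lemma Js_comm:
  assumes m: "\<And>a b. inner (m a) b = inner a (m b)" "\<And>a. J (m a) = m (J a)"
  shows "Js (m a) = m (Js a)"
proof -
  have "inner (Js (m a)) b = inner (m (Js a)) b" for b
  proof -
    have "inner b (Js (m a)) = inner (J b) (m a)" by (rule adj(1)[symmetric])
    also have "\<dots> = inner (J (m b)) a" by (simp only: m)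
    also have "\<dots> = inner b (m (Js a))" by (simp only: adj(1) m(1))
    finally show ?thesis by (simp only: inner_commute)
  qed
  then have "inner (Js (m a) - m (Js a)) (Js (m a) - m (Js a)) = 0" by (simp add: inner_simps)
  then show ?thesis by simp
qed

lemma E_comm:
  assumes m: "\<And>a b. inner (m a) b = inner a (m b)" "\<And>a. J (m a) = m (J a)" "linear m"
  shows "E (m a) = m (E a)"
  using Js_comm[OF m(1,2)] m(2) linear_add[OF m(3)] by (simp add: E_def)

text \<open>\<open>E\<close> is self-adjoint and commutes with \<open>m\<close>, and E E = T E; so
  an \<open>E\<close> on one side may be doubled to the other at the price of 1 / T.\<close>

lemma mE:
  assumes m: "\<And>a b. inner (m a) b = inner a (m b)" "\<And>a. J (m a) = m (J a)" "linear m"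
  shows "inner (m a) (E b) = inner (m (E a)) (E b) / T"
proof -
  have "inner (m (E a)) (E b) = inner (E (m a)) (E b)" using E_comm[OF m] by simp
  also have "\<dots> = inner (m a) (E (E b))" by (rule E_self)
  finally show ?thesis using T by (simp add: EE')
qed

text \<open>Abstract form of the fact that m A A' integrates over (0,T) to m A(T)^2 / 2 if A(0) = 0.
  Here \<open>E a\<close> is the function with constant value A(T), whose square integrates to T
  A(T)^2; hence the factor 1 / (2 T).\<close>

lemma mJ:
  assumes m: "\<And>a b. inner (m a) b = inner a (m b)" "\<And>a. J (m a) = m (J a)" "linear m"
  shows "inner (m (J a)) a = inner (m (E a)) (E a) / (2 * T)"
proof -
  have "inner (m (J a)) a = inner (m a) (Js a)"
    using m(2)[of a] adj(1) by metis
  moreover have "inner (m (J a)) a = inner (m a) (J a)"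
    using m(1) by (simp add: inner_commute)
  ultimately have "2 * inner (m (J a)) a = inner (m a) (E a)" by (simp add: E_def inner_simps)
  then show ?thesis using mE[OF m, of a a] T by (simp add: field_simps)
qed

lemma mJ_nonneg:
  assumes m: "\<And>a b. inner (m a) b = inner a (m b)" "\<And>a. J (m a) = m (J a)" "linear m"
    and "\<And>a. 0 \<le> inner (m a) a"
  shows "0 \<le> inner (m (J a)) a"
  using mJ[OF m] assms(4) T by simp

text \<open>Integration by parts of the second primitive against \<open>a\<close>: a boundary term
  at time T minus the quadratic form in the first primitive. The negative sign is the reason why the
  test element needs the extra term with \<Lambda>.\<close>

lemma mJJ:
  assumes m: "\<And>a b. inner (m a) b = inner a (m b)" "\<And>a. J (m a) = m (J a)" "linear m"
  shows "inner (m (J (J a))) a = inner (m (E (J a))) (E a) / T - inner (m (J a)) (J a)"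
proof -
  have "inner (m (J (J a))) a = inner (m (J a)) (Js a)"
    using m(2)[of "J a"] adj(1) by metis
  also have "\<dots> = inner (m (J a)) (E a) - inner (m (J a)) (J a)" by (simp add: E_def inner_simps)
  finally show ?thesis using mE[OF m, of "J a" a] by simp
qed

lemmas \<rho>_ops = self(1) comm(2) lin(5)
lemmas \<mu>_ops = self(2) comm(3) lin(6)
lemmas R_ops = self(3) comm(4) lin(7)
lemmas K_ops = self(4) comm(5) lin(8)

lemma \<rho>_nonneg: "0 \<le> inner (\<rho> a) a"
  using \<rho>0(2)[of a] \<rho>0(1) by (smt (verit) mult_nonneg_nonneg zero_le_power2)

text \<open>Chosen so that \<Lambda> K0 = R1 + K0: the form \<Lambda> K then dominates the form of
  \<open>R\<close> and still leaves K0 times the squared norm.\<close>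

definition \<Lambda> where "\<Lambda> = (R1 + K0) / K0"

lemma \<Lambda>: "0 < \<Lambda>" "\<Lambda> * K0 = R1 + K0"
  using R0(3) K0(1) by (auto simp: \<Lambda>_def)

text \<open>The form of \<open>J\<close> is nonnegative, so I + \<Lambda> J is coercive with
  constant 1. The graph carries the adjoint I + \<Lambda> Js, because \<open>lions\<close> solves
  the equation tested against images. The result frees the variational equation from the special
  tests p + \<Lambda> J p.\<close>

lemma id_plus_J_surj: "\<exists>p. p + \<Lambda> *\<^sub>R J p = z"
proof -
  have idJ: "0 \<le> inner (J a) a" for a
    using mJ_nonneg[of "\<lambda>x. x" a] by (simp add: linear_id[unfolded id_def])
  define \<Gamma> where "\<Gamma> = (\<lambda>\<phi>. (\<phi>, \<phi> + \<Lambda> *\<^sub>R Js \<phi>, inner z \<phi>)) ` UNIV"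
  have "subspace \<Gamma>" unfolding \<Gamma>_def
    by (intro linear_subspace_image linearI) (auto simp: ladd lscale inner_simps algebra_simps)
  moreover have "1 * (norm a)\<^sup>2 \<le> inner a k" if "(a, k, c) \<in> \<Gamma>" for a k c
    using that idJ[of a] \<Lambda>(1)
    by (auto simp: \<Gamma>_def inner_simps adj[symmetric] power2_norm_eq_inner)
  moreover have "\<bar>c\<bar> \<le> norm z * norm a" if "(a, k, c) \<in> \<Gamma>" for a k c
    using that Cauchy_Schwarz_ineq2[of z a] by (auto simp: \<Gamma>_def)
  ultimately have "\<exists>w\<in>closure (fst ` \<Gamma>). norm w \<le> norm z / 1 \<and> (\<forall>(a, k, c)\<in>\<Gamma>. inner w k = c)"
    by (intro lions) auto
  then obtain p where p: "\<forall>(a, k, c)\<in>\<Gamma>. inner p k = c" by blast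
  have "inner (p + \<Lambda> *\<^sub>R J p - z) \<phi> = 0" for \<phi>
  proof -
    have "(\<phi>, \<phi> + \<Lambda> *\<^sub>R Js \<phi>, inner z \<phi>) \<in> \<Gamma>" by (auto simp: \<Gamma>_def)
    then have "inner p (\<phi> + \<Lambda> *\<^sub>R Js \<phi>) = inner z \<phi>" using p by auto
    then show ?thesis by (simp add: inner_simps adj)
  qed
  then have "p + \<Lambda> *\<^sub>R J p - z = 0" by (metis inner_eq_zero_iff)
  then show ?thesis by auto
qed

text \<open>Testing with \<open>z = p + \<Lambda> J p\<close> for \<open>p\<close> the time derivative of \<open>q\<close> controls both \<open>q\<close> and \<open>s = G p\<close>.
  The second term absorbs the \<open>R\<close>-contributions, including those at time \<open>T\<close>.\<close>

lemma coercive: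
  defines "z p \<equiv> p + \<Lambda> *\<^sub>R J p"
  shows "min \<rho>0 K0 * ((norm (J p))\<^sup>2 + (norm (G p))\<^sup>2)
    \<le> inner (\<rho> (G p) + \<mu> (G (J p))) (G (z p)) + inner (R (J (J p)) + K (J p)) (z p)"
proof -
  define g where "g = G p"
  \<comment> \<open>\<open>a\<close> and \<open>b\<close> represent the values at time T of the
    first and the second time primitive of \<open>p\<close>.\<close>
  define a where "a = E p"
  define b where "b = E (J p)"
  have Gz: "G (z p) = g + \<Lambda> *\<^sub>R J g" by (simp add: z_def g_def ladd lscale comm)
  have 1: "inner (\<rho> g) (G (z p)) \<ge> \<rho>0 * (norm g)\<^sup>2"
  proof -
    have "inner (\<rho> g) (J g) \<ge> 0" using mJ_nonneg[OF \<rho>_ops \<rho>_nonneg, of g] self(1)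
      by (simp add: inner_commute)
    then have "0 \<le> \<Lambda> * inner (\<rho> g) (J g)" using \<Lambda>(1) by simp
    then show ?thesis using \<rho>0(2)[of g] by (simp add: Gz inner_simps)
  qed
  have 2: "inner (\<mu> (G (J p))) (G (z p)) \<ge> 0"
  proof -
    have "0 \<le> inner (\<mu> (J g)) g" by (rule mJ_nonneg[OF \<mu>_ops \<mu>0])
    moreover have "0 \<le> \<Lambda> * inner (\<mu> (J g)) (J g)" using \<Lambda>(1) \<mu>0 by simp
    ultimately show ?thesis by (simp add: Gz inner_simps comm(1)[symmetric] g_def)
  qed
  have 3: "inner (R (J (J p))) (z p) = inner (R b) a / T - inner (R (J p)) (J p) + \<Lambda> * inner (R b) b / (2 * T)"
    using mJJ[OF R_ops, of p] mJ[OF R_ops, of "J p"] by (simp add: z_def inner_simps a_def b_def)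
  have 4: "inner (K (J p)) (z p) = inner (K a) a / (2 * T) + \<Lambda> * inner (K (J p)) (J p)"
    using mJ[OF K_ops, of p] by (simp add: z_def inner_simps a_def)
  \<comment> \<open>All boundary terms at time T together. Nonnegativity of \<open>R\<close> at
    \<Lambda> b + a handles the mixed term, the leftover form of \<open>R\<close> in
    \<open>a\<close> is absorbed by \<Lambda> K, and dividing by \<Lambda> gives the claim.\<close>
  have 5: "0 \<le> \<Lambda> * inner (R b) b / (2 * T) + inner (R b) a / T + inner (K a) a / (2 * T)"
  proof -
    have "0 \<le> inner (R (\<Lambda> *\<^sub>R b + a)) (\<Lambda> *\<^sub>R b + a)" by (rule R0)
    also have "\<dots> = \<Lambda> * (\<Lambda> * inner (R b) b) + 2 * (\<Lambda> * inner (R b) a) + inner (R a) a"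
      using self(3)[of a b] by (simp add: ladd lscale inner_simps inner_commute)
    finally have "0 \<le> \<Lambda> * (\<Lambda> * inner (R b) b + 2 * inner (R b) a) + inner (R a) a"
      by (simp add: algebra_simps)
    moreover have "inner (R a) a \<le> \<Lambda> * inner (K a) a"
    proof -
      have "inner (R a) a \<le> (R1 + K0) * (norm a)\<^sup>2" using R0(2)[of a] K0(1) by (simp add: distrib_right add_increasing2)
      also have "\<dots> = \<Lambda> * (K0 * (norm a)\<^sup>2)" using \<Lambda>(2) by (simp add: mult.assoc[symmetric])
      also have "\<dots> \<le> \<Lambda> * inner (K a) a" using \<Lambda>(1) K0(2)[of a] by (intro mult_left_mono) auto
      finally show ?thesis .
    qed
    ultimately have "0 \<le> \<Lambda> * (\<Lambda> * inner (R b) b + 2 * inner (R b) a + inner (K a) a)"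
      by (simp add: distrib_left)
    then have "0 \<le> \<Lambda> * inner (R b) b + 2 * inner (R b) a + inner (K a) a"
      using \<Lambda>(1) by (simp add: zero_le_mult_iff)
    then have "0 \<le> (\<Lambda> * inner (R b) b + 2 * inner (R b) a + inner (K a) a) / (2 * T)" using T by simp
    then show ?thesis using T by (simp add: add_divide_distrib)
  qed
  \<comment> \<open>Here the surplus K0 in \<Lambda> K0 = R1 + K0 becomes the coercivity constant
    for \<open>J p\<close>.\<close>
  have 6: "K0 * (norm (J p))\<^sup>2 \<le> \<Lambda> * inner (K (J p)) (J p) - inner (R (J p)) (J p)"
  proof -
    have "(R1 + K0) * (norm (J p))\<^sup>2 \<le> \<Lambda> * inner (K (J p)) (J p)"
      using mult_left_mono[OF K0(2)[of "J p"], of \<Lambda>] \<Lambda> by (simp add: mult.assoc[symmetric])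
    then show ?thesis using R0(2)[of "J p"] by (simp add: distrib_right)
  qed
  have "min \<rho>0 K0 * ((norm (J p))\<^sup>2 + (norm g)\<^sup>2) \<le> K0 * (norm (J p))\<^sup>2 + \<rho>0 * (norm g)\<^sup>2"
    unfolding distrib_left by (intro add_mono mult_right_mono) auto
  then show ?thesis using 1 2 3 4 5 6 by (simp add: inner_add_left g_def)
qed

text \<open>The bound that \<open>lions\<close> returns is that of the functional divided by the
  coercivity constant. The numerator estimates G (p + \<Lambda> J p) by G p.\<close>

definition c1 where "c1 = (1 + \<Lambda> * onorm J) / min \<rho>0 K0"

text \<open>The solution found by \<open>lions\<close> lies in the closure of the pairs (J p, G p).
  The constraint G q = J s holds on these pairs because \<open>J\<close> and \<open>G\<close>
  commute, and it is a closed condition, so it survives in the limit although \<open>q\<close>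
  itself need not be of the form J p.\<close>

theorem existence:
  "\<exists>q s. G q = J s \<and> norm q \<le> c1 * norm F \<and>
     (\<forall>z. inner (\<rho> s + \<mu> (G q)) (G z) + inner (R (J q) + K q) z = inner F (G z))"
proof -
  define z where "z p = p + \<Lambda> *\<^sub>R J p" for p
  \<comment> \<open>The form with every operator moved to the test side by adjointness, as
    \<open>lions\<close> requires; \<open>form\<close> verifies this.\<close>
  define k where "k p = (Gt (\<mu> (G (z p))) + Js (R (z p)) + K (z p), \<rho> (G (z p)))" for p
  define \<Gamma> where "\<Gamma> = (\<lambda>p. ((J p, G p), k p, inner F (G (z p)))) ` UNIV"
  have zl: "z (p + p') = z p + z p'" "z (c *\<^sub>R p) = c *\<^sub>R z p" for p p' c
    by (simp_all add: z_def ladd lscale algebra_simps)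
  have "subspace \<Gamma>" unfolding \<Gamma>_def
    by (intro linear_subspace_image linearI)
      (auto simp: k_def zl ladd lscale inner_simps algebra_simps)
  moreover have form: "inner (q, s) (k p)
      = inner (\<rho> s + \<mu> (G q)) (G (z p)) + inner (R (J q) + K q) (z p)" for q s p
  proof -
    have "inner q (Gt (\<mu> (G (z p)))) = inner (\<mu> (G q)) (G (z p))" using adj(2) self(2) by metis
    moreover have "inner q (Js (R (z p))) = inner (R (J q)) (z p)" using adj(1) self(3) by metis
    moreover have "inner q (K (z p)) = inner (K q) (z p)" "inner s (\<rho> (G (z p))) = inner (\<rho> s) (G (z p))"
      using self by metis+
    ultimately show ?thesis by (simp add: k_def inner_simps)
  qed
  have c0: "0 < min \<rho>0 K0" using \<rho>0 K0 by simp
  moreover have "min \<rho>0 K0 * (norm a)\<^sup>2 \<le> inner a k'" if "(a, k', c) \<in> \<Gamma>" for a k' c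
  proof -
    from that obtain p where p: "a = (J p, G p)" "k' = k p" unfolding \<Gamma>_def by blast
    have "(norm a)\<^sup>2 = (norm (J p))\<^sup>2 + (norm (G p))\<^sup>2" by (simp add: p norm_Pair)
    then show ?thesis using coercive[of p] by (simp add: p form z_def)
  qed
  moreover have "\<bar>c\<bar> \<le> (1 + \<Lambda> * onorm J) * norm F * norm a" if "(a, k', c) \<in> \<Gamma>" for a k' c
  proof -
    from that obtain p where p: "a = (J p, G p)" "c = inner F (G (z p))" unfolding \<Gamma>_def by blast
    have "G (z p) = G p + \<Lambda> *\<^sub>R J (G p)" by (simp add: z_def ladd lscale comm)
    then have "norm (G (z p)) \<le> norm (G p) + \<Lambda> * norm (J (G p))"
      using norm_triangle_ineq[of "G p" "\<Lambda> *\<^sub>R J (G p)"] \<Lambda>(1) by simp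
    also have "\<dots> \<le> norm (G p) + \<Lambda> * (onorm J * norm (G p))"
      using onorm[OF bl(1), of "G p"] \<Lambda>(1) by simp
    also have "\<dots> = (1 + \<Lambda> * onorm J) * norm (G p)" by (simp add: algebra_simps)
    also have "\<dots> \<le> (1 + \<Lambda> * onorm J) * norm a"
      using \<Lambda>(1) onorm_pos_le[OF bl(1)] norm_snd_le[of "(J p, G p)"] unfolding p
      by (intro mult_left_mono) (auto simp: norm_Pair)
    finally have "norm (G (z p)) \<le> (1 + \<Lambda> * onorm J) * norm a" .
    then have "norm F * norm (G (z p)) \<le> norm F * ((1 + \<Lambda> * onorm J) * norm a)"
      by (intro mult_left_mono) auto
    then show ?thesis using Cauchy_Schwarz_ineq2[of F "G (z p)"] unfolding p(2) by (simp add: mult_ac)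
  qed
  moreover have "0 \<le> (1 + \<Lambda> * onorm J) * norm F"
    using \<Lambda>(1) onorm_pos_le[OF bl(1)] by simp
  ultimately have "\<exists>w\<in>closure (fst ` \<Gamma>). norm w \<le> (1 + \<Lambda> * onorm J) * norm F / min \<rho>0 K0 \<and>
      (\<forall>(a, k', c)\<in>\<Gamma>. inner w k' = c)"
    by (intro lions)
  then obtain w where w0: "w \<in> closure (fst ` \<Gamma>)" "norm w \<le> (1 + \<Lambda> * onorm J) * norm F / min \<rho>0 K0 \<and>
      (\<forall>(a, k', c)\<in>\<Gamma>. inner w k' = c)" by - (erule bexE, erule that)
  obtain q s where w: "w = (q, s)" by fastforce
  have "G q = J s"
  proof -
    have "closed {w. G (fst w) = J (snd w)}"
      by (intro closed_Collect_eq bounded_linear.continuous_on[OF bl(3)] bounded_linear.continuous_on[OF bl(1)]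
          continuous_on_fst continuous_on_snd continuous_on_id)
    moreover have "fst ` \<Gamma> \<subseteq> {w. G (fst w) = J (snd w)}" by (auto simp: \<Gamma>_def comm)
    ultimately have "closure (fst ` \<Gamma>) \<subseteq> {w. G (fst w) = J (snd w)}" by (intro closure_minimal)
    then show ?thesis using w0(1) w by auto
  qed
  moreover have "norm q \<le> c1 * norm F"
    using conjunct1[OF w0(2)] norm_fst_le[of q s] by (simp add: w c1_def)
  moreover have "inner (\<rho> s + \<mu> (G q)) (G y) + inner (R (J q) + K q) y = inner F (G y)" for y
  proof -
    \<comment> \<open>Every \<open>y\<close> is some p + \<Lambda> J p, so the equation holds for
      all tests.\<close>
    obtain p where "z p = y" using id_plus_J_surj z_def by metis
    moreover have "((J p, G p), k p, inner F (G (z p))) \<in> \<Gamma>" by (auto simp: \<Gamma>_def)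
    then have "inner w (k p) = inner F (G (z p))" using conjunct2[OF w0(2)] by auto
    ultimately show ?thesis unfolding w form by simp
  qed
  ultimately show ?thesis by blast
qed

text \<open>The test element is \<open>v = \<integral>\<^bsub>t\<^esub>\<^bsup>T\<^esup> u\<close>, for which all terms of the weak form are nonnegative.\<close>

theorem uniqueness:
  assumes QW: "G q = J w"
    and weak: "- inner (\<rho> w) (G (- q)) + inner (\<mu> w) (G (Js q)) + inner (R q) (Js q) - inner (K q) (- q) = 0"
    and comm': "\<And>a. Js (G a) = G (Js a)"
  shows "q = 0"
proof -
  have "0 \<le> inner (\<rho> w) (G q)"
    using mJ_nonneg[OF \<rho>_ops \<rho>_nonneg, of w] self(1) by (simp add: QW inner_commute)
  moreover have "0 \<le> inner (\<mu> w) (G (Js q))"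
  proof -
    have "inner (\<mu> w) (G (Js q)) = inner (J (\<mu> w)) (G q)" by (simp add: comm'[symmetric] adj)
    also have "\<dots> = inner (\<mu> (G q)) (G q)" by (simp add: comm QW)
    finally show ?thesis using \<mu>0 by simp
  qed
  moreover have "0 \<le> inner (R q) (Js q)"
    using mJ_nonneg[OF R_ops R0(1), of q] by (simp add: adj[symmetric] comm)
  ultimately have "inner (K q) q \<le> 0" using weak by (simp add: lneg inner_simps)
  then have "K0 * (norm q)\<^sup>2 \<le> 0" using K0(2)[of q] by linarith
  then show ?thesis using K0(1) by (simp add: mult_le_0_iff)
qed

end

section \<open>Operators on the space of square integrable functions\<close>

lemma Kt_swap: "Kt k f = (\<lambda>p. Kx k (\<lambda>p. f (snd p, fst p)) (snd p, fst p))"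
  by (simp add: Kt_def Kx_def)

lemma AE_swap:
  fixes P :: "real \<times> real \<Rightarrow> bool"
  assumes "AE p in lborel. P p" shows "AE p in lborel. P (snd p, fst p)"
proof -
  obtain N where N: "N \<in> null_sets (lborel :: (real \<times> real) measure)" "{p. \<not> P p} \<subseteq> N"
    using assms by (auto elim!: AE_E simp: null_sets_def)
  have Nb: "N \<in> sets borel" using N(1) by auto
  have "AE p in lborel. p \<notin> N" using N(1) by (rule AE_not_in)
  from AE_lborel2(1)[OF this]
  have "AE x in lborel. AE t in lborel. (x, t) \<notin> N" .
  moreover have "{p. (snd p, fst p) \<notin> N} \<in> sets borel"
  proof -
    have "(\<lambda>p::real \<times> real. (snd p, fst p)) \<in> borel \<rightarrow>\<^sub>M borel"
      by (intro borel_measurable_continuous_onI continuous_intros)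
    from measurable_sets[OF this, of "- N"] Nb show ?thesis by (simp add: vimage_def)
  qed
  ultimately have "AE p in lborel. (snd p, fst p) \<notin> N"
    by (intro AE_lborel2I) auto
  then show ?thesis by eventually_elim (use N(2) in auto)
qed

lemma Kt_measurable:
  assumes k: "kernel b M k" and f: "f \<in> borel_measurable borel"
  shows "Kt k f \<in> borel_measurable borel"
  unfolding Kt_swap by (intro borel_swap Kx_measurable[OF k] f)

lemma Kt_SI:
  assumes k: "kernel b M k" and f: "f \<in> SI"
  shows "Kt k f \<in> SI" "(\<integral>p. (Kt k f p)\<^sup>2 \<partial>lborel) \<le> (M * b)\<^sup>2 * (\<integral>p. (f p)\<^sup>2 \<partial>lborel)"
proof -
  note s = Kx_SI[OF k SI_swap[OF f]]
  show "Kt k f \<in> SI" unfolding Kt_swap by (rule SI_swap[OF s(1)])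
  have "(\<integral>p. (Kt k f p)\<^sup>2 \<partial>lborel) = (\<integral>p. (Kx k (\<lambda>p. f (snd p, fst p)) p)\<^sup>2 \<partial>lborel)"
    unfolding Kt_swap using SI_measurable[OF s(1)]
    by (intro integral_swap[of "\<lambda>p. (Kx k (\<lambda>p. f (snd p, fst p)) p)\<^sup>2"]) auto
  also have "\<dots> \<le> (M * b)\<^sup>2 * (\<integral>p. (f (snd p, fst p))\<^sup>2 \<partial>lborel)" by (rule s(2))
  also have "(\<integral>p. (f (snd p, fst p))\<^sup>2 \<partial>lborel) = (\<integral>p. (f p)\<^sup>2 \<partial>lborel)"
    using SI_measurable[OF f] by (intro integral_swap[of "\<lambda>p. (f p)\<^sup>2"]) auto
  finally show "(\<integral>p. (Kt k f p)\<^sup>2 \<partial>lborel) \<le> (M * b)\<^sup>2 * (\<integral>p. (f p)\<^sup>2 \<partial>lborel)" .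
qed

lemma Kt_cong_AE:
  assumes "AE p in lborel. f p = g p" "f \<in> borel_measurable borel" "g \<in> borel_measurable borel"
    and k: "kernel b M k"
  shows "AE p in lborel. Kt k f p = Kt k g p"
  unfolding Kt_swap
  by (rule AE_swap, rule Kx_cong_AE[OF AE_swap[OF assms(1)] _ _ k]) (intro borel_swap assms)+

lemma Kt_add:
  assumes k: "kernel b M k" and f: "f \<in> SI" and g: "g \<in> SI"
  shows "AE p in lborel. Kt k (\<lambda>p. f p + g p) p = Kt k f p + Kt k g p"
  unfolding Kt_swap by (rule AE_swap) (rule Kx_add[OF k SI_swap[OF f] SI_swap[OF g]])

lemma Kt_scale: "Kt k (\<lambda>p. c * f p) = (\<lambda>p. c * Kt k f p)"
  unfolding Kt_swap Kx_scale ..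

lemma Kt_adjoint:
  assumes k: "kernel b M k" and f: "f \<in> SI" and g: "g \<in> SI"
  shows "(\<integral>p. Kt k f p * g p \<partial>lborel) = (\<integral>p. f p * Kt (\<lambda>x y. k y x) g p \<partial>lborel)"
proof -
  let ?f = "\<lambda>p. f (snd p, fst p)" and ?g = "\<lambda>p. g (snd p, fst p)"
  have m: "Kx k ?f \<in> borel_measurable borel" "Kx (\<lambda>x y. k y x) ?g \<in> borel_measurable borel"
    using Kx_SI(1)[OF k SI_swap[OF f]] Kx_SI(1)[OF kernel_transpose[OF k] SI_swap[OF g]]
    by (auto intro: SI_measurable)
  note fg = SI_measurable[OF f] SI_measurable[OF g]
  have "(\<integral>p. Kt k f p * g p \<partial>lborel) = (\<integral>p. Kx k ?f p * ?g p \<partial>lborel)"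
    unfolding Kt_swap using integral_swap[of "\<lambda>p. Kx k ?f p * ?g p"] m borel_swap[OF fg(2)] by simp
  also have "\<dots> = (\<integral>p. ?f p * Kx (\<lambda>x y. k y x) ?g p \<partial>lborel)"
    by (rule Kx_adjoint[OF k SI_swap[OF f] SI_swap[OF g]])
  also have "\<dots> = (\<integral>p. f p * Kt (\<lambda>x y. k y x) g p \<partial>lborel)"
    unfolding Kt_swap using integral_swap[of "\<lambda>p. ?f p * Kx (\<lambda>x y. k y x) ?g p"] m borel_swap[OF fg(1)] by simp
  finally show ?thesis .
qed

definition opx :: "(real \<Rightarrow> real \<Rightarrow> real) \<Rightarrow> l2 \<Rightarrow> l2" where "opx k q = mk (Kx k (rep q))"
definition opt :: "(real \<Rightarrow> real \<Rightarrow> real) \<Rightarrow> l2 \<Rightarrow> l2" where "opt k q = mk (Kt k (rep q))"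
definition mulx :: "(real \<Rightarrow> real) \<Rightarrow> l2 \<Rightarrow> l2" where "mulx m q = mk (\<lambda>p. m (fst p) * rep q p)"

lemma opx_mk: "kernel b M k \<Longrightarrow> f \<in> SI \<Longrightarrow> opx k (mk f) = mk (Kx k f)"
  unfolding opx_def
  by (subst mk_eq_iff) (auto intro!: Kx_SI Kx_cong_AE rep_mk SI_measurable)

lemma opt_mk: "kernel b M k \<Longrightarrow> f \<in> SI \<Longrightarrow> opt k (mk f) = mk (Kt k f)"
  unfolding opt_def
  by (subst mk_eq_iff) (auto intro!: Kt_SI Kt_cong_AE rep_mk SI_measurable)

lemma norm_mk_le:
  assumes "f \<in> SI" "g \<in> SI" "(\<integral>p. (g p)\<^sup>2 \<partial>lborel) \<le> C\<^sup>2 * (\<integral>p. (f p)\<^sup>2 \<partial>lborel)" "0 \<le> C"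
  shows "norm (mk g) \<le> norm (mk f) * C"
proof -
  have "sqrt (\<integral>p. (g p)\<^sup>2 \<partial>lborel) \<le> sqrt (C\<^sup>2 * (\<integral>p. (f p)\<^sup>2 \<partial>lborel))"
    using assms(3) by (rule real_sqrt_le_mono)
  then show ?thesis using assms by (simp add: norm_mk real_sqrt_mult mult.commute)
qed

lemma bounded_linear_opx: assumes k: "kernel b M k" shows "bounded_linear (opx k)"
proof (rule bounded_linear_intro)
  fix p q :: l2 and r :: real
  obtain f where f: "f \<in> SI" "p = mk f" by (rule l2_cases)
  obtain g where g: "g \<in> SI" "q = mk g" by (rule l2_cases)
  show "opx k (p + q) = opx k p + opx k q"
    using Kx_add[OF k f(1) g(1)] f g
    by (simp add: mk_add opx_mk[OF k] Kx_SI[OF k] sq_integrable_add mk_eq_iff)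
  show "opx k (r *\<^sub>R p) = r *\<^sub>R opx k p"
    using f by (simp add: mk_scale opx_mk[OF k] Kx_SI[OF k] sq_integrable_scale Kx_scale)
  show "norm (opx k p) \<le> norm p * (M * b)"
    using f k by (simp add: opx_mk[OF k] norm_mk_le Kx_SI[OF k] kernel_def)
qed

lemma bounded_linear_opt: assumes k: "kernel b M k" shows "bounded_linear (opt k)"
proof (rule bounded_linear_intro)
  fix p q :: l2 and r :: real
  obtain f where f: "f \<in> SI" "p = mk f" by (rule l2_cases)
  obtain g where g: "g \<in> SI" "q = mk g" by (rule l2_cases)
  show "opt k (p + q) = opt k p + opt k q"
    using Kt_add[OF k f(1) g(1)] f g
    by (simp add: mk_add opt_mk[OF k] Kt_SI[OF k] sq_integrable_add mk_eq_iff)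
  show "opt k (r *\<^sub>R p) = r *\<^sub>R opt k p"
    using f by (simp add: mk_scale opt_mk[OF k] Kt_SI[OF k] sq_integrable_scale Kt_scale)
  show "norm (opt k p) \<le> norm p * (M * b)"
    using f k by (simp add: opt_mk[OF k] norm_mk_le Kt_SI[OF k] kernel_def)
qed

lemma opx_adjoint:
  assumes k: "kernel b M k" shows "inner (opx k p) q = inner p (opx (\<lambda>x y. k y x) q)"
proof -
  obtain f where f: "f \<in> SI" "p = mk f" by (rule l2_cases)
  obtain g where g: "g \<in> SI" "q = mk g" by (rule l2_cases)
  show ?thesis using Kx_adjoint[OF k f(1) g(1)] f g
    by (simp add: opx_mk[OF k] opx_mk[OF kernel_transpose[OF k]] inner_mk Kx_SI[OF k]
        Kx_SI[OF kernel_transpose[OF k]])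
qed

lemma opt_adjoint:
  assumes k: "kernel b M k" shows "inner (opt k p) q = inner p (opt (\<lambda>x y. k y x) q)"
proof -
  obtain f where f: "f \<in> SI" "p = mk f" by (rule l2_cases)
  obtain g where g: "g \<in> SI" "q = mk g" by (rule l2_cases)
  show ?thesis using Kt_adjoint[OF k f(1) g(1)] f g
    by (simp add: opt_mk[OF k] opt_mk[OF kernel_transpose[OF k]] inner_mk Kt_SI[OF k]
        Kt_SI[OF kernel_transpose[OF k]])
qed

lemma opx_opt_commute:
  assumes k: "kernel b M k" and k': "kernel b' M' k'"
  shows "opx k (opt k' p) = opt k' (opx k p)"
proof -
  obtain f where f: "f \<in> SI" "p = mk f" by (rule l2_cases)
  show ?thesis using Kx_Kt_commute[OF k k' f(1)] f
    by (simp add: opx_mk[OF k] opt_mk[OF k'] Kx_SI[OF k] Kt_SI[OF k'])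
qed

definition bounded_borel :: "(real \<Rightarrow> real) \<Rightarrow> bool" where
  "bounded_borel m \<longleftrightarrow> m \<in> borel_measurable borel \<and> (\<exists>C. \<forall>x. \<bar>m x\<bar> \<le> C)"

lemma borel_measurable_fst:
  fixes m :: "real \<Rightarrow> real"
  assumes [measurable]: "m \<in> borel_measurable borel"
  shows "(\<lambda>p::real \<times> real. m (fst p)) \<in> borel_measurable borel"
proof -
  have "(\<lambda>p::real \<times> real. m (fst p)) \<in> borel_measurable (borel \<Otimes>\<^sub>M borel)" by measurable
  then show ?thesis by (simp add: borel_prod)
qed

lemma mulx_SI:
  fixes f :: "real \<times> real \<Rightarrow> real"
  assumes m: "bounded_borel m" and f: "f \<in> SI"
  shows "(\<lambda>p. m (fst p) * f p) \<in> SI"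
proof -
  obtain C where C: "\<And>x. \<bar>m x\<bar> \<le> C" using m by (auto simp: bounded_borel_def)
  have [measurable]: "f \<in> borel_measurable borel" by (rule SI_measurable[OF f])
  have [measurable]: "(\<lambda>p::real \<times> real. m (fst p)) \<in> borel_measurable borel"
    using m by (intro borel_measurable_fst) (simp add: bounded_borel_def)
  show ?thesis
    by (rule sq_integrable_bound[OF f, of _ C]) (auto simp: abs_mult intro!: mult_right_mono C)
qed

lemma mulx_mk: assumes m: "bounded_borel m" and f: "f \<in> SI"
  shows "mulx m (mk f) = mk (\<lambda>p. m (fst p) * f p)"
  unfolding mulx_def using rep_mk[OF f]
  by (subst mk_eq_iff) (auto intro!: mulx_SI m f elim!: eventually_mono)

lemma mulx_norm:
  assumes m: "bounded_borel m" and C: "\<And>x. \<bar>m x\<bar> \<le> C"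
  shows "norm (mulx m p) \<le> norm p * C"
proof -
  obtain f where f: "f \<in> SI" "p = mk f" by (rule l2_cases)
  have C0: "0 \<le> C" using C[of 0] by linarith
  have "(\<integral>p. (m (fst p) * f p)\<^sup>2 \<partial>lborel) \<le> (\<integral>p. C\<^sup>2 * (f p)\<^sup>2 \<partial>lborel)"
  proof (rule integral_mono)
    show "integrable lborel (\<lambda>p. (m (fst p) * f p)\<^sup>2)" using mulx_SI[OF m f(1)] by (simp add: sq_integrable_def)
    show "integrable lborel (\<lambda>p. C\<^sup>2 * (f p)\<^sup>2)" using f by (simp add: sq_integrable_def)
    show "(m (fst p) * f p)\<^sup>2 \<le> C\<^sup>2 * (f p)\<^sup>2" for p
      using power_mono[OF C[of "fst p"], of 2] by (simp add: power_mult_distrib mult_right_mono)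
  qed
  then show ?thesis using f C0 by (simp add: mulx_mk[OF m] norm_mk_le mulx_SI[OF m])
qed

lemma bounded_linear_mulx: assumes m: "bounded_borel m" shows "bounded_linear (mulx m)"
proof -
  obtain C where C: "\<And>x. \<bar>m x\<bar> \<le> C" using m by (auto simp: bounded_borel_def)
  show ?thesis
  proof (rule bounded_linear_intro)
    fix p q :: l2 and r :: real
    obtain f where f: "f \<in> SI" "p = mk f" by (rule l2_cases)
    obtain g where g: "g \<in> SI" "q = mk g" by (rule l2_cases)
    show "mulx m (p + q) = mulx m p + mulx m q"
      using f g by (simp add: mk_add mulx_mk[OF m] mulx_SI[OF m] sq_integrable_add distrib_left)
    show "mulx m (r *\<^sub>R p) = r *\<^sub>R mulx m p"
      using f by (simp add: mk_scale mulx_mk[OF m] mulx_SI[OF m] sq_integrable_scale mult.left_commute)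
    show "norm (mulx m p) \<le> norm p * C" by (rule mulx_norm[OF m C])
  qed
qed

lemma inner_mulx:
  assumes m: "bounded_borel m" and "f \<in> SI" "g \<in> SI"
  shows "inner (mulx m (mk f)) (mk g) = (\<integral>p. m (fst p) * f p * g p \<partial>lborel)"
  using assms by (simp add: mulx_mk inner_mk mulx_SI)

lemma mulx_self:
  assumes m: "bounded_borel m" shows "inner (mulx m p) q = inner p (mulx m q)"
proof -
  obtain f where f: "f \<in> SI" "p = mk f" by (rule l2_cases)
  obtain g where g: "g \<in> SI" "q = mk g" by (rule l2_cases)
  show ?thesis using f g by (simp add: mulx_mk[OF m] inner_mk mulx_SI[OF m], simp add: mult_ac)
qed

lemma mulx_bounds:
  assumes m: "bounded_borel m"
  shows "(\<And>x. c \<le> m x) \<Longrightarrow> c * (norm p)\<^sup>2 \<le> inner (mulx m p) p"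
    and "(\<And>x. m x \<le> d) \<Longrightarrow> inner (mulx m p) p \<le> d * (norm p)\<^sup>2"
proof -
  obtain f where f: "f \<in> SI" "p = mk f" by (rule l2_cases)
  have i: "integrable lborel (\<lambda>p. (f p)\<^sup>2)" "integrable lborel (\<lambda>p. m (fst p) * f p * f p)"
    using f sq_integrable_product[OF mulx_SI[OF m f(1)] f(1)] by (auto simp: sq_integrable_def)
  have n: "(norm p)\<^sup>2 = (\<integral>p. (f p)\<^sup>2 \<partial>lborel)" using f by (simp add: norm_mk)
  have e: "inner (mulx m p) p = (\<integral>p. m (fst p) * f p * f p \<partial>lborel)" using f m by (simp add: inner_mulx)
  show "c * (norm p)\<^sup>2 \<le> inner (mulx m p) p" if c: "\<And>x. c \<le> m x"
  proof -
    have "(\<integral>p. c * (f p)\<^sup>2 \<partial>lborel) \<le> (\<integral>p. m (fst p) * f p * f p \<partial>lborel)"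
      using i by (intro integral_mono) (auto simp: power2_eq_square mult.assoc intro!: mult_right_mono c)
    then show ?thesis by (simp add: n e)
  qed
  show "inner (mulx m p) p \<le> d * (norm p)\<^sup>2" if d: "\<And>x. m x \<le> d"
  proof -
    have "(\<integral>p. m (fst p) * f p * f p \<partial>lborel) \<le> (\<integral>p. d * (f p)\<^sup>2 \<partial>lborel)"
      using i by (intro integral_mono) (auto simp: power2_eq_square mult.assoc intro!: mult_right_mono d)
    then show ?thesis by (simp add: n e)
  qed
qed

lemma mulx_opt_commute:
  assumes m: "bounded_borel m" and k: "kernel b M k"
  shows "opt k (mulx m p) = mulx m (opt k p)"
proof -
  obtain f where f: "f \<in> SI" "p = mk f" by (rule l2_cases)
  have "Kt k (\<lambda>p. m (fst p) * f p) = (\<lambda>p. m (fst p) * Kt k f p)"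
  proof
    fix p show "Kt k (\<lambda>p. m (fst p) * f p) p = m (fst p) * Kt k f p"
      unfolding Kt_def by (subst integral_mult_right_zero[symmetric]) (simp add: mult_ac)
  qed
  then show ?thesis using f by (simp add: mulx_mk[OF m] opt_mk[OF k] mulx_SI[OF m] Kt_SI[OF k])
qed

section \<open>Kernels of integration in time and of the Dirichlet problem\<close>

definition kJ :: "real \<Rightarrow> real \<Rightarrow> real \<Rightarrow> real" where
  "kJ T t s = (if 0 < s \<and> s < t \<and> t < T then 1 else 0)"

text \<open>The x-derivative of \<open>kG\<close>. In contrast to \<open>kJ\<close> it is not cut
  off at the ends of the interval: its values at x = 0 and x = l produce the boundary
  slopes.\<close>

definition kD :: "real \<Rightarrow> real \<Rightarrow> real \<Rightarrow> real" where
  "kD l x y = (if 0 \<le> x \<and> x \<le> l \<and> 0 < y \<and> y < l then (if y < x then 1 else 0) - (l - y) / l else 0)"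

text \<open>Green's function of v'' = f, v(0) = v(l) = 0: the kernel x - y for y < x gives the
  solution with zero data at 0, and the linear term in x restores v(l) = 0.\<close>

definition kG :: "real \<Rightarrow> real \<Rightarrow> real \<Rightarrow> real" where
  "kG l x y = (if 0 \<le> x \<and> x \<le> l \<and> 0 < y \<and> y < l then (if y < x then x - y else 0) - x * (l - y) / l else 0)"

lemma kernel_kJ: "0 < T \<Longrightarrow> kernel T 1 (kJ T)"
proof -
  have "(\<lambda>p. kJ T (fst p) (snd p)) \<in> borel_measurable (borel \<Otimes>\<^sub>M borel)"
    unfolding kJ_def by measurable
  then show "0 < T \<Longrightarrow> kernel T 1 (kJ T)" by (auto simp: kernel_def kJ_def borel_prod)
qed

lemma kernel_kD: assumes l: "0 < l" shows "kernel l 1 (kD l)"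
proof -
  have "(\<lambda>p. kD l (fst p) (snd p)) \<in> borel_measurable (borel \<Otimes>\<^sub>M borel)"
    unfolding kD_def by measurable
  then show ?thesis using l by (auto simp: kernel_def kD_def borel_prod abs_le_iff field_simps)
qed

lemma kernel_kG: assumes l: "0 < l" shows "kernel l (2 * l) (kG l)"
proof -
  have "(\<lambda>p. kG l (fst p) (snd p)) \<in> borel_measurable (borel \<Otimes>\<^sub>M borel)"
    unfolding kG_def by measurable
  moreover have "\<bar>kG l x y\<bar> \<le> 2 * l" if "0 \<le> x" "x \<le> l" "0 < y" "y < l" for x y
  proof -
    have "0 \<le> (l - y) / l" "(l - y) / l \<le> 1" using that l by (auto simp: field_simps)
    then have w: "0 \<le> x * ((l - y) / l)" "x * ((l - y) / l) \<le> l * 1"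
      using that mult_mono[of x l "(l - y) / l" 1] by (simp_all del: times_divide_eq_right)
    define w where "w = x * (l - y) / l"
    have "0 \<le> w" "w \<le> l" using w by (simp_all add: w_def)
    then show ?thesis using that unfolding kG_def w_def[symmetric] by auto
  qed
  ultimately show ?thesis using l by (auto simp: kernel_def borel_prod kG_def)
qed

abbreviation "J T \<equiv> opt (kJ T)"
abbreviation "Js T \<equiv> opt (\<lambda>t s. kJ T s t)"
abbreviation "D l \<equiv> opx (kD l)"
abbreviation "Dt l \<equiv> opx (\<lambda>x y. kD l y x)"
abbreviation "G l \<equiv> opx (kG l)"
abbreviation "Gt l \<equiv> opx (\<lambda>x y. kG l y x)"

definition kE :: "real \<Rightarrow> real \<Rightarrow> real \<Rightarrow> real" where
  "kE T t s = indicator {0<..<T} t * indicator {0<..<T} s"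

lemma kernel_kE: "0 < T \<Longrightarrow> kernel T 1 (kE T)"
proof -
  have "(\<lambda>p. kE T (fst p) (snd p)) \<in> borel_measurable (borel \<Otimes>\<^sub>M borel)"
    unfolding kE_def by measurable
  then show "0 < T \<Longrightarrow> kernel T 1 (kE T)" by (auto simp: kernel_def kE_def borel_prod indicator_def)
qed

text \<open>The triangles s < t and t < s fill the square up to the diagonal, which is a null set in
  s for each t.\<close>

lemma J_plus_Js:
  assumes T: "0 < T" shows "J T p + Js T p = opt (kE T) p"
proof -
  obtain f where f: "f \<in> SI" "p = mk f" by (rule l2_cases)
  note k = kernel_kJ[OF T] note k' = kernel_transpose[OF k] note kE = kernel_kE[OF T]
  have [measurable]: "Kt (kJ T) f \<in> borel_measurable borel" "Kt (\<lambda>t s. kJ T s t) f \<in> borel_measurable borel"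
    "Kt (kE T) f \<in> borel_measurable borel"
    by (intro Kt_measurable[OF k] Kt_measurable[OF k'] Kt_measurable[OF kE] SI_measurable f)+
  \<comment> \<open>The coordinates are swapped because \<open>AE_lborel2I\<close> takes the second
    one as outer variable, whereas here almost every x has a square integrable section in t.\<close>
  have "AE p in lborel. Kt (kJ T) f (snd p, fst p) + Kt (\<lambda>t s. kJ T s t) f (snd p, fst p) = Kt (kE T) f (snd p, fst p)"
  proof (rule AE_lborel2I)
    have "(\<lambda>p. Kt (kJ T) f (snd p, fst p)) \<in> borel_measurable borel"
      "(\<lambda>p. Kt (\<lambda>t s. kJ T s t) f (snd p, fst p)) \<in> borel_measurable borel"
      "(\<lambda>p. Kt (kE T) f (snd p, fst p)) \<in> borel_measurable borel" by (intro borel_swap; measurable)+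
    then show "{p. Kt (kJ T) f (snd p, fst p) + Kt (\<lambda>t s. kJ T s t) f (snd p, fst p) = Kt (kE T) f (snd p, fst p)} \<in> sets borel"
      by measurable
    show "AE x in lborel. AE t in lborel. Kt (kJ T) f (snd (t, x), fst (t, x)) + Kt (\<lambda>t s. kJ T s t) f (snd (t, x), fst (t, x))
        = Kt (kE T) f (snd (t, x), fst (t, x))"
      using SI_sections(2)[OF f(1)]
    proof eventually_elim
      case (elim x)
      have "Kt (kJ T) f (x, t) + Kt (\<lambda>t s. kJ T s t) f (x, t) = Kt (kE T) f (x, t)" for t
      proof -
        have "Kt (kJ T) f (x, t) + Kt (\<lambda>t s. kJ T s t) f (x, t)
          = (\<integral>s. kJ T t s * f (x, s) + kJ T s t * f (x, s) \<partial>lborel)"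
          unfolding Kt_def using kernel_integrable[OF k elim, of t] kernel_integrable[OF k' elim, of t] by simp
        also have "\<dots> = (\<integral>s. kE T t s * f (x, s) \<partial>lborel)"
        proof (rule integral_cong_AE)
          have "AE s in lborel. s \<noteq> t" by (rule AE_lborel_singleton)
          then show "AE s in lborel. kJ T t s * f (x, s) + kJ T s t * f (x, s) = kE T t s * f (x, s)"
            by eventually_elim (auto simp: kJ_def kE_def indicator_def)
        qed (use kernel_integrable[OF k elim, of t] kernel_integrable[OF k' elim, of t] kernel_integrable[OF kE elim, of t] in auto)
        finally show ?thesis by (simp add: Kt_def)
      qed
      then show ?case by simp
    qed
  qed
  from AE_swap[OF this] have "AE p in lborel. Kt (kJ T) f p + Kt (\<lambda>t s. kJ T s t) f p = Kt (kE T) f p" by simp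
  then show ?thesis using f
    by (simp add: opt_mk[OF k] opt_mk[OF k'] opt_mk[OF kE] mk_add mk_eq_iff Kt_SI[OF k] Kt_SI[OF k'] Kt_SI[OF kE] sq_integrable_add)
qed

text \<open>\<open>kE\<close> is a rank one kernel, the tensor square of the indicator of (0,T),
  whose integral is T.\<close>

lemma E_E: assumes T: "0 < T" shows "opt (kE T) (opt (kE T) p) = T *\<^sub>R opt (kE T) p"
proof -
  obtain f where f: "f \<in> SI" "p = mk f" by (rule l2_cases)
  note kE = kernel_kE[OF T]
  have "Kt (kE T) (Kt (kE T) f) = (\<lambda>p. T * Kt (kE T) f p)"
  proof
    fix p :: "real \<times> real" obtain x t where p: "p = (x, t)" by fastforce
    define I where "I = (\<integral>r. indicator {0<..<T} r * f (x, r) \<partial>lborel)"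
    have Kt: "Kt (kE T) f (x, s) = indicator {0<..<T} s * I" for s
      by (simp add: Kt_def kE_def mult.assoc I_def)
    have "Kt (kE T) (Kt (kE T) f) (x, t) = (\<integral>s. indicator {0<..<T} t * I * indicator {0<..<T} s \<partial>lborel)"
      unfolding Kt_def[of _ "Kt (kE T) f"] fst_conv snd_conv Kt
      by (intro Bochner_Integration.integral_cong) (auto simp: kE_def indicator_def)
    also have "\<dots> = indicator {0<..<T} t * I * T" using T by simp
    also have "\<dots> = T * Kt (kE T) f (x, t)" using T by (simp add: Kt)
    finally show "Kt (kE T) (Kt (kE T) f) p = T * Kt (kE T) f p" by (simp add: p)
  qed
  then show ?thesis using f by (simp add: opt_mk[OF kE] Kt_SI[OF kE] mk_scale)
qed

text \<open>Bending and tension are merged into one operator: for a = u_xx the first summand is the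
  form with \<open>r\<close>, and since D a = u_x the second is the form with \<tau>. Both are
  bounded on L2, which gives R1.\<close>

lemma evolution_l2:
  assumes l: "0 < l" and T: "0 < T"
    and m: "bounded_borel \<rho>" "bounded_borel \<mu>" "bounded_borel \<tau>" "bounded_borel r" "bounded_borel \<kappa>"
    and lower: "\<And>x. \<rho>0 \<le> \<rho> x" "0 < \<rho>0" "\<And>x. 0 \<le> \<mu> x" "\<And>x. 0 \<le> \<tau> x" "\<And>x. 0 \<le> r x" "\<And>x. \<kappa>0 \<le> \<kappa> x" "0 < \<kappa>0"
  shows "\<exists>R1. evolution (J T) (Js T) (G l) (Gt l) (mulx \<rho>) (mulx \<mu>)
    (\<lambda>a. mulx r a + Dt l (mulx \<tau> (D l a))) (mulx \<kappa>) T \<rho>0 R1 \<kappa>0"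
proof -
  note kJ = kernel_kJ[OF T] note kJ' = kernel_transpose[OF kJ]
  note kG = kernel_kG[OF l] note kG' = kernel_transpose[OF kG]
  note kD = kernel_kD[OF l] note kD' = kernel_transpose[OF kD]
  obtain C where C: "\<And>x. \<bar>r x\<bar> \<le> C" using m by (auto simp: bounded_borel_def)
  obtain C' where C': "\<And>x. \<bar>\<tau> x\<bar> \<le> C'" using m by (auto simp: bounded_borel_def)
  have C0: "0 \<le> C" "0 \<le> C'" using C[of 0] C'[of 0] by linarith+
  define B where "B = onorm (D l)"
  have B: "norm (D l a) \<le> B * norm a" for a unfolding B_def by (rule onorm[OF bounded_linear_opx[OF kD]])
  have blR: "bounded_linear (\<lambda>a. mulx r a + Dt l (mulx \<tau> (D l a)))"
    by (intro bounded_linear_add bounded_linear_mulx m bounded_linear_compose[OF bounded_linear_opx[OF kD']]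
        bounded_linear_compose[OF bounded_linear_mulx[OF m(3)]] bounded_linear_opx[OF kD])
  have Dadj: "inner (Dt l a) b = inner a (D l b)" for a b
    using opx_adjoint[OF kD', of a b] by simp
  have "evolution (J T) (Js T) (G l) (Gt l) (mulx \<rho>) (mulx \<mu>)
    (\<lambda>a. mulx r a + Dt l (mulx \<tau> (D l a))) (mulx \<kappa>) T \<rho>0 (C + C' * B\<^sup>2) \<kappa>0"
  \<comment> \<open>The numbers follow the order of the locale assumptions: 13 and 18 are symmetry
    of \<open>R\<close> and its commutation with \<open>J\<close>, 21 is E E = T E, 24 to 27 are the
    bounds on the forms of \<mu> and \<open>R\<close>.\<close>
  proof (rule evolution.intro, goal_cases)
    case 13
    then show ?case using Dadj opx_adjoint[OF kD] mulx_self[OF m(3)] mulx_self[OF m(4)]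
      by (simp add: inner_simps)
  next
    case (18 a)
    then show ?case
      using mulx_opt_commute[OF m(4) kJ, symmetric] mulx_opt_commute[OF m(3) kJ, symmetric] opx_opt_commute[OF kD kJ] opx_opt_commute[OF kD' kJ]
      linear_add[OF bounded_linear.linear[OF bounded_linear_opt[OF kJ]]] by simp
  next
    case (21 a)
    then show ?case by (simp add: J_plus_Js[OF T] E_E[OF T])
  next
    case (24 a)
    then show ?case using mulx_bounds(1)[OF m(2), of 0 a] lower by simp
  next
    case (25 a)
    then show ?case using mulx_bounds(1)[OF m(4), of 0 a] mulx_bounds(1)[OF m(3), of 0 "D l a"] lower
      by (simp add: inner_simps Dadj)
  next
    case (26 a)
    have "inner (mulx \<tau> (D l a)) (D l a) \<le> C' * (norm (D l a))\<^sup>2"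
      using mulx_bounds(2)[OF m(3), of C' "D l a"] C' abs_le_iff by blast
    also have "\<dots> \<le> C' * (B * norm a)\<^sup>2" using B C0 by (intro mult_left_mono power_mono) auto
    finally show ?case using mulx_bounds(2)[OF m(4), of C a] C
      by (simp add: inner_simps Dadj power_mult_distrib distrib_right abs_le_iff)
  next
    case 27
    then show ?case using C0 by simp
  qed (use l T lower in \<open>auto intro!: bounded_linear_opt[OF kJ] bounded_linear_opt[OF kJ'] bounded_linear_opx[OF kG]
      bounded_linear_opx[OF kG'] bounded_linear_mulx m blR opt_adjoint[OF kJ] opx_adjoint[OF kG] mulx_self mulx_bounds
      mulx_opt_commute[OF _ kJ] opx_opt_commute[OF kG kJ, symmetric]\<close>)
  then show ?thesis by blast
qed

section \<open>Test functions\<close>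

lemma emeasure_lborel_Ioo_finite: "emeasure lborel {a<..<b::real} < top"
  by (cases "a \<le> b") auto

section \<open>Smooth functions of one real variable\<close>

definition smooth :: "(real \<Rightarrow> real) \<Rightarrow> bool" where
  "smooth f \<longleftrightarrow> (\<forall>n x. ((deriv ^^ n) f) field_differentiable (at x))"

text \<open>Peeling off the first derivative suits induction: the product rule and the chain rule
  express it by sums and products of functions that are differentiable one time less.\<close>

primrec diffn :: "nat \<Rightarrow> (real \<Rightarrow> real) \<Rightarrow> bool" where
  "diffn 0 f \<longleftrightarrow> True"
| "diffn (Suc n) f \<longleftrightarrow> (\<forall>x. f field_differentiable (at x)) \<and> diffn n (deriv f)"

lemma diffn_iff: "diffn n f \<longleftrightarrow> (\<forall>k<n. \<forall>x. ((deriv ^^ k) f) field_differentiable (at x))"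
proof (induction n arbitrary: f)
  case (Suc n)
  show ?case unfolding diffn.simps Suc.IH All_less_Suc2 by (simp add: funpow_swap1 funpow_Suc_right del: funpow.simps)
qed simp

lemma smooth_iff_diffn: "smooth f \<longleftrightarrow> (\<forall>n. diffn n f)"
  unfolding smooth_def diffn_iff by auto

lemma smooth_iff: "smooth f \<longleftrightarrow> (\<forall>x. f field_differentiable (at x)) \<and> smooth (deriv f)"
  unfolding smooth_iff_diffn by (metis diffn.simps(1,2) not0_implies_Suc)

lemma smooth_if_derivative:
  assumes "\<And>x. (f has_field_derivative g x) (at x)" "smooth g"
  shows "smooth f"
proof -
  have "deriv f = g" using assms(1) by (auto intro: DERIV_imp_deriv)
  then show ?thesis using assms smooth_iff[of f] field_differentiable_def by blast
qed

text \<open>Coinductive principle: a family closed under differentiation consists of smooth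
  functions, with no formula for the n-th derivative.\<close>

lemma smoothI_family:
  assumes "f \<in> S" "\<And>f. f \<in> S \<Longrightarrow> \<exists>g\<in>S. \<forall>x. (f has_field_derivative g x) (at x)"
  shows "smooth f"
proof -
  have "(deriv ^^ n) f \<in> S" for n
  proof (induction n)
    case (Suc n)
    obtain g where g: "g \<in> S" "\<forall>x. ((deriv ^^ n) f has_field_derivative g x) (at x)" using assms(2)[OF Suc] by blast
    then have "deriv ((deriv ^^ n) f) = g" by (auto intro: DERIV_imp_deriv)
    then show ?case using g by simp
  qed (use assms in simp)
  then show ?thesis unfolding smooth_def field_differentiable_def using assms(2) by blast
qed

lemma diffn_mono: "diffn (Suc n) f \<Longrightarrow> diffn n f"
  unfolding diffn_iff by auto

lemma diffn_add: "diffn n f \<Longrightarrow> diffn n g \<Longrightarrow> diffn n (\<lambda>x. f x + g x)"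
proof (induction n arbitrary: f g)
  case (Suc n)
  have "deriv (\<lambda>x. f x + g x) = (\<lambda>x. deriv f x + deriv g x)"
    using Suc.prems by (auto intro!: deriv_add)
  then show ?case using Suc by (auto intro: field_differentiable_add)
qed simp

lemma diffn_mult: "diffn n f \<Longrightarrow> diffn n g \<Longrightarrow> diffn n (\<lambda>x. f x * g x)"
proof (induction n arbitrary: f g)
  case (Suc n)
  have "deriv (\<lambda>x. f x * g x) = (\<lambda>x. f x * deriv g x + deriv f x * g x)"
    using Suc.prems by (auto intro!: deriv_mult)
  moreover have "diffn n f" "diffn n g" using Suc.prems diffn_mono by blast+
  ultimately show ?case using Suc by (auto intro!: field_differentiable_mult diffn_add)
qed simp

lemma diffn_const: "diffn n (\<lambda>x. c)"
  by (induction n arbitrary: c) auto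

lemma diffn_affine: "diffn n f \<Longrightarrow> diffn n (\<lambda>x. f (s * x + t))"
proof (induction n arbitrary: f)
  case (Suc n)
  have d: "((\<lambda>x. f (s * x + t)) has_field_derivative deriv f (s * x + t) * s) (at x)" for x
  proof (rule DERIV_chain2[where f = f and g = "\<lambda>x. s * x + t"])
    show "(f has_field_derivative deriv f (s * x + t)) (at (s * x + t))"
      using Suc.prems by (auto simp: field_differentiable_derivI)
    show "((\<lambda>x. s * x + t) has_field_derivative s) (at x)" by (auto intro!: derivative_eq_intros)
  qed
  then have "deriv (\<lambda>x. f (s * x + t)) = (\<lambda>x. deriv f (s * x + t) * s)"
    by (auto intro: DERIV_imp_deriv)
  moreover have "diffn n (\<lambda>x. deriv f (s * x + t))" using Suc by simp
  ultimately show ?case using d by (auto intro!: diffn_mult diffn_const simp: field_differentiable_def)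
qed simp

lemma smooth_mult: "smooth f \<Longrightarrow> smooth g \<Longrightarrow> smooth (\<lambda>x. f x * g x)"
  unfolding smooth_iff_diffn by (auto intro: diffn_mult)

lemma smooth_add: "smooth f \<Longrightarrow> smooth g \<Longrightarrow> smooth (\<lambda>x. f x + g x)"
  unfolding smooth_iff_diffn by (auto intro: diffn_add)

lemma smooth_const: "smooth (\<lambda>x. c)"
  unfolding smooth_iff_diffn by (auto intro: diffn_const)

lemma smooth_affine: "smooth f \<Longrightarrow> smooth (\<lambda>x. f (s * x + t))"
  unfolding smooth_iff_diffn by (auto intro: diffn_affine)

section \<open>Flat functions and bumps\<close>

definition flat :: "real poly \<Rightarrow> real \<Rightarrow> real" where
  "flat p x = (if 0 < x then poly p (1 / x) * exp (- (1 / x)) else 0)"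

lemma poly_exp_tendsto_0:
  fixes p :: "real poly"
  shows "((\<lambda>y. y ^ k * poly p y * exp (- y)) \<longlongrightarrow> 0) at_top"
proof (induction p arbitrary: k)
  case (pCons a p)
  have "((\<lambda>y::real. a * (y ^ k / exp y) + y ^ Suc k * poly p y * exp (- y)) \<longlongrightarrow> a * 0 + 0) at_top"
    by (intro tendsto_intros tendsto_power_div_exp_0 pCons.IH)
  then show ?case by (simp add: algebra_simps exp_minus divide_inverse)
qed simp

text \<open>With y = 1 / x the function is p(y) exp(-y), and dy / dx = -y^2 produces the polynomial
  y^2 (p - p'). The family is thus closed under differentiation, also at 0, where exponential decay
  beats every polynomial.\<close>

lemma flat_derivative:
  "(flat p has_field_derivative flat (monom 1 2 * (p - pderiv p)) x) (at x)"
proof -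
  consider "x > 0" | "x < 0" | "x = 0" by linarith
  then show ?thesis
  proof cases
    case 1
    have "((\<lambda>x. poly p (1 / x) * exp (- (1 / x))) has_field_derivative
        flat (monom 1 2 * (p - pderiv p)) x) (at x)"
      using 1 by (auto intro!: derivative_eq_intros poly_DERIV[THEN DERIV_chain2] simp: flat_def poly_monom field_simps power2_eq_square)
    then show ?thesis
      by (rule has_field_derivative_transform_within_open[of _ _ _ "{0<..}"]) (use 1 in \<open>auto simp: flat_def\<close>)
  next
    case 2
    have "((\<lambda>x. 0) has_field_derivative 0) (at x)" by simp
    then have "(flat p has_field_derivative 0) (at x)"
      by (rule has_field_derivative_transform_within_open[of _ _ _ "{..<0}"]) (use 2 in \<open>auto simp: flat_def\<close>)
    then show ?thesis using 2 by (simp add: flat_def)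
  next
    case 3
    have l: "((\<lambda>h. flat p h / h) \<longlongrightarrow> 0) (at_left 0)"
      by (rule tendsto_eventually, rule eventually_at_leftI[of "-1"]) (auto simp: flat_def)
    \<comment> \<open>The right difference quotient at 0, with y the reciprocal of h, is y p(y)
      exp(-y).\<close>
    have "((\<lambda>y. flat p (inverse y) / inverse y) \<longlongrightarrow> 0) at_top"
    proof (rule Lim_transform_eventually)
      show "((\<lambda>y. y ^ 1 * poly p y * exp (- y)) \<longlongrightarrow> 0) at_top" by (rule poly_exp_tendsto_0)
      show "\<forall>\<^sub>F y in at_top. y ^ 1 * poly p y * exp (- y) = flat p (inverse y) / inverse y"
        using eventually_gt_at_top[of 0] by eventually_elim (simp add: flat_def divide_inverse)
    qed
    then have r: "((\<lambda>h. flat p h / h) \<longlongrightarrow> 0) (at_right 0)" by (simp add: filterlim_at_right_to_top)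
    have "((\<lambda>h. flat p h / h) \<longlongrightarrow> 0) (at 0)" using l r by (rule filterlim_split_at)
    then have "(flat p has_field_derivative 0) (at 0)" by (simp add: DERIV_def flat_def)
    then show ?thesis using 3 by (simp add: flat_def)
  qed
qed

lemma smooth_flat: "smooth (flat p)"
  by (rule smoothI_family[of _ "range flat"]) (use flat_derivative in blast)+

text \<open>The parameter \<open>n\<close> steepens the flanks: for growing \<open>n\<close> the
  bumps tend to the indicator of (a, b) and stay below it, which is the situation for dominated
  convergence.\<close>

definition bump :: "real \<Rightarrow> real \<Rightarrow> nat \<Rightarrow> real \<Rightarrow> real" where
  "bump a b n x = flat 1 (real n * x + (- real n * a)) * flat 1 (- real n * x + real n * b)"

lemma bump_eq: "bump a b n x = (if n > 0 \<and> a < x \<and> x < b then exp (- (1 / (n * (x - a)))) * exp (- (1 / (n * (b - x)))) else 0)"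
proof -
  have 1: "real n * x + (- real n * a) = n * (x - a)" "- real n * x + real n * b = n * (b - x)" by (simp_all add: algebra_simps)
  show ?thesis unfolding bump_def 1 flat_def by (auto simp: zero_less_mult_iff)
qed

lemma bump_smooth: "smooth (bump a b n)"
  unfolding bump_def by (intro smooth_mult smooth_affine smooth_flat)

lemma bump_bounds: "0 \<le> bump a b n x" "bump a b n x \<le> 1" "x \<notin> {a<..<b} \<Longrightarrow> bump a b n x = 0"
proof -
  show "bump a b n x \<le> 1"
  proof (cases "n > 0 \<and> a < x \<and> x < b")
    case True
    then have "exp (- (1 / (n * (x - a)))) * exp (- (1 / (n * (b - x)))) \<le> 1 * 1"
      by (intro mult_mono) auto
    then show ?thesis using True by (simp add: bump_eq)
  next
    case False
    then have "bump a b n x = 0" unfolding bump_eq by (rule if_not_P)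
    then show ?thesis by simp
  qed
qed (auto simp: bump_eq)

lemma bump_lim: "(\<lambda>n. bump a b n x) \<longlonglongrightarrow> indicator {a<..<b} x"
proof (cases "a < x \<and> x < b")
  case True
  have c: "(\<lambda>n. exp (- (1 / (real n * d)))) \<longlonglongrightarrow> exp (- 0)" if "d > 0" for d
  proof (intro tendsto_intros)
    have "(\<lambda>n. (1 / real n) * (1 / d)) \<longlonglongrightarrow> 0 * (1 / d)" by (intro tendsto_intros lim_1_over_n)
    then show "(\<lambda>n. 1 / (real n * d)) \<longlonglongrightarrow> 0" by simp
  qed
  have "(\<lambda>n. exp (- (1 / (real n * (x - a)))) * exp (- (1 / (real n * (b - x))))) \<longlonglongrightarrow> exp (- 0) * exp (- 0)"
    using True by (intro tendsto_mult c) auto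
  then have "(\<lambda>n. bump a b n x) \<longlonglongrightarrow> exp (- 0) * exp (- 0)"
    by (rule Lim_transform_eventually) (use True in \<open>auto simp: bump_eq intro!: eventually_sequentiallyI[of 1]\<close>)
  then show ?thesis using True by simp
next
  case False
  then show ?thesis by (auto simp: bump_eq)
qed

section \<open>Supports, bounds and integrability of test functions\<close>

lemma test_functions_alt:
  "\<phi> \<in> test_functions b \<longleftrightarrow> smooth \<phi> \<and> (\<exists>c d. 0 < c \<and> d < b \<and> (\<forall>x. x \<notin> {c..d} \<longrightarrow> \<phi> x = 0))"
proof
  assume "\<phi> \<in> test_functions b"
  then obtain K where K: "smooth \<phi>" "compact K" "K \<subseteq> {0<..<b}" "\<forall>x. x \<notin> K \<longrightarrow> \<phi> x = 0"
    by (auto simp: test_functions_def smooth_def)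
  show "smooth \<phi> \<and> (\<exists>c d. 0 < c \<and> d < b \<and> (\<forall>x. x \<notin> {c..d} \<longrightarrow> \<phi> x = 0))"
  proof (cases "K = {}")
    case True
    then show ?thesis using K by (intro conjI exI[of _ 1] exI[of _ "b - 1"]) auto
  next
    case False
    obtain c where c: "c \<in> K" "\<forall>x\<in>K. c \<le> x" using compact_attains_inf[OF K(2) False] by blast
    obtain d where d: "d \<in> K" "\<forall>x\<in>K. x \<le> d" using compact_attains_sup[OF K(2) False] by blast
    show ?thesis using K c d by (intro conjI exI[of _ c] exI[of _ d]) (auto simp: subset_iff)
  qed
next
  assume "smooth \<phi> \<and> (\<exists>c d. 0 < c \<and> d < b \<and> (\<forall>x. x \<notin> {c..d} \<longrightarrow> \<phi> x = 0))"
  then obtain c d where cd: "smooth \<phi>" "0 < c" "d < b" "\<forall>x. x \<notin> {c..d} \<longrightarrow> \<phi> x = 0" by blast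
  then have "compact {c..d}" "{c..d} \<subseteq> {0<..<b}" by auto
  then show "\<phi> \<in> test_functions b" using cd by (auto simp: test_functions_def smooth_def)
qed

lemma bump_test: "0 < a \<Longrightarrow> b < l \<Longrightarrow> bump a b n \<in> test_functions l"
  unfolding test_functions_alt using bump_smooth bump_bounds(3)
  by (intro conjI exI[of _ a] exI[of _ b]) auto

lemma test_functions_continuous:
  assumes "\<phi> \<in> test_functions b"
  shows "continuous_on S \<phi>" "continuous_on S (deriv \<phi>)" "\<phi> \<in> borel_measurable borel"
    "deriv \<phi> \<in> borel_measurable borel" "(\<phi> has_field_derivative deriv \<phi> x) (at x)"
proof -
  have s: "smooth \<phi>" "smooth (deriv \<phi>)" using assms smooth_iff[of \<phi>] by (simp_all add: test_functions_alt)
  have c: "continuous_on S f" if "smooth f" for f S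
    using that[THEN smooth_iff[THEN iffD1]]
    by (auto intro!: continuous_at_imp_continuous_on field_differentiable_imp_continuous_at)
  show "continuous_on S \<phi>" "continuous_on S (deriv \<phi>)" using s c by auto
  show "\<phi> \<in> borel_measurable borel" "deriv \<phi> \<in> borel_measurable borel"
    using s c by (auto intro!: borel_measurable_continuous_onI)
  show "(\<phi> has_field_derivative deriv \<phi> x) (at x)"
    using s(1)[THEN smooth_iff[THEN iffD1]] by (auto simp: field_differentiable_derivI)
qed

lemma test_functions_bounded:
  assumes "\<phi> \<in> test_functions b"
  obtains C where "\<And>x. \<bar>\<phi> x\<bar> \<le> C" "\<And>x. \<bar>deriv \<phi> x\<bar> \<le> C"
    "\<And>x. x \<notin> {0<..<b} \<Longrightarrow> \<phi> x = 0" "\<And>x. x \<notin> {0<..<b} \<Longrightarrow> deriv \<phi> x = 0"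
proof -
  obtain c d where cd: "0 < c" "d < b" "\<And>x. x \<notin> {c..d} \<Longrightarrow> \<phi> x = 0"
    using assms by (auto simp: test_functions_alt)
  have d0: "deriv \<phi> x = 0" if x: "x \<notin> {c..d}" for x
  proof (rule DERIV_imp_deriv)
    have "((\<lambda>x. 0) has_field_derivative 0) (at x)" by simp
    then show "(\<phi> has_field_derivative 0) (at x)"
      by (rule has_field_derivative_transform_within_open[of _ _ _ "- {c..d}"])
        (use x cd(3) in \<open>auto simp: open_Compl closed_real_atLeastAtMost\<close>)
  qed
  have bd: "\<exists>C. \<forall>x. \<bar>f x\<bar> \<le> C" if "continuous_on {c..d} f" "\<And>x. x \<notin> {c..d} \<Longrightarrow> f x = 0" for f :: "real \<Rightarrow> real"
  proof -
    have "bounded (f ` {c..d})" using that(1) by (intro compact_imp_bounded compact_continuous_image) auto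
    then obtain C where "\<And>y. y \<in> f ` {c..d} \<Longrightarrow> norm y \<le> C" unfolding bounded_iff by blast
    then have "\<bar>f x\<bar> \<le> C" if "x \<in> {c..d}" for x using that by force
    then have "\<bar>f x\<bar> \<le> max C 0" for x using that(2)[of x] by (cases "x \<in> {c..d}") (auto simp: le_max_iff_disj)
    then show ?thesis by blast
  qed
  obtain C where C: "\<And>x. \<bar>\<phi> x\<bar> \<le> C" using bd[OF test_functions_continuous(1)[OF assms] cd(3)] by blast
  obtain C' where C': "\<And>x. \<bar>deriv \<phi> x\<bar> \<le> C'" using bd[OF test_functions_continuous(2)[OF assms] d0] by blast
  show ?thesis
  proof (rule that[of "max C C'"])
    show "\<bar>\<phi> x\<bar> \<le> max C C'" "\<bar>deriv \<phi> x\<bar> \<le> max C C'" for x using C C' by (auto intro: max.coboundedI1 max.coboundedI2)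
    show "\<phi> x = 0" "deriv \<phi> x = 0" if "x \<notin> {0<..<b}" for x using that cd d0 by auto
  qed
qed

lemma sq_integrable_bounded_support:
  fixes f :: "real \<Rightarrow> real"
  assumes "f \<in> borel_measurable borel" "\<And>x. \<bar>f x\<bar> \<le> C" "\<And>x. x \<notin> {0<..<b} \<Longrightarrow> f x = 0"
  shows "f \<in> SI" "integrable lborel f"
proof -
  have i: "integrable lborel (\<lambda>x. C * indicator {0<..<b} x)" for C :: real
    by (intro integrable_mult_right integrable_real_indicator) (auto simp: emeasure_lborel_Ioo_finite)
  show "integrable lborel f"
    using i[of C] by (rule Bochner_Integration.integrable_bound)
      (use assms in \<open>auto simp: indicator_def intro: order_trans[OF _ abs_ge_self]\<close>)
  have "integrable lborel (\<lambda>x. (f x)\<^sup>2)"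
    using i[of "C\<^sup>2"]
  proof (rule Bochner_Integration.integrable_bound)
    have "\<bar>f x\<bar>\<^sup>2 \<le> C\<^sup>2" for x using assms(2)[of x] by (intro power_mono) auto
    then show "AE x in lborel. norm ((f x)\<^sup>2) \<le> norm (C\<^sup>2 * indicator {0<..<b} x)"
      using assms(3) by (auto simp: indicator_def)
  qed (use assms in auto)
  then show "f \<in> SI" using assms by (simp add: sq_integrable_def)
qed

lemma test_functions_sq:
  assumes "\<phi> \<in> test_functions b"
  shows "\<phi> \<in> SI" "deriv \<phi> \<in> SI"
    "integrable lborel \<phi>" "integrable lborel (deriv \<phi>)"
proof -
  obtain C where C: "\<And>x. \<bar>\<phi> x\<bar> \<le> C" "\<And>x. \<bar>deriv \<phi> x\<bar> \<le> C"
    "\<And>x. x \<notin> {0<..<b} \<Longrightarrow> \<phi> x = 0" "\<And>x. x \<notin> {0<..<b} \<Longrightarrow> deriv \<phi> x = 0"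
    using test_functions_bounded[OF assms] by blast
  show "\<phi> \<in> SI" "deriv \<phi> \<in> SI"
    "integrable lborel \<phi>" "integrable lborel (deriv \<phi>)"
    using sq_integrable_bounded_support[where f = \<phi>, OF _ C(1) C(3)]
      sq_integrable_bounded_support[where f = "deriv \<phi>", OF _ C(2) C(4)]
      test_functions_continuous(3,4)[OF assms] by blast+
qed

section \<open>Functions determined by their integrals\<close>

lemma AE_zero_boxes:
  fixes f :: "'a::euclidean_space \<Rightarrow> real"
  assumes f: "integrable lborel f" and z: "\<And>a b. (\<integral>x. indicator (box a b) x * f x \<partial>lborel) = 0"
  shows "AE x in lborel. f x = 0"
proof -
  have [measurable]: "f \<in> borel_measurable borel" using f by auto
  \<comment> \<open>The positive and the negative part of \<open>f\<close>, taken as densities, give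
    measures that agree on boxes. Boxes are an intersection stable generator, so the measures and
    then the densities coincide.\<close>
  define M where "M g = density lborel (\<lambda>x. ennreal (g x))" for g :: "'a \<Rightarrow> real"
  have em: "emeasure (M g) A = ennreal (\<integral>x. indicator A x * g x \<partial>lborel)"
    if A: "A \<in> sets borel" and g: "integrable lborel g" "\<And>x. 0 \<le> g x" for g A
  proof -
    have "emeasure (M g) A = (\<integral>\<^sup>+x. ennreal (g x) * indicator A x \<partial>lborel)"
      unfolding M_def using A g by (intro emeasure_density) auto
    also have "\<dots> = (\<integral>\<^sup>+x. ennreal (indicator A x * g x) \<partial>lborel)"
      by (intro nn_integral_cong) (auto simp: indicator_def)
    also have "\<dots> = ennreal (\<integral>x. indicator A x * g x \<partial>lborel)"
      using integrable_mult_indicator[of A lborel g] A g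
      by (intro nn_integral_eq_integral) auto
    finally show ?thesis .
  qed
  define p where "p x = max (f x) 0" for x
  define n where "n x = max (- f x) 0" for x
  have pn: "integrable lborel p" "integrable lborel n" "\<And>x. 0 \<le> p x" "\<And>x. 0 \<le> n x"
    using f unfolding p_def n_def by (auto intro!: Bochner_Integration.integrable_max)
  have fpn: "f x = p x - n x" for x by (auto simp: p_def n_def)
  have "M p = M n"
  proof (rule measure_eqI_generator_eq)
    let ?E = "range (\<lambda>(a, b). box a b::'a set)"
    show "Int_stable ?E" by (auto simp: Int_stable_def box_Int_box)
    show "?E \<subseteq> Pow UNIV" "sets (M p) = sigma_sets UNIV ?E" "sets (M n) = sigma_sets UNIV ?E"
      by (simp_all add: borel_eq_box M_def)
    let ?A = "\<lambda>n::nat. box (- (real n *\<^sub>R One)) (real n *\<^sub>R One) :: 'a set"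
    show "range ?A \<subseteq> ?E" "(\<Union>i. ?A i) = UNIV" unfolding UN_box_eq_UNIV by auto
    show "emeasure (M p) (?A i) \<noteq> \<infinity>" for i using pn by (subst em) auto
    show "emeasure (M p) X = emeasure (M n) X" if "X \<in> ?E" for X
    proof -
      obtain a b where X: "X = box a b" using \<open>X \<in> ?E\<close> by auto
      have "integrable lborel (\<lambda>x. indicator X x * p x)" "integrable lborel (\<lambda>x. indicator X x * n x)"
        using integrable_mult_indicator[of X lborel p] integrable_mult_indicator[of X lborel n] pn X by auto
      then have "(\<integral>x. indicator X x * p x \<partial>lborel) - (\<integral>x. indicator X x * n x \<partial>lborel) = 0"
        using z[of a b] by (simp add: fpn X right_diff_distrib)
      then show ?thesis using pn X by (simp add: em)
    qed
  qed
  then have "(\<integral>x. indicator A x * p x \<partial>lborel) = (\<integral>x. indicator A x * n x \<partial>lborel)" if "A \<in> sets borel" for A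
    using em[OF that pn(1,3)] em[OF that pn(2,4)] pn by (simp add: integral_nonneg_AE)
  then have "AE x in lborel. p x = n x"
    using pn by (intro density_unique_real) (auto simp: set_lebesgue_integral_def)
  then show ?thesis by eventually_elim (simp add: fpn)
qed

text \<open>Bumps inside (0, b) tend to indicators of intervals, so \<open>f\<close> has integral
  zero over every interval with closure in (0, b).\<close>

lemma fundamental_lemma_variations:
  assumes f: "f \<in> SI" and z: "\<And>\<phi>. \<phi> \<in> test_functions b \<Longrightarrow> (\<integral>x. f x * \<phi> x \<partial>lborel) = 0"
  shows "AE x in lborel. x \<in> {0<..<b} \<longrightarrow> f x = 0"
proof -
  have fm [measurable]: "f \<in> borel_measurable borel" using f by (simp add: sq_integrable_def)
  have ind: "integrable lborel (\<lambda>x. indicator {c<..<d} x * f x)" for c d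
  proof -
    have "(\<lambda>x. indicator {c<..<d} x * f x) = (\<lambda>x. f x * indicator {c<..<d} x)" by auto
    moreover have "(indicator {c<..<d} :: real \<Rightarrow> real) \<in> SI"
    proof -
      have "(\<lambda>x. (indicator {c<..<d} x :: real)\<^sup>2) = indicator {c<..<d}" by (auto simp: indicator_def)
      moreover have "integrable lborel (indicator {c<..<d} :: real \<Rightarrow> real)"
        by (intro integrable_real_indicator) (auto simp: emeasure_lborel_Ioo_finite)
      ultimately show ?thesis by (simp add: sq_integrable_def)
    qed
    ultimately show ?thesis using sq_integrable_product[OF f] by simp
  qed
  have int: "(\<integral>x. indicator {c<..<d} x * f x \<partial>lborel) = 0" if cd: "0 < c" "d < b" for c d
  proof (rule LIMSEQ_unique)
    show "(\<lambda>n. \<integral>x. bump c d n x * f x \<partial>lborel) \<longlonglongrightarrow> (\<integral>x. indicator {c<..<d} x * f x \<partial>lborel)"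
    proof (rule integral_dominated_convergence[where w = "\<lambda>x. \<bar>indicator {c<..<d} x * f x\<bar>"])
      show "integrable lborel (\<lambda>x. \<bar>indicator {c<..<d} x * f x\<bar>)" using ind by (rule integrable_abs)
      show "AE x in lborel. (\<lambda>n. bump c d n x * f x) \<longlonglongrightarrow> indicator {c<..<d} x * f x"
        by (intro AE_I2 tendsto_intros bump_lim)
      show "AE x in lborel. norm (bump c d n x * f x) \<le> \<bar>indicator {c<..<d} x * f x\<bar>" for n
      proof (rule AE_I2)
        fix x
        have "bump c d n x \<le> indicator {c<..<d} x" using bump_bounds(2)[of c d n x] bump_bounds(3)[of x c d n] by (auto simp: indicator_def)
        then show "norm (bump c d n x * f x) \<le> \<bar>indicator {c<..<d} x * f x\<bar>"
          using bump_bounds(1)[of c d n x] by (auto simp: abs_mult intro!: mult_right_mono)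
      qed
      show "(\<lambda>x. bump c d n x * f x) \<in> borel_measurable lborel" for n
        using test_functions_continuous(3)[OF bump_test[OF cd]] by auto
    qed (use ind[of c d] in auto)
    have "(\<integral>x. bump c d n x * f x \<partial>lborel) = 0" for n
      using z[OF bump_test[OF cd]] by (simp add: mult.commute)
    then show "(\<lambda>n. \<integral>x. bump c d n x * f x \<partial>lborel) \<longlonglongrightarrow> 0" by simp
  qed
  have "AE x in lborel. indicator {c<..<d} x * f x = 0" if cd: "0 < c" "d < b" for c d
  proof (rule AE_zero_boxes[OF ind])
    fix a a' :: real
    have "(\<integral>x. indicator (box a a') x * (indicator {c<..<d} x * f x) \<partial>lborel)
        = (\<integral>x. indicator {max a c<..<min a' d} x * f x \<partial>lborel)"
      by (intro Bochner_Integration.integral_cong) (auto simp: indicator_def box_real)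
    also have "\<dots> = 0" using cd by (intro int) auto
    finally show "(\<integral>x. indicator (box a a') x * (indicator {c<..<d} x * f x) \<partial>lborel) = 0" .
  qed
  \<comment> \<open>Countably many compactly contained intervals exhaust (0, b), so the exceptional
    sets unite to a null set.\<close>
  then have "AE x in lborel. \<forall>n. indicator {1 / Suc n<..<b - 1 / Suc n} x * f x = 0"
    by (subst AE_all_countable) auto
  then show ?thesis
  proof eventually_elim
    case (elim x)
    show ?case
    proof
      assume x: "x \<in> {0<..<b}"
      obtain n where n: "1 / real (Suc n) < min x (b - x)" using x nat_approx_posE[of "min x (b - x)"] by auto
      then have "x \<in> {1 / Suc n<..<b - 1 / Suc n}" by auto
      then show "f x = 0" using elim[rule_format, of n] by simp
    qed
  qed
qed

section \<open>Borel representatives\<close>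

lemma AE_lebesgue_on:
  fixes \<Omega> :: "'a::euclidean_space set"
  assumes "\<Omega> \<in> sets borel"
  shows "(AE x in lebesgue_on \<Omega>. P x) \<longleftrightarrow> (AE x in lborel. x \<in> \<Omega> \<longrightarrow> P x)"
  using assms by (subst AE_restrict_space_iff) (auto simp: AE_completion_iff)

text \<open>Functions in the problem are only Lebesgue measurable on an open set. A Borel
  modification that vanishes outside it has measurable sections, and its integrals over the set and
  over the whole space agree.\<close>

definition brep :: "'a::euclidean_space set \<Rightarrow> ('a \<Rightarrow> real) \<Rightarrow> ('a \<Rightarrow> real) \<Rightarrow> bool" where
  "brep \<Omega> f g \<longleftrightarrow> g \<in> SI \<and> (\<forall>x. x \<notin> \<Omega> \<longrightarrow> g x = 0) \<and> (AE x in lebesgue_on \<Omega>. f x = g x)"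

context
  fixes \<Omega> :: "'a::euclidean_space set"
  assumes \<Omega>: "\<Omega> \<in> sets borel"
begin

lemma \<Omega>_leb: "\<Omega> \<inter> space lebesgue \<in> sets lebesgue" using \<Omega> by auto

lemma integral_lebesgue_on_borel:
  fixes g :: "'a \<Rightarrow> real"
  assumes g: "g \<in> borel_measurable borel" "\<And>x. x \<notin> \<Omega> \<Longrightarrow> g x = 0"
  shows "(\<integral>x. g x \<partial>lebesgue_on \<Omega>) = (\<integral>x. g x \<partial>lborel)"
    "integrable (lebesgue_on \<Omega>) g \<longleftrightarrow> integrable lborel g"
proof -
  have e: "(\<lambda>x. indicator \<Omega> x *\<^sub>R g x) = g" by (intro ext) (use g(2) in \<open>auto simp: indicator_def\<close>)
  show "(\<integral>x. g x \<partial>lebesgue_on \<Omega>) = (\<integral>x. g x \<partial>lborel)"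
    unfolding integral_restrict_space[OF \<Omega>_leb] e by (rule integral_completion) (use g(1) in simp)
  show "integrable (lebesgue_on \<Omega>) g \<longleftrightarrow> integrable lborel g"
    unfolding integrable_restrict_space[OF \<Omega>_leb] e by (rule integrable_completion) (use g(1) in simp)
qed

lemma lebesgue_on_measurable_AE:
  fixes f g :: "'a \<Rightarrow> real"
  assumes g: "g \<in> borel_measurable borel" and ae: "AE x in lebesgue_on \<Omega>. f x = g x"
  shows "f \<in> borel_measurable (lebesgue_on \<Omega>)"
proof -
  have "(\<lambda>x. indicator \<Omega> x * g x) \<in> borel_measurable lebesgue"
    using g \<Omega> by (intro measurable_completion) auto
  moreover have "AE x in lebesgue. indicator \<Omega> x * g x = indicator \<Omega> x * f x"
    using ae unfolding AE_lebesgue_on[OF \<Omega>] AE_completion_iff by eventually_elim (auto simp: indicator_def)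
  ultimately have "(\<lambda>x. indicator \<Omega> x * f x) \<in> borel_measurable lebesgue"
    by (rule borel_measurable_AE)
  then show ?thesis by (simp add: borel_measurable_restrict_space_iff[OF \<Omega>_leb] mult.commute)
qed

lemma brep_sq:
  assumes "brep \<Omega> f g" shows "f \<in> sq_integrable (lebesgue_on \<Omega>)"
proof -
  have g: "g \<in> SI" "\<And>x. x \<notin> \<Omega> \<Longrightarrow> g x = 0" "AE x in lebesgue_on \<Omega>. f x = g x"
    using assms by (auto simp: brep_def)
  have gm: "g \<in> borel_measurable borel" using g by (simp add: sq_integrable_def)
  have f: "f \<in> borel_measurable (lebesgue_on \<Omega>)" by (rule lebesgue_on_measurable_AE[OF gm g(3)])
  have gl: "g \<in> borel_measurable (lebesgue_on \<Omega>)" by (rule lebesgue_on_measurable_AE[OF gm]) simp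
  have "integrable (lebesgue_on \<Omega>) (\<lambda>x. (g x)\<^sup>2)"
    using g gm by (subst integral_lebesgue_on_borel(2)) (auto simp: sq_integrable_def)
  then have "g \<in> sq_integrable (lebesgue_on \<Omega>)" using gl by (simp add: sq_integrable_def)
  then show ?thesis by (rule sq_integrable_cong_AE[OF _ f]) (use g(3) in \<open>auto elim: eventually_mono\<close>)
qed

lemma brep_exists:
  assumes f: "f \<in> sq_integrable (lebesgue_on \<Omega>)"
  obtains g where "brep \<Omega> f g"
proof -
  have "(\<lambda>x. indicator \<Omega> x *\<^sub>R f x) \<in> borel_measurable lebesgue"
    using sq_integrable_measurable[OF f] unfolding borel_measurable_restrict_space_iff[OF \<Omega>_leb] .
  then obtain g' where g': "g' \<in> borel_measurable lborel" "AE x in lborel. indicator \<Omega> x *\<^sub>R f x = g' x"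
    using completion_ex_borel_measurable_real by blast
  define g where "g x = indicator \<Omega> x * g' x" for x
  have gm: "g \<in> borel_measurable borel" using g'(1) \<Omega> unfolding g_def by (intro borel_measurable_times) auto
  have g0: "\<And>x. x \<notin> \<Omega> \<Longrightarrow> g x = 0" by (simp add: g_def)
  have ae: "AE x in lebesgue_on \<Omega>. f x = g x"
    unfolding AE_lebesgue_on[OF \<Omega>] using g'(2) by eventually_elim (auto simp: g_def)
  have gl: "g \<in> borel_measurable (lebesgue_on \<Omega>)" by (rule lebesgue_on_measurable_AE[OF gm]) simp
  have "g \<in> sq_integrable (lebesgue_on \<Omega>)" by (rule sq_integrable_cong_AE[OF f gl ae])
  then have "integrable lborel (\<lambda>x. (g x)\<^sup>2)"
    using gm g0 by (subst integral_lebesgue_on_borel(2)[symmetric]) (auto simp: sq_integrable_def)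
  then have "brep \<Omega> f g" using gm g0 ae by (auto simp: brep_def sq_integrable_def)
  then show ?thesis using that by blast
qed

lemma integral_brep:
  assumes "brep \<Omega> f g" and h: "h \<in> borel_measurable borel"
  shows "(\<integral>x. f x * h x \<partial>lebesgue_on \<Omega>) = (\<integral>x. g x * h x \<partial>lborel)"
proof -
  have g: "g \<in> SI" "\<And>x. x \<notin> \<Omega> \<Longrightarrow> g x = 0" "AE x in lebesgue_on \<Omega>. f x = g x"
    using assms by (auto simp: brep_def)
  have gm: "g \<in> borel_measurable borel" using g by (simp add: sq_integrable_def)
  have m: "f \<in> borel_measurable (lebesgue_on \<Omega>)" "g \<in> borel_measurable (lebesgue_on \<Omega>)"
     "h \<in> borel_measurable (lebesgue_on \<Omega>)"
    by (rule lebesgue_on_measurable_AE[OF gm g(3)] lebesgue_on_measurable_AE[OF gm] lebesgue_on_measurable_AE[OF h]; simp)+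
  have "(\<integral>x. f x * h x \<partial>lebesgue_on \<Omega>) = (\<integral>x. g x * h x \<partial>lebesgue_on \<Omega>)"
    using m g(3) by (intro integral_cong_AE) (auto elim: eventually_mono)
  also have "\<dots> = (\<integral>x. g x * h x \<partial>lborel)"
    using gm h g(2) by (intro integral_lebesgue_on_borel) auto
  finally show ?thesis .
qed

lemma integral_brep2:
  assumes fg: "brep \<Omega> f g" and fg': "brep \<Omega> f' g'"
  shows "(\<integral>x. f x * f' x \<partial>lebesgue_on \<Omega>) = (\<integral>x. g x * g' x \<partial>lborel)"
proof -
  have g': "g' \<in> borel_measurable borel" using fg' by (simp add: brep_def sq_integrable_def)
  have m: "f \<in> borel_measurable (lebesgue_on \<Omega>)" "f' \<in> borel_measurable (lebesgue_on \<Omega>)"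
    using brep_sq[OF fg] brep_sq[OF fg'] by (auto simp: sq_integrable_def)
  have "g' \<in> borel_measurable (lebesgue_on \<Omega>)" by (rule lebesgue_on_measurable_AE[OF g']) simp
  then have "(\<integral>x. f x * f' x \<partial>lebesgue_on \<Omega>) = (\<integral>x. f x * g' x \<partial>lebesgue_on \<Omega>)"
    using m fg' by (intro integral_cong_AE) (auto simp: brep_def elim: eventually_mono)
  then show ?thesis using integral_brep[OF fg g'] by simp
qed

end

lemma brep_sq_lborel: "brep \<Omega> f g \<Longrightarrow> g \<in> SI"
  by (simp add: brep_def)

section \<open>Weak derivatives on an interval\<close>

lemma test_functions_lin:
  assumes "\<phi> \<in> test_functions b" "\<psi> \<in> test_functions b"
  shows "(\<lambda>x. \<phi> x + c * \<psi> x) \<in> test_functions b"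
proof -
  obtain a d where 1: "0 < a" "d < b" "\<And>x. x \<notin> {a..d} \<Longrightarrow> \<phi> x = 0" using assms(1) by (auto simp: test_functions_alt)
  obtain a' d' where 2: "0 < a'" "d' < b" "\<And>x. x \<notin> {a'..d'} \<Longrightarrow> \<psi> x = 0" using assms(2) by (auto simp: test_functions_alt)
  have "smooth (\<lambda>x. \<phi> x + c * \<psi> x)"
    using assms by (intro smooth_add smooth_mult smooth_const) (auto simp: test_functions_alt)
  moreover have "\<forall>x. x \<notin> {min a a'..max d d'} \<longrightarrow> \<phi> x + c * \<psi> x = 0"
  proof (intro allI impI)
    fix x assume "x \<notin> {min a a'..max d d'}"
    then have "x \<notin> {a..d}" "x \<notin> {a'..d'}" by auto
    then show "\<phi> x + c * \<psi> x = 0" using 1(3) 2(3) by simp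
  qed
  moreover have "0 < min a a'" "max d d' < b" using 1 2 by auto
  ultimately show ?thesis unfolding test_functions_alt by blast
qed

text \<open>Mean zero is what makes the primitive vanish again to the right of the support.\<close>

lemma antiderivative_test_function:
  assumes h: "h \<in> test_functions b" and z: "(\<integral>x. h x \<partial>lborel) = 0"
  shows "\<exists>H\<in>test_functions b. deriv H = h"
proof -
  obtain c d where cd: "0 < c" "d < b" "\<And>x. x \<notin> {c..d} \<Longrightarrow> h x = 0" using h by (auto simp: test_functions_alt)
  \<comment> \<open>The point -1 lies to the left of the support, so the primitive is zero before
    the support and a neighbourhood of it lies in the range of the fundamental theorem.\<close>
  define H where "H x = integral {-1..x} h" for x
  have z0: "H x = 0" if "x < c" for x
  proof -
    have "H x = integral {-1..x} (\<lambda>x. 0)" unfolding H_def using that cd(3)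
      by (intro Henstock_Kurzweil_Integration.integral_cong) auto
    then show ?thesis by simp
  qed
  have der: "(H has_field_derivative h x) (at x)" for x
  proof (cases "x < c")
    case True
    have "((\<lambda>x. 0) has_field_derivative 0) (at x)" by simp
    then have "(H has_field_derivative 0) (at x)"
      by (rule has_field_derivative_transform_within_open[of _ _ _ "{..<c}"]) (use True z0 in auto)
    then show ?thesis using True cd by auto
  next
    case False
    have "((\<lambda>u. integral {-1..u} h) has_real_derivative h x) (at x within {-1..x + 1})"
      using False cd by (intro integral_has_real_derivative test_functions_continuous(1)[OF h]) auto
    moreover have "at x within {-1..x + 1} = at x"
      using False cd by (intro at_within_interior) auto
    ultimately show ?thesis by (simp add: H_def[abs_def])
  qed
  have z1: "H x = 0" if "d < x" for x
  proof -
    have "(h has_integral 0) UNIV" using has_integral_integral_lborel[OF test_functions_sq(3)[OF h]] z by simp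
    moreover have "h = (\<lambda>y. if y \<in> {-1..x} then h y else 0)" using cd that by force
    ultimately have "((\<lambda>y. if y \<in> {-1..x} then h y else 0) has_integral 0) UNIV" by simp
    then have "(h has_integral 0) {-1..x}" by (simp only: has_integral_restrict_UNIV)
    then show ?thesis by (simp add: H_def integral_unique)
  qed
  have "smooth H" using h by (intro smooth_if_derivative[OF der]) (auto simp: test_functions_alt)
  then have "H \<in> test_functions b" unfolding test_functions_alt using z0 z1 cd by (intro conjI exI[of _ c] exI[of _ d]) auto
  moreover have "deriv H = h" using der by (auto intro: DERIV_imp_deriv)
  ultimately show ?thesis by blast
qed

lemma indicator_sq: "(indicator {a<..<b} :: real \<Rightarrow> real) \<in> SI"
proof -
  have "(\<lambda>x. (indicator {a<..<b} x :: real)\<^sup>2) = indicator {a<..<b}" by (auto simp: indicator_def)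
  moreover have "integrable lborel (indicator {a<..<b} :: real \<Rightarrow> real)"
    by (intro integrable_real_indicator emeasure_lborel_Ioo_finite[unfolded infinity_ennreal_def[symmetric]]) auto
  ultimately show ?thesis by (simp add: sq_integrable_def)
qed

text \<open>Subtracting a multiple of one fixed bump gives any test function mean zero and thereby
  makes it the derivative of a test function. So \<open>f\<close> tested with \<phi> equals a
  constant times the mean of \<phi>.\<close>

lemma du_bois_reymond:
  assumes f: "f \<in> SI" and b: "0 < b"
    and z: "\<And>\<phi>. \<phi> \<in> test_functions b \<Longrightarrow> (\<integral>x. f x * deriv \<phi> x \<partial>lborel) = 0"
  shows "\<exists>c. AE x in lborel. x \<in> {0<..<b} \<longrightarrow> f x = c"
proof -
  define \<psi> where "\<psi> = bump (b / 3) (2 * b / 3) 1"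
  have \<psi>: "\<psi> \<in> test_functions b" unfolding \<psi>_def using b by (intro bump_test) auto
  define I where "I = (\<integral>x. \<psi> x \<partial>lborel)"
  have "I \<noteq> 0"
  proof
    assume "I = 0"
    then have "AE x in lborel. \<psi> x = 0"
      unfolding I_def using bump_bounds(1) test_functions_sq(3)[OF \<psi>]
      by (subst (asm) integral_nonneg_eq_0_iff_AE) (auto simp: \<psi>_def)
    then have "AE x in lborel. x \<notin> {b / 3<..<2 * b / 3}"
      by eventually_elim (auto simp: \<psi>_def bump_eq split: if_splits)
    then have "emeasure lborel {b / 3<..<2 * b / 3} = 0"
      by (subst (asm) AE_iff_null_sets[symmetric]) auto
    then show False using b by simp
  qed
  define c where "c = (\<integral>x. f x * \<psi> x \<partial>lborel) / I"
  have "(\<integral>x. (f x - c * indicator {0<..<b} x) * \<phi> x \<partial>lborel) = 0" if \<phi>: "\<phi> \<in> test_functions b" for \<phi>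
  proof -
    define K where "K = (\<integral>x. \<phi> x \<partial>lborel)"
    let ?h = "\<lambda>x. \<phi> x + (- K / I) * \<psi> x"
    have h: "?h \<in> test_functions b" by (rule test_functions_lin[OF \<phi> \<psi>])
    have "(\<integral>x. ?h x \<partial>lborel) = K + (- K / I) * I"
      unfolding K_def I_def using test_functions_sq(3)[OF \<phi>] test_functions_sq(3)[OF \<psi>]
      by (subst Bochner_Integration.integral_add) auto
    then have "(\<integral>x. ?h x \<partial>lborel) = 0" using \<open>I \<noteq> 0\<close> by simp
    then obtain H where H: "H \<in> test_functions b" "deriv H = ?h"
      using antiderivative_test_function[OF h] by blast
    note i = sq_integrable_product[OF f test_functions_sq(1)[OF \<phi>]] sq_integrable_product[OF f test_functions_sq(1)[OF \<psi>]]
    have "0 = (\<integral>x. f x * ?h x \<partial>lborel)" using z[OF H(1)] H(2) by simp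
    also have "\<dots> = (\<integral>x. f x * \<phi> x + (- K / I) * (f x * \<psi> x) \<partial>lborel)"
      by (intro Bochner_Integration.integral_cong) (auto simp: algebra_simps)
    also have "\<dots> = (\<integral>x. f x * \<phi> x \<partial>lborel) + (- K / I) * (\<integral>x. f x * \<psi> x \<partial>lborel)"
      using i by (subst Bochner_Integration.integral_add) auto
    finally have 1: "(\<integral>x. f x * \<phi> x \<partial>lborel) = c * K" using \<open>I \<noteq> 0\<close> by (simp add: c_def field_simps)
    have "(\<integral>x. (f x - c * indicator {0<..<b} x) * \<phi> x \<partial>lborel) = (\<integral>x. f x * \<phi> x - c * \<phi> x \<partial>lborel)"
    proof (intro Bochner_Integration.integral_cong refl)
      fix x
      have "indicator {0<..<b} x * \<phi> x = \<phi> x"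
        using test_functions_bounded[OF \<phi>] by (metis indicator_simps mult_1 mult_zero_left)
      then show "(f x - c * indicator {0<..<b} x) * \<phi> x = f x * \<phi> x - c * \<phi> x"
        by (simp add: left_diff_distrib mult.assoc)
    qed
    also have "\<dots> = (\<integral>x. f x * \<phi> x \<partial>lborel) - c * K"
      unfolding K_def using i test_functions_sq(3)[OF \<phi>] by simp
    finally show ?thesis using 1 by simp
  qed
  then have "AE x in lborel. x \<in> {0<..<b} \<longrightarrow> f x - c * indicator {0<..<b} x = 0"
    by (intro fundamental_lemma_variations sq_integrable_diff f sq_integrable_scale indicator_sq)
  then have "AE x in lborel. x \<in> {0<..<b} \<longrightarrow> f x = c" by eventually_elim auto
  then show ?thesis by blast
qed

lemma integral_deriv_test:
  assumes \<phi>: "\<phi> \<in> test_functions b" and b: "0 < b"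
  shows "(\<integral>x. kJ b x y * deriv \<phi> x \<partial>lborel) = - \<phi> y"
proof -
  have out: "\<phi> x = 0" if "x \<notin> {0<..<b}" for x using test_functions_bounded[OF \<phi>] that by metis
  show ?thesis
  proof (cases "0 < y \<and> y < b")
    case False
    then have "kJ b x y = 0" for x by (auto simp: kJ_def)
    then show ?thesis using out[of y] False by simp
  next
    case True
    have "(\<integral>x. kJ b x y * deriv \<phi> x \<partial>lborel) = (\<integral>x. deriv \<phi> x * indicator {y..b} x \<partial>lborel)"
    proof (rule integral_cong_AE)
      have "AE x in lborel. x \<noteq> y \<and> x \<noteq> b" using AE_lborel_singleton[of y] AE_lborel_singleton[of b] by auto
      then show "AE x in lborel. kJ b x y * deriv \<phi> x = deriv \<phi> x * indicator {y..b} x"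
        by eventually_elim (use True in \<open>auto simp: kJ_def indicator_def\<close>)
    qed (use kernel_measurable(3)[OF kernel_kJ[OF b]] test_functions_continuous(4)[OF \<phi>] in auto)
    also have "\<dots> = \<phi> b - \<phi> y"
      using True test_functions_continuous(5)[OF \<phi>] continuous_on_eq_continuous_at[OF open_UNIV, of "deriv \<phi>"]
        test_functions_continuous(2)[OF \<phi>, of UNIV]
      by (intro integral_FTC_Icc_real) auto
    finally show ?thesis using out[of b] by simp
  qed
qed

text \<open>Fubini moves the kernel to the smooth factor, where the classical fundamental theorem
  applies; \<open>g\<close> is only square integrable.\<close>

lemma primitive_by_parts:
  assumes g: "g \<in> SI" and \<phi>: "\<phi> \<in> test_functions b" and b: "0 < b"
  shows "(\<integral>x. (\<integral>y. kJ b x y * g y \<partial>lborel) * deriv \<phi> x \<partial>lborel) = - (\<integral>y. g y * \<phi> y \<partial>lborel)"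
  unfolding kernel_adjoint1[OF kernel_kJ[OF b] g test_functions_sq(2)[OF \<phi>]] integral_deriv_test[OF \<phi> b]
  by simp

lemma primitive_sq:
  assumes k: "kernel b M k" and g: "g \<in> SI"
  shows "(\<lambda>x. \<integral>y. k x y * g y \<partial>lborel) \<in> SI"
proof -
  have [measurable]: "(\<lambda>x. \<integral>y. k x y * g y \<partial>lborel) \<in> borel_measurable borel"
    using kernel_apply_measurable1[OF k] sq_integrable_measurable[OF g] by simp
  have "integrable lborel (\<lambda>x. M\<^sup>2 * b * (\<integral>y. (g y)\<^sup>2 \<partial>lborel) * indicator {0..b} x)"
    by (intro integrable_mult_right integrable_real_indicator) (auto simp: emeasure_lborel_Icc_eq)
  then have "integrable lborel (\<lambda>x. (\<integral>y. k x y * g y \<partial>lborel)\<^sup>2)"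
  proof (rule Bochner_Integration.integrable_bound)
    show "AE x in lborel. norm ((\<integral>y. k x y * g y \<partial>lborel)\<^sup>2)
        \<le> norm (M\<^sup>2 * b * (\<integral>y. (g y)\<^sup>2 \<partial>lborel) * indicator {0..b} x)"
    proof (rule AE_I2)
      fix x
      have "norm ((\<integral>y. k x y * g y \<partial>lborel)\<^sup>2) = (\<integral>y. k x y * g y \<partial>lborel)\<^sup>2" by simp
      also note kernel_apply_bound[OF k g, of x]
      also note abs_ge_self
      finally show "norm ((\<integral>y. k x y * g y \<partial>lborel)\<^sup>2) \<le> norm (M\<^sup>2 * b * (\<integral>y. (g y)\<^sup>2 \<partial>lborel) * indicator {0..b} x)"
        by simp
    qed
  qed simp
  then show ?thesis by (simp add: sq_integrable_def)
qed

lemma fundamental_theorem_weak: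
  assumes f: "f \<in> SI" and g: "g \<in> SI" and b: "0 < b"
    and w: "\<And>\<phi>. \<phi> \<in> test_functions b \<Longrightarrow> (\<integral>x. f x * deriv \<phi> x \<partial>lborel) = - (\<integral>x. g x * \<phi> x \<partial>lborel)"
  shows "\<exists>c. AE x in lborel. x \<in> {0<..<b} \<longrightarrow> f x = c + (\<integral>y. kJ b x y * g y \<partial>lborel)"
proof -
  let ?P = "\<lambda>x. \<integral>y. kJ b x y * g y \<partial>lborel"
  have P: "?P \<in> SI" by (rule primitive_sq[OF kernel_kJ[OF b] g])
  have "(\<integral>x. (f x - ?P x) * deriv \<phi> x \<partial>lborel) = 0" if \<phi>: "\<phi> \<in> test_functions b" for \<phi>
    using sq_integrable_product[OF f test_functions_sq(2)[OF \<phi>]] sq_integrable_product[OF P test_functions_sq(2)[OF \<phi>]]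
      primitive_by_parts[OF g \<phi> b] w[OF \<phi>] by (simp add: left_diff_distrib)
  then obtain c where "AE x in lborel. x \<in> {0<..<b} \<longrightarrow> f x - ?P x = c"
    using du_bois_reymond[OF sq_integrable_diff[OF f P] b] by blast
  then have "AE x in lborel. x \<in> {0<..<b} \<longrightarrow> f x = c + ?P x" by eventually_elim auto
  then show ?thesis by blast
qed

section \<open>The Dirichlet Green operator and its derivative\<close>

abbreviation "Kj b g \<equiv> (\<lambda>x. \<integral>y. kJ b x y * g y \<partial>lborel)"
abbreviation "Kd l g \<equiv> (\<lambda>x. \<integral>y. kD l x y * g y \<partial>lborel)"
abbreviation "Kg l g \<equiv> (\<lambda>x. \<integral>y. kG l x y * g y \<partial>lborel)"

lemma Kd_eq:
  assumes l: "0 < l" and g: "g \<in> SI" and x: "x \<in> {0<..<l}"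
  shows "Kd l g x = Kj l g x - (\<integral>y. indicator {0<..<l} y * ((l - y) / l) * g y \<partial>lborel)"
proof -
  let ?w = "\<lambda>y. indicator {0<..<l} y * ((l - y) / l)"
  have "kJ l x y - ?w y = kD l x y" for y
    using x by (auto simp: kJ_def kD_def indicator_def)
  moreover have i: "integrable lborel (\<lambda>y. kJ l x y * g y)" "integrable lborel (\<lambda>y. kD l x y * g y)"
    using kernel_integrable[OF kernel_kJ[OF l] g] kernel_integrable[OF kernel_kD[OF l] g] by auto
  ultimately have "integrable lborel (\<lambda>y. ?w y * g y)" "(\<integral>y. ?w y * g y \<partial>lborel) = Kj l g x - Kd l g x"
  proof -
    assume a: "\<And>y. kJ l x y - ?w y = kD l x y"
    have e: "?w y * g y = kJ l x y * g y - kD l x y * g y" for y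
      unfolding left_diff_distrib[symmetric] a[symmetric] by simp
    show "integrable lborel (\<lambda>y. ?w y * g y)" "(\<integral>y. ?w y * g y \<partial>lborel) = Kj l g x - Kd l g x"
      unfolding e using i by auto
  qed
  then show ?thesis by simp
qed

text \<open>Integrating \<open>kD\<close> in its first argument from 0 to x gives \<open>kG\<close>;
  Fubini transfers this identity of kernels to the operators.\<close>

lemma Kg_eq:
  assumes l: "0 < l" and g: "g \<in> SI" and x: "x \<in> {0<..<l}"
  shows "Kg l g x = Kj l (Kd l g) x"
proof -
  have kk: "(\<integral>z. kD l z y * kJ l x z \<partial>lborel) = kG l x y" for y
  proof (cases "0 < y \<and> y < l")
    case False
    then have "kD l z y = 0" "kG l x y = 0" for z by (auto simp: kD_def kG_def)
    then show ?thesis by simp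
  next
    case True
    have "kD l z y * kJ l x z = indicator {y<..<x} z - (l - y) / l * indicator {0<..<x} z" if "z \<noteq> y" for z
      using True x that by (auto simp: kD_def kJ_def indicator_def)
    then have "(\<integral>z. kD l z y * kJ l x z \<partial>lborel) = (\<integral>z. indicator {y<..<x} z - (l - y) / l * indicator {0<..<x} z \<partial>lborel)"
      using AE_lborel_singleton[of y] kernel_measurable(3)[OF kernel_kD[OF l], of y] kernel_measurable(2)[OF kernel_kJ[OF l], of x]
      by (intro integral_cong_AE) (auto elim!: eventually_mono)
    also have "\<dots> = measure lborel {y<..<x} - (l - y) / l * measure lborel {0<..<x}"
      using emeasure_lborel_Ioo_finite by (subst Bochner_Integration.integral_diff) auto
    also have "\<dots> = kG l x y" using True x by (auto simp: kG_def measure_def)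
    finally show ?thesis .
  qed
  have "Kj l (Kd l g) x = (\<integral>z. Kd l g z * kJ l x z \<partial>lborel)" by (simp add: mult.commute)
  also have "\<dots> = (\<integral>y. g y * (\<integral>z. kD l z y * kJ l x z \<partial>lborel) \<partial>lborel)"
    by (rule kernel_adjoint1[OF kernel_kD[OF l] g kernel_row[OF kernel_kJ[OF l]]])
  finally show ?thesis by (simp add: kk mult.commute)
qed

text \<open>On (0, l) the function differs from the primitive of \<open>g\<close> by a constant, and
  constants vanish against derivatives of test functions.\<close>

lemma Kd_weak:
  assumes l: "0 < l" and g: "g \<in> SI" and \<phi>: "\<phi> \<in> test_functions l"
  shows "(\<integral>x. Kd l g x * deriv \<phi> x \<partial>lborel) = - (\<integral>x. g x * \<phi> x \<partial>lborel)"
proof -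
  let ?c = "\<integral>y. indicator {0<..<l} y * ((l - y) / l) * g y \<partial>lborel"
  have out: "deriv \<phi> x = 0" if "x \<notin> {0<..<l}" for x using test_functions_bounded[OF \<phi>] that by metis
  have "(\<integral>x. Kd l g x * deriv \<phi> x \<partial>lborel) = (\<integral>x. Kj l g x * deriv \<phi> x - ?c * deriv \<phi> x \<partial>lborel)"
  proof (intro Bochner_Integration.integral_cong refl)
    fix x show "Kd l g x * deriv \<phi> x = Kj l g x * deriv \<phi> x - ?c * deriv \<phi> x"
    proof (cases "x \<in> {0<..<l}")
      case True
      show ?thesis unfolding Kd_eq[OF l g True] by (rule left_diff_distrib)
    qed (simp add: out)
  qed
  also have "\<dots> = (\<integral>x. Kj l g x * deriv \<phi> x \<partial>lborel) - ?c * (\<integral>x. deriv \<phi> x \<partial>lborel)"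
    using sq_integrable_product[OF primitive_sq[OF kernel_kJ[OF l] g] test_functions_sq(2)[OF \<phi>]] test_functions_sq(4)[OF \<phi>]
    by simp
  also have "(\<integral>x. deriv \<phi> x \<partial>lborel) = 0"
  proof -
    have "(\<integral>x. deriv \<phi> x \<partial>lborel) = (\<integral>x. deriv \<phi> x * indicator {0..l} x \<partial>lborel)"
    proof (intro Bochner_Integration.integral_cong refl)
      fix x show "deriv \<phi> x = deriv \<phi> x * indicator {0..l} x" using out[of x] by (cases "x \<in> {0<..<l}") auto
    qed
    also have "\<dots> = \<phi> l - \<phi> 0"
      using l test_functions_continuous(5)[OF \<phi>] continuous_on_eq_continuous_at[OF open_UNIV, of "deriv \<phi>"]
        test_functions_continuous(2)[OF \<phi>, of UNIV]
      by (intro integral_FTC_Icc_real) auto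
    also have "\<dots> = 0" using test_functions_bounded[OF \<phi>] by (metis diff_self greaterThanLessThan_iff order_less_irrefl)
    finally show ?thesis .
  qed
  finally show ?thesis using primitive_by_parts[OF g \<phi> l] by simp
qed

lemma Kg_weak:
  assumes l: "0 < l" and g: "g \<in> SI" and \<phi>: "\<phi> \<in> test_functions l"
  shows "(\<integral>x. Kg l g x * deriv \<phi> x \<partial>lborel) = - (\<integral>x. Kd l g x * \<phi> x \<partial>lborel)"
proof -
  have out: "deriv \<phi> x = 0" if "x \<notin> {0<..<l}" for x using test_functions_bounded[OF \<phi>] that by metis
  have "(\<integral>x. Kg l g x * deriv \<phi> x \<partial>lborel) = (\<integral>x. Kj l (Kd l g) x * deriv \<phi> x \<partial>lborel)"
  proof (intro Bochner_Integration.integral_cong refl)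
    fix x show "Kg l g x * deriv \<phi> x = Kj l (Kd l g) x * deriv \<phi> x"
    proof (cases "x \<in> {0<..<l}")
      case True
      show ?thesis unfolding Kg_eq[OF l g True] ..
    qed (simp add: out)
  qed
  then show ?thesis using primitive_by_parts[OF primitive_sq[OF kernel_kD[OF l] g] \<phi> l] by simp
qed

lemma kernel_continuous:
  assumes k: "kernel l M k" and g: "g \<in> SI" and C: "0 \<le> C"
    and mod: "\<And>x x'. x \<in> {0..l} \<Longrightarrow> x' \<in> {0..l} \<Longrightarrow> (\<integral>y. (k x y - k x' y)\<^sup>2 \<partial>lborel) \<le> C * \<bar>x - x'\<bar>"
  shows "continuous_on {0..l} (\<lambda>x. \<integral>y. k x y * g y \<partial>lborel)"
  unfolding continuous_on_iff
proof (intro ballI allI impI)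
  fix x e :: real assume x: "x \<in> {0..l}" and e: "0 < e"
  define N where "N = C * (\<integral>y. (g y)\<^sup>2 \<partial>lborel)"
  have N: "0 \<le> N" using C by (simp add: N_def)
  have "dist (\<integral>y. k x' y * g y \<partial>lborel) (\<integral>y. k x y * g y \<partial>lborel) < e"
    if x': "x' \<in> {0..l}" "dist x' x < e\<^sup>2 / (N + 1)" for x'
  proof -
    note r = kernel_row[OF k]
    have "(\<integral>y. k x' y * g y \<partial>lborel) - (\<integral>y. k x y * g y \<partial>lborel) = (\<integral>y. (k x' y - k x y) * g y \<partial>lborel)"
      using kernel_integrable[OF k g] by (simp add: left_diff_distrib)
    then have "((\<integral>y. k x' y * g y \<partial>lborel) - (\<integral>y. k x y * g y \<partial>lborel))\<^sup>2
        \<le> (\<integral>y. (k x' y - k x y)\<^sup>2 \<partial>lborel) * (\<integral>y. (g y)\<^sup>2 \<partial>lborel)"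
      using cauchy_schwarz_integral[OF sq_integrable_diff[OF r r] g] by simp
    also have "\<dots> \<le> C * \<bar>x' - x\<bar> * (\<integral>y. (g y)\<^sup>2 \<partial>lborel)"
      using mod[OF x'(1) x] by (intro mult_right_mono) auto
    also have "\<dots> = N * \<bar>x' - x\<bar>" by (simp add: N_def)
    also have "\<dots> \<le> (N + 1) * \<bar>x' - x\<bar>" by (intro mult_right_mono) auto
    also have "\<dots> < e\<^sup>2" using x'(2) N by (simp add: dist_real_def field_simps)
    finally have "\<bar>(\<integral>y. k x' y * g y \<partial>lborel) - (\<integral>y. k x y * g y \<partial>lborel)\<bar>\<^sup>2 < e\<^sup>2" by simp
    then show ?thesis unfolding dist_real_def by (rule power_less_imp_less_base) (use e in simp)
  qed
  moreover have "0 < e\<^sup>2 / (N + 1)" using e N by simp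
  ultimately show "\<exists>d>0. \<forall>x'\<in>{0..l}. dist x' x < d \<longrightarrow>
      dist (\<integral>y. k x' y * g y \<partial>lborel) (\<integral>y. k x y * g y \<partial>lborel) < e" by blast
qed

text \<open>The correction term of \<open>kD\<close> does not depend on x, so two rows differ by an
  indicator between x and x', up to sign. The resulting Hoelder exponent 1/2 later provides
  equicontinuity.\<close>

lemma kD_modulus:
  assumes l: "0 < l" and x: "x \<in> {0..l}" "x' \<in> {0..l}"
  shows "(\<integral>y. (kD l x y - kD l x' y)\<^sup>2 \<partial>lborel) \<le> \<bar>x - x'\<bar>"
proof -
  have "(\<integral>y. (kD l x y - kD l x' y)\<^sup>2 \<partial>lborel) \<le> (\<integral>y. indicator {min x x'..max x x'} y \<partial>lborel)"
  proof (rule integral_mono)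
    show "integrable lborel (\<lambda>y. (kD l x y - kD l x' y)\<^sup>2)"
      using sq_integrable_diff[OF kernel_row[OF kernel_kD[OF l]] kernel_row[OF kernel_kD[OF l]]] by (simp add: sq_integrable_def)
    show "integrable lborel (indicator {min x x'..max x x'} :: real \<Rightarrow> real)"
      by (intro integrable_real_indicator) (auto simp: emeasure_lborel_Icc_eq)
    show "(kD l x y - kD l x' y)\<^sup>2 \<le> indicator {min x x'..max x x'} y" for y
      using x by (auto simp: kD_def indicator_def)
  qed
  also have "\<dots> = \<bar>x - x'\<bar>" by (auto simp: min_def max_def)
  finally show ?thesis .
qed

lemma Kd_continuous:
  assumes l: "0 < l" and g: "g \<in> SI"
  shows "continuous_on {0..l} (Kd l g)"
  using kernel_continuous[OF kernel_kD[OF l] g, of 1] kD_modulus[OF l] by simp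

lemma Kg_continuous:
  assumes l: "0 < l" and g: "g \<in> SI"
  shows "continuous_on {0..l} (Kg l g)"
proof (rule kernel_continuous[OF kernel_kG[OF l] g, of "4 * l\<^sup>2"])
  fix x x' assume x: "x \<in> {0..l}" "x' \<in> {0..l}"
  have "(\<integral>y. (kG l x y - kG l x' y)\<^sup>2 \<partial>lborel) \<le> (\<integral>y. 4 * l * \<bar>x - x'\<bar> * indicator {0..l} y \<partial>lborel)"
  proof (rule integral_mono)
    show "integrable lborel (\<lambda>y. (kG l x y - kG l x' y)\<^sup>2)"
      using sq_integrable_diff[OF kernel_row[OF kernel_kG[OF l]] kernel_row[OF kernel_kG[OF l]]] by (simp add: sq_integrable_def)
    show "integrable lborel (\<lambda>y. 4 * l * \<bar>x - x'\<bar> * indicator {0..l} y)"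
      by (intro integrable_mult_right integrable_real_indicator) (auto simp: emeasure_lborel_Icc_eq)
    show "(kG l x y - kG l x' y)\<^sup>2 \<le> 4 * l * \<bar>x - x'\<bar> * indicator {0..l} y" for y
    proof (cases "0 < y \<and> y < l")
      case False
      then show ?thesis using l by (auto simp: kG_def)
    next
      case True
      define w where "w = (x - x') * ((l - y) / l)"
      have "\<bar>w\<bar> \<le> \<bar>x - x'\<bar> * 1"
        unfolding abs_mult w_def using True l by (intro mult_left_mono) (auto simp: field_simps)
      moreover have "kG l x y - kG l x' y = (if y < x then x - y else 0) - (if y < x' then x' - y else 0) - w"
        using True x by (simp add: kG_def w_def field_simps)
      ultimately have "\<bar>kG l x y - kG l x' y\<bar> \<le> 2 * \<bar>x - x'\<bar>" by (auto split: if_splits; smt (verit))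
      then have "\<bar>kG l x y - kG l x' y\<bar>\<^sup>2 \<le> (2 * \<bar>x - x'\<bar>)\<^sup>2" by (intro power_mono) auto
      also have "\<dots> = 4 * \<bar>x - x'\<bar> * \<bar>x - x'\<bar>" by (simp add: power2_eq_square)
      also have "\<dots> \<le> 4 * \<bar>x - x'\<bar> * l" using x by (intro mult_left_mono) auto
      finally show ?thesis using True by (simp add: mult_ac)
    qed
  qed
  also have "\<dots> = 4 * l\<^sup>2 * \<bar>x - x'\<bar>" using l by (simp add: power2_eq_square)
  finally show "(\<integral>y. (kG l x y - kG l x' y)\<^sup>2 \<partial>lborel) \<le> 4 * l\<^sup>2 * \<bar>x - x'\<bar>" .
qed simp

section \<open>Boundary values and normal forms\<close>

lemma continuous_AE_unique:
  fixes g h :: "real \<Rightarrow> real"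
  assumes g: "continuous_on {0..b} g" and h: "continuous_on {0..b} h" and b: "0 < b"
    and ae: "AE x in lborel. x \<in> {0<..<b} \<longrightarrow> g x = h x" and p: "p \<in> {0..b}"
  shows "g p = h p"
proof (rule ccontr)
  assume ne: "g p \<noteq> h p"
  have "continuous_on {0..b} (\<lambda>x. g x - h x)" by (intro continuous_intros g h)
  then obtain d where d: "0 < d" "\<And>x. x \<in> {0..b} \<Longrightarrow> dist x p < d \<Longrightarrow> dist (g x - h x) (g p - h p) < \<bar>g p - h p\<bar>"
    using ne p unfolding continuous_on_iff by (metis right_minus_eq zero_less_abs_iff)
  let ?U = "{max 0 (p - d)<..<min b (p + d)}"
  have "AE x in lborel. x \<notin> ?U" using ae
  proof eventually_elim
    case (elim x)
    show ?case
    proof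
      assume x: "x \<in> ?U"
      then have "g x = h x" "x \<in> {0..b}" "dist x p < d" using elim by (auto simp: dist_real_def)
      then show False using d(2)[of x] by (simp add: dist_real_def)
    qed
  qed
  then have "emeasure lborel ?U = 0" by (subst (asm) AE_iff_null_sets[symmetric]) auto
  moreover have lt: "max 0 (p - d) < min b (p + d)" using d(1) p b by auto
  then have "emeasure lborel ?U = ennreal (min b (p + d) - max 0 (p - d))" by (intro emeasure_lborel_Ioo) simp
  moreover have "0 < min b (p + d) - max 0 (p - d)" using lt by linarith
  ultimately show False by (metis ennreal_eq_0_iff not_le)
qed

text \<open>Evaluates the definite description as soon as one continuous representative is
  known.\<close>

lemma boundary_value_eq:
  assumes g: "continuous_on {0..b} g" and b: "0 < b" and ae: "AE x in interval b. g x = f x" and p: "p \<in> {0..b}"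
  shows "boundary_value b f p = g p"
  unfolding boundary_value_def
proof (rule the_equality)
  show "\<exists>g'. continuous_on {0..b} g' \<and> (AE x in interval b. g' x = f x) \<and> g' p = g p" using g ae by blast
  fix c assume "\<exists>g'. continuous_on {0..b} g' \<and> (AE x in interval b. g' x = f x) \<and> g' p = c"
  then obtain h where h: "continuous_on {0..b} h" "AE x in interval b. h x = f x" "h p = c" by blast
  have "AE x in interval b. h x = g x" using h(2) ae by eventually_elim simp
  then have "AE x in lborel. x \<in> {0<..<b} \<longrightarrow> h x = g x" by (subst (asm) AE_lebesgue_on) auto
  then show "c = g p" using continuous_AE_unique[OF h(1) g b _ p] h(3) by simp
qed

lemma Ioo_borel: "{0<..<b::real} \<in> sets borel" by simp

lemmas brep_exists1 = brep_exists[OF Ioo_borel]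

lemma has_weak_deriv_brep:
  assumes f: "brep {0<..<b} f g" and f1: "brep {0<..<b} f1 g1"
  shows "has_weak_deriv b f f1 \<longleftrightarrow>
    (\<forall>\<phi>\<in>test_functions b. (\<integral>x. g x * deriv \<phi> x \<partial>lborel) = - (\<integral>x. g1 x * \<phi> x \<partial>lborel))"
  unfolding has_weak_deriv_def
  using brep_sq[OF Ioo_borel f] brep_sq[OF Ioo_borel f1] integral_brep[OF Ioo_borel f]
    integral_brep[OF Ioo_borel f1] test_functions_continuous(3,4) by auto

lemma brep_cong:
  assumes "brep \<Omega> f g" "AE x in lebesgue_on \<Omega>. f x = f' x" shows "brep \<Omega> f' g"
proof -
  have "AE x in lebesgue_on \<Omega>. f' x = g x"
    using assms(2) assms(1)[unfolded brep_def, THEN conjunct2, THEN conjunct2] by eventually_elim simp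
  then show ?thesis using assms by (simp add: brep_def)
qed

lemma brep_unique:
  assumes "brep \<Omega> f g" "brep \<Omega> f g'" "\<Omega> \<in> sets borel" shows "AE x in lborel. g x = g' x"
proof -
  have "AE x in lebesgue_on \<Omega>. g x = g' x"
    using assms(1)[unfolded brep_def, THEN conjunct2, THEN conjunct2] assms(2)[unfolded brep_def, THEN conjunct2, THEN conjunct2]
    by eventually_elim simp
  then have "AE x in lborel. x \<in> \<Omega> \<longrightarrow> g x = g' x" using assms(3) by (simp add: AE_lebesgue_on)
  then show ?thesis using assms(1,2) by (auto simp: brep_def elim!: eventually_mono)
qed

lemma has_weak_deriv_cong:
  assumes w: "has_weak_deriv b f f1" and "AE x in interval b. f x = f' x" "AE x in interval b. f1 x = f1' x"
  shows "has_weak_deriv b f' f1'"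
proof -
  obtain g where g: "brep {0<..<b} f g" using w brep_exists1 unfolding has_weak_deriv_def by blast
  obtain g1 where g1: "brep {0<..<b} f1 g1" using w brep_exists1 unfolding has_weak_deriv_def by blast
  show ?thesis using w has_weak_deriv_brep[OF g g1] has_weak_deriv_brep[OF brep_cong[OF g assms(2)] brep_cong[OF g1 assms(3)]] by simp
qed

lemma has_weak_deriv_unique:
  assumes w: "has_weak_deriv b f f1" "has_weak_deriv b f f2"
  shows "AE x in interval b. f1 x = f2 x"
proof -
  obtain g where g: "brep {0<..<b} f g" using w(1) brep_exists1 unfolding has_weak_deriv_def by blast
  obtain g1 where g1: "brep {0<..<b} f1 g1" using w(1) brep_exists1 unfolding has_weak_deriv_def by blast
  obtain g2 where g2: "brep {0<..<b} f2 g2" using w(2) brep_exists1 unfolding has_weak_deriv_def by blast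
  note s = brep_sq_lborel[OF g1] brep_sq_lborel[OF g2]
  have "(\<integral>x. (g1 x - g2 x) * \<phi> x \<partial>lborel) = 0" if \<phi>: "\<phi> \<in> test_functions b" for \<phi>
  proof -
    have "(\<integral>x. g1 x * \<phi> x \<partial>lborel) = (\<integral>x. g2 x * \<phi> x \<partial>lborel)"
      using w[unfolded has_weak_deriv_brep[OF g g1] has_weak_deriv_brep[OF g g2]] \<phi> by simp
    then show ?thesis
      using sq_integrable_product[OF s(1) test_functions_sq(1)[OF \<phi>]] sq_integrable_product[OF s(2) test_functions_sq(1)[OF \<phi>]]
      by (simp add: left_diff_distrib)
  qed
  then have "AE x in lborel. x \<in> {0<..<b} \<longrightarrow> g1 x - g2 x = 0"
    by (intro fundamental_lemma_variations sq_integrable_diff s)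
  then have "AE x in interval b. g1 x = g2 x" by (simp add: AE_lebesgue_on)
  moreover have "AE x in interval b. f1 x = g1 x" "AE x in interval b. f2 x = g2 x" using g1 g2 by (auto simp: brep_def)
  ultimately show ?thesis by eventually_elim simp
qed

lemma brep_restrict:
  assumes h: "h \<in> SI" and \<Omega>: "\<Omega> \<in> sets borel"
  shows "brep \<Omega> h (\<lambda>x. indicator \<Omega> x * h x)"
proof -
  have "(\<lambda>x. indicator \<Omega> x * h x) \<in> SI"
    by (rule sq_integrable_bound[OF h, of _ 1])
      (use \<Omega> sq_integrable_measurable[OF h] in \<open>auto simp: indicator_def intro!: borel_measurable_times\<close>)
  then show ?thesis using \<Omega> by (auto simp: brep_def AE_lebesgue_on)
qed

lemma integral_indicator_test:
  assumes \<phi>: "\<phi> \<in> test_functions b"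
  shows "(\<integral>x. indicator {0<..<b} x * h x * \<phi> x \<partial>lborel) = (\<integral>x. h x * \<phi> x \<partial>lborel)"
    "(\<integral>x. indicator {0<..<b} x * h x * deriv \<phi> x \<partial>lborel) = (\<integral>x. h x * deriv \<phi> x \<partial>lborel)"
proof -
  obtain C where out: "\<And>x. x \<notin> {0<..<b} \<Longrightarrow> \<phi> x = 0" "\<And>x. x \<notin> {0<..<b} \<Longrightarrow> deriv \<phi> x = 0"
    using test_functions_bounded[OF \<phi>] by metis
  show "(\<integral>x. indicator {0<..<b} x * h x * \<phi> x \<partial>lborel) = (\<integral>x. h x * \<phi> x \<partial>lborel)"
  proof (intro Bochner_Integration.integral_cong refl)
    fix x show "indicator {0<..<b} x * h x * \<phi> x = h x * \<phi> x" using out(1)[of x] by (cases "x \<in> {0<..<b}") auto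
  qed
  show "(\<integral>x. indicator {0<..<b} x * h x * deriv \<phi> x \<partial>lborel) = (\<integral>x. h x * deriv \<phi> x \<partial>lborel)"
  proof (intro Bochner_Integration.integral_cong refl)
    fix x show "indicator {0<..<b} x * h x * deriv \<phi> x = h x * deriv \<phi> x" using out(2)[of x] by (cases "x \<in> {0<..<b}") auto
  qed
qed

lemma has_weak_deriv_lborel:
  assumes "f \<in> SI" "f1 \<in> SI"
    and "\<And>\<phi>. \<phi> \<in> test_functions b \<Longrightarrow> (\<integral>x. f x * deriv \<phi> x \<partial>lborel) = - (\<integral>x. f1 x * \<phi> x \<partial>lborel)"
  shows "has_weak_deriv b f f1"
  unfolding has_weak_deriv_brep[OF brep_restrict[OF assms(1) Ioo_borel] brep_restrict[OF assms(2) Ioo_borel]]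
  using assms(3) by (simp add: integral_indicator_test)

lemma has_weak_deriv_Kd_Kg:
  assumes l: "0 < l" and g: "g \<in> SI"
  shows "has_weak_deriv l (Kd l g) g" "has_weak_deriv l (Kg l g) (Kd l g)"
  by (intro has_weak_deriv_lborel primitive_sq[OF kernel_kD[OF l]] primitive_sq[OF kernel_kG[OF l]] g Kd_weak Kg_weak l; assumption)+

lemma V2_cong:
  assumes "f \<in> V2 b" and ae: "AE x in interval b. f x = f' x" shows "f' \<in> V2 b"
proof -
  have "(AE x in interval b. g x = f x) \<longleftrightarrow> (AE x in interval b. g x = f' x)" for g
    using ae by (auto elim: eventually_elim2)
  then have "boundary_value b f' = boundary_value b f" by (auto simp: boundary_value_def fun_eq_iff)
  moreover have "f' \<in> H2 b" using assms has_weak_deriv_cong[OF _ ae, of _] unfolding V2_def H2_def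
    by (auto intro: AE_I2)
  ultimately show ?thesis using assms by (simp add: V2_def)
qed

lemma V2_Kg:
  assumes l: "0 < l" and g: "g \<in> SI"
  shows "Kg l g \<in> V2 l"
proof -
  have "Kg l g \<in> H2 l" using has_weak_deriv_Kd_Kg[OF l g] by (auto simp: H2_def)
  moreover have "boundary_value l (Kg l g) p = Kg l g p" if "p \<in> {0..l}" for p
    using that by (intro boundary_value_eq Kg_continuous[OF l g] l) auto
  moreover have "kG l 0 y = 0" "kG l l y = 0" for y using l by (auto simp: kG_def)
  ultimately show ?thesis using l by (simp add: V2_def)
qed

text \<open>The second derivative determines a function up to an affine one, and the two boundary
  values determine the affine part. Thus \<open>V2\<close> is the range of the Green
  operator.\<close>

lemma V2_normal_form:
  assumes f: "f \<in> V2 l" and w: "has_weak_deriv l f f1" "has_weak_deriv l f1 f2" and g: "brep {0<..<l} f2 g" and l: "0 < l"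
  shows "AE x in interval l. f1 x = Kd l g x" "AE x in interval l. f x = Kg l g x"
proof -
  note gs = brep_sq_lborel[OF g]
  obtain F where F: "brep {0<..<l} f F" using w(1) brep_exists1 unfolding has_weak_deriv_def by blast
  obtain F1 where F1: "brep {0<..<l} f1 F1" using w(1) brep_exists1 unfolding has_weak_deriv_def by blast
  obtain c where "AE x in lborel. x \<in> {0<..<l} \<longrightarrow> F1 x = c + Kj l g x"
    using fundamental_theorem_weak[OF brep_sq_lborel[OF F1] gs l] w(2) has_weak_deriv_brep[OF F1 g] by blast
  then have "AE x in lborel. x \<in> {0<..<l} \<longrightarrow>
      F1 x = c + (\<integral>y. indicator {0<..<l} y * ((l - y) / l) * g y \<partial>lborel) + Kd l g x"
    by eventually_elim (simp add: Kd_eq[OF l gs])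
  then obtain m where m: "AE x in lborel. x \<in> {0<..<l} \<longrightarrow> F1 x = m + Kd l g x" by blast
  obtain d where d: "AE x in lborel. x \<in> {0<..<l} \<longrightarrow> F x = d + Kj l F1 x"
    using fundamental_theorem_weak[OF brep_sq_lborel[OF F] brep_sq_lborel[OF F1] l] w(1) has_weak_deriv_brep[OF F F1] by blast
  have Kd_sq: "Kd l g \<in> SI" by (rule primitive_sq[OF kernel_kD[OF l] gs])
  have J1: "Kj l F1 x = m * x + Kg l g x" if x: "x \<in> {0<..<l}" for x
  proof -
    have "Kj l F1 x = (\<integral>y. m * indicator {0<..<x} y + kJ l x y * Kd l g y \<partial>lborel)"
    proof (rule integral_cong_AE)
      show "AE y in lborel. kJ l x y * F1 y = m * indicator {0<..<x} y + kJ l x y * Kd l g y"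
        using m by eventually_elim (use x in \<open>auto simp: kJ_def indicator_def\<close>)
    qed (use kernel_measurable(2)[OF kernel_kJ[OF l], of x] sq_integrable_measurable[OF brep_sq_lborel[OF F1]]
        sq_integrable_measurable[OF Kd_sq] in auto)
    also have "\<dots> = m * x + Kj l (Kd l g) x"
      using x kernel_integrable[OF kernel_kJ[OF l] Kd_sq, of x] emeasure_lborel_Ioo_finite
      by (subst Bochner_Integration.integral_add) auto
    finally show ?thesis using Kg_eq[OF l gs x] by simp
  qed
  have Fx: "AE x in lborel. x \<in> {0<..<l} \<longrightarrow> F x = d + m * x + Kg l g x"
    using d by eventually_elim (simp add: J1)
  have bv: "boundary_value l f p = d + m * p + Kg l g p" if "p \<in> {0..l}" for p
  proof (rule boundary_value_eq[of l "\<lambda>x. d + m * x + Kg l g x"])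
    show "continuous_on {0..l} (\<lambda>x. d + m * x + Kg l g x)" by (intro continuous_intros Kg_continuous[OF l gs])
    have "AE x in interval l. F x = d + m * x + Kg l g x" using Fx by (simp add: AE_lebesgue_on)
    moreover have "AE x in interval l. f x = F x" using F by (simp add: brep_def)
    ultimately show "AE x in interval l. d + m * x + Kg l g x = f x" by eventually_elim simp
  qed (use l that in auto)
  \<comment> \<open>The Green part vanishes at both ends, so the boundary conditions speak about the
    affine part d + m x only.\<close>
  have z: "kG l 0 y = 0" "kG l l y = 0" for y using l by (auto simp: kG_def)
  have "d = 0" using bv[of 0] f l by (simp add: V2_def z)
  moreover have "m = 0" using bv[of l] f l \<open>d = 0\<close> by (simp add: V2_def z)
  ultimately have "AE x in interval l. F x = Kg l g x" "AE x in interval l. F1 x = Kd l g x"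
    using Fx m by (simp_all add: AE_lebesgue_on)
  moreover have "AE x in interval l. f x = F x" "AE x in interval l. f1 x = F1 x" using F F1 by (auto simp: brep_def)
  ultimately show "AE x in interval l. f1 x = Kd l g x" "AE x in interval l. f x = Kg l g x"
    by (auto elim: eventually_elim2)
qed

section \<open>Functions on the cylinder as elements of the Hilbert space\<close>

definition Om :: "real \<Rightarrow> real \<Rightarrow> (real \<times> real) set" where "Om l T = {0<..<l} \<times> {0<..<T}"

lemma Om_borel: "Om l T \<in> sets borel"
  unfolding Om_def by (intro borel_open open_Times) auto

lemma cylinder_Om: "cylinder l T = lebesgue_on (Om l T)" by (simp add: Om_def)

lemma AE_cylinder: "(AE p in cylinder l T. P p) \<longleftrightarrow> (AE p in lborel. p \<in> Om l T \<longrightarrow> P p)"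
  unfolding cylinder_Om by (rule AE_lebesgue_on[OF Om_borel])

lemma brep_AE: "brep (Om l T) f g \<Longrightarrow> AE p in cylinder l T. f p = g p"
  unfolding cylinder_Om brep_def by blast

lemma indicator_Om: "indicator (Om l T) (x, t) = indicator {0<..<l} x * (indicator {0<..<T} t :: real)"
  by (simp add: Om_def indicator_times)

lemma AE_fst: assumes "AE x in lborel. P x" shows "AE p in (lborel :: (real \<times> real) measure). P (fst p)"
proof -
  obtain N where N: "N \<in> null_sets (lborel :: real measure)" "{p. \<not> P p} \<subseteq> N"
    using assms by (auto elim!: AE_E simp: null_sets_def)
  have "{p::real \<times> real. fst p \<notin> N} \<in> sets borel"
  proof -
    have "(fst :: real \<times> real \<Rightarrow> real) \<in> borel \<rightarrow>\<^sub>M borel"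
      by (intro borel_measurable_continuous_onI continuous_intros)
    from measurable_sets[OF this, of "- N"] N show ?thesis by (auto simp: vimage_def)
  qed
  then have "AE p in (lborel :: (real \<times> real) measure). fst p \<notin> N"
    using AE_not_in[OF N(1)] by (intro AE_lborel2I) auto
  then show ?thesis by eventually_elim (use N(2) in auto)
qed

text \<open>The choice is harmless: two Borel modifications agree almost everywhere and give the
  same element of \<open>l2\<close>.\<close>

definition emb :: "real \<Rightarrow> real \<Rightarrow> (real \<times> real \<Rightarrow> real) \<Rightarrow> l2" where
  "emb l T f = mk (SOME g. brep (Om l T) f g)"

lemma emb_eq: assumes "brep (Om l T) f g" shows "emb l T f = mk g"
proof -
  have "brep (Om l T) f (SOME g. brep (Om l T) f g)"
    by (rule someI[where P = "\<lambda>g. brep (Om l T) f g"]) (rule assms)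
  from brep_unique[OF this assms Om_borel] show ?thesis
    unfolding emb_def using \<open>brep (Om l T) f (SOME g. brep (Om l T) f g)\<close> assms
    by (subst mk_eq_iff) (auto dest: brep_sq_lborel)
qed

lemma emb_obtain:
  assumes "f \<in> sq_integrable (cylinder l T)"
  obtains g where "brep (Om l T) f g" "emb l T f = mk g" "g \<in> SI"
  using brep_exists[OF Om_borel assms[unfolded cylinder_Om]] emb_eq brep_sq_lborel by metis

lemma brep_self: "h \<in> SI \<Longrightarrow> (\<And>p. p \<notin> Om l T \<Longrightarrow> h p = 0) \<Longrightarrow> brep (Om l T) h h"
  by (simp add: brep_def)

lemma emb_eq_iff:
  assumes f: "f \<in> sq_integrable (cylinder l T)" and f': "f' \<in> sq_integrable (cylinder l T)"
  shows "emb l T f = emb l T f' \<longleftrightarrow> (AE p in cylinder l T. f p = f' p)"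
proof -
  obtain g where g: "brep (Om l T) f g" "emb l T f = mk g" "g \<in> SI" using emb_obtain[OF f] by blast
  obtain g' where g': "brep (Om l T) f' g'" "emb l T f' = mk g'" "g' \<in> SI" using emb_obtain[OF f'] by blast
  show ?thesis
  proof
    assume "emb l T f = emb l T f'"
    then have "AE p in lborel. g p = g' p" using g g' by (simp add: mk_eq_iff)
    then have "AE p in cylinder l T. g p = g' p" unfolding cylinder_Om AE_lebesgue_on[OF Om_borel] by eventually_elim simp
    moreover have "AE p in cylinder l T. f p = g p" "AE p in cylinder l T. f' p = g' p"
      using g(1) g'(1) by (auto intro: brep_AE)
    ultimately show "AE p in cylinder l T. f p = f' p" by eventually_elim simp
  next
    assume "AE p in cylinder l T. f p = f' p"
    then have "brep (Om l T) f' g" unfolding cylinder_Om by (rule brep_cong[OF g(1)])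
    then show "emb l T f = emb l T f'" using g(2) emb_eq by simp
  qed
qed

lemma brep_sections:
  assumes "brep (Om l T) f g"
  shows "AE t in interval T. brep {0<..<l} (\<lambda>x. f (x, t)) (\<lambda>x. g (x, t))"
    and "AE x in interval l. brep {0<..<T} (\<lambda>t. f (x, t)) (\<lambda>t. g (x, t))"
proof -
  have g: "g \<in> SI" "\<And>p. p \<notin> Om l T \<Longrightarrow> g p = 0" "AE p in lborel. p \<in> Om l T \<longrightarrow> f p = g p"
    using assms by (auto simp: brep_def AE_lebesgue_on[OF Om_borel])
  show "AE t in interval T. brep {0<..<l} (\<lambda>x. f (x, t)) (\<lambda>x. g (x, t))"
    unfolding AE_lebesgue_on[OF Ioo_borel] using AE_lborel2(2)[OF g(3)] SI_sections(1)[OF g(1)]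
    by eventually_elim (use g(2) in \<open>auto simp: brep_def AE_lebesgue_on[OF Ioo_borel] Om_def\<close>)
  show "AE x in interval l. brep {0<..<T} (\<lambda>t. f (x, t)) (\<lambda>t. g (x, t))"
    unfolding AE_lebesgue_on[OF Ioo_borel] using AE_lborel2(1)[OF g(3)] SI_sections(2)[OF g(1)]
    by eventually_elim (use g(2) in \<open>auto simp: brep_def AE_lebesgue_on[OF Ioo_borel] Om_def\<close>)
qed

lemma AE_cylinder_sections:
  assumes "AE p in cylinder l T. P p"
  shows "AE t in interval T. AE x in interval l. P (x, t)" "AE x in interval l. AE t in interval T. P (x, t)"
proof -
  have a: "AE p in lborel. p \<in> Om l T \<longrightarrow> P p" using assms unfolding AE_cylinder .
  show "AE t in interval T. AE x in interval l. P (x, t)"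
    unfolding AE_lebesgue_on[OF Ioo_borel] using AE_lborel2(2)[OF a] by eventually_elim (auto simp: Om_def elim!: eventually_mono)
  show "AE x in interval l. AE t in interval T. P (x, t)"
    unfolding AE_lebesgue_on[OF Ioo_borel] using AE_lborel2(1)[OF a] by eventually_elim (auto simp: Om_def elim!: eventually_mono)
qed

lemma borel_coefficient:
  assumes m: "m \<in> Linf (interval l)" and ae: "AE x in interval l. c \<le> m x \<and> m x \<le> d"
  obtains mb where "bounded_borel mb" "\<And>x. c \<le> mb x" "AE x in interval l. m x = mb x"
proof -
  have "(\<lambda>x. indicator {0<..<l} x *\<^sub>R m x) \<in> borel_measurable lebesgue"
    using m by (simp add: Linf_def borel_measurable_restrict_space_iff del: real_scaleR_def)
  then obtain m' where m': "m' \<in> borel_measurable lborel" "AE x in lborel. indicator {0<..<l} x *\<^sub>R m x = m' x"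
    using completion_ex_borel_measurable_real by blast
  define mb where "mb x = max c (min d (m' x))" for x
  have "mb \<in> borel_measurable borel" using m'(1) unfolding mb_def by simp
  moreover have "\<bar>mb x\<bar> \<le> max \<bar>c\<bar> \<bar>d\<bar>" for x by (auto simp: mb_def)
  ultimately have "bounded_borel mb" by (auto simp: bounded_borel_def)
  moreover have "AE x in interval l. m x = mb x"
    using ae m'(2) unfolding AE_lebesgue_on[OF Ioo_borel] by eventually_elim (auto simp: mb_def)
  ultimately show ?thesis using that[of mb] by (simp add: mb_def)
qed

lemma integral_cylinder_coefficient:
  assumes m: "bounded_borel mb" "AE x in interval l. m x = mb x"
    and f: "f \<in> sq_integrable (cylinder l T)" and f': "f' \<in> sq_integrable (cylinder l T)"
  shows "(\<integral>p. m (fst p) * f p * f' p \<partial>cylinder l T) = inner (mulx mb (emb l T f)) (emb l T f')"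
    "integrable (cylinder l T) (\<lambda>p. m (fst p) * f p * f' p)"
proof -
  obtain g where g: "brep (Om l T) f g" "emb l T f = mk g" "g \<in> SI" using emb_obtain[OF f] by blast
  obtain g' where g': "brep (Om l T) f' g'" "emb l T f' = mk g'" "g' \<in> SI" using emb_obtain[OF f'] by blast
  have "AE x in lborel. x \<in> {0<..<l} \<longrightarrow> m x = mb x" using m(2) by (simp add: AE_lebesgue_on[OF Ioo_borel])
  from AE_fst[OF this] have "AE p in cylinder l T. m (fst p) = mb (fst p)"
    unfolding cylinder_Om AE_lebesgue_on[OF Om_borel] by eventually_elim (auto simp: Om_def)
  moreover have "AE p in cylinder l T. f p = g p" by (rule brep_AE[OF g(1)])
  ultimately have ae: "AE p in lebesgue_on (Om l T). mb (fst p) * g p = m (fst p) * f p"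
    unfolding cylinder_Om by eventually_elim simp
  have self: "brep (Om l T) (\<lambda>p. mb (fst p) * g p) (\<lambda>p. mb (fst p) * g p)"
    using g by (intro brep_self mulx_SI m) (auto simp: brep_def)
  note b = brep_cong[OF self ae]
  show "(\<integral>p. m (fst p) * f p * f' p \<partial>cylinder l T) = inner (mulx mb (emb l T f)) (emb l T f')"
    unfolding cylinder_Om integral_brep2[OF Om_borel b g'(1)] using g g' m by (simp add: inner_mulx)
  show "integrable (cylinder l T) (\<lambda>p. m (fst p) * f p * f' p)"
    using brep_sq[OF Om_borel b] f' unfolding cylinder_Om by (intro sq_integrable_product)
qed

lemma integral_cylinder:
  assumes f: "f \<in> sq_integrable (cylinder l T)" and f': "f' \<in> sq_integrable (cylinder l T)"
  shows "(\<integral>p. f p * f' p \<partial>cylinder l T) = inner (emb l T f) (emb l T f')"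
proof -
  obtain g where g: "brep (Om l T) f g" "emb l T f = mk g" "g \<in> SI" using emb_obtain[OF f] by blast
  obtain g' where g': "brep (Om l T) f' g'" "emb l T f' = mk g'" "g' \<in> SI" using emb_obtain[OF f'] by blast
  show ?thesis unfolding cylinder_Om integral_brep2[OF Om_borel g(1) g'(1)] using g g' by (simp add: inner_mk)
qed

text \<open>Orthogonal projection onto functions supported in the cylinder. It commutes with all
  operators of the problem, so solutions found on the plane can be cut down to the cylinder.\<close>

definition X :: "real \<Rightarrow> real \<Rightarrow> l2 \<Rightarrow> l2" where
  "X l T q = mk (\<lambda>p. indicator (Om l T) p * rep q p)"

lemma cut_SI: assumes f: "f \<in> SI" shows "(\<lambda>p. indicator (Om l T) p * f p) \<in> SI"
  using brep_restrict[OF f Om_borel] brep_sq_lborel by blast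

lemma X_mk: assumes f: "f \<in> SI" shows "X l T (mk f) = mk (\<lambda>p. indicator (Om l T) p * f p)"
  unfolding X_def using rep_mk[OF f]
  by (subst mk_eq_iff) (auto intro!: cut_SI f elim!: eventually_mono)

lemma X_emb: assumes f: "f \<in> sq_integrable (cylinder l T)" shows "X l T (emb l T f) = emb l T f"
proof -
  obtain g where g: "brep (Om l T) f g" "emb l T f = mk g" "g \<in> SI" using emb_obtain[OF f] by blast
  have "(\<lambda>p. indicator (Om l T) p * g p) = g" using g(1) by (auto simp: brep_def indicator_def fun_eq_iff)
  then show ?thesis using g by (simp add: X_mk)
qed

lemma X_obtain:
  obtains g where "g \<in> SI" "\<And>p. p \<notin> Om l T \<Longrightarrow> g p = 0" "X l T q = mk g" "brep (Om l T) g g" "emb l T g = X l T q"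
proof -
  let ?g = "\<lambda>p. indicator (Om l T) p * rep q p"
  have g: "?g \<in> SI" "\<And>p. p \<notin> Om l T \<Longrightarrow> ?g p = 0" by (auto intro: cut_SI)
  show ?thesis using that[OF g X_def brep_self[OF g]] emb_eq[OF brep_self[OF g]] X_def by simp
qed

lemma X_idem: "X l T (X l T q) = X l T q"
proof -
  obtain g where g: "g \<in> SI" "\<And>p. p \<notin> Om l T \<Longrightarrow> g p = 0" "X l T q = mk g" using X_obtain[of l T q] by metis
  then have "(\<lambda>p. indicator (Om l T) p * g p) = g" by (auto simp: indicator_def fun_eq_iff)
  then show ?thesis using g by (simp add: X_mk)
qed

lemma X_self: "inner (X l T p) q = inner p (X l T q)"
proof -
  obtain f where f: "f \<in> SI" "p = mk f" by (rule l2_cases)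
  obtain g where g: "g \<in> SI" "q = mk g" by (rule l2_cases)
  show ?thesis using f g by (simp add: X_mk inner_mk cut_SI, simp add: mult_ac)
qed

lemma X_norm: "norm (X l T q) \<le> norm q"
proof -
  have "(norm (X l T q))\<^sup>2 = inner (X l T q) q"
    unfolding power2_norm_eq_inner X_self[of _ _ _ "X l T q"] X_idem by (rule X_self[symmetric])
  also have "\<dots> \<le> norm (X l T q) * norm q" by (rule norm_cauchy_schwarz)
  finally show ?thesis by (cases "norm (X l T q) = 0") (auto simp: power2_eq_square)
qed

lemma X_add: "X l T (p + q) = X l T p + X l T q"
proof -
  obtain f where f: "f \<in> SI" "p = mk f" by (rule l2_cases)
  obtain g where g: "g \<in> SI" "q = mk g" by (rule l2_cases)
  show ?thesis using f g by (simp add: X_mk mk_add cut_SI sq_integrable_add distrib_left)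
qed

lemma X_diff: "X l T (p - q) = X l T p - X l T q"
proof -
  obtain f where f: "f \<in> SI" "p = mk f" by (rule l2_cases)
  obtain g where g: "g \<in> SI" "q = mk g" by (rule l2_cases)
  show ?thesis using f g by (simp add: X_mk mk_diff cut_SI sq_integrable_diff right_diff_distrib)
qed

lemma X_uminus: "X l T (- p) = - X l T p"
  using X_diff[of l T 0 p] X_diff[of l T 0 0] by simp

lemma X_mulx: assumes m: "bounded_borel m" shows "X l T (mulx m q) = mulx m (X l T q)"
proof -
  obtain f where f: "f \<in> SI" "q = mk f" by (rule l2_cases)
  show ?thesis using f m by (simp add: X_mk mulx_mk mulx_SI cut_SI mult.left_commute)
qed

text \<open>Kernels in x live on the closed interval and the cylinder is open, so the identity may
  fail for x = 0 and x = l. These lines are null sets.\<close>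

lemma X_opx:
  assumes k: "kernel l M k" and z: "\<And>x y. y \<notin> {0<..<l} \<Longrightarrow> k x y = 0"
  shows "X l T (opx k q) = opx k (X l T q)"
proof -
  obtain f where f: "f \<in> SI" "q = mk f" by (rule l2_cases)
  have "AE x in lborel. x \<noteq> 0 \<and> x \<noteq> l"
    using AE_lborel_singleton[of 0] AE_lborel_singleton[of l] by auto
  then have "AE p in (lborel :: (real \<times> real) measure). fst p \<noteq> 0 \<and> fst p \<noteq> l"
    by (rule AE_fst[where P = "\<lambda>x. x \<noteq> 0 \<and> x \<noteq> l"])
  then have "AE p in lborel. indicator (Om l T) p * Kx k f p = Kx k (\<lambda>p. indicator (Om l T) p * f p) p"
  proof eventually_elim
    case (elim p)
    obtain x t where p: "p = (x, t)" by fastforce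
    have "Kx k (\<lambda>p. indicator (Om l T) p * f p) (x, t) = (\<integral>y. indicator {0<..<T} t * (k x y * f (y, t)) \<partial>lborel)"
      unfolding Kx_def
    proof (intro Bochner_Integration.integral_cong refl, simp only: fst_conv snd_conv)
      fix y show "k x y * (indicator (Om l T) (y, t) * f (y, t)) = indicator {0<..<T} t * (k x y * f (y, t))"
        using z[of y x] by (cases "y \<in> {0<..<l}") (simp_all add: indicator_Om)
    qed
    also have "\<dots> = indicator {0<..<T} t * Kx k f (x, t)" by (simp add: Kx_def)
    also have "\<dots> = indicator (Om l T) (x, t) * Kx k f (x, t)"
    proof (cases "x \<in> {0<..<l}")
      case False
      then have "x \<notin> {0..l}" using elim p by auto
      then have "k x y = 0" for y using k by (auto simp: kernel_def indicator_def dest: spec[of _ x])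
      then show ?thesis by (simp add: Kx_def)
    qed (simp add: indicator_Om)
    finally show ?case by (simp add: p)
  qed
  then show ?thesis using f
    by (simp add: X_mk opx_mk[OF k] Kx_SI[OF k] cut_SI mk_eq_iff)
qed

lemma X_opt:
  assumes k: "kernel T M k" and z: "\<And>t s. s \<notin> {0<..<T} \<Longrightarrow> k t s = 0" "\<And>t s. t \<notin> {0<..<T} \<Longrightarrow> k t s = 0"
  shows "X l T (opt k q) = opt k (X l T q)"
proof -
  obtain f where f: "f \<in> SI" "q = mk f" by (rule l2_cases)
  have "indicator (Om l T) (x, t) * Kt k f (x, t) = Kt k (\<lambda>p. indicator (Om l T) p * f p) (x, t)" for x t
  proof -
    have "Kt k (\<lambda>p. indicator (Om l T) p * f p) (x, t) = (\<integral>s. indicator {0<..<l} x * (k t s * f (x, s)) \<partial>lborel)"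
      unfolding Kt_def
    proof (intro Bochner_Integration.integral_cong refl, simp only: fst_conv snd_conv)
      fix s show "k t s * (indicator (Om l T) (x, s) * f (x, s)) = indicator {0<..<l} x * (k t s * f (x, s))"
        using z(1)[of s t] by (cases "s \<in> {0<..<T}") (simp_all add: indicator_Om)
    qed
    also have "\<dots> = indicator {0<..<l} x * Kt k f (x, t)" by (simp add: Kt_def)
    also have "\<dots> = indicator (Om l T) (x, t) * Kt k f (x, t)"
      using z(2)[of t] by (cases "t \<in> {0<..<T}") (simp_all add: indicator_Om Kt_def)
    finally show ?thesis by simp
  qed
  then have "(\<lambda>p. indicator (Om l T) p * Kt k f p) = Kt k (\<lambda>p. indicator (Om l T) p * f p)" by auto
  then show ?thesis using f by (simp add: X_mk opt_mk[OF k] Kt_SI[OF k] cut_SI)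
qed

lemma X_ops:
  assumes "0 < l" "0 < T"
  shows "X l T (J T q) = J T (X l T q)" "X l T (Js T q) = Js T (X l T q)"
    "X l T (G l q) = G l (X l T q)" "X l T (D l q) = D l (X l T q)"
proof -
  show "X l T (J T q) = J T (X l T q)" using assms by (intro X_opt[OF kernel_kJ]) (auto simp: kJ_def)
  show "X l T (Js T q) = Js T (X l T q)" using assms by (intro X_opt[OF kernel_transpose[OF kernel_kJ]]) (auto simp: kJ_def)
  show "X l T (G l q) = G l (X l T q)" using assms by (intro X_opx[OF kernel_kG]) (auto simp: kG_def)
  show "X l T (D l q) = D l (X l T q)" using assms by (intro X_opx[OF kernel_kD]) (auto simp: kD_def)
qed

section \<open>Spatial derivatives\<close>

text \<open>Passes from an identity on almost every spatial section to one in \<open>l2\<close>.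
  Outside the open cylinder both sides vanish, except possibly on the null lines x = 0 and x =
  l.\<close>

lemma brep_eq_Kx:
  assumes l: "0 < l" and g: "brep (Om l T) f g" and Q: "Q \<in> SI" "\<And>p. p \<notin> Om l T \<Longrightarrow> Q p = 0"
    and k: "kernel l M k"
    and ae: "AE t in interval T. AE x in interval l. f (x, t) = (\<integral>y. k x y * Q (y, t) \<partial>lborel)"
  shows "mk g = opx k (mk Q)"
proof -
  have gS: "g \<in> SI" "\<And>p. p \<notin> Om l T \<Longrightarrow> g p = 0" using g by (auto simp: brep_def)
  have "AE p in lborel. g p = Kx k Q p"
  proof (rule AE_lborel2I)
    have [measurable]: "g \<in> borel_measurable borel" "Kx k Q \<in> borel_measurable borel"
      using gS Kx_measurable[OF k] SI_measurable Q by auto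
    show "{p. g p = Kx k Q p} \<in> sets borel" by measurable
    have ends: "AE x in lborel. x \<noteq> 0 \<and> x \<noteq> l" using AE_lborel_singleton[of 0] AE_lborel_singleton[of l] by auto
    have "AE t in lborel. t \<in> {0<..<T} \<longrightarrow> brep {0<..<l} (\<lambda>x. f (x, t)) (\<lambda>x. g (x, t))"
      using brep_sections(1)[OF g] by (simp add: AE_lebesgue_on[OF Ioo_borel])
    moreover have "AE t in lborel. t \<in> {0<..<T} \<longrightarrow> (AE x in interval l. f (x, t) = (\<integral>y. k x y * Q (y, t) \<partial>lborel))"
      using ae by (simp add: AE_lebesgue_on[OF Ioo_borel])
    ultimately show "AE t in lborel. AE x in lborel. g (x, t) = Kx k Q (x, t)"
    proof eventually_elim
      case (elim t)
      show ?case
      proof (cases "t \<in> {0<..<T}")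
        case False
        then show ?thesis using gS Q by (simp add: Om_def Kx_def)
      next
        case True
        have "AE x in interval l. f (x, t) = g (x, t)" using elim True by (simp add: brep_def)
        then have "AE x in interval l. g (x, t) = Kx k Q (x, t)"
          using elim(2)[rule_format, OF True] unfolding Kx_def by eventually_elim simp
        then have "AE x in lborel. x \<in> {0<..<l} \<longrightarrow> g (x, t) = Kx k Q (x, t)" by (simp add: AE_lebesgue_on[OF Ioo_borel])
        then show ?thesis using ends
        proof eventually_elim
          case (elim x)
          show ?case
          proof (cases "x \<in> {0<..<l}")
            case False
            then have "x \<notin> {0..l}" using elim by auto
            then have "k x y = 0" for y using k by (auto simp: kernel_def indicator_def dest: spec[of _ x])
            then show ?thesis using gS(2)[of "(x, t)"] False by (cases "t < T") (auto simp: Kx_def Om_def)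
          qed (use elim in simp)
        qed
      qed
    qed
  qed
  then show ?thesis using gS Q by (simp add: opx_mk[OF k] mk_eq_iff Kx_SI[OF k])
qed

text \<open>Almost every section has the normal form given by its second derivative, so
  \<open>uxx\<close> alone determines the rest.\<close>

lemma L2_V2_emb:
  assumes l: "0 < l" and v: "L2_V2 l T u ux uxx"
  shows "emb l T u = G l (emb l T uxx)" "emb l T ux = D l (emb l T uxx)"
proof -
  have sq: "u \<in> sq_integrable (cylinder l T)" "ux \<in> sq_integrable (cylinder l T)" "uxx \<in> sq_integrable (cylinder l T)"
    using v by (auto simp: L2_V2_def)
  obtain g where g: "brep (Om l T) u g" "emb l T u = mk g" "g \<in> SI" using emb_obtain[OF sq(1)] by blast
  obtain gx where gx: "brep (Om l T) ux gx" "emb l T ux = mk gx" "gx \<in> SI" using emb_obtain[OF sq(2)] by blast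
  obtain Q where Q: "brep (Om l T) uxx Q" "emb l T uxx = mk Q" "Q \<in> SI" using emb_obtain[OF sq(3)] by blast
  have Q0: "\<And>p. p \<notin> Om l T \<Longrightarrow> Q p = 0" using Q(1) unfolding brep_def by blast
  have ae: "AE t in interval T. (\<lambda>x. u (x, t)) \<in> V2 l \<and> has_weak_deriv l (\<lambda>x. u (x, t)) (\<lambda>x. ux (x, t)) \<and>
      has_weak_deriv l (\<lambda>x. ux (x, t)) (\<lambda>x. uxx (x, t))" using v by (simp add: L2_V2_def)
  have "AE t in interval T. (AE x in interval l. ux (x, t) = Kd l (\<lambda>x. Q (x, t)) x) \<and> (AE x in interval l. u (x, t) = Kg l (\<lambda>x. Q (x, t)) x)"
    using ae brep_sections(1)[OF Q(1)]
  proof eventually_elim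
    case (elim t)
    then show ?case using V2_normal_form[of "\<lambda>x. u (x, t)" l "\<lambda>x. ux (x, t)" "\<lambda>x. uxx (x, t)" "\<lambda>x. Q (x, t)"] l by blast
  qed
  then have 1: "AE t in interval T. AE x in interval l. ux (x, t) = Kd l (\<lambda>x. Q (x, t)) x"
    "AE t in interval T. AE x in interval l. u (x, t) = Kg l (\<lambda>x. Q (x, t)) x" by (auto elim: eventually_mono)
  show "emb l T u = G l (emb l T uxx)" unfolding g(2) Q(2)
    by (rule brep_eq_Kx[OF l g(1) Q(3) Q0 kernel_kG[OF l] 1(2)])
  show "emb l T ux = D l (emb l T uxx)" unfolding gx(2) Q(2)
    by (rule brep_eq_Kx[OF l gx(1) Q(3) Q0 kernel_kD[OF l] 1(1)])
qed

lemma SI_sq_cylinder: "h \<in> SI \<Longrightarrow> h \<in> sq_integrable (cylinder l T)"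
  unfolding cylinder_Om using brep_sq[OF Om_borel brep_restrict[OF _ Om_borel]] .

lemma L2_V2_cong:
  assumes v: "L2_V2 l T u ux uxx" and u': "u' \<in> sq_integrable (cylinder l T)" and ae: "AE p in cylinder l T. u p = u' p"
  shows "L2_V2 l T u' ux uxx"
proof -
  have "AE t in interval T. (\<lambda>x. u' (x, t)) \<in> V2 l \<and> has_weak_deriv l (\<lambda>x. u' (x, t)) (\<lambda>x. ux (x, t)) \<and>
      has_weak_deriv l (\<lambda>x. ux (x, t)) (\<lambda>x. uxx (x, t))"
    using v[unfolded L2_V2_def, THEN conjunct2, THEN conjunct2, THEN conjunct2] AE_cylinder_sections(1)[OF ae]
  proof eventually_elim
    case (elim t)
    then show ?case using V2_cong[of "\<lambda>x. u (x, t)" l "\<lambda>x. u' (x, t)"]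
        has_weak_deriv_cong[of l "\<lambda>x. u (x, t)" "\<lambda>x. ux (x, t)" "\<lambda>x. u' (x, t)" "\<lambda>x. ux (x, t)"] by auto
  qed
  then show ?thesis using v u' by (simp add: L2_V2_def)
qed

lemma L2_V2_Kx:
  assumes l: "0 < l" and Q: "Q \<in> SI"
  shows "L2_V2 l T (Kx (kG l) Q) (Kx (kD l) Q) Q"
proof -
  have "AE t in interval T. (\<lambda>x. Kx (kG l) Q (x, t)) \<in> V2 l \<and>
      has_weak_deriv l (\<lambda>x. Kx (kG l) Q (x, t)) (\<lambda>x. Kx (kD l) Q (x, t)) \<and>
      has_weak_deriv l (\<lambda>x. Kx (kD l) Q (x, t)) (\<lambda>x. Q (x, t))"
    unfolding AE_lebesgue_on[OF Ioo_borel] using SI_sections(1)[OF Q]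
  proof eventually_elim
    case (elim t)
    then show ?case using V2_Kg[OF l elim] has_weak_deriv_Kd_Kg[OF l elim] by (simp add: Kx_def)
  qed
  then show ?thesis using Kx_SI(1)[OF kernel_kG[OF l] Q] Kx_SI(1)[OF kernel_kD[OF l] Q] Q
    by (simp add: L2_V2_def SI_sq_cylinder)
qed

lemma Kx_kG_outside: "Q \<in> SI \<Longrightarrow> (\<And>p. p \<notin> Om l T \<Longrightarrow> Q p = 0) \<Longrightarrow> p \<notin> Om l T \<Longrightarrow> Kx (kG l) Q p = 0"
proof -
  assume Q: "\<And>p. p \<notin> Om l T \<Longrightarrow> Q p = 0" and p: "p \<notin> Om l T"
  obtain x t where xt: "p = (x, t)" by fastforce
  show ?thesis
  proof (cases "t \<in> {0<..<T}")
    case True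
    then have "x \<notin> {0<..<l}" using p xt by (auto simp: Om_def)
    then have "kG l x y = 0" for y by (auto simp: kG_def)
    then show ?thesis by (simp add: Kx_def xt)
  next
    case False
    then have "Q (y, t) = 0" for y using Q by (auto simp: Om_def)
    then show ?thesis by (simp add: Kx_def xt)
  qed
qed

text \<open>If the Green operator gives zero, then so do its first and second weak derivative, and
  the second one is \<open>q\<close>. Support in the cylinder is required, since \<open>G\<close>
  does not see values with x outside (0, l).\<close>

lemma G_injective:
  assumes l: "0 < l" and q: "X l T q = q" and z: "G l q = 0"
  shows "q = 0"
proof -
  obtain Q where Q: "Q \<in> SI" "\<And>p. p \<notin> Om l T \<Longrightarrow> Q p = 0" "q = mk Q" using X_obtain[of l T q] q by metis
  have "Kx (kG l) Q \<in> SI" by (rule Kx_SI(1)[OF kernel_kG[OF l] Q(1)])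
  then have "AE p in lborel. Kx (kG l) Q p = 0"
    using z Q by (simp add: opx_mk[OF kernel_kG[OF l]] zero_l2_def mk_eq_iff sq_integrable_zero)
  from AE_lborel2(2)[OF this] have "AE t in lborel. AE x in lborel. Q (x, t) = 0"
    using SI_sections(1)[OF Q(1)]
  proof eventually_elim
    case (elim t)
    let ?g = "\<lambda>x. Q (x, t)"
    have Kg0: "AE x in interval l. Kg l ?g x = 0"
      unfolding AE_lebesgue_on[OF Ioo_borel] using elim(1) by (auto simp: Kx_def elim: eventually_mono)
    have 0: "has_weak_deriv l (\<lambda>x. 0) (\<lambda>x. 0)" by (intro has_weak_deriv_lborel sq_integrable_zero) simp
    have "has_weak_deriv l (\<lambda>x. 0) (Kd l ?g)"
      by (rule has_weak_deriv_cong[OF has_weak_deriv_Kd_Kg(2)[OF l elim(2)] Kg0]) simp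
    then have Kd0: "AE x in interval l. Kd l ?g x = 0" by (rule has_weak_deriv_unique[OF _ 0])
    have "has_weak_deriv l (\<lambda>x. 0) ?g"
      by (rule has_weak_deriv_cong[OF has_weak_deriv_Kd_Kg(1)[OF l elim(2)] Kd0]) simp
    then have "AE x in interval l. Q (x, t) = 0" by (rule has_weak_deriv_unique[OF _ 0])
    then show ?case unfolding AE_lebesgue_on[OF Ioo_borel]
    proof eventually_elim
      case (elim x)
      then show ?case using Q(2)[of "(x, t)"] by (cases "x \<in> {0<..<l}") (auto simp: Om_def)
    qed
  qed
  moreover have "{p. Q p = 0} \<in> sets borel" using SI_measurable[OF Q(1)] by measurable
  ultimately have "AE p in lborel. Q p = 0" by (intro AE_lborel2I)
  then show ?thesis using Q by (simp add: zero_l2_def mk_eq_iff sq_integrable_zero)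
qed

section \<open>Time derivatives\<close>

text \<open>The operator recovering a function from its time derivative when it vanishes at time \<open>s0 \<in> {0, T}\<close>.\<close>

definition end_kernel :: "real \<Rightarrow> real \<Rightarrow> (real \<Rightarrow> real \<Rightarrow> real) \<Rightarrow> bool" where
  "end_kernel T s0 k \<longleftrightarrow> s0 = 0 \<and> k = kJ T \<or> s0 = T \<and> k = (\<lambda>t s. - kJ T s t)"

lemma kernel_uminus: "kernel b M k \<Longrightarrow> kernel b M (\<lambda>x y. - k x y)"
  by (simp add: kernel_def)

lemma end_kernel: assumes "end_kernel T s0 k" "0 < T"
  shows "kernel T 1 k" "\<And>t s. t \<notin> {0<..<T} \<Longrightarrow> k t s = 0"
  using assms kernel_kJ[of T] kernel_uminus[OF kernel_transpose[OF kernel_kJ[of T]]]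
  by (auto simp: end_kernel_def kJ_def)

text \<open>The weak derivative fixes \<open>g'\<close> up to a constant, which the continuous
  representative determines at \<open>s0\<close>. The comparison uses \<open>Kd\<close>, which is
  continuous on the closed interval and differs from the primitive by a constant inside;
  \<open>kJ\<close> itself jumps to zero at T.\<close>

lemma weak_primitive_endpoint:
  assumes T: "0 < T" and g: "continuous_on {0..T} g" and ae: "AE t in lborel. t \<in> {0<..<T} \<longrightarrow> g' t = g t"
    and g': "g' \<in> SI" and h: "h \<in> SI"
    and w: "\<And>\<phi>. \<phi> \<in> test_functions T \<Longrightarrow> (\<integral>x. g' x * deriv \<phi> x \<partial>lborel) = - (\<integral>x. h x * \<phi> x \<partial>lborel)"
    and k: "end_kernel T s0 k" and z: "g s0 = 0"
  shows "AE t in lborel. t \<in> {0<..<T} \<longrightarrow> g' t = (\<integral>s. k t s * h s \<partial>lborel)"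
proof -
  obtain c where c: "AE t in lborel. t \<in> {0<..<T} \<longrightarrow> g' t = c + Kj T h t"
    using fundamental_theorem_weak[OF g' h T w] by blast
  define m where "m = c + (\<integral>y. indicator {0<..<T} y * ((T - y) / T) * h y \<partial>lborel)"
  have "AE t in lborel. t \<in> {0<..<T} \<longrightarrow> g t = m + Kd T h t"
    using c ae by eventually_elim (simp add: Kd_eq[OF T h] m_def)
  then have gt: "g t = m + Kd T h t" if "t \<in> {0..T}" for t
    using continuous_AE_unique[OF g _ T _ that, of "\<lambda>t. m + Kd T h t"] Kd_continuous[OF T h]
    by (simp add: continuous_intros)
  have s0: "s0 \<in> {0..T}" using k T by (auto simp: end_kernel_def)
  have "g t = (\<integral>s. k t s * h s \<partial>lborel)" if t: "t \<in> {0<..<T}" for t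
  proof -
    note i = kernel_integrable[OF kernel_kD[OF T] h]
    have "g t = Kd T h t - Kd T h s0" using gt[of t] gt[OF s0] z t by auto
    also have "\<dots> = (\<integral>s. (kD T t s - kD T s0 s) * h s \<partial>lborel)" using i by (simp add: left_diff_distrib)
    also have "\<dots> = (\<integral>s. k t s * h s \<partial>lborel)"
    proof (rule integral_cong_AE)
      have "AE s in lborel. s \<noteq> t" by (rule AE_lborel_singleton)
      then show "AE s in lborel. (kD T t s - kD T s0 s) * h s = k t s * h s"
        by eventually_elim (use t k in \<open>auto simp: end_kernel_def kD_def kJ_def\<close>)
    qed (use kernel_measurable(2)[OF kernel_kD[OF T]] kernel_measurable(2)[OF end_kernel(1)[OF k T]] sq_integrable_measurable[OF h] in auto)
    finally show ?thesis .
  qed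
  then show ?thesis using ae by (auto elim!: eventually_mono)
qed

lemma AE_ex_between:
  assumes "AE x in lborel. P x" "a < (b::real)" shows "\<exists>x\<in>{a<..<b}. P x"
proof (rule ccontr)
  assume "\<not> ?thesis"
  then have "AE x in lborel. x \<notin> {a<..<b}" using assms(1) by (auto elim!: eventually_mono)
  then have "emeasure lborel {a<..<b} = 0" by (subst (asm) AE_iff_null_sets[symmetric]) auto
  then show False using assms(2) by simp
qed

lemma SI_tensor:
  fixes a b :: "real \<Rightarrow> real"
  assumes a: "a \<in> SI" and b: "b \<in> SI"
  shows "(\<lambda>p. a (fst p) * b (snd p)) \<in> SI"
proof -
  have [measurable]: "a \<in> borel_measurable borel" "b \<in> borel_measurable borel" using a b by (auto simp: sq_integrable_def)
  have "(\<lambda>p. a (fst p) * b (snd p)) \<in> borel_measurable (borel \<Otimes>\<^sub>M borel)" by measurable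
  moreover have "integrable lborel (\<lambda>(x, y). (a x)\<^sup>2 * (b y)\<^sup>2)"
    using a b by (intro integrable_tensor) (auto simp: sq_integrable_def)
  ultimately show ?thesis by (simp add: sq_integrable_def borel_prod split_beta' power_mult_distrib)
qed

lemma box_prod_real: "box (a, c) (b, d) = {a<..<b} \<times> {c<..<d::real}" for a b :: real
  by (auto simp: box_def Basis_prod_def)

text \<open>In the definition of the weak time derivative the exceptional null set of x depends on
  the test function \<psi>. Integrating against \<open>a\<close> in x removes it and leaves a
  statement on a scalar function of time.\<close>

lemma section_weak_deriv:
  assumes v: "has_weak_time_deriv l T v vt" and gv: "brep (Om l T) v gv" and gw: "brep (Om l T) vt gw"
    and A: "a \<in> SI" and \<psi>: "\<psi> \<in> test_functions T"
  shows "(\<integral>t. (\<integral>x. a x * gv (x, t) \<partial>lborel) * deriv \<psi> t \<partial>lborel)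
    = - (\<integral>t. (\<integral>x. a x * gw (x, t) \<partial>lborel) * \<psi> t \<partial>lborel)"
proof -
  have S: "gv \<in> SI" "gw \<in> SI" "\<And>p. p \<notin> Om l T \<Longrightarrow> gv p = 0" "\<And>p. p \<notin> Om l T \<Longrightarrow> gw p = 0"
    using gv gw unfolding brep_def by blast+
  have i1: "integrable lborel (\<lambda>p. gv p * (a (fst p) * deriv \<psi> (snd p)))"
    by (intro sq_integrable_product S SI_tensor A test_functions_sq[OF \<psi>])
  have i2: "integrable lborel (\<lambda>p. gw p * (a (fst p) * \<psi> (snd p)))"
    by (intro sq_integrable_product S SI_tensor A test_functions_sq[OF \<psi>])
  have pull1: "(\<integral>x. g (x, t) * (a x * c) \<partial>lborel) = (\<integral>x. a x * g (x, t) \<partial>lborel) * c" for g :: "real \<times> real \<Rightarrow> real" and t c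
    by (subst integral_mult_left_zero[symmetric]) (simp add: mult_ac)
  have pull2: "(\<integral>t. g (x, t) * (a x * \<phi> t) \<partial>lborel) = a x * (\<integral>t. g (x, t) * \<phi> t \<partial>lborel)" for g :: "real \<times> real \<Rightarrow> real" and x \<phi>
    by (subst integral_mult_right_zero[symmetric]) (simp add: mult_ac)
  have "AE x in interval l. (\<integral>t. v (x, t) * deriv \<psi> t \<partial>interval T) = - (\<integral>t. vt (x, t) * \<psi> t \<partial>interval T)"
    using v \<psi> by (simp add: has_weak_time_deriv_def)
  then have "AE x in interval l. (\<integral>t. gv (x, t) * deriv \<psi> t \<partial>lborel) = - (\<integral>t. gw (x, t) * \<psi> t \<partial>lborel)"
    using brep_sections(2)[OF gv] brep_sections(2)[OF gw]
    by eventually_elim (simp add: integral_brep[OF Ioo_borel] test_functions_continuous[OF \<psi>])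
  then have ae: "AE x in lborel. (\<integral>t. gv (x, t) * deriv \<psi> t \<partial>lborel) = - (\<integral>t. gw (x, t) * \<psi> t \<partial>lborel)"
    unfolding AE_lebesgue_on[OF Ioo_borel]
  proof eventually_elim
    case (elim x)
    show ?case
    proof (cases "x \<in> {0<..<l}")
      case False
      then have "gv (x, t) = 0" "gw (x, t) = 0" for t using S(3,4)[of "(x, t)"] by (auto simp: Om_def)
      then show ?thesis by simp
    qed (use elim in blast)
  qed
  have "(\<integral>t. (\<integral>x. a x * gv (x, t) \<partial>lborel) * deriv \<psi> t \<partial>lborel) = (\<integral>x. a x * (\<integral>t. gv (x, t) * deriv \<psi> t \<partial>lborel) \<partial>lborel)"
    using integrable_lborel2(3,6)[OF i1] by (simp add: pull1 pull2)
  also have "\<dots> = (\<integral>x. - (a x * (\<integral>t. gw (x, t) * \<psi> t \<partial>lborel)) \<partial>lborel)"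
  proof (rule integral_cong_AE)
    show "(\<lambda>x. a x * (\<integral>t. gv (x, t) * deriv \<psi> t \<partial>lborel)) \<in> borel_measurable lborel"
      using borel_measurable_integrable[OF integrable_lborel2(5)[OF i1]] by (simp add: pull2)
    show "(\<lambda>x. - (a x * (\<integral>t. gw (x, t) * \<psi> t \<partial>lborel))) \<in> borel_measurable lborel"
      using borel_measurable_integrable[OF integrable_lborel2(5)[OF i2]] by (simp add: pull2)
    show "AE x in lborel. a x * (\<integral>t. gv (x, t) * deriv \<psi> t \<partial>lborel) = - (a x * (\<integral>t. gw (x, t) * \<psi> t \<partial>lborel))"
      using ae by eventually_elim simp
  qed
  also have "\<dots> = - (\<integral>t. (\<integral>x. a x * gw (x, t) \<partial>lborel) * \<psi> t \<partial>lborel)"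
    using integrable_lborel2(3,6)[OF i2] by (simp add: pull1 pull2)
  finally show ?thesis .
qed

lemma section_continuous:
  assumes U: "\<And>t. t \<in> {0..T} \<Longrightarrow> U t \<in> sq_integrable M"
    and lim: "\<And>t. t \<in> {0..T} \<Longrightarrow> ((\<lambda>t'. \<integral>x. (U t' x - U t x)\<^sup>2 \<partial>M) \<longlongrightarrow> 0) (at t within {0..T})"
    and a: "a \<in> sq_integrable M"
  shows "continuous_on {0..T::real} (\<lambda>t. \<integral>x. a x * U t x \<partial>M)"
  unfolding continuous_on_def
proof
  fix t assume t: "t \<in> {0..T}"
  let ?N = "sqrt (\<integral>x. (a x)\<^sup>2 \<partial>M)"
  have "((\<lambda>t'. (\<integral>x. a x * U t' x \<partial>M) - (\<integral>x. a x * U t x \<partial>M)) \<longlongrightarrow> 0) (at t within {0..T})"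
  proof (rule Lim_null_comparison)
    show "((\<lambda>t'. ?N * sqrt (\<integral>x. (U t' x - U t x)\<^sup>2 \<partial>M)) \<longlongrightarrow> 0) (at t within {0..T})"
      using tendsto_mult_right_zero[OF tendsto_real_sqrt[OF lim[OF t], unfolded real_sqrt_zero]] .
    have "norm ((\<integral>x. a x * U t' x \<partial>M) - (\<integral>x. a x * U t x \<partial>M)) \<le> ?N * sqrt (\<integral>x. (U t' x - U t x)\<^sup>2 \<partial>M)"
      if t': "t' \<in> {0..T}" for t'
    proof -
      have "(\<integral>x. a x * U t' x \<partial>M) - (\<integral>x. a x * U t x \<partial>M) = (\<integral>x. a x * (U t' x - U t x) \<partial>M)"
        using sq_integrable_product[OF a U[OF t]] sq_integrable_product[OF a U[OF t']] by (simp add: right_diff_distrib)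
      then have "((\<integral>x. a x * U t' x \<partial>M) - (\<integral>x. a x * U t x \<partial>M))\<^sup>2 \<le> (\<integral>x. (a x)\<^sup>2 \<partial>M) * (\<integral>x. (U t' x - U t x)\<^sup>2 \<partial>M)"
        using cauchy_schwarz_integral[OF a sq_integrable_diff[OF U[OF t'] U[OF t]]] by simp
      from real_sqrt_le_mono[OF this] show ?thesis by (simp add: real_sqrt_mult)
    qed
    then show "\<forall>\<^sub>F t' in at t within {0..T}. norm ((\<integral>x. a x * U t' x \<partial>M) - (\<integral>x. a x * U t x \<partial>M)) \<le> ?N * sqrt (\<integral>x. (U t' x - U t x)\<^sup>2 \<partial>M)"
      by (auto simp: eventually_at_filter)
  qed
  then show "((\<lambda>t. \<integral>x. a x * U t x \<partial>M) \<longlongrightarrow> (\<integral>x. a x * U t x \<partial>M)) (at t within {0..T})"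
    by (rule LIM_zero_cancel)
qed

text \<open>Reduction to one variable: averages over intervals in x satisfy the scalar statement
  \<open>weak_primitive_endpoint\<close>. So the difference \<open>f\<close> has integral zero over
  every box and vanishes.\<close>

lemma time_deriv_emb:
  assumes l: "0 < l" and T: "0 < T" and v: "has_weak_time_deriv l T v vt" and z: "vanishes_at_time l T v s0"
    and k: "end_kernel T s0 k"
  shows "emb l T v = opt k (emb l T vt)"
proof -
  have sq: "v \<in> sq_integrable (cylinder l T)" "vt \<in> sq_integrable (cylinder l T)" using v by (auto simp: has_weak_time_deriv_def)
  obtain gv where gv: "brep (Om l T) v gv" "emb l T v = mk gv" "gv \<in> SI" using emb_obtain[OF sq(1)] by blast
  obtain gw where gw: "brep (Om l T) vt gw" "emb l T vt = mk gw" "gw \<in> SI" using emb_obtain[OF sq(2)] by blast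
  have out: "\<And>p. p \<notin> Om l T \<Longrightarrow> gv p = 0" "\<And>p. p \<notin> Om l T \<Longrightarrow> gw p = 0" using gv(1) gw(1) unfolding brep_def by blast+
  obtain U where U: "\<forall>t\<in>{0..T}. U t \<in> sq_integrable (interval l)"
    "AE t in interval T. AE x in interval l. U t x = v (x, t)"
    "\<forall>t\<in>{0..T}. ((\<lambda>t'. \<integral>x. (U t' x - U t x)\<^sup>2 \<partial>interval l) \<longlongrightarrow> 0) (at t within {0..T})"
    "AE x in interval l. U s0 x = 0" using z unfolding vanishes_at_time_def by blast
  note kk = end_kernel[OF k T]
  define f where "f p = gv p - Kt k gw p" for p
  have fS: "f \<in> SI" unfolding f_def by (intro sq_integrable_diff gv Kt_SI[OF kk(1)] gw)
  have fout: "f p = 0" if p: "p \<notin> Om l T" for p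
  proof -
    obtain x t where xt: "p = (x, t)" by fastforce
    have "Kt k gw (x, t) = 0"
    proof (cases "t \<in> {0<..<T}")
      case True
      then have "gw (x, s) = 0" for s using p xt out(2)[of "(x, s)"] by (auto simp: Om_def)
      then show ?thesis by (simp add: Kt_def)
    qed (use kk(2) in \<open>simp add: Kt_def\<close>)
    then show ?thesis using out(1)[OF p] by (simp add: f_def xt)
  qed
  have Aint: "AE t in lborel. (\<integral>x. indicator {a<..<b} x * f (x, t) \<partial>lborel) = 0" for a b
  proof -
    define A where "A = {max a 0<..<min b l}"
    have A: "A \<subseteq> {0<..<l}" "A \<in> sets borel" by (auto simp: A_def)
    \<comment> \<open>Integration over \<open>A\<close> written as a kernel operator whose values do
      not depend on x in (0, l); \<open>Kx_Kt_commute\<close> then interchanges it with the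
      primitive in time.\<close>
    define kA where "kA = (\<lambda>x y::real. indicator {0<..<l} x * indicator A y :: real)"
    have kA: "kernel l 1 kA"
    proof -
      have "(\<lambda>p. kA (fst p) (snd p)) \<in> borel_measurable (borel \<Otimes>\<^sub>M borel)"
        unfolding kA_def using A(2) by measurable
      then show ?thesis using l A(1) by (auto simp: kernel_def kA_def borel_prod indicator_def)
    qed
    have Ksec: "Kx kA g (x, t) = (\<integral>y. indicator A y * g (y, t) \<partial>lborel)" if "x \<in> {0<..<l}" for x t and g :: "real \<times> real \<Rightarrow> real"
      using that by (simp add: Kx_def kA_def)
    \<comment> \<open>Any x in (0, l) with square integrable sections would do; almost every one
      qualifies.\<close>
    obtain x0 where x0: "x0 \<in> {0<..<l}" "(\<lambda>t. Kx kA gv (x0, t)) \<in> SI" "(\<lambda>t. Kx kA gw (x0, t)) \<in> SI"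
    proof -
      have "AE x in lborel. (\<lambda>t. Kx kA gv (x, t)) \<in> SI \<and> (\<lambda>t. Kx kA gw (x, t)) \<in> SI"
        using SI_sections(2)[OF Kx_SI(1)[OF kA gv(3)]] SI_sections(2)[OF Kx_SI(1)[OF kA gw(3)]] by eventually_elim simp
      from AE_ex_between[OF this l] show ?thesis using that by blast
    qed
    define g' where "g' t = (\<integral>x. indicator A x * gv (x, t) \<partial>lborel)" for t
    define h where "h t = (\<integral>x. indicator A x * gw (x, t) \<partial>lborel)" for t
    have gh: "g' \<in> SI" "h \<in> SI"
      using x0(2,3) unfolding Ksec[OF x0(1)] g'_def h_def by auto
    define g where "g t = (\<integral>x. indicator A x * U t x \<partial>interval l)" for t
    have Asq: "indicator A \<in> SI" unfolding A_def by (rule indicator_sq)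
    have Asq': "indicator A \<in> sq_integrable (interval l)"
      using brep_sq[OF Ioo_borel brep_restrict[OF Asq Ioo_borel]] .
    have gc: "continuous_on {0..T} g" unfolding g_def
      by (rule section_continuous) (use U Asq' in auto)
    have "AE x in interval l. indicator A x * U s0 x = 0" using U(4) by eventually_elim simp
    then have gz: "g s0 = 0" unfolding g_def by (rule integral_eq_zero_AE)
    have "AE t in interval T. g' t = g t"
      using U(2) brep_sections(1)[OF gv(1)]
    proof eventually_elim
      case (elim t)
      have "AE x in interval l. v (x, t) = U t x" using elim(1) by eventually_elim simp
      then have "brep {0<..<l} (U t) (\<lambda>x. gv (x, t))" by (rule brep_cong[OF elim(2)])
      from integral_brep[OF Ioo_borel this, of "indicator A"] show ?case using A by (simp add: g_def g'_def mult.commute)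
    qed
    then have ae: "AE t in lborel. t \<in> {0<..<T} \<longrightarrow> g' t = g t" by (simp add: AE_lebesgue_on[OF Ioo_borel])
    have w: "(\<integral>t. g' t * deriv \<psi> t \<partial>lborel) = - (\<integral>t. h t * \<psi> t \<partial>lborel)" if "\<psi> \<in> test_functions T" for \<psi>
      unfolding g'_def h_def by (rule section_weak_deriv[OF v gv(1) gw(1) Asq that])
    have "AE t in lborel. t \<in> {0<..<T} \<longrightarrow> g' t = (\<integral>s. k t s * h s \<partial>lborel)"
      by (rule weak_primitive_endpoint[OF T gc ae gh w k gz])
    then show ?thesis using SI_sections(1)[OF gv(3)] SI_sections(1)[OF Kt_SI(1)[OF kk(1) gw(3)]]
    proof eventually_elim
      case (elim t)
      show ?case
      proof (cases "t \<in> {0<..<T}")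
        case False
        then have "f (x, t) = 0" for x using fout[of "(x, t)"] by (auto simp: Om_def)
        then show ?thesis by simp
      next
        case True
        have "(\<integral>s. k t s * h s \<partial>lborel) = Kt k (Kx kA gw) (x0, t)"
          by (simp add: Kt_def Ksec[OF x0(1)] h_def)
        also have "\<dots> = Kx kA (Kt k gw) (x0, t)" using Kx_Kt_commute[OF kA kk(1) gw(3)] by simp
        finally have "(\<integral>x. indicator A x * gv (x, t) \<partial>lborel) = (\<integral>x. indicator A x * Kt k gw (x, t) \<partial>lborel)"
          using elim(1) True by (simp add: g'_def Ksec[OF x0(1)])
        then have "(\<integral>x. indicator A x * f (x, t) \<partial>lborel) = 0"
          using sq_integrable_product[OF Asq elim(2)] sq_integrable_product[OF Asq elim(3)]
          by (simp add: f_def right_diff_distrib)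
        moreover have "indicator A x * f (x, t) = indicator {a<..<b} x * f (x, t)" for x
          using fout[of "(x, t)"] by (cases "x \<in> {0<..<l}") (auto simp: A_def Om_def indicator_def)
        ultimately show ?thesis by simp
      qed
    qed
  qed
  have ind: "indicator (Om l T) \<in> SI"
  proof -
    have "indicator (Om l T) = (\<lambda>p. indicator {0<..<l} (fst p) * indicator {0<..<T} (snd p) :: real)"
      by (auto simp: fun_eq_iff Om_def indicator_times)
    then show ?thesis using SI_tensor[OF indicator_sq[of 0 l] indicator_sq[of 0 T]] by simp
  qed
  have "(\<lambda>p. f p * indicator (Om l T) p) = f" using fout by (auto simp: indicator_def fun_eq_iff)
  then have fi: "integrable lborel f" using sq_integrable_product[OF fS ind] by simp
  have "AE p in lborel. f p = 0"
  proof (rule AE_zero_boxes[OF fi])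
    fix q r :: "real \<times> real"
    obtain a c b d where qr: "q = (a, c)" "r = (b, d)" by fastforce
    have ib: "integrable lborel (\<lambda>p. indicator (box q r) p * f p)"
      using integrable_mult_indicator[of "box q r" lborel f] fi by simp
    have "(\<integral>p. indicator (box q r) p * f p \<partial>lborel) = (\<integral>t. (\<integral>x. indicator (box q r) (x, t) * f (x, t) \<partial>lborel) \<partial>lborel)"
      using integrable_lborel2(3)[OF ib] by simp
    also have "\<dots> = (\<integral>t. indicator {c<..<d} t * (\<integral>x. indicator {a<..<b} x * f (x, t) \<partial>lborel) \<partial>lborel)"
      by (subst integral_mult_right_zero[symmetric]) (simp add: qr box_prod_real indicator_times mult_ac)
    also have "\<dots> = 0"
    proof (rule integral_eq_zero_AE)
      show "AE t in lborel. indicator {c<..<d} t * (\<integral>x. indicator {a<..<b} x * f (x, t) \<partial>lborel) = 0"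
        using Aint[of a b] by eventually_elim simp
    qed
    finally show "(\<integral>p. indicator (box q r) p * f p \<partial>lborel) = 0" .
  qed
  then have "AE p in lborel. gv p = Kt k gw p" by eventually_elim (simp add: f_def)
  then show ?thesis using gv gw by (simp add: opt_mk[OF kk(1)] mk_eq_iff Kt_SI[OF kk(1)])
qed

section \<open>Primitives in time and their vanishing at an end\<close>

lemma integral_deriv_test':
  assumes \<phi>: "\<phi> \<in> test_functions b" and b: "0 < b"
  shows "(\<integral>x. kJ b y x * deriv \<phi> x \<partial>lborel) = \<phi> y"
proof -
  have out: "\<phi> x = 0" if "x \<notin> {0<..<b}" for x using test_functions_bounded[OF \<phi>] that by metis
  show ?thesis
  proof (cases "0 < y \<and> y < b")
    case False
    then have "kJ b y x = 0" for x by (auto simp: kJ_def)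
    then show ?thesis using out[of y] False by simp
  next
    case True
    have "(\<integral>x. kJ b y x * deriv \<phi> x \<partial>lborel) = (\<integral>x. deriv \<phi> x * indicator {0..y} x \<partial>lborel)"
    proof (rule integral_cong_AE)
      have "AE x in lborel. x \<noteq> y \<and> x \<noteq> 0" using AE_lborel_singleton[of y] AE_lborel_singleton[of 0] by auto
      then show "AE x in lborel. kJ b y x * deriv \<phi> x = deriv \<phi> x * indicator {0..y} x"
        by eventually_elim (use True in \<open>auto simp: kJ_def indicator_def\<close>)
    qed (use kernel_measurable(2)[OF kernel_kJ[OF b]] test_functions_continuous(4)[OF \<phi>] in auto)
    also have "\<dots> = \<phi> y - \<phi> 0"
      using True test_functions_continuous(5)[OF \<phi>] continuous_on_eq_continuous_at[OF open_UNIV, of "deriv \<phi>"]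
        test_functions_continuous(2)[OF \<phi>, of UNIV]
      by (intro integral_FTC_Icc_real) auto
    finally show ?thesis using out[of 0] by simp
  qed
qed

lemma end_kernel_test:
  assumes k: "end_kernel T s0 k" and T: "0 < T" and \<psi>: "\<psi> \<in> test_functions T"
  shows "(\<integral>t. k t s * deriv \<psi> t \<partial>lborel) = - \<psi> s"
  using k integral_deriv_test[OF \<psi> T] integral_deriv_test'[OF \<psi> T] by (auto simp: end_kernel_def)

lemma end_kernel_by_parts:
  assumes k: "end_kernel T s0 k" and T: "0 < T" and \<psi>: "\<psi> \<in> test_functions T" and g: "g \<in> SI"
  shows "(\<integral>t. (\<integral>s. k t s * g s \<partial>lborel) * deriv \<psi> t \<partial>lborel) = - (\<integral>s. g s * \<psi> s \<partial>lborel)"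
  unfolding kernel_adjoint1[OF end_kernel(1)[OF k T] g test_functions_sq(2)[OF \<psi>]] end_kernel_test[OF k T \<psi>] by simp

lemma has_weak_time_deriv_Kt:
  assumes T: "0 < T" and k: "end_kernel T s0 k" and W: "W \<in> SI"
  shows "has_weak_time_deriv l T (Kt k W) W"
  unfolding has_weak_time_deriv_def
proof (intro conjI ballI)
  note kk = end_kernel[OF k T]
  show "Kt k W \<in> sq_integrable (cylinder l T)" "W \<in> sq_integrable (cylinder l T)"
    using Kt_SI[OF kk(1) W] W SI_sq_cylinder by auto
  fix \<psi> assume \<psi>: "\<psi> \<in> test_functions T"
  show "AE x in interval l. (\<integral>t. Kt k W (x, t) * deriv \<psi> t \<partial>interval T) = - (\<integral>t. W (x, t) * \<psi> t \<partial>interval T)"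
    unfolding AE_lebesgue_on[OF Ioo_borel] using SI_sections(2)[OF W] SI_sections(2)[OF Kt_SI(1)[OF kk(1) W]]
  proof eventually_elim
    case (elim x)
    have "(\<integral>t. Kt k W (x, t) * deriv \<psi> t \<partial>interval T) = (\<integral>t. Kt k W (x, t) * deriv \<psi> t \<partial>lborel)"
      unfolding integral_brep[OF Ioo_borel brep_restrict[OF elim(2) Ioo_borel] test_functions_continuous(4)[OF \<psi>]]
      by (rule integral_indicator_test[OF \<psi>])
    moreover have "(\<integral>t. W (x, t) * \<psi> t \<partial>interval T) = (\<integral>t. W (x, t) * \<psi> t \<partial>lborel)"
      unfolding integral_brep[OF Ioo_borel brep_restrict[OF elim(1) Ioo_borel] test_functions_continuous(3)[OF \<psi>]]
      by (rule integral_indicator_test[OF \<psi>])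
    ultimately show ?case using end_kernel_by_parts[OF k T \<psi> elim(1)] by (simp add: Kt_def)
  qed
qed

lemma integral_interval_le:
  fixes F :: "real \<Rightarrow> real"
  assumes F: "integrable lborel F" "\<And>x. 0 \<le> F x"
  shows "(\<integral>x. F x \<partial>interval l) \<le> (\<integral>x. F x \<partial>lborel)"
proof -
  have m: "F \<in> borel_measurable borel" using F by auto
  have "(\<integral>x. F x \<partial>interval l) = (\<integral>x. indicator {0<..<l} x *\<^sub>R F x \<partial>lborel)"
    using m by (subst integral_restrict_space) (auto intro!: integral_completion)
  also have "\<dots> \<le> (\<integral>x. F x \<partial>lborel)"
    using F integrable_mult_indicator[of "{0<..<l}" lborel F] by (intro integral_mono) (auto simp: indicator_def)
  finally show ?thesis .
qed

lemma vanishes_Kt: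
  assumes T: "0 < T" and k: "end_kernel T s0 k" and W: "W \<in> SI"
  shows "vanishes_at_time l T (Kt k W) s0"
proof -
  \<comment> \<open>The version of \<open>k\<close> that is continuous up to both ends in the mean
    square sense. \<open>k\<close> is cut off at 0 and T, whereas the representative in time has to
    be given on the closed interval.\<close>
  define kc where "kc t s = (if 0 \<le> t \<and> t \<le> T \<and> 0 < s \<and> s < T then (if s0 = 0 then (if s < t then 1 else 0) else (if t < s then -1 else 0)) else 0 :: real)" for t s
  have s0: "s0 = 0 \<or> s0 = T" using k by (auto simp: end_kernel_def)
  have kkc: "kernel T 1 kc"
  proof -
    have "(\<lambda>p. kc (fst p) (snd p)) \<in> borel_measurable (borel \<Otimes>\<^sub>M borel)" unfolding kc_def by measurable
    then show ?thesis using T by (auto simp: kernel_def kc_def borel_prod)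
  qed
  have k_kc: "k t s = kc t s" if "t \<in> {0<..<T}" for t s
    using that k T by (auto simp: end_kernel_def kc_def kJ_def)
  have kc0: "kc s0 s = 0" for s using s0 T by (auto simp: kc_def)
  define N where "N x = (\<integral>s. (W (x, s))\<^sup>2 \<partial>lborel)" for x
  have W2: "integrable lborel (\<lambda>p. (W p)\<^sup>2)" using W by (simp add: sq_integrable_def)
  have N: "integrable lborel N" unfolding N_def by (rule integrable_lborel2(5)[OF W2])
  have N0: "0 \<le> N x" for x by (simp add: N_def)
  have meas: "(\<lambda>x. Kt kc W (x, t)) \<in> borel_measurable borel" for t
    by (rule borel_section(1)[OF Kt_measurable[OF kkc SI_measurable[OF W]]])
  have diff: "AE x in lborel. (Kt kc W (x, t') - Kt kc W (x, t))\<^sup>2 \<le> \<bar>t' - t\<bar> * N x" if t: "t \<in> {0..T}" "t' \<in> {0..T}" for t t'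
    using SI_sections(2)[OF W]
  proof eventually_elim
    case (elim x)
    have "Kt kc W (x, t') - Kt kc W (x, t) = (\<integral>s. (kc t' s - kc t s) * W (x, s) \<partial>lborel)"
      using kernel_integrable[OF kkc elim] by (simp add: Kt_def left_diff_distrib)
    then have "(Kt kc W (x, t') - Kt kc W (x, t))\<^sup>2 \<le> (\<integral>s. (kc t' s - kc t s)\<^sup>2 \<partial>lborel) * N x"
      using cauchy_schwarz_integral[OF sq_integrable_diff[OF kernel_row[OF kkc] kernel_row[OF kkc]] elim] by (simp add: N_def)
    also have "\<dots> \<le> \<bar>t' - t\<bar> * N x"
    proof (rule mult_right_mono[OF _ N0])
      have "(\<integral>s. (kc t' s - kc t s)\<^sup>2 \<partial>lborel) \<le> (\<integral>s. indicator {min t t'..max t t'} s \<partial>lborel)"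
      proof (rule integral_mono)
        show "integrable lborel (\<lambda>s. (kc t' s - kc t s)\<^sup>2)"
          using sq_integrable_diff[OF kernel_row[OF kkc] kernel_row[OF kkc]] by (simp add: sq_integrable_def)
        show "integrable lborel (indicator {min t t'..max t t'} :: real \<Rightarrow> real)"
          by (intro integrable_real_indicator) (auto simp: emeasure_lborel_Icc_eq)
        show "(kc t' s - kc t s)\<^sup>2 \<le> indicator {min t t'..max t t'} s" for s
          using t by (auto simp: kc_def indicator_def)
      qed
      also have "\<dots> = \<bar>t' - t\<bar>" by (auto simp: min_def max_def)
      finally show "(\<integral>s. (kc t' s - kc t s)\<^sup>2 \<partial>lborel) \<le> \<bar>t' - t\<bar>" .
    qed
    finally show ?case .
  qed
  have diffi: "integrable lborel (\<lambda>x. (Kt kc W (x, t') - Kt kc W (x, t))\<^sup>2)" if "t \<in> {0..T}" "t' \<in> {0..T}" for t t'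
  proof (rule Bochner_Integration.integrable_bound[of lborel "\<lambda>x. \<bar>t' - t\<bar> * N x"])
    show "integrable lborel (\<lambda>x. \<bar>t' - t\<bar> * N x)" using N by simp
    show "(\<lambda>x. (Kt kc W (x, t') - Kt kc W (x, t))\<^sup>2) \<in> borel_measurable lborel" using meas by simp
    show "AE x in lborel. norm ((Kt kc W (x, t') - Kt kc W (x, t))\<^sup>2) \<le> norm (\<bar>t' - t\<bar> * N x)"
      using diff[OF that] by eventually_elim (simp add: N0)
  qed
  have z: "Kt kc W (x, s0) = 0" for x by (simp add: Kt_def kc0)
  \<comment> \<open>Compare with time \<open>s0\<close>, where the function is zero; the difference
    is already known to be square integrable.\<close>
  have U: "(\<lambda>x. Kt kc W (x, t)) \<in> SI" if "t \<in> {0..T}" for t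
    using diffi[of s0 t] that s0 T meas by (auto simp: sq_integrable_def z)
  show ?thesis unfolding vanishes_at_time_def
  proof (intro exI[of _ "\<lambda>t x. Kt kc W (x, t)"] conjI ballI)
    show "(\<lambda>x. Kt kc W (x, t)) \<in> sq_integrable (interval l)" if "t \<in> {0..T}" for t
      using brep_sq[OF Ioo_borel brep_restrict[OF U[OF that] Ioo_borel]] .
    show "AE t in interval T. AE x in interval l. Kt kc W (x, t) = Kt k W (x, t)"
      unfolding AE_lebesgue_on[OF Ioo_borel] by (auto simp: Kt_def k_kc)
    show "AE x in interval l. Kt kc W (x, s0) = 0" by (simp add: z)
    fix t assume t: "t \<in> {0..T}"
    show "((\<lambda>t'. \<integral>x. (Kt kc W (x, t') - Kt kc W (x, t))\<^sup>2 \<partial>interval l) \<longlongrightarrow> 0) (at t within {0..T})"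
    proof (rule Lim_null_comparison)
      have "((\<lambda>t'. \<bar>t' - t\<bar> * (\<integral>x. N x \<partial>lborel)) \<longlongrightarrow> \<bar>t - t\<bar> * (\<integral>x. N x \<partial>lborel)) (at t within {0..T})"
        by (intro tendsto_intros)
      then show "((\<lambda>t'. \<bar>t' - t\<bar> * (\<integral>x. N x \<partial>lborel)) \<longlongrightarrow> 0) (at t within {0..T})" by simp
      have "norm (\<integral>x. (Kt kc W (x, t') - Kt kc W (x, t))\<^sup>2 \<partial>interval l) \<le> \<bar>t' - t\<bar> * (\<integral>x. N x \<partial>lborel)"
        if t': "t' \<in> {0..T}" for t'
      proof -
        have "(\<integral>x. (Kt kc W (x, t') - Kt kc W (x, t))\<^sup>2 \<partial>interval l) \<le> (\<integral>x. (Kt kc W (x, t') - Kt kc W (x, t))\<^sup>2 \<partial>lborel)"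
          by (intro integral_interval_le diffi t t') simp
        also have "\<dots> \<le> (\<integral>x. \<bar>t' - t\<bar> * N x \<partial>lborel)"
          using diffi[OF t t'] N diff[OF t t'] by (intro integral_mono_AE) auto
        finally show ?thesis by simp
      qed
      then show "\<forall>\<^sub>F t' in at t within {0..T}. norm (\<integral>x. (Kt kc W (x, t') - Kt kc W (x, t))\<^sup>2 \<partial>interval l) \<le> \<bar>t' - t\<bar> * (\<integral>x. N x \<partial>lborel)"
        by (auto simp: eventually_at_filter)
    qed
  qed
qed

lemma vanishes_cong:
  assumes "vanishes_at_time l T u s0" and ae: "AE p in cylinder l T. u p = u' p"
  shows "vanishes_at_time l T u' s0"
proof -
  obtain U where U: "\<forall>t\<in>{0..T}. U t \<in> sq_integrable (interval l)"
    "AE t in interval T. AE x in interval l. U t x = u (x, t)"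
    "\<forall>t\<in>{0..T}. ((\<lambda>t'. \<integral>x. (U t' x - U t x)\<^sup>2 \<partial>interval l) \<longlongrightarrow> 0) (at t within {0..T})"
    "AE x in interval l. U s0 x = 0" using assms(1) unfolding vanishes_at_time_def by blast
  have "AE t in interval T. AE x in interval l. U t x = u' (x, t)"
    using U(2) AE_cylinder_sections(1)[OF ae] by eventually_elim (auto elim: eventually_elim2)
  then show ?thesis unfolding vanishes_at_time_def using U by blast
qed

lemma has_weak_time_deriv_cong:
  assumes w: "has_weak_time_deriv l T u ut" and ae: "AE p in cylinder l T. u p = u' p"
    and u': "u' \<in> sq_integrable (cylinder l T)"
  shows "has_weak_time_deriv l T u' ut"
proof -
  have "AE x in interval l. (\<integral>t. u' (x, t) * deriv \<psi> t \<partial>interval T) = - (\<integral>t. ut (x, t) * \<psi> t \<partial>interval T)"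
    if \<psi>: "\<psi> \<in> test_functions T" for \<psi>
  proof -
    have sq: "u \<in> sq_integrable (cylinder l T)" using w by (simp add: has_weak_time_deriv_def)
    obtain g where g: "brep (Om l T) u g" "emb l T u = mk g" "g \<in> SI" using emb_obtain[OF sq] by blast
    have g': "brep (Om l T) u' g" by (rule brep_cong[OF g(1)]) (use ae in \<open>simp only: cylinder_Om\<close>)
    have "AE x in interval l. (\<integral>t. u (x, t) * deriv \<psi> t \<partial>interval T) = - (\<integral>t. ut (x, t) * \<psi> t \<partial>interval T)"
      using w \<psi> by (simp add: has_weak_time_deriv_def)
    then show ?thesis using brep_sections(2)[OF g(1)] brep_sections(2)[OF g']
      by eventually_elim (simp add: integral_brep[OF Ioo_borel] test_functions_continuous[OF \<psi>])
  qed
  then show ?thesis using w u' by (simp add: has_weak_time_deriv_def)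
qed

section \<open>Compactness of integration in time\<close>

lemma L2_class_eq_iff:
  assumes "f \<in> sq_integrable M" "g \<in> sq_integrable M"
  shows "L2_class M f = L2_class M g \<longleftrightarrow> (AE x in M. f x = g x)"
  unfolding L2_class_def eq_equiv_class_iff[OF equiv_ae_equal assms]
  using assms by (simp add: ae_equal_def)

lemma L2_class_mspace: "f \<in> sq_integrable M \<Longrightarrow> L2_class M f \<in> mspace (L2 M)"
  unfolding mspace_L2 L2_class_def by (rule quotientI)

lemma L2_rep_class:
  assumes f: "f \<in> sq_integrable M"
  shows "L2_rep (L2_class M f) \<in> sq_integrable M" "AE x in M. L2_rep (L2_class M f) x = f x"
proof -
  note r = L2_rep_in[OF L2_class_mspace[OF f, unfolded mspace_L2]]
  show "L2_rep (L2_class M f) \<in> sq_integrable M" by (rule r(1))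
  show "AE x in M. L2_rep (L2_class M f) x = f x"
    using r(2) L2_class_eq_iff[OF r(1) f] by simp
qed

lemma L2_dist_class:
  assumes f: "f \<in> sq_integrable M" and g: "g \<in> sq_integrable M"
  shows "L2_dist M (L2_class M f) (L2_class M g) = sqrt (\<integral>x. (f x - g x)\<^sup>2 \<partial>M)"
proof -
  have "(\<integral>x. (L2_rep (L2_class M f) x - L2_rep (L2_class M g) x)\<^sup>2 \<partial>M) = (\<integral>x. (f x - g x)\<^sup>2 \<partial>M)"
  proof (rule integral_cong_AE)
    show "AE x in M. (L2_rep (L2_class M f) x - L2_rep (L2_class M g) x)\<^sup>2 = (f x - g x)\<^sup>2"
      using L2_rep_class(2)[OF f] L2_rep_class(2)[OF g] by eventually_elim simp
  qed (use L2_rep_class(1)[OF f] L2_rep_class(1)[OF g] f g in \<open>auto simp: sq_integrable_def\<close>)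
  then show ?thesis by (simp add: L2_dist_def)
qed

lemma Kd_holder:
  assumes l: "0 < l" and g: "g \<in> SI" and x: "x \<in> {0..l}" "x' \<in> {0..l}"
  shows "(Kd l g x - Kd l g x')\<^sup>2 \<le> \<bar>x - x'\<bar> * (\<integral>y. (g y)\<^sup>2 \<partial>lborel)"
proof -
  note k = kernel_kD[OF l]
  have "Kd l g x - Kd l g x' = (\<integral>y. (kD l x y - kD l x' y) * g y \<partial>lborel)"
    using kernel_integrable[OF k g] by (simp add: left_diff_distrib)
  then have "(Kd l g x - Kd l g x')\<^sup>2 \<le> (\<integral>y. (kD l x y - kD l x' y)\<^sup>2 \<partial>lborel) * (\<integral>y. (g y)\<^sup>2 \<partial>lborel)"
    using cauchy_schwarz_integral[OF sq_integrable_diff[OF kernel_row[OF k] kernel_row[OF k]] g] by simp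
  also have "\<dots> \<le> \<bar>x - x'\<bar> * (\<integral>y. (g y)\<^sup>2 \<partial>lborel)"
    by (intro mult_right_mono kD_modulus[OF l x]) simp
  finally show ?thesis .
qed

lemma Kj_conv_Kd:
  assumes T: "0 < T" and g: "g \<in> SI" and t: "t \<in> {0<..<T}"
  shows "Kj T g t = Kd T g t - Kd T g 0"
proof -
  have "kJ T t s = kD T t s - kD T 0 s" for s using t by (auto simp: kJ_def kD_def)
  then show ?thesis using kernel_integrable[OF kernel_kD[OF T] g] by (simp add: left_diff_distrib)
qed

lemma continuous_sq_integrable:
  assumes g: "continuous_on {0..T} g" shows "g \<in> sq_integrable (interval T)"
proof -
  have "(\<lambda>x. indicator {0..T} x *\<^sub>R g x) \<in> borel_measurable borel"
    using g by (intro borel_measurable_continuous_on_indicator) auto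
  then have m: "(\<lambda>x. indicator {0<..<T} x * (indicator {0..T} x *\<^sub>R g x)) \<in> borel_measurable borel"
    by (intro borel_measurable_times) auto
  have e: "(\<lambda>x. indicator {0<..<T} x * (indicator {0..T} x *\<^sub>R g x)) = (\<lambda>x. indicator {0<..<T} x * g x)"
    by (auto simp: indicator_def)
  have "bounded (g ` {0..T})" by (rule compact_imp_bounded[OF compact_continuous_image[OF g compact_Icc]])
  then obtain C where C0: "\<And>y. y \<in> g ` {0..T} \<Longrightarrow> norm y \<le> C" unfolding bounded_iff by blast
  have C: "\<bar>g x\<bar> \<le> C" if "x \<in> {0..T}" for x using C0[of "g x"] that by simp
  have "(\<lambda>x. indicator {0<..<T} x * g x) \<in> SI"
  proof (rule sq_integrable_bounded_support(1)[OF m[unfolded e], of "max C 0" T])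
    show "\<bar>indicator {0<..<T} x * g x\<bar> \<le> max C 0" for x
      using C[of x] by (cases "x \<in> {0<..<T}") auto
  qed simp
  then have "brep {0<..<T} g (\<lambda>x. indicator {0<..<T} x * g x)"
    by (auto simp: brep_def AE_lebesgue_on[OF Ioo_borel])
  then show ?thesis by (rule brep_sq[OF Ioo_borel])
qed

lemma Kj_sq_interval: "0 < T \<Longrightarrow> g \<in> SI \<Longrightarrow> Kj T g \<in> sq_integrable (interval T)"
  using brep_sq[OF Ioo_borel brep_restrict[OF primitive_sq[OF kernel_kJ] Ioo_borel]] by blast

text \<open>Primitives of a bounded set in L2 are uniformly Hoelder continuous with exponent 1/2 and
  vanish at 0. Arzela-Ascoli gives a uniformly convergent subsequence, and on a bounded interval
  this implies convergence in L2.\<close>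

theorem primitives_relatively_compact:
  assumes T: "0 < T"
    and B: "\<And>h. h \<in> B \<Longrightarrow> \<exists>g\<in>SI. (\<integral>s. (g s)\<^sup>2 \<partial>lborel) \<le> C \<and> h = L2_class (interval T) (Kj T g)"
  shows "compactin (mtopology_of (L2 (interval T))) (mtopology_of (L2 (interval T)) closure_of B)"
proof -
  let ?M = "interval T"
  interpret L: Metric_space "mspace (L2 ?M)" "mdist (L2 ?M)" by (rule Metric_space_mspace_mdist)
  have BM: "B \<subseteq> mspace (L2 ?M)" using B Kj_sq_interval[OF T] L2_class_mspace by blast
  have seq: "\<exists>h r. h \<in> mspace (L2 ?M) \<and> strict_mono r \<and> limitin L.mtopology (\<sigma> \<circ> r) h sequentially"
    if \<sigma>: "range \<sigma> \<subseteq> B" for \<sigma> :: "nat \<Rightarrow> (real \<Rightarrow> real) set"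
  proof -
    have "\<forall>n. \<exists>g. g \<in> SI \<and> (\<integral>s. (g s)\<^sup>2 \<partial>lborel) \<le> C \<and> \<sigma> n = L2_class ?M (Kj T g)"
      using B \<sigma> by blast
    from choice[OF this] obtain g where g0: "\<forall>n. g n \<in> SI \<and>
      (\<integral>s. (g n s)\<^sup>2 \<partial>lborel) \<le> C \<and> \<sigma> n = L2_class ?M (Kj T (g n))" ..
    have g: "g n \<in> SI" "(\<integral>s. (g n s)\<^sup>2 \<partial>lborel) \<le> C" "\<sigma> n = L2_class ?M (Kj T (g n))" for n
      using g0[rule_format, of n] by simp_all
    have "0 \<le> (\<integral>s. (g 0 s)\<^sup>2 \<partial>lborel)" by simp
    then have C: "0 \<le> C" using g(2)[of 0] by linarith
    \<comment> \<open>The primitive from 0 in a form that is continuous on the closed interval; on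
      (0,T) it agrees with \<open>Kj\<close>.\<close>
    define H where "H n t = Kd T (g n) t - Kd T (g n) 0" for n t
    have Hd: "\<bar>H n t - H n t'\<bar> \<le> sqrt (\<bar>t - t'\<bar> * C)" if "t \<in> {0..T}" "t' \<in> {0..T}" for n t t'
    proof -
      have "(H n t - H n t')\<^sup>2 \<le> \<bar>t - t'\<bar> * (\<integral>s. (g n s)\<^sup>2 \<partial>lborel)"
        unfolding H_def using Kd_holder[OF T g(1) that] by simp
      also have "\<dots> \<le> \<bar>t - t'\<bar> * C" using g(2) by (intro mult_left_mono) auto
      finally show ?thesis using real_sqrt_le_mono by fastforce
    qed
    have Hb: "norm (H n t) \<le> sqrt (T * C)" if "t \<in> {0..T}" for n t
    proof -
      have "\<bar>H n t - H n 0\<bar> \<le> sqrt (\<bar>t - 0\<bar> * C)" using Hd[OF that, of 0 n] T by simp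
      also have "\<dots> \<le> sqrt (T * C)" using that C by (intro real_sqrt_le_mono mult_right_mono) auto
      finally show ?thesis by (simp add: H_def)
    qed
    have eq: "\<exists>d. 0 < d \<and> (\<forall>n y. y \<in> {0..T} \<and> norm (x - y) < d \<longrightarrow> norm (H n x - H n y) < e)"
      if "x \<in> {0..T}" "0 < e" for x e
    \<comment> \<open>For a distance below this, the Hoelder bound sqrt (d C) is less than
      \<open>e\<close>; the summand 1 covers C = 0.\<close>
    proof (intro exI[of _ "e\<^sup>2 / (C + 1)"] conjI allI impI)
      show "0 < e\<^sup>2 / (C + 1)" using that C by simp
      fix n y assume y: "y \<in> {0..T} \<and> norm (x - y) < e\<^sup>2 / (C + 1)"
      have "\<bar>x - y\<bar> * C \<le> \<bar>x - y\<bar> * (C + 1)" by (intro mult_left_mono) auto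
      also have "\<dots> < e\<^sup>2" using y C by (simp add: field_simps)
      finally have "sqrt (\<bar>x - y\<bar> * C) < e" using that by (metis real_sqrt_less_mono real_sqrt_abs abs_of_pos)
      then show "norm (H n x - H n y) < e" using Hd[of x y n] that y by simp
    qed
    obtain h r where hr: "continuous_on {0..T} h" "strict_mono (r :: nat \<Rightarrow> nat)"
      "\<And>e. 0 < e \<Longrightarrow> \<exists>N. \<forall>n x. n \<ge> N \<and> x \<in> {0..T} \<longrightarrow> norm (H (r n) x - h x) < e"
      by (rule Arzela_Ascoli[of "{0..T}" H "sqrt (T * C)"]) (use Hb eq in auto)
    have hS: "h \<in> sq_integrable ?M" by (rule continuous_sq_integrable[OF hr(1)])
    have HS: "H n \<in> sq_integrable ?M" for n
      unfolding H_def by (intro continuous_sq_integrable continuous_intros Kd_continuous[OF T g(1)])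
    have \<sigma>H: "\<sigma> n = L2_class ?M (H n)" for n
      unfolding g(3) using Kj_conv_Kd[OF T g(1)]
      by (subst L2_class_eq_iff[OF Kj_sq_interval[OF T g(1)] HS]) (auto simp: AE_lebesgue_on[OF Ioo_borel] H_def)
    have "(\<lambda>n. mdist (L2 ?M) (\<sigma> (r n)) (L2_class ?M h)) \<longlonglongrightarrow> 0"
    proof (rule LIMSEQ_I)
      fix e :: real assume e: "0 < e"
      define d where "d = e / (sqrt T + 1)"
      have d: "0 < d" using e T by (simp add: d_def add_pos_pos)
      obtain N where N: "\<And>n x. n \<ge> N \<Longrightarrow> x \<in> {0..T} \<Longrightarrow> \<bar>H (r n) x - h x\<bar> < d" using hr(3)[OF d] by auto
      have "mdist (L2 ?M) (\<sigma> (r n)) (L2_class ?M h) < e" if n: "n \<ge> N" for n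
      proof -
        have "(\<integral>x. (H (r n) x - h x)\<^sup>2 \<partial>?M) \<le> (\<integral>x. d\<^sup>2 \<partial>?M)"
        proof (rule integral_mono_AE)
          show "integrable ?M (\<lambda>x. (H (r n) x - h x)\<^sup>2)" using sq_integrable_diff[OF HS hS] by (simp add: sq_integrable_def)
          show "integrable ?M (\<lambda>x. d\<^sup>2)"
            by (intro finite_measure.integrable_const finite_measure_lebesgue_on) auto
          have "(H (r n) x - h x)\<^sup>2 \<le> d\<^sup>2" if "x \<in> {0<..<T}" for x
            using N[OF n, of x] that d by (intro power2_le_iff_abs_le[THEN iffD2]) auto
          then show "AE x in ?M. (H (r n) x - h x)\<^sup>2 \<le> d\<^sup>2" by (auto simp: AE_lebesgue_on[OF Ioo_borel])
        qed
        also have "(\<integral>x. d\<^sup>2 \<partial>?M) = d\<^sup>2 * T" using T by (simp add: measure_restrict_space)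
        finally have "sqrt (\<integral>x. (H (r n) x - h x)\<^sup>2 \<partial>?M) \<le> d * sqrt T"
          using d by (metis real_sqrt_le_mono real_sqrt_mult real_sqrt_abs abs_of_pos)
        also have "\<dots> < e" using e T by (simp add: d_def field_simps add_pos_pos)
        finally show ?thesis unfolding mdist_L2 \<sigma>H by (simp add: L2_dist_class[OF HS hS])
      qed
      then show "\<exists>N. \<forall>n\<ge>N. norm (mdist (L2 ?M) (\<sigma> (r n)) (L2_class ?M h) - 0) < e" by auto
    qed
    then have "limitin L.mtopology (\<sigma> \<circ> r) (L2_class ?M h) sequentially"
      using BM \<sigma> L2_class_mspace[OF hS] by (subst L.limitin_metric_dist_null) (auto simp: comp_def subset_iff)
    then show ?thesis using L2_class_mspace[OF hS] hr(2) by blast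
  qed
  \<comment> \<open>For compactness of the closure it suffices to extract limits from sequences in
    \<open>B\<close> itself.\<close>
  have "compactin L.mtopology (L.mtopology closure_of B)"
    unfolding L.compact_closure_of_eq_Bolzano_Weierstrass
    using L.Bolzano_Weierstrass_property[OF BM BM] seq by blast
  then show ?thesis by (simp add: mtopology_of_def)
qed

section \<open>The second time derivative\<close>

lemma H2_0_sq: "\<phi> \<in> H2_0 l \<Longrightarrow> \<phi> \<in> sq_integrable (interval l)"
  by (auto simp: H2_0_def H2_def has_weak_deriv_def)

lemma H2_norm_ge: "sqrt (\<integral>x. (v x)\<^sup>2 \<partial>interval l) \<le> H2_norm l v"
  unfolding H2_norm_def by (intro real_sqrt_le_mono) (simp add: add.assoc)

lemma weak_deriv_zero:
  assumes f: "has_weak_deriv l f f'" and z: "AE x in interval l. f x = 0"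
  shows "has_weak_deriv l f (weak_deriv l f)" "AE x in interval l. weak_deriv l f x = 0"
proof -
  show w: "has_weak_deriv l f (weak_deriv l f)"
    unfolding weak_deriv_def by (rule someI[where P = "\<lambda>g. has_weak_deriv l f g"]) (rule f)
  have "has_weak_deriv l (\<lambda>x. 0) (\<lambda>x. 0)" by (intro has_weak_deriv_lborel sq_integrable_zero) simp
  moreover have "has_weak_deriv l (\<lambda>x. 0) (weak_deriv l f)" by (rule has_weak_deriv_cong[OF w z]) simp
  ultimately show "AE x in interval l. weak_deriv l f x = 0" using has_weak_deriv_unique by blast
qed

text \<open>Makes the set in \<open>Hminus2_norm\<close> nonempty, so that its supremum behaves. The
  norm needs an argument because \<open>weak_deriv\<close> picks an arbitrary representative, which
  is zero only almost everywhere.\<close>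

lemma zero_H2_0: "(\<lambda>x. 0) \<in> H2_0 l" "H2_norm l (\<lambda>x. 0) = 0"
proof -
  let ?z = "\<lambda>x::real. 0::real"
  have 0: "has_weak_deriv l ?z ?z" by (intro has_weak_deriv_lborel sq_integrable_zero) simp
  note 1 = weak_deriv_zero[OF 0]
  have z1: "AE x in interval l. weak_deriv l ?z x = 0" using 1(2) by simp
  have "has_weak_deriv l (weak_deriv l ?z) ?z"
    by (rule has_weak_deriv_cong[OF 0]) (use z1 in \<open>auto elim: eventually_mono\<close>)
  then have z2: "AE x in interval l. weak_deriv l (weak_deriv l ?z) x = 0" using weak_deriv_zero(2) z1 by blast
  have "(\<integral>x. (weak_deriv l ?z x)\<^sup>2 \<partial>interval l) = 0" "(\<integral>x. (weak_deriv l (weak_deriv l ?z) x)\<^sup>2 \<partial>interval l) = 0"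
    using z1 z2 by (auto intro!: integral_eq_zero_AE elim: eventually_mono)
  then show n: "H2_norm l ?z = 0" by (simp add: H2_norm_def)
  have "smooth ?z" by (rule smooth_const)
  then have "?z \<in> test_functions l" unfolding test_functions_alt by (intro conjI exI[of _ 1] exI[of _ "l - 1"]) auto
  moreover have "?z \<in> H2 l" using 0 by (auto simp: H2_def)
  ultimately show "?z \<in> H2_0 l" unfolding H2_0_def using n by (auto intro!: exI[of _ "\<lambda>n x. 0"])
qed

text \<open>The embedding of L2 into the dual of H2_0: the solution constructed here has u_tt in L2,
  while the definition of a weak solution asks for a functional.\<close>

definition pairing :: "real \<Rightarrow> (real \<times> real \<Rightarrow> real) \<Rightarrow> real \<Rightarrow> (real \<Rightarrow> real) \<Rightarrow> real" where
  "pairing l S t \<phi> = (\<integral>x. S (x, t) * \<phi> x \<partial>interval l)"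

lemma pairing_bound:
  assumes S: "(\<lambda>x. S (x, t)) \<in> SI" and v: "v \<in> H2_0 l"
  shows "\<bar>pairing l S t v\<bar> \<le> sqrt (\<integral>x. (S (x, t))\<^sup>2 \<partial>lborel) * H2_norm l v"
proof -
  have S': "(\<lambda>x. S (x, t)) \<in> sq_integrable (interval l)"
    using brep_sq[OF Ioo_borel brep_restrict[OF S Ioo_borel]] .
  have "(pairing l S t v)\<^sup>2 \<le> (\<integral>x. (S (x, t))\<^sup>2 \<partial>interval l) * (\<integral>x. (v x)\<^sup>2 \<partial>interval l)"
    unfolding pairing_def by (rule cauchy_schwarz_integral[OF S' H2_0_sq[OF v]])
  also have "\<dots> \<le> (\<integral>x. (S (x, t))\<^sup>2 \<partial>lborel) * (\<integral>x. (v x)\<^sup>2 \<partial>interval l)"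
    using S by (intro mult_right_mono integral_interval_le) (auto simp: sq_integrable_def)
  finally have "\<bar>pairing l S t v\<bar> \<le> sqrt (\<integral>x. (S (x, t))\<^sup>2 \<partial>lborel) * sqrt (\<integral>x. (v x)\<^sup>2 \<partial>interval l)"
    using real_sqrt_le_mono by (fastforce simp: real_sqrt_mult)
  also have "\<dots> \<le> sqrt (\<integral>x. (S (x, t))\<^sup>2 \<partial>lborel) * H2_norm l v"
    by (intro mult_left_mono H2_norm_ge) simp
  finally show ?thesis .
qed

lemma pairing_Hminus2:
  assumes S: "(\<lambda>x. S (x, t)) \<in> SI"
  shows "pairing l S t \<in> Hminus2 l" "(Hminus2_norm l (pairing l S t))\<^sup>2 \<le> (\<integral>x. (S (x, t))\<^sup>2 \<partial>lborel)"
proof -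
  let ?N = "sqrt (\<integral>x. (S (x, t))\<^sup>2 \<partial>lborel)"
  have S': "(\<lambda>x. S (x, t)) \<in> sq_integrable (interval l)"
    using brep_sq[OF Ioo_borel brep_restrict[OF S Ioo_borel]] .
  have lin: "pairing l S t (\<lambda>x. c * u x + d * v x) = c * pairing l S t u + d * pairing l S t v"
    if "u \<in> H2_0 l" "v \<in> H2_0 l" for u v c d
  proof -
    have "pairing l S t (\<lambda>x. c * u x + d * v x) = (\<integral>x. c * (S (x, t) * u x) + d * (S (x, t) * v x) \<partial>interval l)"
      unfolding pairing_def by (intro Bochner_Integration.integral_cong) (auto simp: algebra_simps)
    then show ?thesis
      using sq_integrable_product[OF S' H2_0_sq[OF that(1)]] sq_integrable_product[OF S' H2_0_sq[OF that(2)]]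
      by (simp add: pairing_def)
  qed
  show "pairing l S t \<in> Hminus2 l" unfolding Hminus2_def using lin pairing_bound[OF S] by blast
  let ?B = "{\<bar>pairing l S t v\<bar> |v. v \<in> H2_0 l \<and> H2_norm l v \<le> 1}"
  have ub: "y \<le> ?N" if "y \<in> ?B" for y
  proof -
    obtain v where v: "y = \<bar>pairing l S t v\<bar>" "v \<in> H2_0 l" "H2_norm l v \<le> 1" using \<open>y \<in> ?B\<close> by blast
    have "?N * H2_norm l v \<le> ?N * 1" using v(3) by (intro mult_left_mono) auto
    then show ?thesis using pairing_bound[OF S v(2)] v(1) by linarith
  qed
  have mem: "\<bar>pairing l S t (\<lambda>x. 0)\<bar> \<in> ?B" using zero_H2_0 by force
  have "Sup ?B \<le> ?N" using mem ub by (intro cSup_least) auto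
  moreover have "0 \<le> Sup ?B"
    using mem ub by (intro order_trans[OF abs_ge_zero cSup_upper[OF mem]] bdd_aboveI[of _ ?N]) auto
  ultimately have "(Sup ?B)\<^sup>2 \<le> ?N\<^sup>2" by (intro power_mono)
  then show "(Hminus2_norm l (pairing l S t))\<^sup>2 \<le> (\<integral>x. (S (x, t))\<^sup>2 \<partial>lborel)" by (simp add: Hminus2_norm_def)
qed

lemma borel_measurable_interval: "f \<in> borel_measurable borel \<Longrightarrow> f \<in> borel_measurable (interval b)" for f :: "real \<Rightarrow> real"
  by (rule lebesgue_on_measurable_AE[OF Ioo_borel, of f]) auto

lemma pairing_borel:
  assumes S: "S \<in> SI" and \<phi>: "brep {0<..<l} \<phi> \<phi>b"
  shows "pairing l S t \<phi> = (\<integral>x. \<phi>b x * S (x, t) \<partial>lborel)"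
    "(\<lambda>t. \<integral>x. \<phi>b x * S (x, t) \<partial>lborel) \<in> borel_measurable borel"
proof -
  show "pairing l S t \<phi> = (\<integral>x. \<phi>b x * S (x, t) \<partial>lborel)"
    unfolding pairing_def using integral_brep[OF Ioo_borel \<phi> borel_section(1)[OF SI_measurable[OF S]], of t]
    by (simp add: mult.commute)
  have [measurable]: "S \<in> borel_measurable (borel \<Otimes>\<^sub>M borel)" "\<phi>b \<in> borel_measurable borel"
    using SI_measurable[OF S] brep_sq_lborel[OF \<phi>] by (auto simp: borel_prod sq_integrable_def)
  have "(\<lambda>(t, x). \<phi>b x * S (x, t)) \<in> borel_measurable (borel \<Otimes>\<^sub>M lborel)" by measurable
  then show "(\<lambda>t. \<integral>x. \<phi>b x * S (x, t) \<partial>lborel) \<in> borel_measurable borel"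
    by (rule lborel.borel_measurable_lebesgue_integral)
qed

lemma L2_Hminus2_pairing:
  assumes S: "S \<in> SI" shows "L2_Hminus2 l T (pairing l S)"
  unfolding L2_Hminus2_def
proof (intro conjI ballI)
  have S2: "integrable lborel (\<lambda>p. (S p)\<^sup>2)" using S by (simp add: sq_integrable_def)
  have sec: "AE t in interval T. (\<lambda>x. S (x, t)) \<in> SI"
    unfolding AE_lebesgue_on[OF Ioo_borel] using SI_sections(1)[OF S] by eventually_elim simp
  then show "AE t in interval T. pairing l S t \<in> Hminus2 l" by eventually_elim (rule pairing_Hminus2)
  show "(\<lambda>t. pairing l S t \<phi>) \<in> borel_measurable (interval T)" if \<phi>: "\<phi> \<in> H2_0 l" for \<phi>
  proof -
    obtain \<phi>b where b: "brep {0<..<l} \<phi> \<phi>b" using brep_exists1[OF H2_0_sq[OF \<phi>]] by blast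
    show ?thesis unfolding pairing_borel(1)[OF S b] by (rule borel_measurable_interval[OF pairing_borel(2)[OF S b]])
  qed
  have "(\<integral>\<^sup>+t. ennreal ((Hminus2_norm l (pairing l S t))\<^sup>2) \<partial>interval T)
      \<le> (\<integral>\<^sup>+t. ennreal (\<integral>x. (S (x, t))\<^sup>2 \<partial>lborel) \<partial>interval T)"
    using sec by (intro nn_integral_mono_AE) (auto elim!: eventually_mono intro!: ennreal_leI pairing_Hminus2)
  also have "\<dots> = (\<integral>\<^sup>+t. ennreal (\<integral>x. (S (x, t))\<^sup>2 \<partial>lborel) * indicator {0<..<T} t \<partial>lborel)"
    by (subst nn_integral_restrict_space) (auto simp: nn_integral_completion)
  also have "\<dots> \<le> (\<integral>\<^sup>+t. ennreal (\<integral>x. (S (x, t))\<^sup>2 \<partial>lborel) \<partial>lborel)"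
    by (intro nn_integral_mono) (auto simp: indicator_def)
  also have "\<dots> = ennreal (\<integral>t. (\<integral>x. (S (x, t))\<^sup>2 \<partial>lborel) \<partial>lborel)"
    using integrable_lborel2(2)[OF S2] by (intro nn_integral_eq_integral) auto
  also have "\<dots> < \<infinity>" by simp
  finally show "(\<integral>\<^sup>+t. ennreal ((Hminus2_norm l (pairing l S t))\<^sup>2) \<partial>interval T) < \<infinity>" .
qed

text \<open>Apply the adjoint of \<open>J\<close> to the test function: in time it turns the
  derivative of \<psi> into - \<psi> and leaves the factor in x alone.\<close>

lemma has_weak_time_deriv_Hminus2_pairing:
  assumes T: "0 < T" and S: "S \<in> SI" and ut: "ut \<in> SI" "\<And>p. p \<notin> Om l T \<Longrightarrow> ut p = 0"
    and eq: "mk ut = J T (mk S)"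
  shows "has_weak_time_deriv_Hminus2 l T ut (pairing l S)"
  unfolding has_weak_time_deriv_Hminus2_def
proof (intro conjI ballI)
  show "ut \<in> sq_integrable (cylinder l T)" by (rule SI_sq_cylinder[OF ut(1)])
  show "L2_Hminus2 l T (pairing l S)" by (rule L2_Hminus2_pairing[OF S])
  fix \<psi> \<phi> assume \<psi>: "\<psi> \<in> test_functions T" and \<phi>: "\<phi> \<in> H2_0 l"
  obtain \<phi>b where b: "brep {0<..<l} \<phi> \<phi>b" using brep_exists1[OF H2_0_sq[OF \<phi>]] by blast
  note bs = brep_sq_lborel[OF b]
  note kJ = kernel_kJ[OF T]
  let ?h = "\<lambda>p. \<phi>b (fst p) * deriv \<psi> (snd p)"
  let ?h' = "\<lambda>p. \<phi>b (fst p) * \<psi> (snd p)"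
  have h: "?h \<in> SI" "?h' \<in> SI" by (intro SI_tensor bs test_functions_sq[OF \<psi>])+
  have ae: "AE p in lborel. ut p = Kt (kJ T) S p"
    using eq ut S by (simp add: opt_mk[OF kJ] mk_eq_iff Kt_SI[OF kJ])
  have \<psi>0: "deriv \<psi> t = 0" "\<psi> t = 0" if "t \<notin> {0<..<T}" for t using test_functions_bounded[OF \<psi>] that by metis+
  have b0: "\<phi>b x = 0" if "x \<notin> {0<..<l}" for x using b that unfolding brep_def by blast
  have bh: "brep (Om l T) (\<lambda>p. \<phi> (fst p) * deriv \<psi> (snd p)) ?h"
  proof -
    have "?h p = 0" if "p \<notin> Om l T" for p using that \<psi>0(1)[of "snd p"] b0[of "fst p"] by (cases p) (auto simp: Om_def)
    then have "brep (Om l T) ?h ?h" by (intro brep_self h)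
    moreover have "AE x in lborel. x \<in> {0<..<l} \<longrightarrow> \<phi> x = \<phi>b x" using b by (simp add: brep_def AE_lebesgue_on[OF Ioo_borel])
    from AE_fst[OF this] have "AE p in lebesgue_on (Om l T). ?h p = \<phi> (fst p) * deriv \<psi> (snd p)"
      unfolding AE_lebesgue_on[OF Om_borel] by eventually_elim (auto simp: Om_def)
    ultimately show ?thesis by (rule brep_cong)
  qed
  have "(\<integral>(x, t). ut (x, t) * \<phi> x * deriv \<psi> t \<partial>cylinder l T)
      = (\<integral>p. ut p * (\<phi> (fst p) * deriv \<psi> (snd p)) \<partial>lebesgue_on (Om l T))"
    by (simp add: cylinder_Om split_beta' mult.assoc)
  also have "\<dots> = (\<integral>p. ut p * ?h p \<partial>lborel)"
    by (rule integral_brep2[OF Om_borel brep_self[OF ut] bh])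
  also have "\<dots> = (\<integral>p. Kt (kJ T) S p * ?h p \<partial>lborel)"
    using ae ut Kt_SI(1)[OF kJ S] h by (intro integral_cong_AE) (auto simp: sq_integrable_def elim!: eventually_mono)
  also have "\<dots> = (\<integral>p. S p * Kt (\<lambda>t s. kJ T s t) ?h p \<partial>lborel)" by (rule Kt_adjoint[OF kJ S h(1)])
  also have "Kt (\<lambda>t s. kJ T s t) ?h = (\<lambda>p. - ?h' p)"
  proof
    fix p
    have "Kt (\<lambda>t s. kJ T s t) ?h p = (\<integral>s. \<phi>b (fst p) * (kJ T s (snd p) * deriv \<psi> s) \<partial>lborel)"
      unfolding Kt_def by (intro Bochner_Integration.integral_cong) (auto simp: mult_ac)
    also have "\<dots> = \<phi>b (fst p) * - \<psi> (snd p)" by (simp add: integral_deriv_test[OF \<psi> T])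
    finally show "Kt (\<lambda>t s. kJ T s t) ?h p = - ?h' p" by simp
  qed
  also have "(\<integral>p. S p * - ?h' p \<partial>lborel) = - (\<integral>p. S p * ?h' p \<partial>lborel)" by simp
  also have "(\<integral>p. S p * ?h' p \<partial>lborel) = (\<integral>t. (\<integral>x. S (x, t) * (\<phi>b x * \<psi> t) \<partial>lborel) \<partial>lborel)"
    using integrable_lborel2(3)[OF sq_integrable_product[OF S h(2)]] by simp
  also have "\<dots> = (\<integral>t. (\<integral>x. \<phi>b x * S (x, t) \<partial>lborel) * \<psi> t \<partial>lborel)"
    by (subst integral_mult_left_zero[symmetric]) (simp add: mult_ac)
  also have "\<dots> = (\<integral>t. pairing l S t \<phi> * \<psi> t \<partial>interval T)"
    unfolding pairing_borel(1)[OF S b] using pairing_borel(2)[OF S b] test_functions_continuous(3)[OF \<psi>] \<psi>0(2)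
    by (intro integral_lebesgue_on_borel(1)[OF Ioo_borel, symmetric]) auto
  finally show "(\<integral>(x, t). ut (x, t) * \<phi> x * deriv \<psi> t \<partial>cylinder l T) = - (\<integral>t. pairing l S t \<phi> * \<psi> t \<partial>interval T)" .
qed

lemma Kt_outside:
  assumes Q: "\<And>p. p \<notin> Om l T \<Longrightarrow> Q p = 0" and k: "\<And>t s. t \<notin> {0<..<T} \<Longrightarrow> k t s = 0" and p: "p \<notin> Om l T"
  shows "Kt k Q p = 0"
proof -
  obtain x t where xt: "p = (x, t)" by fastforce
  show ?thesis
  proof (cases "t \<in> {0<..<T}")
    case True
    then have "x \<notin> {0<..<l}" using p xt by (auto simp: Om_def)
    then have "Q (x, s) = 0" for s using Q[of "(x, s)"] by (auto simp: Om_def)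
    then show ?thesis by (simp add: Kt_def xt)
  qed (simp add: Kt_def xt k)
qed

lemma opt_uminus: assumes k: "kernel b M k" shows "opt (\<lambda>t s. - k t s) q = - opt k q"
proof -
  obtain f where f: "f \<in> SI" "q = mk f" by (rule l2_cases)
  have "Kt (\<lambda>t s. - k t s) f = (\<lambda>p. - Kt k f p)" by (simp add: Kt_def)
  then show ?thesis using f by (simp add: opt_mk[OF k] opt_mk[OF kernel_uminus[OF k]] mk_uminus Kt_SI[OF k])
qed

section \<open>Weak solutions\<close>

text \<open>Each coefficient is paired with a Borel version whose bounds hold everywhere. The
  operators use the Borel versions, the weak formulation the original ones.\<close>

locale beam =
  fixes l T :: real and \<rho> \<mu> \<tau> r \<kappa> \<rho>b \<mu>b \<tau>b rb \<kappa>b :: "real \<Rightarrow> real" and \<rho>0 \<kappa>0 :: real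
  assumes pos: "0 < l" "0 < T" "0 < \<rho>0" "0 < \<kappa>0"
    and bb: "bounded_borel \<rho>b" "bounded_borel \<mu>b" "bounded_borel \<tau>b" "bounded_borel rb" "bounded_borel \<kappa>b"
    and low: "\<And>x. \<rho>0 \<le> \<rho>b x" "\<And>x. 0 \<le> \<mu>b x" "\<And>x. 0 \<le> \<tau>b x" "\<And>x. 0 \<le> rb x" "\<And>x. \<kappa>0 \<le> \<kappa>b x"
    and coeff: "AE x in interval l. \<rho> x = \<rho>b x" "AE x in interval l. \<mu> x = \<mu>b x" "AE x in interval l. \<tau> x = \<tau>b x"
      "AE x in interval l. r x = rb x" "AE x in interval l. \<kappa> x = \<kappa>b x"
begin

abbreviation "cyl \<equiv> cylinder l T"
abbreviation "e \<equiv> emb l T"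
abbreviation "JJ \<equiv> J T"
abbreviation "SS \<equiv> Js T"
abbreviation "GG \<equiv> G l"
abbreviation "DD \<equiv> D l"

lemmas kJ = kernel_kJ[OF pos(2)]
lemmas kG = kernel_kG[OF pos(1)]
lemmas kD = kernel_kD[OF pos(1)]
lemmas Xo = X_ops[OF pos(1,2)]

lemma linear_ops: "linear JJ" "linear SS" "linear GG" "linear DD" "linear (mulx \<rho>b)" "linear (mulx \<mu>b)"
    "linear (mulx \<tau>b)" "linear (mulx rb)" "linear (mulx \<kappa>b)"
  by (intro bounded_linear.linear bounded_linear_opt[OF kJ] bounded_linear_opt[OF kernel_transpose[OF kJ]]
      bounded_linear_opx[OF kG] bounded_linear_opx[OF kD] bounded_linear_mulx bb)+

lemmas ladd = linear_ops[THEN linear_add]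
lemmas ldiff = linear_ops[THEN linear_diff]
lemmas lneg = linear_ops[THEN linear_neg]

lemma commute: "GG (JJ q) = JJ (GG q)" "GG (SS q) = SS (GG q)" "DD (JJ q) = JJ (DD q)"
  using opx_opt_commute[OF kG kJ] opx_opt_commute[OF kG kernel_transpose[OF kJ]] opx_opt_commute[OF kD kJ] by auto

lemma weak_integral:
  assumes sq: "ut \<in> sq_integrable cyl" "vt \<in> sq_integrable cyl" "v \<in> sq_integrable cyl" "ux \<in> sq_integrable cyl"
    "vx \<in> sq_integrable cyl" "uxx \<in> sq_integrable cyl" "vxx \<in> sq_integrable cyl" "vxxt \<in> sq_integrable cyl"
  shows "(\<integral>(x, t). - \<rho> x * ut (x, t) * vt (x, t) + \<mu> x * ut (x, t) * v (x, t)
                     + \<tau> x * ux (x, t) * vx (x, t) + r x * uxx (x, t) * vxx (x, t)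
                     - \<kappa> x * uxx (x, t) * vxxt (x, t) \<partial>cyl)
    = - inner (mulx \<rho>b (e ut)) (e vt) + inner (mulx \<mu>b (e ut)) (e v) + inner (mulx \<tau>b (e ux)) (e vx)
      + inner (mulx rb (e uxx)) (e vxx) - inner (mulx \<kappa>b (e uxx)) (e vxxt)"
proof -
  note 1 = integral_cylinder_coefficient[OF bb(1) coeff(1) sq(1) sq(2)]
  note 2 = integral_cylinder_coefficient[OF bb(2) coeff(2) sq(1) sq(3)]
  note 3 = integral_cylinder_coefficient[OF bb(3) coeff(3) sq(4) sq(5)]
  note 4 = integral_cylinder_coefficient[OF bb(4) coeff(4) sq(6) sq(7)]
  note 5 = integral_cylinder_coefficient[OF bb(5) coeff(5) sq(6) sq(8)]
  have "(\<integral>(x, t). - \<rho> x * ut (x, t) * vt (x, t) + \<mu> x * ut (x, t) * v (x, t)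
                     + \<tau> x * ux (x, t) * vx (x, t) + r x * uxx (x, t) * vxx (x, t)
                     - \<kappa> x * uxx (x, t) * vxxt (x, t) \<partial>cyl)
    = (\<integral>p. - (\<rho> (fst p) * ut p * vt p) + \<mu> (fst p) * ut p * v p + \<tau> (fst p) * ux p * vx p
        + r (fst p) * uxx p * vxx p - \<kappa> (fst p) * uxx p * vxxt p \<partial>cyl)"
    by (simp add: split_beta')
  then show ?thesis using 1 2 3 4 5 by simp
qed

text \<open>\<open>q\<close> and \<open>w\<close> stand for u_xx and u_t, and \<open>y\<close> for
  v_xxt. As v vanishes at time T, v_xx is - Js y, and v, v_x, v_t follow by applying
  \<open>G\<close> and \<open>D\<close>. The test functions are thus parametrised by one free
  element supported in the cylinder.\<close>

definition weak_form :: "l2 \<Rightarrow> l2 \<Rightarrow> l2 \<Rightarrow> bool" where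
  "weak_form q w F \<longleftrightarrow> (\<forall>y. X l T y = y \<longrightarrow>
     - inner (mulx \<rho>b w) (GG y) + inner (mulx \<mu>b w) (GG (- SS y)) + inner (mulx \<tau>b (DD q)) (DD (- SS y))
      + inner (mulx rb q) (- SS y) - inner (mulx \<kappa>b q) y = inner F (GG (- SS y)))"

lemma end_kernel_T: "end_kernel T T (\<lambda>t s. - kJ T s t)" by (simp add: end_kernel_def)
lemma end_kernel_0: "end_kernel T 0 (kJ T)" by (simp add: end_kernel_def)

text \<open>The vanishing at T is known for v only. It is transferred to v_xx by injectivity of
  \<open>G\<close>, which commutes with integration in time.\<close>

lemma test_function_emb:
  assumes v: "L2_V2 l T v vx vxx" "L2_V2 l T vt vxt vxxt" "has_weak_time_deriv l T v vt" "vanishes_at_time l T v T"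
  shows "e v = GG (- SS (e vxxt))" "e vx = DD (- SS (e vxxt))" "e vxx = - SS (e vxxt)" "e vt = GG (e vxxt)"
proof -
  note 1 = L2_V2_emb[OF pos(1) v(1)] and 2 = L2_V2_emb[OF pos(1) v(2)]
  have sq: "vxx \<in> sq_integrable cyl" "vxxt \<in> sq_integrable cyl" using v by (auto simp: L2_V2_def)
  have "e v = - SS (e vt)"
    using time_deriv_emb[OF pos(1,2) v(3,4) end_kernel_T] opt_uminus[OF kernel_transpose[OF kJ]] by simp
  then have "GG (e vxx + SS (e vxxt)) = 0" by (simp add: 1 2 ladd commute)
  moreover have "X l T (e vxx + SS (e vxxt)) = e vxx + SS (e vxxt)"
    by (simp add: X_add Xo X_emb[OF sq(1)] X_emb[OF sq(2)])
  ultimately have "e vxx + SS (e vxxt) = 0" using G_injective[OF pos(1)] by blast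
  then show "e vxx = - SS (e vxxt)" by (simp add: eq_neg_iff_add_eq_0)
  then show "e v = GG (- SS (e vxxt))" "e vx = DD (- SS (e vxxt))" "e vt = GG (e vxxt)" using 1 2 by simp_all
qed

text \<open>For each \<open>y\<close> an actual admissible test function is built: integrate
  \<open>y\<close> back from time T and apply the Green operator. Its embedded derivatives are those
  in \<open>weak_form\<close>.\<close>

lemma weak_solution_imp_weak_form:
  assumes u: "weak_solution l T \<rho> \<mu> \<tau> r \<kappa> f u" and f: "f \<in> sq_integrable cyl"
  shows "\<exists>q w. X l T q = q \<and> GG q = JJ w \<and> e u = GG q \<and> weak_form q w (e f)"
proof -
  obtain ux uxx ut utt where 1: "L2_V2 l T u ux uxx" "has_weak_time_deriv l T u ut" "vanishes_at_time l T u 0"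
    and weak: "\<And>v vx vxx vt vxt vxxt. L2_V2 l T v vx vxx \<Longrightarrow> L2_V2 l T vt vxt vxxt \<Longrightarrow>
           has_weak_time_deriv l T v vt \<Longrightarrow> vanishes_at_time l T v T \<Longrightarrow>
           (\<integral>(x, t). - \<rho> x * ut (x, t) * vt (x, t) + \<mu> x * ut (x, t) * v (x, t)
                     + \<tau> x * ux (x, t) * vx (x, t) + r x * uxx (x, t) * vxx (x, t)
                     - \<kappa> x * uxx (x, t) * vxxt (x, t) \<partial>cyl)
             = (\<integral>(x, t). f (x, t) * v (x, t) \<partial>cyl)"
    using u unfolding weak_solution_def by (elim exE conjE) (rule that, assumption+, blast)
  have sq: "ux \<in> sq_integrable cyl" "uxx \<in> sq_integrable cyl" "ut \<in> sq_integrable cyl"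
    using 1 by (auto simp: L2_V2_def has_weak_time_deriv_def)
  note E = L2_V2_emb[OF pos(1) 1(1)]
  have "weak_form (e uxx) (e ut) (e f)" unfolding weak_form_def
  proof (intro allI impI)
    fix y assume y: "X l T y = y"
    obtain Y where Y: "Y \<in> SI" "\<And>p. p \<notin> Om l T \<Longrightarrow> Y p = 0" "y = mk Y" "e Y = y" using X_obtain[of l T y] y by metis
    \<comment> \<open>Minus the integral from t to T: the primitive in time that vanishes at
      T.\<close>
    define k where "k = (\<lambda>t s. - kJ T s t)"
    have kk: "end_kernel T T k" "kernel T 1 k" using end_kernel_T end_kernel(1)[OF end_kernel_T pos(2)] by (auto simp: k_def)
    define P where "P = Kt k Y"
    have P: "P \<in> SI" unfolding P_def by (rule Kt_SI(1)[OF kk(2) Y(1)])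
    have v: "L2_V2 l T (Kx (kG l) P) (Kx (kD l) P) P" "L2_V2 l T (Kx (kG l) Y) (Kx (kD l) Y) Y"
      by (intro L2_V2_Kx pos P Y)+
    have vv: "Kx (kG l) P = Kt k (Kx (kG l) Y)" unfolding P_def by (rule Kx_Kt_commute[OF kG kk(2) Y(1)])
    have GY: "Kx (kG l) Y \<in> SI" by (rule Kx_SI(1)[OF kG Y(1)])
    have t: "has_weak_time_deriv l T (Kx (kG l) P) (Kx (kG l) Y)" "vanishes_at_time l T (Kx (kG l) P) T"
      unfolding vv by (intro has_weak_time_deriv_Kt[OF pos(2) kk(1) GY] vanishes_Kt[OF pos(2) kk(1) GY])+
    have sqv: "Kx (kG l) P \<in> sq_integrable cyl" "Kx (kD l) P \<in> sq_integrable cyl" "P \<in> sq_integrable cyl"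
      "Kx (kG l) Y \<in> sq_integrable cyl" "Y \<in> sq_integrable cyl" using v by (auto simp: L2_V2_def)
    note te = test_function_emb[OF v t, unfolded Y(4)]
    have "(\<integral>(x, t). f (x, t) * Kx (kG l) P (x, t) \<partial>cyl) = inner (e f) (e (Kx (kG l) P))"
      using integral_cylinder[OF f sqv(1)] by (simp add: split_beta')
    then show "- inner (mulx \<rho>b (e ut)) (GG y) + inner (mulx \<mu>b (e ut)) (GG (- SS y)) + inner (mulx \<tau>b (DD (e uxx))) (DD (- SS y))
      + inner (mulx rb (e uxx)) (- SS y) - inner (mulx \<kappa>b (e uxx)) y = inner (e f) (GG (- SS y))"
      using weak[OF v t] weak_integral[OF sq(3) sqv(4) sqv(1) sq(1) sqv(2) sq(2) sqv(3) sqv(5)]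
      unfolding te Y(4) E(2) by simp
  qed
  moreover have "GG (e uxx) = JJ (e ut)" using time_deriv_emb[OF pos(1,2) 1(2,3) end_kernel_0] E by simp
  moreover have "X l T (e uxx) = e uxx" by (rule X_emb[OF sq(2)])
  ultimately show ?thesis using E by blast
qed

lemma evolution: "\<exists>R1. evolution JJ SS GG (Gt l) (mulx \<rho>b) (mulx \<mu>b) (\<lambda>a. mulx rb a + Dt l (mulx \<tau>b (DD a))) (mulx \<kappa>b) T \<rho>0 R1 \<kappa>0"
  by (intro evolution_l2 pos bb low)

lemma R_inner: "inner (mulx rb a + Dt l (mulx \<tau>b (DD a))) z = inner (mulx rb a) z + inner (mulx \<tau>b (DD a)) (DD z)"
  using opx_adjoint[OF kernel_transpose[OF kD]] by (simp add: inner_simps)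

text \<open>Both solutions satisfy the same operator equation, which is linear, so the abstract
  \<open>uniqueness\<close> applies to the difference of the second space derivatives.\<close>

lemma weak_solution_unique:
  assumes u: "weak_solution l T \<rho> \<mu> \<tau> r \<kappa> f u" "weak_solution l T \<rho> \<mu> \<tau> r \<kappa> f u'" and f: "f \<in> sq_integrable cyl"
  shows "e u = e u'"
proof -
  obtain q w where 1: "X l T q = q" "GG q = JJ w" "e u = GG q" "weak_form q w (e f)"
    using weak_solution_imp_weak_form[OF u(1) f] by blast
  obtain q' w' where 2: "X l T q' = q'" "GG q' = JJ w'" "e u' = GG q'" "weak_form q' w' (e f)"
    using weak_solution_imp_weak_form[OF u(2) f] by blast
  obtain R1 where "evolution JJ SS GG (Gt l) (mulx \<rho>b) (mulx \<mu>b) (\<lambda>a. mulx rb a + Dt l (mulx \<tau>b (DD a))) (mulx \<kappa>b) T \<rho>0 R1 \<kappa>0"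
    using evolution by blast
  then interpret evolution JJ SS GG "Gt l" "mulx \<rho>b" "mulx \<mu>b" "\<lambda>a. mulx rb a + Dt l (mulx \<tau>b (DD a))" "mulx \<kappa>b" T \<rho>0 R1 \<kappa>0 .
  have "q - q' = 0"
  proof (rule uniqueness)
    show "GG (q - q') = JJ (w - w')" using 1 2 by (simp add: ldiff)
    \<comment> \<open>The test element y = - (q - q') makes v_xx equal to Js (q - q'), as
      \<open>uniqueness\<close> expects.\<close>
    have X: "X l T (- (q - q')) = - (q - q')" using 1(1) 2(1) by (simp only: X_uminus X_diff)
    show "- inner (mulx \<rho>b (w - w')) (GG (- (q - q'))) + inner (mulx \<mu>b (w - w')) (GG (SS (q - q')))
        + inner (mulx rb (q - q') + Dt l (mulx \<tau>b (DD (q - q')))) (SS (q - q')) - inner (mulx \<kappa>b (q - q')) (- (q - q')) = 0"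
      using 1(4)[unfolded weak_form_def, rule_format, OF X] 2(4)[unfolded weak_form_def, rule_format, OF X]
      unfolding R_inner linear_ops(2)[THEN linear_neg] minus_minus
      unfolding linear_ops(4-9)[THEN linear_diff, of q q'] linear_ops(4-9)[THEN linear_diff, of w w'] linear_ops(7)[THEN linear_diff] inner_diff_left
      by linarith
    show "SS (GG a) = GG (SS a)" for a by (simp add: commute)
  qed
  then show ?thesis using 1(3) 2(3) by simp
qed

text \<open>In \<open>existence\<close> the unknowns are u_xxt and u_tt and every z is allowed. For
  z = - Js y, moving the time integration to the other factor turns u_tt into u_t and u_xxt into
  u_xx, with the signs of the weak form.\<close>

lemma weak_form_solvable:
  "\<exists>C\<ge>0. \<forall>F. X l T F = F \<longrightarrow> (\<exists>q s. X l T q = q \<and> X l T s = s \<and> GG q = JJ s \<and> norm q \<le> C * norm F \<and>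
     weak_form (JJ q) (GG q) F)"
proof -
  obtain R1 where "evolution JJ SS GG (Gt l) (mulx \<rho>b) (mulx \<mu>b) (\<lambda>a. mulx rb a + Dt l (mulx \<tau>b (DD a))) (mulx \<kappa>b) T \<rho>0 R1 \<kappa>0"
    using evolution by blast
  then interpret evolution JJ SS GG "Gt l" "mulx \<rho>b" "mulx \<mu>b" "\<lambda>a. mulx rb a + Dt l (mulx \<tau>b (DD a))" "mulx \<kappa>b" T \<rho>0 R1 \<kappa>0 .
  have "\<exists>q s. X l T q = q \<and> X l T s = s \<and> GG q = JJ s \<and> norm q \<le> \<bar>c1\<bar> * norm F \<and> weak_form (JJ q) (GG q) F"
    if F: "X l T F = F" for F
  proof -
    obtain q s where qs: "GG q = JJ s" "norm q \<le> c1 * norm F"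
      "\<And>z. inner (mulx \<rho>b s + mulx \<mu>b (GG q)) (GG z) + inner (mulx rb (JJ q) + Dt l (mulx \<tau>b (DD (JJ q))) + mulx \<kappa>b q) z = inner F (GG z)"
      using existence[of F] by blast
    \<comment> \<open>The abstract solution lives on the whole plane. Cutting it to the cylinder
      keeps the constraint, since \<open>X\<close> commutes with \<open>G\<close> and
      \<open>J\<close>, and does not increase the norm.\<close>
    let ?q = "X l T q" and ?s = "X l T s"
    have eq: "GG ?q = JJ ?s" using qs(1) by (simp add: Xo[symmetric])
    have n: "norm ?q \<le> \<bar>c1\<bar> * norm F"
    proof -
      have "norm ?q \<le> c1 * norm F" using qs(2) X_norm[of l T q] by linarith
      also have "\<dots> \<le> \<bar>c1\<bar> * norm F" by (intro mult_right_mono) auto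
      finally show ?thesis .
    qed
    have "weak_form (JJ ?q) (GG ?q) F" unfolding weak_form_def
    proof (intro allI impI)
      fix y assume y: "X l T y = y"
      define z where "z = - SS y"
      have z: "X l T z = z" using y by (simp add: z_def X_uminus Xo)
      have Gz: "X l T (GG z) = GG z" "X l T (DD z) = DD z" using z by (simp_all add: Xo)
      \<comment> \<open>Tests supported in the cylinder cannot distinguish an element from its
        projection.\<close>
      have m: "inner (mulx m (X l T a)) b = inner (mulx m a) b" if "X l T b = b" "bounded_borel m" for m a b
        using X_self[of l T "mulx m a" b] that by (simp add: X_mulx[symmetric])
      have "inner (mulx \<rho>b ?s) (GG z) + inner (mulx \<mu>b (GG ?q)) (GG z) + inner (mulx rb (JJ ?q)) z
          + inner (mulx \<tau>b (DD (JJ ?q))) (DD z) + inner (mulx \<kappa>b ?q) z = inner F (GG z)"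
        using qs(3)[of z] unfolding Xo[symmetric] by (simp add: m[OF Gz(1)] m[OF Gz(2)] m[OF z] bb inner_add_left R_inner[unfolded inner_add_left])
      moreover have "inner (mulx \<rho>b ?s) (GG z) = - inner (mulx \<rho>b (GG ?q)) (GG y)"
      proof -
        have "inner (mulx \<rho>b ?s) (GG z) = - inner (mulx \<rho>b ?s) (SS (GG y))" by (simp add: z_def lneg commute)
        also have "\<dots> = - inner (JJ (mulx \<rho>b ?s)) (GG y)" using opt_adjoint[OF kJ] by simp
        also have "\<dots> = - inner (mulx \<rho>b (GG ?q)) (GG y)" by (simp add: mulx_opt_commute[OF bb(1) kJ] eq)
        finally show ?thesis .
      qed
      moreover have "inner (mulx \<kappa>b ?q) z = - inner (mulx \<kappa>b (JJ ?q)) y"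
      proof -
        have "inner (mulx \<kappa>b ?q) z = - inner (JJ (mulx \<kappa>b ?q)) y" using opt_adjoint[OF kJ] by (simp add: z_def)
        then show ?thesis by (simp add: mulx_opt_commute[OF bb(5) kJ])
      qed
      ultimately show "- inner (mulx \<rho>b (GG ?q)) (GG y) + inner (mulx \<mu>b (GG ?q)) (GG (- SS y)) + inner (mulx \<tau>b (DD (JJ ?q))) (DD (- SS y))
        + inner (mulx rb (JJ ?q)) (- SS y) - inner (mulx \<kappa>b (JJ ?q)) y = inner F (GG (- SS y))"
        unfolding z_def by linarith
    qed
    then show ?thesis using eq n X_idem by blast
  qed
  then show ?thesis by (intro exI[of _ "\<bar>c1\<bar>"]) auto
qed

text \<open>\<open>u\<close> is any function that agrees almost everywhere with the explicit
  formula, because the output operator works with the representative chosen by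
  \<open>L2_rep\<close>. The explicit spatial derivative is kept for reading off the slope.\<close>

lemma weak_solution_construct:
  assumes f: "f \<in> sq_integrable cyl" and Q: "Q \<in> SI" "\<And>p. p \<notin> Om l T \<Longrightarrow> Q p = 0" and S: "S \<in> SI"
    and eq: "GG (mk Q) = JJ (mk S)" and weak: "weak_form (JJ (mk Q)) (GG (mk Q)) (e f)"
    and u: "u \<in> sq_integrable cyl" "AE p in cyl. Kx (kG l) (Kt (kJ T) Q) p = u p"
  shows "weak_solution l T \<rho> \<mu> \<tau> r \<kappa> f u"
    "AE t in interval T. has_weak_deriv l (\<lambda>x. u (x, t)) (\<lambda>x. Kx (kD l) (Kt (kJ T) Q) (x, t))"
proof -
  define P where "P = Kt (kJ T) Q"
  have P: "P \<in> SI" unfolding P_def by (rule Kt_SI(1)[OF kJ Q(1)])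
  have P0: "\<And>p. p \<notin> Om l T \<Longrightarrow> P p = 0"
    unfolding P_def by (rule Kt_outside[OF Q(2)]) (auto simp: kJ_def)
  have GQ: "Kx (kG l) Q \<in> SI" by (rule Kx_SI(1)[OF kG Q(1)])
  have GQ0: "\<And>p. p \<notin> Om l T \<Longrightarrow> Kx (kG l) Q p = 0" by (rule Kx_kG_outside[OF Q])
  have vv: "Kx (kG l) P = Kt (kJ T) (Kx (kG l) Q)" unfolding P_def by (rule Kx_Kt_commute[OF kG kJ Q(1)])
  have V: "L2_V2 l T u (Kx (kD l) P) P"
    by (rule L2_V2_cong[OF L2_V2_Kx[OF pos(1) P] u(1)]) (use u(2) P_def in simp)
  then show "AE t in interval T. has_weak_deriv l (\<lambda>x. u (x, t)) (\<lambda>x. Kx (kD l) (Kt (kJ T) Q) (x, t))"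
    unfolding P_def[symmetric] L2_V2_def by (auto elim: eventually_mono)
  have W: "has_weak_time_deriv l T u (Kx (kG l) Q)"
    by (rule has_weak_time_deriv_cong[OF has_weak_time_deriv_Kt[OF pos(2) end_kernel_0 GQ] _ u(1)])
      (use u(2) vv P_def in simp)
  have Z: "vanishes_at_time l T u 0"
    by (rule vanishes_cong[OF vanishes_Kt[OF pos(2) end_kernel_0 GQ]]) (use u(2) vv P_def in simp)
  have H: "has_weak_time_deriv_Hminus2 l T (Kx (kG l) Q) (pairing l S)"
  proof (intro has_weak_time_deriv_Hminus2_pairing pos S GQ GQ0)
    show "mk (Kx (kG l) Q) = JJ (mk S)" using eq unfolding opx_mk[OF kG Q(1)] .
  qed
  have emb: "e P = JJ (mk Q)" "e (Kx (kG l) Q) = GG (mk Q)"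
    using emb_eq[OF brep_self[OF P P0]] emb_eq[OF brep_self[OF GQ GQ0]] Q
    by (simp_all add: P_def opt_mk[OF kJ] opx_mk[OF kG])
  have sq: "Kx (kD l) P \<in> sq_integrable cyl" "P \<in> sq_integrable cyl" "Kx (kG l) Q \<in> sq_integrable cyl"
    using V W by (auto simp: L2_V2_def has_weak_time_deriv_def)
  have I: "(\<integral>(x, t). - \<rho> x * Kx (kG l) Q (x, t) * vt (x, t) + \<mu> x * Kx (kG l) Q (x, t) * v (x, t)
                     + \<tau> x * Kx (kD l) P (x, t) * vx (x, t) + r x * P (x, t) * vxx (x, t)
                     - \<kappa> x * P (x, t) * vxxt (x, t) \<partial>cyl) = (\<integral>(x, t). f (x, t) * v (x, t) \<partial>cyl)"
    if v: "L2_V2 l T v vx vxx" "L2_V2 l T vt vxt vxxt" "has_weak_time_deriv l T v vt" "vanishes_at_time l T v T"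
    for v vx vxx vt vxt vxxt
  proof -
    have sqv: "v \<in> sq_integrable cyl" "vx \<in> sq_integrable cyl" "vxx \<in> sq_integrable cyl" "vt \<in> sq_integrable cyl" "vxxt \<in> sq_integrable cyl"
      using v by (auto simp: L2_V2_def)
    have "(\<integral>(x, t). f (x, t) * v (x, t) \<partial>cyl) = inner (e f) (e v)"
      using integral_cylinder[OF f sqv(1)] by (simp add: split_beta')
    then show ?thesis
      using weak[unfolded weak_form_def, rule_format, OF X_emb[OF sqv(5)]]
      unfolding weak_integral[OF sq(3) sqv(4) sqv(1) sq(1) sqv(2) sq(2) sqv(3) sqv(5)]
        test_function_emb[OF v] L2_V2_emb(2)[OF pos(1) V] emb by simp
  qed
  show "weak_solution l T \<rho> \<mu> \<tau> r \<kappa> f u" unfolding weak_solution_def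
    using V W H Z I by blast
qed

text \<open>With the explicit solution, u_x(p,t) is the time primitive of u_xt(p,t), and evaluating
  \<open>D\<close> at a point is bounded on L2(0,l) with squared norm at most l. So the bound on
  u_xxt by the load passes to the slope.\<close>

theorem well_posed:
  "\<exists>C\<ge>0. \<forall>F\<in>mspace (L2 cyl). (\<exists>!u. is_solution l T \<rho> \<mu> \<tau> r \<kappa> F u) \<and>
    (\<forall>p\<in>{0..l}. \<exists>g\<in>SI. (\<integral>s. (g s)\<^sup>2 \<partial>lborel) \<le> C * (L2_norm cyl F)\<^sup>2 \<and>
      slope_output l T \<rho> \<mu> \<tau> r \<kappa> p F = L2_class (interval T) (Kj T g))"
proof -
  obtain C where C: "0 \<le> C" "\<And>F. X l T F = F \<Longrightarrow> (\<exists>q s. X l T q = q \<and> X l T s = s \<and> GG q = JJ s \<and> norm q \<le> C * norm F \<and>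
     weak_form (JJ q) (GG q) F)" using weak_form_solvable by blast
  have "(\<exists>!u. is_solution l T \<rho> \<mu> \<tau> r \<kappa> F u) \<and>
    (\<forall>p\<in>{0..l}. \<exists>g\<in>SI. (\<integral>s. (g s)\<^sup>2 \<partial>lborel) \<le> l * C\<^sup>2 * (L2_norm cyl F)\<^sup>2 \<and>
      slope_output l T \<rho> \<mu> \<tau> r \<kappa> p F = L2_class (interval T) (Kj T g))" if F: "F \<in> mspace (L2 cyl)" for F
  proof -
    define f where "f = L2_rep F"
    have f: "f \<in> sq_integrable cyl" using L2_rep_in(1) F by (simp add: mspace_L2 f_def)
    have nf: "(norm (e f))\<^sup>2 = (L2_norm cyl F)\<^sup>2"
    proof -
      have "(L2_norm cyl F)\<^sup>2 = (\<integral>p. f p * f p \<partial>cyl)"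
        unfolding L2_norm_def f_def[symmetric] by (subst real_sqrt_pow2) (simp_all add: power2_eq_square)
      then show ?thesis unfolding power2_norm_eq_inner integral_cylinder[OF f f] by simp
    qed
    obtain q s where qs: "X l T q = q" "X l T s = s" "GG q = JJ s" "norm q \<le> C * norm (e f)" "weak_form (JJ q) (GG q) (e f)"
      using C(2)[OF X_emb[OF f]] by blast
    obtain Q where Q: "Q \<in> SI" "\<And>p. p \<notin> Om l T \<Longrightarrow> Q p = 0" "q = mk Q" using X_obtain[of l T q] qs(1) by metis
    obtain S where S: "S \<in> SI" "s = mk S" using l2_cases by blast
    define u0 where "u0 = Kx (kG l) (Kt (kJ T) Q)"
    have u0: "u0 \<in> sq_integrable cyl" unfolding u0_def by (intro SI_sq_cylinder Kx_SI(1)[OF kG] Kt_SI(1)[OF kJ] Q)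
    define U where "U = L2_class cyl u0"
    have U: "U \<in> mspace (L2 cyl)" unfolding U_def by (rule L2_class_mspace[OF u0])
    define u where "u = L2_rep U"
    have u: "u \<in> sq_integrable cyl" "AE p in cyl. u0 p = u p"
      using L2_rep_class[OF u0] by (auto simp: u_def U_def elim: eventually_mono)
    have ws: "weak_solution l T \<rho> \<mu> \<tau> r \<kappa> f u"
      "AE t in interval T. has_weak_deriv l (\<lambda>x. u (x, t)) (\<lambda>x. Kx (kD l) (Kt (kJ T) Q) (x, t))"
      by (rule weak_solution_construct[OF f Q(1,2) S(1) qs(3)[unfolded Q(3) S(2)] qs(5)[unfolded Q(3)] u(1) u(2)[unfolded u0_def]],
          assumption)+
    have sol: "is_solution l T \<rho> \<mu> \<tau> r \<kappa> F U" using ws(1) U by (simp add: is_solution_def f_def u_def)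
    have uniq: "U' = U" if "is_solution l T \<rho> \<mu> \<tau> r \<kappa> F U'" for U'
    proof -
      have U': "U' \<in> mspace (L2 cyl)" "weak_solution l T \<rho> \<mu> \<tau> r \<kappa> f (L2_rep U')"
        using that by (auto simp: is_solution_def f_def)
      note r = L2_rep_in[OF U'(1)[unfolded mspace_L2]]
      have "e (L2_rep U') = e u" by (rule weak_solution_unique[OF U'(2) ws(1) f])
      then have "AE p in cyl. L2_rep U' p = u p" using emb_eq_iff[OF r(1) u(1)] by simp
      then have "L2_class cyl (L2_rep U') = L2_class cyl u" using L2_class_eq_iff[OF r(1) u(1)] by simp
      also have "L2_class cyl u = U" unfolding u_def by (rule L2_rep_in(2)[OF U[unfolded mspace_L2]])
      finally show ?thesis using r(2) by simp
    qed
    have solU: "solution l T \<rho> \<mu> \<tau> r \<kappa> F = U" unfolding solution_def using sol uniq by (rule the_equality)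
    have slope: "\<exists>g\<in>SI. (\<integral>s. (g s)\<^sup>2 \<partial>lborel) \<le> l * C\<^sup>2 * (L2_norm cyl F)\<^sup>2 \<and>
        slope_output l T \<rho> \<mu> \<tau> r \<kappa> p F = L2_class (interval T) (Kj T g)" if p: "p \<in> {0..l}" for p
    proof -
      \<comment> \<open>The trace u_xt(p,s), meaningful for every \<open>p\<close> in the closed
        interval because the kernel has a row there.\<close>
      define g where "g s = Kx (kD l) Q (p, s)" for s
      have gm: "g \<in> borel_measurable borel" unfolding g_def by (rule borel_section(2)[OF Kx_measurable[OF kD SI_measurable[OF Q(1)]]])
      have Q2: "integrable lborel (\<lambda>p. (Q p)\<^sup>2)" using Q(1) by (simp add: sq_integrable_def)
      have gb: "AE s in lborel. (g s)\<^sup>2 \<le> l * (\<integral>y. (Q (y, s))\<^sup>2 \<partial>lborel)"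
        using SI_sections(1)[OF Q(1)]
      proof eventually_elim
        case (elim s)
        have "(g s)\<^sup>2 \<le> 1\<^sup>2 * l * (\<integral>y. (Q (y, s))\<^sup>2 \<partial>lborel) * indicator {0..l} p"
          unfolding g_def Kx_def using kernel_apply_bound[OF kD elim, of p] by simp
        then show ?case using p by simp
      qed
      have gi: "integrable lborel (\<lambda>s. (g s)\<^sup>2)"
      proof (rule Bochner_Integration.integrable_bound[of lborel "\<lambda>s. l * (\<integral>y. (Q (y, s))\<^sup>2 \<partial>lborel)"])
        show "integrable lborel (\<lambda>s. l * (\<integral>y. (Q (y, s))\<^sup>2 \<partial>lborel))" using integrable_lborel2(2)[OF Q2] by simp
        show "AE s in lborel. norm ((g s)\<^sup>2) \<le> norm (l * (\<integral>y. (Q (y, s))\<^sup>2 \<partial>lborel))"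
          using gb by eventually_elim (use pos in simp)
      qed (use gm in simp)
      have g: "g \<in> SI" using gm gi by (simp add: sq_integrable_def)
      have "(\<integral>s. (g s)\<^sup>2 \<partial>lborel) \<le> (\<integral>s. l * (\<integral>y. (Q (y, s))\<^sup>2 \<partial>lborel) \<partial>lborel)"
        using gi gb integrable_lborel2(2)[OF Q2] by (intro integral_mono_AE) auto
      also have "\<dots> = l * (norm q)\<^sup>2" using integrable_lborel2(3)[OF Q2] Q by (simp add: norm_mk)
      also have "\<dots> \<le> l * (C * norm (e f))\<^sup>2" using qs(4) pos by (intro mult_left_mono power_mono) auto
      also have "\<dots> = l * C\<^sup>2 * (L2_norm cyl F)\<^sup>2" by (simp add: power_mult_distrib nf)
      finally have le: "(\<integral>s. (g s)\<^sup>2 \<partial>lborel) \<le> l * C\<^sup>2 * (L2_norm cyl F)\<^sup>2" .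
      let ?b = "\<lambda>t. boundary_value l (weak_deriv l (\<lambda>x. u (x, t))) p"
      have "AE t in interval T. (\<lambda>x. Kt (kJ T) Q (x, t)) \<in> SI"
        unfolding AE_lebesgue_on[OF Ioo_borel] using SI_sections(1)[OF Kt_SI(1)[OF kJ Q(1)]] by eventually_elim simp
      then have ae: "AE t in interval T. ?b t = Kj T g t" using ws(2)
      proof eventually_elim
        case (elim t)
        let ?P = "\<lambda>x. Kt (kJ T) Q (x, t)"
        have "has_weak_deriv l (\<lambda>x. u (x, t)) (weak_deriv l (\<lambda>x. u (x, t)))"
          unfolding weak_deriv_def by (rule someI[where P = "\<lambda>g. has_weak_deriv l (\<lambda>x. u (x, t)) g"]) (rule elim(2))
        from has_weak_deriv_unique[OF elim(2) this]
        have "AE x in interval l. Kd l ?P x = weak_deriv l (\<lambda>x. u (x, t)) x" by (simp add: Kx_def)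
        then have "?b t = Kd l ?P p" by (intro boundary_value_eq Kd_continuous[OF pos(1) elim(1)] pos p)
        also have "\<dots> = Kx (kD l) (Kt (kJ T) Q) (p, t)" by (simp add: Kx_def)
        \<comment> \<open>Interchanging slope and time integration at the fixed point
          \<open>p\<close> uses that the operators commute pointwise.\<close>
        also have "\<dots> = Kt (kJ T) (Kx (kD l) Q) (p, t)" by (simp only: Kx_Kt_commute[OF kD kJ Q(1)])
        also have "\<dots> = Kj T g t" by (simp add: Kt_def g_def)
        finally show ?case .
      qed
      have Kj: "Kj T g \<in> sq_integrable (interval T)" by (rule Kj_sq_interval[OF pos(2) g])
      have "Kj T g \<in> borel_measurable borel" by (rule kernel_apply_measurable1[OF kJ gm])
      from lebesgue_on_measurable_AE[OF Ioo_borel this ae]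
      have "?b \<in> sq_integrable (interval T)"
        by (rule sq_integrable_cong_AE[OF Kj]) (use ae in \<open>auto elim: eventually_mono\<close>)
      then have "L2_class (interval T) ?b = L2_class (interval T) (Kj T g)" using Kj ae by (simp add: L2_class_eq_iff)
      then show ?thesis using g le by (auto simp: slope_output_def solU u_def)
    qed
    show ?thesis using sol uniq slope by blast
  qed
  then show ?thesis using C(1) pos by (intro exI[of _ "l * C\<^sup>2"]) auto
qed

end

text \<open>Unique solvability is part of the claim because \<open>solution\<close> is a definite
  description and is meaningful only then. Compactness follows since the outputs of all admissible
  loads are primitives of functions from one ball in L2.\<close>

theorem lemma1:
  fixes l T C\<^sub>F :: real
    and \<rho>\<^sub>A \<mu> T\<^sub>r r \<kappa> :: "real \<Rightarrow> real"
    and \<rho>\<^sub>0 \<rho>\<^sub>1 \<mu>\<^sub>0 \<mu>\<^sub>1 T\<^sub>r\<^sub>0 T\<^sub>r\<^sub>1 r\<^sub>0 r\<^sub>1 \<kappa>\<^sub>0 \<kappa>\<^sub>1 :: real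
  assumes "l > 0" "T > 0" "C\<^sub>F > 0"
    and "\<rho>\<^sub>A \<in> Linf (interval l)" "\<mu> \<in> Linf (interval l)" "T\<^sub>r \<in> Linf (interval l)"
      "r \<in> Linf (interval l)" "\<kappa> \<in> Linf (interval l)"
    and "0 < \<rho>\<^sub>0" "AE x in interval l. \<rho>\<^sub>0 \<le> \<rho>\<^sub>A x \<and> \<rho>\<^sub>A x \<le> \<rho>\<^sub>1"
    and "0 \<le> T\<^sub>r\<^sub>0" "AE x in interval l. T\<^sub>r\<^sub>0 \<le> T\<^sub>r x \<and> T\<^sub>r x \<le> T\<^sub>r\<^sub>1"
    and "0 < r\<^sub>0" "AE x in interval l. r\<^sub>0 \<le> r x \<and> r x \<le> r\<^sub>1"
    and "0 \<le> \<mu>\<^sub>0" "AE x in interval l. \<mu>\<^sub>0 \<le> \<mu> x \<and> \<mu> x \<le> \<mu>\<^sub>1"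
    and "0 < \<kappa>\<^sub>0" "AE x in interval l. \<kappa>\<^sub>0 \<le> \<kappa> x \<and> \<kappa> x \<le> \<kappa>\<^sub>1"
  shows "(\<forall>F \<in> admissible_loads l T C\<^sub>F. \<exists>!u. is_solution l T \<rho>\<^sub>A \<mu> T\<^sub>r r \<kappa> F u) \<and>
    compact_operator (L2 (cylinder l T)) (L2 (interval T)) (admissible_loads l T C\<^sub>F)
      (slope_output l T \<rho>\<^sub>A \<mu> T\<^sub>r r \<kappa> 0) \<and>
    compact_operator (L2 (cylinder l T)) (L2 (interval T)) (admissible_loads l T C\<^sub>F)
      (slope_output l T \<rho>\<^sub>A \<mu> T\<^sub>r r \<kappa> l)"
proof -
  obtain \<rho>b where \<rho>b: "bounded_borel \<rho>b" "\<And>x. \<rho>\<^sub>0 \<le> \<rho>b x" "AE x in interval l. \<rho>\<^sub>A x = \<rho>b x"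
    using borel_coefficient[OF assms(4,10)] by blast
  obtain \<mu>b where \<mu>b: "bounded_borel \<mu>b" "\<And>x. \<mu>\<^sub>0 \<le> \<mu>b x" "AE x in interval l. \<mu> x = \<mu>b x"
    using borel_coefficient[OF assms(5,16)] by blast
  obtain \<tau>b where \<tau>b: "bounded_borel \<tau>b" "\<And>x. T\<^sub>r\<^sub>0 \<le> \<tau>b x" "AE x in interval l. T\<^sub>r x = \<tau>b x"
    using borel_coefficient[OF assms(6,12)] by blast
  obtain rb where rb: "bounded_borel rb" "\<And>x. r\<^sub>0 \<le> rb x" "AE x in interval l. r x = rb x"
    using borel_coefficient[OF assms(7,14)] by blast
  obtain \<kappa>b where \<kappa>b: "bounded_borel \<kappa>b" "\<And>x. \<kappa>\<^sub>0 \<le> \<kappa>b x" "AE x in interval l. \<kappa> x = \<kappa>b x"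
    using borel_coefficient[OF assms(8,18)] by blast
  interpret beam l T \<rho>\<^sub>A \<mu> T\<^sub>r r \<kappa> \<rho>b \<mu>b \<tau>b rb \<kappa>b \<rho>\<^sub>0 \<kappa>\<^sub>0
  proof (rule beam.intro)
    show "0 \<le> \<mu>b x" "0 \<le> \<tau>b x" "0 \<le> rb x" for x
      using \<mu>b(2)[of x] \<tau>b(2)[of x] rb(2)[of x] assms(11,13,15) by linarith+
  qed (fact assms \<rho>b \<mu>b \<tau>b rb \<kappa>b)+
  from well_posed obtain C where C0: "0 \<le> C" and C1: "\<forall>F\<in>mspace (L2 (cylinder l T)).
    (\<exists>!u. is_solution l T \<rho>\<^sub>A \<mu> T\<^sub>r r \<kappa> F u) \<and>
    (\<forall>p\<in>{0..l}. \<exists>g\<in>SI. (\<integral>s. (g s)\<^sup>2 \<partial>lborel) \<le> C * (L2_norm (cylinder l T) F)\<^sup>2 \<and>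
      slope_output l T \<rho>\<^sub>A \<mu> T\<^sub>r r \<kappa> p F = L2_class (interval T) (Kj T g))" by (elim exE conjE)
  have C2: "\<exists>!u. is_solution l T \<rho>\<^sub>A \<mu> T\<^sub>r r \<kappa> F u" if "F \<in> mspace (L2 (cylinder l T))" for F
    by (rule conjunct1[OF bspec[OF C1 that]])
  have C3: "\<exists>g\<in>SI. (\<integral>s. (g s)\<^sup>2 \<partial>lborel) \<le> C * (L2_norm (cylinder l T) F)\<^sup>2 \<and>
      slope_output l T \<rho>\<^sub>A \<mu> T\<^sub>r r \<kappa> p F = L2_class (interval T) (Kj T g)"
    if "F \<in> mspace (L2 (cylinder l T))" "p \<in> {0..l}" for F p
    by (rule bspec[OF conjunct2[OF bspec[OF C1 that(1)]] that(2)])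
  have sub: "admissible_loads l T C\<^sub>F \<subseteq> mspace (L2 (cylinder l T))" by (auto simp: admissible_loads_def)
  have compact: "compact_operator (L2 (cylinder l T)) (L2 (interval T)) (admissible_loads l T C\<^sub>F)
      (slope_output l T \<rho>\<^sub>A \<mu> T\<^sub>r r \<kappa> p)" if p: "p \<in> {0..l}" for p
  proof -
    \<comment> \<open>The bound is the same for all admissible loads, so every subset of them is
      covered by one application of \<open>primitives_relatively_compact\<close>.\<close>
    have out: "\<exists>g\<in>SI. (\<integral>s. (g s)\<^sup>2 \<partial>lborel) \<le> C * C\<^sub>F \<and>
        slope_output l T \<rho>\<^sub>A \<mu> T\<^sub>r r \<kappa> p F = L2_class (interval T) (Kj T g)" if F: "F \<in> admissible_loads l T C\<^sub>F" for F
    proof -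
      have "C * (L2_norm (cylinder l T) F)\<^sup>2 \<le> C * C\<^sub>F"
        using F C0 by (intro mult_left_mono) (auto simp: admissible_loads_def)
      then show ?thesis using C3[OF subsetD[OF sub F] p] by (elim bexE conjE) (intro bexI conjI; simp)
    qed
    show ?thesis unfolding compact_operator_def
    proof (intro conjI allI impI sub)
      show "slope_output l T \<rho>\<^sub>A \<mu> T\<^sub>r r \<kappa> p ` admissible_loads l T C\<^sub>F \<subseteq> mspace (L2 (interval T))"
        using out Kj_sq_interval[OF assms(2)] L2_class_mspace by fastforce
      fix B assume B: "B \<subseteq> admissible_loads l T C\<^sub>F"
      show "compactin (mtopology_of (L2 (interval T)))
          (mtopology_of (L2 (interval T)) closure_of (slope_output l T \<rho>\<^sub>A \<mu> T\<^sub>r r \<kappa> p ` B))"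
        by (rule primitives_relatively_compact[OF assms(2), of _ "C * C\<^sub>F"]) (use B out in blast)
    qed
  qed
  show ?thesis
  proof (intro conjI ballI)
    show "\<exists>!u. is_solution l T \<rho>\<^sub>A \<mu> T\<^sub>r r \<kappa> F u" if "F \<in> admissible_loads l T C\<^sub>F" for F
      by (rule C2[OF subsetD[OF sub that]])
  qed (intro compact; use assms(1) in simp)+
qed

end
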